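(* Let $\lambda,T>0$ and let $\mu$ be a symmetric minimizer of $\mathcal{E}^{1d}_{\lambda,T}$ (i.e. $\mu_{-t}=\mu_t$ for $t\in[0,T]$). Then $\mu_T$ is atomic with finitely many non-zero atoms.
   Context: Let $Q=\mathbb{R}/\mathbb{Z}$ and $Q_T=(-T,T)\times Q$. Let $\mathcal{A}_T^*$ be the set of finite positive measures $\mu$ on $Q_T$ of the form $\mu=dt\otimes\mu_t$ such that for a.e. $t\in(-T,T)$, $\mu_t=\sum_i\phi_i\delta_{X_i}$ ($\phi_i>0$, $X_i\in Q$ distinct), and for which there is a finite real-valued measure $m\ll\mu$ on $Q_T$ with $\partial_t\mu+\partial_xm=0$ in the sense of distributions. Set \[ I(\mu)=\min_m\Big\{\int_{-T}^TN(t)\,dt+\int_{Q_T}\Big|\frac{dm}{d\mu}\Big|^2d\mu\Big\}, \] the minimum being over all such $m$, where $N(t)$ is the number of atoms of $\mu_t$; formally $I(\mu)=\int_{-T}^T\sum_{i=1}^{N(t)}[1+\phi_i|\dot X_i|^2]\,dt$. If $I(\mu)<\infty$ the curve $t\mapsto\mu_t$ is Wasserstein-continuous on $[-T,T]$, so the traces $\mu_{\pm T}$ are defined. For positive measures of equal mass on $Q$, $W_{\rm per}^2(\lambda_1,\lambda_2)=\min_\pi\int|x-y|_{\rm per}^2d\pi$ over couplings $\pi$ of $\lambda_1,\lambda_2$, where $|\cdot|_{\rm per}$ is the distance on the torus $Q$. The energy, for $\mu\in\mathcal{A}_T^*$ with $\mu_t(Q)=1$, is \[ \mathcal{E}^{1d}_{\lambda,T}(\mu)=I(\mu)+\lambda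 W_{\rm per}^2(\mu_{-T},1)+\lambda W_{\rm per}^2(\mu_T,1), \] where $1$ denotes Lebesgue measure on $Q$. *)

theory Defs
  imports "HOL-Probability.Probability"
begin

text \<open>
  The torus \<open>Q = \<real>/\<int>\<close> is represented by its fundamental domain \<open>[0,1)\<close>; the quotient map
  restricts to a Borel isomorphism from \<open>[0,1)\<close> onto \<open>Q\<close>, so measures on \<open>Q\<close> are measures on the
  Borel sets of \<open>[0,1)\<close>. The topology and the differentiable structure of the torus enter only
  through the periodic distance and through test functions that are \<open>1\<close>-periodic in space.
\<close>

definition torus :: "real measure" where
  "torus = restrict_space borel {0..<1}"

definition cylinder :: "real \<Rightarrow> (real \<times> real) measure" where
  "cylinder T = restrict_space borel ({-T<..<T} \<times> {0..<1})"

definition torus_lebesgue :: "real measure" where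
  "torus_lebesgue = restrict_space lborel {0..<1}"

definition dist_per :: "real \<Rightarrow> real \<Rightarrow> real" where
  "dist_per x y = infdist (x - y) \<int>"

subsection \<open>Finite signed measures\<close>

text \<open>A finite real-valued measure on the measurable sets of \<open>M\<close>. Only the measurable sets of \<open>M\<close>
  matter; the values of \<open>m\<close> elsewhere are irrelevant.\<close>

definition signed_measure_on :: "'a measure \<Rightarrow> ('a set \<Rightarrow> real) \<Rightarrow> bool" where
  "signed_measure_on M m \<longleftrightarrow>
     m {} = 0 \<and>
     (\<forall>A :: nat \<Rightarrow> 'a set. range A \<subseteq> sets M \<longrightarrow> disjoint_family A \<longrightarrow>
        (\<lambda>i. m (A i)) sums m (\<Union>i. A i))"

definition signed_abs_cont :: "'a measure \<Rightarrow> ('a set \<Rightarrow> real) \<Rightarrow> bool" where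
  "signed_abs_cont M m \<longleftrightarrow> (\<forall>A\<in>null_sets M. m A = 0)"

text \<open>\<open>dm/dM\<close>, determined up to \<open>M\<close>-null sets.\<close>

definition signed_RN_deriv :: "'a measure \<Rightarrow> ('a set \<Rightarrow> real) \<Rightarrow> 'a \<Rightarrow> real" where
  "signed_RN_deriv M m =
     (SOME v. integrable M v \<and> (\<forall>A\<in>sets M. m A = (\<integral>x\<in>A. v x \<partial>M)))"

text \<open>Integration against \<open>m\<close> by the Jordan decomposition; the negative part of \<open>m\<close> is the positive
  part of \<open>- m\<close>.\<close>

definition signed_pos_part :: "'a measure \<Rightarrow> ('a set \<Rightarrow> real) \<Rightarrow> 'a measure" where
  "signed_pos_part M m =
     measure_of (space M) (sets M) (\<lambda>A. SUP B\<in>{B \<in> sets M. B \<subseteq> A}. ennreal (m B))"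

definition signed_integral :: "'a measure \<Rightarrow> ('a set \<Rightarrow> real) \<Rightarrow> ('a \<Rightarrow> real) \<Rightarrow> real" where
  "signed_integral M m f =
     (\<integral>x. f x \<partial>signed_pos_part M m) - (\<integral>x. f x \<partial>signed_pos_part M (\<lambda>A. - m A))"

subsection \<open>The continuity equation\<close>

text \<open>\<open>D i j\<close> is the mixed partial derivative of order \<open>i\<close> in \<open>t\<close> and \<open>j\<close> in \<open>x\<close>.\<close>

definition smooth_function :: "(real \<times> real \<Rightarrow> real) \<Rightarrow> bool" where
  "smooth_function \<psi> \<longleftrightarrow>
     (\<exists>D :: nat \<Rightarrow> nat \<Rightarrow> real \<times> real \<Rightarrow> real. D 0 0 = \<psi> \<and>
        (\<forall>i j p. (D i j has_derivative (\<lambda>(h, k). D (Suc i) j p * h + D i (Suc j) p * k)) (at p)))"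

text \<open>Smooth functions with compact support in \<open>(-T,T) \<times> Q\<close>, lifted to \<open>\<real> \<times> \<real>\<close>.\<close>

definition test_function :: "real \<Rightarrow> (real \<times> real \<Rightarrow> real) \<Rightarrow> bool" where
  "test_function T \<psi> \<longleftrightarrow>
     smooth_function \<psi> \<and>
     (\<forall>t x. \<psi> (t, x + 1) = \<psi> (t, x)) \<and>
     (\<exists>a<T. \<forall>t x. \<bar>t\<bar> > a \<longrightarrow> \<psi> (t, x) = 0)"

text \<open>\<open>m\<close> is a finite real-valued measure on the cylinder with \<open>m \<lless> \<mu>\<close> and
  \<open>\<partial>\<^sub>t\<mu> + \<partial>\<^sub>xm = 0\<close> in the sense of distributions.\<close>

definition flux :: "real \<Rightarrow> (real \<times> real) measure \<Rightarrow> ((real \<times> real) set \<Rightarrow> real) \<Rightarrow> bool" where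
  "flux T \<mu> m \<longleftrightarrow>
     signed_measure_on \<mu> m \<and> signed_abs_cont \<mu> m \<and>
     (\<forall>\<psi>. test_function T \<psi> \<longrightarrow>
        (\<integral>(t, x). deriv (\<lambda>s. \<psi> (s, x)) t \<partial>\<mu>)
          + signed_integral \<mu> m (\<lambda>(t, x). deriv (\<lambda>y. \<psi> (t, y)) x) = 0)"

subsection \<open>Time slices and atoms\<close>

text \<open>\<open>\<mu> = dt \<otimes> \<kappa>\<^sub>t\<close>\<close>

definition disintegration ::
    "real \<Rightarrow> (real \<times> real) measure \<Rightarrow> (real \<Rightarrow> real measure) \<Rightarrow> bool" where
  "disintegration T \<mu> \<kappa> \<longleftrightarrow>
     (\<forall>t\<in>{-T<..<T}. sets (\<kappa> t) = sets torus \<and> finite_measure (\<kappa> t)) \<and>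
     (\<forall>A\<in>sets torus. (\<lambda>t. emeasure (\<kappa> t) A) \<in> borel_measurable (restrict_space borel {-T<..<T})) \<and>
     (\<forall>A\<in>sets (cylinder T).
        emeasure \<mu> A = (\<integral>\<^sup>+t\<in>{-T<..<T}. emeasure (\<kappa> t) {x. (t, x) \<in> A} \<partial>lborel))"

text \<open>A version of \<open>t \<mapsto> \<mu>\<^sub>t\<close>, determined for almost every \<open>t\<close>.\<close>

definition slices :: "real \<Rightarrow> (real \<times> real) measure \<Rightarrow> real \<Rightarrow> real measure" where
  "slices T \<mu> = (SOME \<kappa>. disintegration T \<mu> \<kappa>)"

text \<open>\<open>\<nu> = \<Sum>\<^sub>x\<^sub>\<in>\<^sub>S \<phi>\<^sub>x \<delta>\<^sub>x\<close> with \<open>\<phi>\<^sub>x > 0\<close>, finitely or countably many atoms being allowed.\<close>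

definition atomic :: "real measure \<Rightarrow> bool" where
  "atomic \<nu> \<longleftrightarrow>
     sets \<nu> = sets torus \<and>
     (\<exists>S (\<phi> :: real \<Rightarrow> real). countable S \<and> S \<subseteq> {0..<1} \<and> (\<forall>x\<in>S. \<phi> x > 0) \<and>
        (\<forall>A\<in>sets torus. emeasure \<nu> A = (\<integral>\<^sup>+x. ennreal (\<phi> x) * indicator A x \<partial>count_space S)))"

definition atoms :: "real measure \<Rightarrow> real set" where
  "atoms \<nu> = {x \<in> space \<nu>. emeasure \<nu> {x} > 0}"

text \<open>The cardinality of the set of atoms, equal to \<open>\<infinity>\<close> if there are infinitely many.\<close>

definition num_atoms :: "real measure \<Rightarrow> ennreal" where
  "num_atoms \<nu> = emeasure (count_space UNIV) (atoms \<nu>)"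

definition A_star :: "real \<Rightarrow> (real \<times> real) measure set" where
  "A_star T = {\<mu>. sets \<mu> = sets (cylinder T) \<and> finite_measure \<mu> \<and>
     (\<exists>\<kappa>. disintegration T \<mu> \<kappa> \<and> (AE t\<in>{-T<..<T} in lborel. atomic (\<kappa> t))) \<and>
     (\<exists>m. flux T \<mu> m)}"

definition internal_energy :: "real \<Rightarrow> (real \<times> real) measure \<Rightarrow> ennreal" where
  "internal_energy T \<mu> =
     (INF m\<in>{m. flux T \<mu> m}.
        (\<integral>\<^sup>+t\<in>{-T<..<T}. num_atoms (slices T \<mu> t) \<partial>lborel)
        + (\<integral>\<^sup>+p. ennreal (\<bar>signed_RN_deriv \<mu> m p\<bar>\<^sup>2) \<partial>\<mu>))"

subsection \<open>Periodic Wasserstein distance and traces\<close>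

definition couplings :: "real measure \<Rightarrow> real measure \<Rightarrow> (real \<times> real) measure set" where
  "couplings \<rho> \<nu> =
     {\<pi>. sets \<pi> = sets (torus \<Otimes>\<^sub>M torus) \<and> distr \<pi> torus fst = \<rho> \<and> distr \<pi> torus snd = \<nu>}"

text \<open>The squared distance; it is \<open>\<infinity>\<close> for measures of different mass.\<close>

definition W_per_sq :: "real measure \<Rightarrow> real measure \<Rightarrow> ennreal" where
  "W_per_sq \<rho> \<nu> =
     (INF \<pi>\<in>couplings \<rho> \<nu>. \<integral>\<^sup>+(x, y). ennreal ((dist_per x y)\<^sup>2) \<partial>\<pi>)"

text \<open>\<open>\<gamma>\<close> represents \<open>t \<mapsto> \<mu>\<^sub>t\<close> by a Wasserstein-continuous curve on the closed interval
  \<open>[-T,T]\<close>. Such a curve is unique on \<open>[-T,T]\<close>, and it exists whenever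
  \<open>internal_energy T \<mu> < \<infinity>\<close>.\<close>

definition continuous_slices ::
    "real \<Rightarrow> (real \<times> real) measure \<Rightarrow> (real \<Rightarrow> real measure) \<Rightarrow> bool" where
  "continuous_slices T \<mu> \<gamma> \<longleftrightarrow>
     disintegration T \<mu> \<gamma> \<and>
     (\<forall>t\<in>{-T..T}. sets (\<gamma> t) = sets torus \<and> finite_measure (\<gamma> t) \<and>
        ((\<lambda>s. W_per_sq (\<gamma> s) (\<gamma> t)) \<longlongrightarrow> 0) (at t within {-T..T}))"

text \<open>The value at \<open>t \<in> [-T,T]\<close> of the Wasserstein-continuous curve; for \<open>t = \<plusminus>T\<close> these are the
  traces of \<open>\<mu>\<close>.\<close>

definition slice :: "real \<Rightarrow> (real \<times> real) measure \<Rightarrow> real \<Rightarrow> real measure" where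
  "slice T \<mu> t = (THE \<nu>. \<exists>\<gamma>. continuous_slices T \<mu> \<gamma> \<and> \<nu> = \<gamma> t)"

subsection \<open>The energy and its minimizers\<close>

text \<open>If the internal energy is infinite, the sum is \<open>\<infinity>\<close> whatever the values of the (then possibly
  undefined) traces.\<close>

definition energy :: "real \<Rightarrow> real \<Rightarrow> (real \<times> real) measure \<Rightarrow> ennreal" where
  "energy lam T \<mu> =
     internal_energy T \<mu>
     + ennreal lam * W_per_sq (slice T \<mu> (-T)) torus_lebesgue
     + ennreal lam * W_per_sq (slice T \<mu> T) torus_lebesgue"

definition unit_A_star :: "real \<Rightarrow> (real \<times> real) measure set" where
  "unit_A_star T =
     {\<mu> \<in> A_star T. AE t\<in>{-T<..<T} in lborel. emeasure (slices T \<mu> t) (space torus) = 1}"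

definition energy_minimizer :: "real \<Rightarrow> real \<Rightarrow> (real \<times> real) measure \<Rightarrow> bool" where
  "energy_minimizer lam T \<mu> \<longleftrightarrow>
     \<mu> \<in> unit_A_star T \<and> (\<forall>\<nu>\<in>unit_A_star T. energy lam T \<mu> \<le> energy lam T \<nu>)"

definition time_symmetric :: "real \<Rightarrow> (real \<times> real) measure \<Rightarrow> bool" where
  "time_symmetric T \<mu> \<longleftrightarrow> (\<forall>t\<in>{0..T}. slice T \<mu> (-t) = slice T \<mu> t)"

end

theory Submission
  imports Defs
begin

text \<open>
  The curve \<open>t \<mapsto> \<mu>\<^sub>t\<close> is compared with its linear reparametrization that traverses \<open>[-T,t]\<close> during
  \<open>[-T,T]\<close>. Slowing down does not increase the kinetic energy, it multiplies the atom count on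
  \<open>[-T,t]\<close> by \<open>2T/(T+t) = 1 + O(T-t)\<close>, and it replaces the trace \<open>\<mu>\<^sub>T\<close> by \<open>\<mu>\<^sub>t\<close>. The Kantorovich potential
  of \<open>\<mu>\<^sub>t\<close> is Lipschitz, so the price paid at the boundary is at most a constant times the momentum
  \<open>\<integral>|v|\<close> on \<open>(t,T)\<close>, which Young's inequality absorbs into the saved kinetic energy up to \<open>O(T-t)\<close>.
  Hence \<open>\<integral>\<^sub>t\<^sup>T N \<le> C (T-t)\<close>. So there are times \<open>s \<rightarrow> T\<close> at which \<open>\<mu>\<^sub>s\<close> has a bounded number of atoms, and
  this bound passes to the weak limit \<open>\<mu>\<^sub>T\<close>.
\<close>

subsection \<open>Signed measures\<close>

text \<open>The internal energy is an infimum over fluxes, so the comparison is run with a flux that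
  is optimal up to a small error. The momentum in the estimate belongs to that flux, while the curve
  was constructed from another one; uniqueness of the continuous representative shows that every
  flux controls the same curve. To extract this control from the weak equation, it is tested with
  products of a function of time and a sine or cosine. These spatial factors are countably many, so
  one null set of times serves for all, and positive trigonometric kernels approximate a Lipschitz
  function without increasing its Lipschitz constant. The potential comes from one-dimensional
  transport: the lifted distribution function is shifted until it has the mean of the identity. The
  derivative of the potential is then bounded by 3, and Young's inequality produces
  \<open>9 * lam\<^sup>2 / 4\<close>. The final constant also contains the total atom count, which
  is finite because a minimizer has at most the energy of a resting Dirac mass.\<close>

lemma signed_measure_on_uminus: "signed_measure_on M m \<Longrightarrow> signed_measure_on M (\<lambda>A. - m A)"
  by (auto simp: signed_measure_on_def intro: sums_minus)

lemma signed_measure_on_sums: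
  assumes "signed_measure_on M m" "range A \<subseteq> sets M" "disjoint_family A"
  shows "(\<lambda>i. m (A i)) sums m (\<Union>i. A i)"
  using assms unfolding signed_measure_on_def by blast

lemma set_integrable_of_integrable:
  fixes v :: "'a \<Rightarrow> 'b :: {banach, second_countable_topology}"
  assumes "integrable M v" "A \<in> sets M" shows "set_integrable M A v"
  using assms unfolding set_integrable_def by (simp add: integrable_mult_indicator)

lemma signed_measure_on_Un:
  assumes m: "signed_measure_on M m" and A: "A \<in> sets M" "B \<in> sets M" "A \<inter> B = {}"
  shows "m (A \<union> B) = m A + m B"
proof -
  have "disjoint_family (binaryset A B)"
    using A by (auto simp: disjoint_family_on_def binaryset_def)
  moreover have "range (binaryset A B) \<subseteq> sets M"
    using A by (auto simp: range_binaryset_eq)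
  ultimately have "(\<lambda>i. m (binaryset A B i)) sums m (\<Union>i. binaryset A B i)"
    by (intro signed_measure_on_sums[OF m])
  then have "(\<lambda>i. m (binaryset A B i)) sums m (A \<union> B)"
    by (simp only: UN_binaryset_eq)
  moreover have "(\<lambda>i. m (binaryset A B i)) sums (m A + m B)"
    using m by (intro binaryset_sums) (auto simp: signed_measure_on_def)
  ultimately show ?thesis
    by (rule sums_unique2)
qed

lemma signed_measure_on_Diff:
  assumes m: "signed_measure_on M m" and A: "A \<in> sets M" "B \<in> sets M" "B \<subseteq> A"
  shows "m (A - B) = m A - m B"
proof -
  have "m (B \<union> (A - B)) = m B + m (A - B)"
    using A by (intro signed_measure_on_Un[OF m]) auto
  moreover have "B \<union> (A - B) = A" using A by auto
  ultimately show ?thesis by simp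
qed

section \<open>Hahn decomposition of a finite signed measure\<close>

definition signed_negative :: "'a measure \<Rightarrow> ('a set \<Rightarrow> real) \<Rightarrow> 'a set \<Rightarrow> bool" where
  "signed_negative M m A \<longleftrightarrow> A \<in> sets M \<and> (\<forall>B\<in>sets M. B \<subseteq> A \<longrightarrow> m B \<le> 0)"

text \<open>The supremum of \<open>m\<close> over the subsets of \<open>A\<close> may a priori be
  infinite, hence the truncation at 1: either some subset has mass at least 1, or the supremum is
  finite and some subset has at least half of it. The empty set serves if no subset has positive
  mass.\<close>

lemma signed_almost_maximal_subset:
  assumes m: "signed_measure_on M m" and A: "A \<in> sets M"
  shows "\<exists>B\<in>sets M. B \<subseteq> A \<and> 0 \<le> m B \<and> (\<forall>C\<in>sets M. C \<subseteq> A \<longrightarrow> min 1 (m C / 2) \<le> m B)"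
proof (cases "\<exists>C\<in>sets M. C \<subseteq> A \<and> m C \<ge> 1")
  case True
  then obtain C where "C \<in> sets M" "C \<subseteq> A" "m C \<ge> 1" by blast
  then show ?thesis by (intro bexI[of _ C]) (auto simp: min_def)
next
  case False
  have m0: "m {} = 0" using m by (simp add: signed_measure_on_def)
  show ?thesis
  proof (cases "\<exists>C\<in>sets M. C \<subseteq> A \<and> m C > 0")
    case False
    then show ?thesis
      using m0 by (intro bexI[of _ "{}"]) (auto simp: min_def not_less)
  next
    case True
    then obtain C where C: "C \<in> sets M" "C \<subseteq> A" "m C > 0" by blast
    let ?S = "m ` {C\<in>sets M. C \<subseteq> A}"
    have bdd: "bdd_above ?S"
      using False by (intro bdd_aboveI[of _ 1]) auto
    have ne: "?S \<noteq> {}" using C by auto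
    have le: "m C \<le> Sup ?S" if "C \<in> sets M" "C \<subseteq> A" for C
      using bdd that by (intro cSup_upper) auto
    have pos: "Sup ?S > 0" using le[OF C(1,2)] C(3) by linarith
    then have "Sup ?S / 2 < Sup ?S" by simp
    then obtain B where B: "B \<in> sets M" "B \<subseteq> A" "Sup ?S / 2 < m B"
      using less_cSup_iff[OF ne bdd] by auto
    show ?thesis
    proof (intro bexI[of _ B] conjI ballI impI)
      show "0 \<le> m B" using B pos by linarith
      fix C assume "C \<in> sets M" "C \<subseteq> A"
      then show "min 1 (m C / 2) \<le> m B" using le[of C] B(3) by linarith
    qed (use B in auto)
  qed
qed

text \<open>Greedy exhaustion: almost maximal pieces of nonnegative mass are removed from
  \<open>D\<close> again and again. Their masses form a convergent series and tend to 0, yet at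
  every stage they dominate \<open>min 1 (m B / 2)\<close> for each \<open>B\<close> that remains at
  the end, so nothing of positive mass remains. Only nonnegative mass was removed, whence
  \<open>m A \<le> m D\<close>.\<close>

lemma signed_negative_subset:
  assumes m: "signed_measure_on M m" and D: "D \<in> sets M"
  shows "\<exists>A. signed_negative M m A \<and> A \<subseteq> D \<and> m A \<le> m D"
proof -
  obtain f where f: "\<And>A. A \<in> sets M \<Longrightarrow> f A \<in> sets M \<and> f A \<subseteq> A \<and> 0 \<le> m (f A) \<and>
      (\<forall>C\<in>sets M. C \<subseteq> A \<longrightarrow> min 1 (m C / 2) \<le> m (f A))"
    using signed_almost_maximal_subset[OF m] by metis
  define E where "E = rec_nat D (\<lambda>_ A. A - f A)"
  have E0: "E 0 = D" and ES: "\<And>n. E (Suc n) = E n - f (E n)"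
    by (auto simp: E_def)
  have Es: "E n \<in> sets M" for n
    by (induction n) (use D f in \<open>auto simp: E0 ES\<close>)
  have anti: "E (n + k) \<subseteq> E n" for n k
    by (induction k) (auto simp: ES)
  have disj: "disjoint_family (\<lambda>n. f (E n))"
  proof -
    have "f (E i) \<inter> f (E j) = {}" if "i < j" for i j
    proof -
      have "f (E j) \<subseteq> E j" using f Es by blast
      also have "E j \<subseteq> E (Suc i)" using anti[of "Suc i" "j - Suc i"] that by simp
      finally show ?thesis by (auto simp: ES)
    qed
    then show ?thesis
      by (auto simp: disjoint_family_on_def) (metis Int_iff empty_iff linorder_neqE_nat)
  qed
  let ?U = "\<Union>n. f (E n)"
  have sums: "(\<lambda>n. m (f (E n))) sums m ?U"
    using m f Es disj by (auto simp: signed_measure_on_def image_subset_iff)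
  have US: "?U \<in> sets M" using f Es by auto
  have "f (E n) \<subseteq> D" for n
    using f[OF Es[of n]] anti[of 0 n] by (auto simp: E0)
  then have UD: "?U \<subseteq> D" by blast
  have "0 \<le> m (f (E n))" for n using f[OF Es] by blast
  then have "m ?U \<ge> 0"
    using sums_le[OF _ sums_zero sums] by simp
  then have le: "m (D - ?U) \<le> m D"
    using signed_measure_on_Diff[OF m D US UD] by simp
  have "m B \<le> 0" if B: "B \<in> sets M" "B \<subseteq> D - ?U" for B
  proof (rule ccontr)
    assume pos: "\<not> m B \<le> 0"
    have BE: "B \<subseteq> E n" for n
      by (induction n) (use B in \<open>auto simp: E0 ES\<close>)
    have "min 1 (m B / 2) \<le> m (f (E n))" for n
      using f[OF Es[of n]] B BE by blast
    moreover have "(\<lambda>n. m (f (E n))) \<longlonglongrightarrow> 0"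
      using sums by (intro summable_LIMSEQ_zero) (auto simp: sums_iff)
    ultimately have "min 1 (m B / 2) \<le> 0"
      by (intro LIMSEQ_le_const) auto
    then show False using pos by (auto simp: min_def split: if_splits)
  qed
  then show ?thesis
    using le D US by (intro exI[of _ "D - ?U"]) (auto simp: signed_negative_def)
qed

lemma signed_negative_UN:
  assumes m: "signed_measure_on M m" and N: "\<And>n::nat. signed_negative M m (N n)"
  shows "signed_negative M m (\<Union>n. N n)"
  unfolding signed_negative_def
proof (intro conjI ballI impI)
  show "(\<Union>n. N n) \<in> sets M" using N by (auto simp: signed_negative_def)
  fix B assume B: "B \<in> sets M" "B \<subseteq> (\<Union>n. N n)"
  define C where "C n = B \<inter> disjointed N n" for n
  have Ns: "range N \<subseteq> sets M" using N by (auto simp: signed_negative_def)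
  have Cs: "C n \<in> sets M" for n
    using sets.range_disjointed_sets[OF Ns] B by (auto simp: C_def)
  have "disjoint_family C"
    using disjoint_family_disjointed[of N] by (auto simp: C_def disjoint_family_on_def)
  moreover have "(\<Union>n. C n) = B"
    using B UN_disjointed_eq[of N] by (auto simp: C_def)
  ultimately have sums: "(\<lambda>n. m (C n)) sums m B"
    using m Cs by (auto simp: signed_measure_on_def image_subset_iff)
  have "m (C n) \<le> 0" for n
  proof -
    have "C n \<subseteq> N n" using disjointed_subset[of N n] by (auto simp: C_def)
    then show ?thesis using N[of n] Cs[of n] unfolding signed_negative_def by blast
  qed
  then show "m B \<le> 0"
    using sums_le[OF _ sums sums_zero] by simp
qed

text \<open>\<open>N\<close> is the union of a minimizing sequence of negative sets. The infimum is
  finite, because the union of negative sets of mass below \<open>- real n\<close> for all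
  \<open>n\<close> could not have a real mass. A set of negative mass outside \<open>N\<close> would
  contain a negative set that, joined to \<open>N\<close>, goes below the infimum. Positive sets are
  expressed as negative sets of \<open>\<lambda>A. - m A\<close>.\<close>

lemma signed_Hahn_decomposition:
  assumes m: "signed_measure_on M m"
  shows "\<exists>N. signed_negative M m N \<and> signed_negative M (\<lambda>A. - m A) (space M - N)"
proof -
  have m0: "m {} = 0" using m by (simp add: signed_measure_on_def)
  let ?S = "m ` {A. signed_negative M m A}"
  have emp: "signed_negative M m {}" using m0 by (auto simp: signed_negative_def)
  have mono: "m B \<le> m A" if B: "signed_negative M m B" "A \<in> sets M" "A \<subseteq> B" for A B
  proof -
    have "m (B - A) \<le> 0" using B by (auto simp: signed_negative_def)
    then show ?thesis using signed_measure_on_Diff[OF m _ B(2,3)] B(1) by (auto simp: signed_negative_def)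
  qed
  have bdd: "bdd_below ?S"
  proof (rule ccontr)
    assume "\<not> bdd_below ?S"
    then have "\<exists>A. signed_negative M m A \<and> m A < - real n" for n
      by (force simp: bdd_below_def not_le)
    then obtain A where A: "\<And>n. signed_negative M m (A n)" "\<And>n::nat. m (A n) < - real n"
      by metis
    have le: "m (\<Union>n. A n) \<le> - real n" for n
    proof -
      have "m (\<Union>n. A n) \<le> m (A n)"
        using A(1)[of n] by (intro mono[OF signed_negative_UN[OF m A(1)]]) (auto simp: signed_negative_def)
      then show ?thesis using A(2)[of n] by linarith
    qed
    obtain n where "- m (\<Union>n. A n) < real n"
      using reals_Archimedean2 by blast
    then show False using le[of n] by linarith
  qed
  have ne: "?S \<noteq> {}" using emp by auto
  have "\<exists>A. signed_negative M m A \<and> m A < Inf ?S + 1 / real (Suc n)" for n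
  proof -
    have "Inf ?S < Inf ?S + 1 / real (Suc n)" by simp
    then obtain y where "y \<in> ?S" "y < Inf ?S + 1 / real (Suc n)"
      using cInf_less_iff[OF ne bdd] by blast
    then show ?thesis by (auto simp del: of_nat_Suc)
  qed
  then obtain A where A: "\<And>n. signed_negative M m (A n)" "\<And>n. m (A n) < Inf ?S + 1 / real (Suc n)"
    by metis
  define N where "N = (\<Union>n. A n)"
  have N: "signed_negative M m N"
    unfolding N_def by (rule signed_negative_UN[OF m A(1)])
  have "m N \<le> Inf ?S"
  proof (rule LIMSEQ_le_const)
    show "(\<lambda>n. Inf ?S + 1 / real (Suc n)) \<longlonglongrightarrow> Inf ?S"
      using tendsto_add[OF tendsto_const LIMSEQ_inverse_real_of_nat, of "Inf ?S"]
      by (simp add: inverse_eq_divide)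
    show "\<exists>N'. \<forall>n\<ge>N'. m N \<le> Inf ?S + 1 / real (Suc n)"
    proof (intro exI allI impI)
      fix n
      have "m N \<le> m (A n)" using A(1)[of n] by (intro mono[OF N]) (auto simp: N_def signed_negative_def)
      then show "m N \<le> Inf ?S + 1 / real (Suc n)" using A(2)[of n] by linarith
    qed
  qed
  have "0 \<le> m D" if D: "D \<in> sets M" "D \<subseteq> space M - N" for D
  proof (rule ccontr)
    assume neg: "\<not> 0 \<le> m D"
    obtain A where A: "signed_negative M m A" "A \<subseteq> D" "m A \<le> m D"
      using signed_negative_subset[OF m D(1)] by blast
    have "signed_negative M m (\<Union>n. binaryset A N n)"
      using A N m0 emp by (intro signed_negative_UN[OF m]) (auto simp: binaryset_def)
    then have "signed_negative M m (A \<union> N)" by (simp add: UN_binaryset_eq)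
    then have "Inf ?S \<le> m (A \<union> N)" using bdd by (intro cInf_lower) auto
    also have "\<dots> = m A + m N"
      using A N D by (intro signed_measure_on_Un[OF m]) (auto simp: signed_negative_def)
    finally show False using A neg \<open>m N \<le> Inf ?S\<close> by linarith
  qed
  then show ?thesis using N by (auto simp: signed_negative_def)
qed

section \<open>Radon-Nikodym derivatives and densities of signed measures\<close>

lemma signed_Radon_Nikodym_pos:
  assumes "finite_measure M"
    and m: "signed_measure_on M m" and ac: "signed_abs_cont M m"
    and P: "signed_negative M (\<lambda>A. - m A) P"
  shows "\<exists>v. integrable M v \<and> (\<forall>A\<in>sets M. m (A \<inter> P) = (\<integral>x\<in>A. v x \<partial>M))"
proof -
  interpret finite_measure M by fact
  have Ps: "P \<in> sets M" and pos: "0 \<le> m (A \<inter> P)" if "A \<in> sets M" for A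
    using P that by (auto simp: signed_negative_def)
  have Ps: "P \<in> sets M" using P by (auto simp: signed_negative_def)
  \<comment> \<open>\<open>m\<close> is nonnegative on subsets of \<open>P\<close>, so
    \<open>ennreal\<close> loses nothing and \<open>N\<close> is a finite measure to which the
    Radon-Nikodym theorem for positive measures applies.\<close>
  define N where "N = measure_of (space M) (sets M) (\<lambda>A. ennreal (m (A \<inter> P)))"
  have sN[simp]: "sets N = sets M" "space N = space M" by (auto simp: N_def)
  have eN: "emeasure N A = ennreal (m (A \<inter> P))" if "A \<in> sets M" for A
  proof (rule emeasure_measure_of[OF N_def])
    show "positive (sets N) (\<lambda>A. ennreal (m (A \<inter> P)))"
      using m by (auto simp: positive_def signed_measure_on_def)
    show "countably_additive (sets N) (\<lambda>A. ennreal (m (A \<inter> P)))"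
    proof (rule countably_additiveI)
      fix A :: "nat \<Rightarrow> _" assume A: "range A \<subseteq> sets N" "disjoint_family A" "(\<Union>i. A i) \<in> sets N"
      have "disjoint_family (\<lambda>i. A i \<inter> P)" using A by (auto simp: disjoint_family_on_def)
      then have "(\<lambda>i. m (A i \<inter> P)) sums m (\<Union>i. A i \<inter> P)"
        using A Ps by (intro signed_measure_on_sums[OF m]) auto
      then show "(\<Sum>i. ennreal (m (A i \<inter> P))) = ennreal (m ((\<Union>i. A i) \<inter> P))"
        using A pos by (subst suminf_ennreal2) (auto simp: sums_iff UN_simps[symmetric] image_subset_iff simp del: UN_simps)
    qed
  qed (use that sets.sets_into_space in auto)
  have "finite_measure N"
    by (intro finite_measureI) (simp add: eN)
  have "absolutely_continuous M N"
    unfolding absolutely_continuous_def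
  proof
    fix A assume A: "A \<in> null_sets M"
    then have "A \<inter> P \<in> null_sets M" using Ps by (intro null_set_Int2) auto
    then show "A \<in> null_sets N" using ac A eN[of A] by (auto simp: signed_abs_cont_def null_sets_def)
  qed
  then obtain f where f: "f \<in> borel_measurable M" "density M f = N"
    using Radon_Nikodym_finite_measure[of N] \<open>finite_measure N\<close> by auto
  have nnA: "(\<integral>\<^sup>+x. f x * indicator A x \<partial>M) = ennreal (m (A \<inter> P))" if "A \<in> sets M" for A
    using f that eN[OF that] by (metis emeasure_density)
  have "(\<integral>\<^sup>+x. f x \<partial>M) = ennreal (m (space M \<inter> P))"
    using nnA[of "space M"] by (auto cong: nn_integral_cong simp: mult.commute)
  then have fin: "(\<integral>\<^sup>+x. f x \<partial>M) \<noteq> \<infinity>" by simp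
  then have ae: "AE x in M. f x \<noteq> \<infinity>" using f by (intro nn_integral_PInf_AE) auto
  then have ae': "AE x in M. ennreal (enn2real (f x)) = f x"
    by eventually_elim (auto simp: less_top)
  define v where "v x = enn2real (f x)" for x
  have [measurable]: "f \<in> borel_measurable M" by fact
  have [measurable]: "v \<in> borel_measurable M" unfolding v_def by measurable
  have v0: "v x \<ge> 0" for x by (simp add: v_def)
  have nv: "(\<integral>\<^sup>+x. ennreal (v x) * indicator A x \<partial>M) = ennreal (m (A \<inter> P))" if "A \<in> sets M" for A
    unfolding nnA[OF that, symmetric] v_def
    by (intro nn_integral_cong_AE) (use ae' in \<open>eventually_elim, simp\<close>)
  have int: "integrable M v"
  proof (rule integrableI_nonneg)
    have "(\<integral>\<^sup>+x. ennreal (v x) \<partial>M) = ennreal (m (space M \<inter> P))"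
      using nv[of "space M"] by (auto cong: nn_integral_cong simp: mult.commute)
    then show "(\<integral>\<^sup>+x. ennreal (v x) \<partial>M) < \<infinity>" by simp
  qed (use v0 in auto)
  have "m (A \<inter> P) = (\<integral>x\<in>A. v x \<partial>M)" if A: "A \<in> sets M" for A
  proof -
    have "(\<integral>x\<in>A. v x \<partial>M) = enn2real (\<integral>\<^sup>+x. ennreal (indicator A x * v x) \<partial>M)"
      unfolding set_lebesgue_integral_def real_scaleR_def using A v0
      by (intro integral_eq_nn_integral) (auto)
    also have "(\<integral>\<^sup>+x. ennreal (indicator A x * v x) \<partial>M) = (\<integral>\<^sup>+x. ennreal (v x) * indicator A x \<partial>M)"
      by (intro nn_integral_cong) (auto split: split_indicator)
    finally show ?thesis using nv[OF A] pos[OF A] by simp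
  qed
  then show ?thesis using int by blast
qed

lemma signed_Radon_Nikodym:
  assumes "finite_measure M" and m: "signed_measure_on M m" and ac: "signed_abs_cont M m"
  shows "\<exists>v. integrable M v \<and> (\<forall>A\<in>sets M. m A = (\<integral>x\<in>A. v x \<partial>M))"
proof -
  obtain N where N: "signed_negative M m N" "signed_negative M (\<lambda>A. - m A) (space M - N)"
    using signed_Hahn_decomposition[OF m] by blast
  have Ns: "N \<in> sets M" using N by (auto simp: signed_negative_def)
  obtain v where v: "integrable M v" "\<And>A. A \<in> sets M \<Longrightarrow> m (A \<inter> (space M - N)) = (\<integral>x\<in>A. v x \<partial>M)"
    using signed_Radon_Nikodym_pos[OF assms N(2)] by blast
  have "\<exists>v. integrable M v \<and> (\<forall>A\<in>sets M. - m (A \<inter> N) = (\<integral>x\<in>A. v x \<partial>M))"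
    using N ac by (intro signed_Radon_Nikodym_pos[OF assms(1) signed_measure_on_uminus[OF m]])
      (auto simp: signed_abs_cont_def)
  then obtain w where w: "integrable M w" "\<And>A. A \<in> sets M \<Longrightarrow> - m (A \<inter> N) = (\<integral>x\<in>A. w x \<partial>M)"
    by blast
  have "m A = (\<integral>x\<in>A. (v x - w x) \<partial>M)" if A: "A \<in> sets M" for A
  proof -
    have "m ((A \<inter> (space M - N)) \<union> (A \<inter> N)) = m (A \<inter> (space M - N)) + m (A \<inter> N)"
      using A Ns by (intro signed_measure_on_Un[OF m]) auto
    moreover have "(A \<inter> (space M - N)) \<union> (A \<inter> N) = A" using A sets.sets_into_space by blast
    moreover have "(\<integral>x\<in>A. (v x - w x) \<partial>M) = (\<integral>x\<in>A. v x \<partial>M) - (\<integral>x\<in>A. w x \<partial>M)"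
      using v w A by (intro set_integral_diff) (auto intro: set_integrable_of_integrable)
    ultimately show ?thesis using v(2)[OF A] w(2)[OF A] by simp
  qed
  then show ?thesis using v w by (intro exI[of _ "\<lambda>x. v x - w x"]) auto
qed

lemma signed_RN_deriv:
  assumes "finite_measure M" and m: "signed_measure_on M m" and ac: "signed_abs_cont M m"
  shows "integrable M (signed_RN_deriv M m)"
    and "\<And>A. A \<in> sets M \<Longrightarrow> m A = (\<integral>x\<in>A. signed_RN_deriv M m x \<partial>M)"
  using someI_ex[OF signed_Radon_Nikodym[OF assms]] unfolding signed_RN_deriv_def by auto

lemma signed_RN_deriv_unique:
  assumes v: "integrable M v" "\<And>A. A \<in> sets M \<Longrightarrow> m A = (\<integral>x\<in>A. v x \<partial>M)"
  shows "AE x in M. signed_RN_deriv M m x = v x"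
proof -
  let ?w = "signed_RN_deriv M m"
  have "integrable M ?w \<and> (\<forall>A\<in>sets M. m A = (\<integral>x\<in>A. ?w x \<partial>M))"
    unfolding signed_RN_deriv_def by (rule someI[of _ v]) (use v in auto)
  then show ?thesis
    using v by (intro density_unique_real) auto
qed

lemma signed_measure_on_density:
  assumes v: "integrable M v"
  shows "signed_measure_on M (\<lambda>A. \<integral>x\<in>A. v x \<partial>M)" "signed_abs_cont M (\<lambda>A. \<integral>x\<in>A. v x \<partial>M)"
proof -
  have "(\<lambda>i. \<integral>x\<in>A i. v x \<partial>M) sums (\<integral>x\<in>(\<Union>i. A i). v x \<partial>M)"
    if A: "range A \<subseteq> sets M" "disjoint_family A" for A :: "nat \<Rightarrow> _"
  proof -
    have s: "set_integrable M B v" if "B \<in> sets M" for B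
      using that v by (auto intro: set_integrable_of_integrable)
    have "(\<lambda>i. \<integral>x\<in>(\<Union>j<i. A j). v x \<partial>M) \<longlonglongrightarrow> (\<integral>x\<in>(\<Union>i. \<Union>j<i. A j). v x \<partial>M)"
      using A by (intro set_integral_cont_up s sets.countable_UN) (fastforce simp: incseq_def)+
    moreover have "(\<integral>x\<in>(\<Union>j<i. A j). v x \<partial>M) = (\<Sum>j<i. \<integral>x\<in>A j. v x \<partial>M)" for i
      using A by (intro set_integral_finite_Union s) (auto simp: disjoint_family_on_def)
    moreover have "(\<Union>i. \<Union>j<i. A j) = (\<Union>i. A i)" by auto
    ultimately show ?thesis by (simp add: sums_def)
  qed
  then show "signed_measure_on M (\<lambda>A. \<integral>x\<in>A. v x \<partial>M)"
    by (auto simp: signed_measure_on_def set_lebesgue_integral_def)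
  show "signed_abs_cont M (\<lambda>A. \<integral>x\<in>A. v x \<partial>M)"
    unfolding signed_abs_cont_def
  proof
    fix A assume "A \<in> null_sets M"
    then have "AE x in M. x \<notin> A" by (rule AE_not_in)
    then show "(\<integral>x\<in>A. v x \<partial>M) = 0"
      unfolding set_lebesgue_integral_def by (intro integral_eq_zero_AE) (auto elim: eventually_mono)
  qed
qed

text \<open>\<open>ennreal\<close> sends negative reals to 0, so the density on the right is the
  positive part of \<open>v\<close>, and the supremum that defines \<open>signed_pos_part\<close> is
  attained at the part of \<open>A\<close> where \<open>v\<close> is nonnegative.\<close>

lemma signed_pos_part_eq_density:
  assumes v: "integrable M v" "\<And>A. A \<in> sets M \<Longrightarrow> m A = (\<integral>x\<in>A. v x \<partial>M)"
  shows "signed_pos_part M m = density M (\<lambda>x. ennreal (v x))"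
proof -
  have [measurable]: "v \<in> borel_measurable M" using v by auto
  have s: "set_integrable M B v" if "B \<in> sets M" for B
    using that v by (auto intro: set_integrable_of_integrable)
  have *: "ennreal (m A) \<le> (\<integral>\<^sup>+x. ennreal (v x) * indicator A x \<partial>M)" if A: "A \<in> sets M" for A
  proof -
    have "m A \<le> (\<integral>x. max 0 (v x) * indicator A x \<partial>M)"
      unfolding v(2)[OF A] set_lebesgue_integral_def
      using v A s[OF A, unfolded set_integrable_def]
      by (intro integral_mono integrable_real_mult_indicator) (auto split: split_indicator)
    then have "ennreal (m A) \<le> ennreal (\<integral>x. max 0 (v x) * indicator A x \<partial>M)"
      by (rule ennreal_leI)
    also have "\<dots> = (\<integral>\<^sup>+x. ennreal (max 0 (v x) * indicator A x) \<partial>M)"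
      using v A by (intro nn_integral_eq_integral[symmetric] integrable_real_mult_indicator) auto
    also have "\<dots> = (\<integral>\<^sup>+x. ennreal (v x) * indicator A x \<partial>M)"
      by (intro nn_integral_cong) (auto split: split_indicator simp: max_def ennreal_neg)
    finally show ?thesis .
  qed
  have sup: "(SUP B\<in>{B \<in> sets M. B \<subseteq> A}. ennreal (m B)) = emeasure (density M (\<lambda>x. ennreal (v x))) A"
    if A: "A \<in> sets M" for A
  proof (subst emeasure_density[OF _ A], simp, rule antisym)
    show "(SUP B\<in>{B \<in> sets M. B \<subseteq> A}. ennreal (m B)) \<le> (\<integral>\<^sup>+x. ennreal (v x) * indicator A x \<partial>M)"
    proof (rule SUP_least)
      fix B assume B: "B \<in> {B \<in> sets M. B \<subseteq> A}"
      then have "ennreal (m B) \<le> (\<integral>\<^sup>+x. ennreal (v x) * indicator B x \<partial>M)" by (intro *) auto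
      also have "\<dots> \<le> (\<integral>\<^sup>+x. ennreal (v x) * indicator A x \<partial>M)"
        using B by (intro nn_integral_mono) (auto split: split_indicator)
      finally show "ennreal (m B) \<le> (\<integral>\<^sup>+x. ennreal (v x) * indicator A x \<partial>M)" .
    qed
    let ?B = "{x\<in>space M. v x \<ge> 0} \<inter> A"
    have B: "?B \<in> sets M" using A by measurable
    have "(\<integral>\<^sup>+x. ennreal (v x) * indicator A x \<partial>M) = (\<integral>\<^sup>+x. ennreal (indicator ?B x * v x) \<partial>M)"
      by (intro nn_integral_cong) (auto split: split_indicator simp: ennreal_neg)
    also have "\<dots> = ennreal (m ?B)"
      unfolding v(2)[OF B] set_lebesgue_integral_def real_scaleR_def using s[OF B]
      by (intro nn_integral_eq_integral) (auto simp: set_integrable_def split: split_indicator)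
    also have "\<dots> \<le> (SUP B\<in>{B \<in> sets M. B \<subseteq> A}. ennreal (m B))"
      using B by (intro SUP_upper) auto
    finally show "(\<integral>\<^sup>+x. ennreal (v x) * indicator A x \<partial>M) \<le> (SUP B\<in>{B \<in> sets M. B \<subseteq> A}. ennreal (m B))" .
  qed
  let ?D = "density M (\<lambda>x. ennreal (v x))"
  have "signed_pos_part M m = measure_of (space M) (sets M) (emeasure ?D)"
    unfolding signed_pos_part_def
    by (rule measure_of_eq) (auto simp: sets.space_closed sets.sigma_sets_eq sup)
  also have "\<dots> = ?D"
    using measure_of_of_measure[of ?D] by simp
  finally show ?thesis .
qed

text \<open>The bridge from the Jordan decomposition to an ordinary integral, used whenever the weak
  equation is rewritten with a velocity: the two parts have densities \<open>max 0 (v x)\<close> and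
  \<open>max 0 (- v x)\<close>, whose difference is \<open>v\<close>.\<close>

lemma signed_integral_density:
  fixes f :: "'a \<Rightarrow> real"
  assumes v: "integrable M v" "\<And>A. A \<in> sets M \<Longrightarrow> m A = (\<integral>x\<in>A. v x \<partial>M)"
    and f: "f \<in> borel_measurable M" "\<And>x. x \<in> space M \<Longrightarrow> \<bar>f x\<bar> \<le> C"
  shows "integrable M (\<lambda>x. f x * v x)" "signed_integral M m f = (\<integral>x. f x * v x \<partial>M)"
proof -
  have [measurable]: "v \<in> borel_measurable M" "f \<in> borel_measurable M" using v f by auto
  have int: "integrable M (\<lambda>x. f x * w x)" if w: "integrable M w" for w
  proof (rule Bochner_Integration.integrable_bound[of M "\<lambda>x. C * w x"])
    show "AE x in M. norm (f x * w x) \<le> norm (C * w x)"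
    proof (rule AE_I2)
      fix x assume "x \<in> space M"
      then have "\<bar>f x\<bar> \<le> \<bar>C\<bar>" using f(2)[of x] by linarith
      then show "norm (f x * w x) \<le> norm (C * w x)"
        by (simp add: abs_mult mult_right_mono)
    qed
  qed (use w in auto)
  show "integrable M (\<lambda>x. f x * v x)" using v by (intro int) auto
  have pos: "(\<integral>x. f x \<partial>signed_pos_part M m') = (\<integral>x. max 0 (w x) * f x \<partial>M)"
    if w: "integrable M w" "\<And>A. A \<in> sets M \<Longrightarrow> m' A = (\<integral>x\<in>A. w x \<partial>M)" for m' w
  proof -
    have [measurable]: "w \<in> borel_measurable M" using w by auto
    have "signed_pos_part M m' = density M (\<lambda>x. ennreal (w x))"
      by (rule signed_pos_part_eq_density) (use w in auto)
    also have "\<dots> = density M (\<lambda>x. ennreal (max 0 (w x)))"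
      by (rule density_cong) (auto simp: max_def ennreal_neg)
    finally show ?thesis by (simp only:) (rule integral_real_density; auto)
  qed
  have "signed_integral M m f = (\<integral>x. max 0 (v x) * f x \<partial>M) - (\<integral>x. max 0 (- v x) * f x \<partial>M)"
    unfolding signed_integral_def
    using v by (simp add: pos[of v] pos[of "\<lambda>x. - v x" "\<lambda>A. - m A"] set_lebesgue_integral_def)
  also have "\<dots> = (\<integral>x. max 0 (v x) * f x - max 0 (- v x) * f x \<partial>M)"
    using int[of "\<lambda>x. max 0 (v x)"] int[of "\<lambda>x. max 0 (- v x)"] v
    by (intro Bochner_Integration.integral_diff[symmetric]) (auto simp: mult.commute)
  also have "\<dots> = (\<integral>x. f x * v x \<partial>M)"
    by (intro Bochner_Integration.integral_cong) (auto simp: max_def)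
  finally show "signed_integral M m f = (\<integral>x. f x * v x \<partial>M)" .
qed

subsection \<open>The torus\<close>

lemma space_torus [simp]: "space torus = {0..<1}"
  by (simp add: torus_def space_restrict_space)

lemma sets_torus: "A \<in> sets torus \<longleftrightarrow> A \<subseteq> {0..<1} \<and> A \<in> sets borel"
  by (simp add: torus_def sets_restrict_space_iff)

lemma sets_torus_lebesgue [simp, measurable_cong]: "sets torus_lebesgue = sets torus"
  by (simp add: torus_lebesgue_def torus_def sets_restrict_space)

lemma space_torus_lebesgue [simp]: "space torus_lebesgue = {0..<1}"
  by (simp add: torus_lebesgue_def space_restrict_space)

lemma emeasure_torus_lebesgue: "A \<in> sets torus \<Longrightarrow> emeasure torus_lebesgue A = emeasure lborel A"
  by (auto simp: torus_lebesgue_def emeasure_restrict_space sets_torus)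

lemma prob_space_torus_lebesgue: "prob_space torus_lebesgue"
  by (intro prob_spaceI) (simp add: emeasure_torus_lebesgue sets_torus)

lemma measurable_torus_id: "(\<lambda>x. x) \<in> measurable torus borel"
  by (simp add: torus_def measurable_restrict_space1)

lemma measurable_torus_borel: "f \<in> measurable borel N \<Longrightarrow> f \<in> measurable torus N"
  by (simp add: torus_def measurable_restrict_space1)

lemma measurable_frac_torus [measurable]: "frac \<in> measurable borel torus"
proof -
  have "(\<lambda>x::real. x - of_int \<lfloor>x\<rfloor>) \<in> borel_measurable borel" by measurable
  then have "frac \<in> borel_measurable (borel :: real measure)"
    by (simp add: frac_def[abs_def])
  then show ?thesis
    unfolding torus_def by (rule measurable_restrict_space2[rotated]) (simp add: frac_lt_1)
qed

definition torus_prob :: "real measure \<Rightarrow> bool" where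
  "torus_prob \<rho> \<longleftrightarrow> sets \<rho> = sets torus \<and> prob_space \<rho>"

lemma torus_probD:
  assumes "torus_prob \<rho>"
  shows "sets \<rho> = sets torus" "space \<rho> = {0..<1}" "prob_space \<rho>" "finite_measure \<rho>"
    "emeasure \<rho> {0..<1} = 1"
  using assms sets_eq_imp_space_eq[of \<rho> torus] prob_space.emeasure_space_1[of \<rho>]
  by (auto simp: torus_prob_def prob_space_def)

lemma torus_prob_measurable:
  "torus_prob \<rho> \<Longrightarrow> f \<in> measurable torus N \<Longrightarrow> f \<in> measurable \<rho> N"
  using measurable_cong_sets[OF torus_probD(1) refl] by blast

lemma torus_prob_torus_lebesgue: "torus_prob torus_lebesgue"
  by (simp add: torus_prob_def prob_space_torus_lebesgue)

lemma sets_torus_generated: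
  "sets torus = sigma_sets {0..<1} (range (\<lambda>a. {0..<1} \<inter> {a<..}))"
proof -
  have 1: "sets (borel :: real measure) = sigma_sets UNIV (range (\<lambda>a. {a<..}))"
    by (simp add: borel_Ioi)
  have "{0..<1::real} \<in> sigma_sets UNIV (range (\<lambda>a. {a<..}))"
    unfolding 1[symmetric] by measurable
  from sigma_sets_Int[OF this] show ?thesis
    by (simp add: torus_def sets_restrict_space 1 image_image)
qed

lemma Int_stable_torus_generator: "Int_stable (range (\<lambda>a::real. {0..<1} \<inter> {a<..}))"
proof (rule Int_stableI_image)
  fix a b :: real
  show "\<exists>k\<in>UNIV. {0..<1} \<inter> {a<..} \<inter> ({0..<1} \<inter> {b<..}) = {0..<1} \<inter> {k<..}"
    by (intro bexI[of _ "max a b"]) auto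
qed

section \<open>Periodic Lipschitz functions and the periodic distance\<close>

definition lip_per :: "real \<Rightarrow> (real \<Rightarrow> real) \<Rightarrow> bool" where
  "lip_per L f \<longleftrightarrow> (\<forall>x. f (x + 1) = f x) \<and> (\<forall>x y. \<bar>f x - f y\<bar> \<le> L * \<bar>x - y\<bar>)"

lemma periodic_add_int:
  assumes "\<And>x::real. f (x + 1) = f x"
  shows "f (x + of_int k) = f x"
proof -
  have nat: "f (y + of_nat n) = f y" for y n
    by (induction n) (use assms[of "y + of_nat _"] in \<open>auto simp: algebra_simps\<close>)
  show ?thesis
  proof (cases "k \<ge> 0")
    case True
    then show ?thesis using nat[of x "nat k"] by simp
  next
    case False
    then show ?thesis using nat[of "x + of_int k" "nat (- k)"] by simp
  qed
qed

lemma lip_per_nonneg: "lip_per L f \<Longrightarrow> 0 \<le> L"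
  unfolding lip_per_def by (metis abs_ge_zero abs_one diff_zero mult.right_neutral order_trans)

lemma lip_per_frac: "lip_per L f \<Longrightarrow> f (frac x) = f x"
  using periodic_add_int[of f "frac x" "\<lfloor>x\<rfloor>"] by (simp add: lip_per_def frac_def)

lemma lip_per_continuous: "lip_per L f \<Longrightarrow> continuous_on S f"
proof -
  assume f: "lip_per L f"
  then have "L-lipschitz_on S f"
    using lip_per_nonneg[OF f] by (auto simp: lipschitz_on_def lip_per_def dist_real_def)
  then show ?thesis by (rule lipschitz_on_continuous_on)
qed

lemma lip_per_borel: "lip_per L f \<Longrightarrow> f \<in> borel_measurable borel"
  by (intro borel_measurable_continuous_onI lip_per_continuous)

lemma lip_per_bounded: "lip_per L f \<Longrightarrow> \<bar>f x\<bar> \<le> \<bar>f 0\<bar> + L"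
proof -
  assume f: "lip_per L f"
  have "\<bar>f (frac x) - f 0\<bar> \<le> L * \<bar>frac x - 0\<bar>" using f unfolding lip_per_def by blast
  also have "\<dots> \<le> L * 1"
    using lip_per_nonneg[OF f] frac_lt_1[of x] by (intro mult_left_mono) auto
  finally show ?thesis using lip_per_frac[OF f, of x] by linarith
qed

lemma lip_per_integrable:
  assumes f: "lip_per L f" and \<rho>: "sets \<rho> = sets torus" "finite_measure \<rho>"
  shows "integrable \<rho> f"
proof -
  interpret finite_measure \<rho> by fact
  have "f \<in> borel_measurable \<rho>"
    using measurable_torus_borel[OF lip_per_borel[OF f]] \<rho> measurable_cong_sets by blast
  then show ?thesis
    by (intro integrable_const_bound[of _ "\<bar>f 0\<bar> + L"]) (auto simp: lip_per_bounded[OF f])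
qed

lemma dist_per_nonneg: "0 \<le> dist_per x y"
  by (simp add: dist_per_def infdist_nonneg)

lemma dist_per_int: "\<exists>k::int. dist_per x y = \<bar>x - y - of_int k\<bar>"
proof -
  obtain a :: real where a: "a \<in> \<int>" "infdist (x - y) \<int> = dist (x - y) a"
    using infdist_attains_inf[OF closed_Ints, of "x - y"] by (metis Ints_0 empty_iff)
  then obtain k :: int where "a = of_int k" by (elim Ints_cases)
  then show ?thesis
    using a(2) by (intro exI[of _ k]) (simp add: dist_per_def dist_real_def)
qed

lemma dist_per_le_int: "dist_per x y \<le> \<bar>x - y - of_int k\<bar>"
  using infdist_le[of "of_int k" \<int> "x - y"] by (simp add: dist_per_def dist_real_def)

lemma dist_per_le_abs: "dist_per x y \<le> \<bar>x - y\<bar>"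
  using dist_per_le_int[of x y 0] by simp

lemma dist_per_add_int: "dist_per (x + of_int k) y = dist_per x y"
proof (rule antisym)
  obtain j :: int where "dist_per x y = \<bar>x - y - of_int j\<bar>" using dist_per_int by blast
  then show "dist_per (x + of_int k) y \<le> dist_per x y"
    using dist_per_le_int[of "x + of_int k" y "j + k"] by simp
  obtain j :: int where "dist_per (x + of_int k) y = \<bar>x + of_int k - y - of_int j\<bar>" using dist_per_int by blast
  then show "dist_per x y \<le> dist_per (x + of_int k) y"
    using dist_per_le_int[of x y "j - k"] by (simp add: algebra_simps)
qed

lemma dist_per_commute: "dist_per x y = dist_per y x"
proof -
  have "dist_per x y \<le> dist_per y x" for x y
  proof -
    obtain j :: int where "dist_per y x = \<bar>y - x - of_int j\<bar>" using dist_per_int by blast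
    moreover have "\<bar>x - y - of_int (- j)\<bar> = \<bar>y - x - of_int j\<bar>" by simp
    ultimately show ?thesis using dist_per_le_int[of x y "- j"] by linarith
  qed
  then show ?thesis using antisym by blast
qed

lemma dist_per_frac: "dist_per (frac x) (frac y) = dist_per x y"
proof -
  have 1: "dist_per (frac x) y = dist_per x y" for x y
    using dist_per_add_int[of "frac x" "\<lfloor>x\<rfloor>" y] by (simp add: frac_def)
  show ?thesis by (metis 1 dist_per_commute)
qed

lemma dist_per_le_1: "dist_per x y \<le> 1"
  using dist_per_le_int[of x y "\<lfloor>x - y\<rfloor>"] floor_correct[of "x - y"] by linarith

text \<open>A Lipschitz bound on the line and periodicity together give the bound for the torus
  distance with the same constant: replace \<open>y\<close> by its integer translate closest to
  \<open>x\<close>.\<close>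

lemma lip_per_dist_per:
  assumes f: "lip_per L f"
  shows "\<bar>f x - f y\<bar> \<le> L * dist_per x y"
proof -
  obtain k :: int where k: "dist_per x y = \<bar>x - y - of_int k\<bar>" using dist_per_int by blast
  have "\<bar>f x - f (y + of_int k)\<bar> \<le> L * \<bar>x - (y + of_int k)\<bar>" using f by (simp add: lip_per_def)
  moreover have "f (y + of_int k) = f y" using f by (intro periodic_add_int) (simp add: lip_per_def)
  ultimately show ?thesis by (simp add: k algebra_simps)
qed

lemma measurable_dist_per [measurable]: "(\<lambda>p. dist_per (fst p) (snd p)) \<in> borel_measurable borel"
  unfolding dist_per_def by (intro borel_measurable_continuous_onI continuous_intros)

text \<open>A test function that sees exactly the points at periodic distance less than
  \<open>r\<close> from \<open>p\<close>; it will detect the support of a weak limit.\<close>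

lemma lip_per_bump: "lip_per 1 (\<lambda>x. max 0 (r - dist_per x p))"
  unfolding lip_per_def
proof (intro conjI allI)
  fix x y
  show "max 0 (r - dist_per (x + 1) p) = max 0 (r - dist_per x p)"
    using dist_per_add_int[of x 1 p] by simp
  have "\<bar>infdist (x - p) \<int> - infdist (y - p) \<int>\<bar> \<le> dist (x - p) (y - p)"
    by (rule infdist_triangle_abs)
  then show "\<bar>max 0 (r - dist_per x p) - max 0 (r - dist_per y p)\<bar> \<le> 1 * \<bar>x - y\<bar>"
    by (simp add: dist_per_def dist_real_def)
qed

text \<open>For nonnegative \<open>a\<close> the set is the open arc from \<open>a\<close> to 1,
  whose complement on the torus lifts to the periodic set \<open>C\<close>; the approximants are
  truncated multiples of the distance to \<open>C\<close>. For negative \<open>a\<close> the set is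
  the whole torus.\<close>

lemma torus_indicator_approx:
  fixes a :: real
  shows "\<exists>F::nat \<Rightarrow> real \<Rightarrow> real. (\<forall>n. lip_per (real n) (F n)) \<and> (\<forall>n z. 0 \<le> F n z \<and> F n z \<le> 1) \<and>
    (\<forall>z\<in>{0..<1}. (\<lambda>n. F n z) \<longlonglongrightarrow> indicator ({0..<1} \<inter> {a<..}) z)"
proof (cases "a < 0")
  case True
  then show ?thesis by (intro exI[of _ "\<lambda>_ _. 1"]) (auto simp: lip_per_def)
next
  case False
  define C where "C = {z::real. frac z \<le> a}"
  define F where "F n z = min 1 (real n * infdist z C)" for n z
  have "0 \<in> C" using False by (simp add: C_def)
  then have ne: "C \<noteq> {}" by auto
  have per: "infdist (z + 1) C = infdist z C" for z
  proof -
    have "(+) 1 ` C = C"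
    proof (intro equalityI subsetI)
      fix z assume "z \<in> C"
      then have "z - 1 \<in> C" by (auto simp: C_def frac_def)
      then show "z \<in> (+) 1 ` C" by (intro image_eqI[of _ _ "z - 1"]) auto
    qed (auto simp: C_def frac_def)
    then have "infdist (z + 1) C = (INF x\<in>(+) 1 ` C. dist (z + 1) x)"
      using ne by (simp add: infdist_notempty)
    also have "\<dots> = (INF x\<in>C. dist z x)"
      by (simp add: image_image dist_real_def algebra_simps)
    finally show ?thesis using ne by (simp add: infdist_notempty)
  qed
  have lip: "lip_per (real n) (F n)" for n
    unfolding lip_per_def
  proof (intro conjI allI)
    fix x y
    show "F n (x + 1) = F n x" by (simp add: F_def per)
    have "\<bar>F n x - F n y\<bar> \<le> \<bar>real n * infdist x C - real n * infdist y C\<bar>"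
      unfolding F_def by linarith
    also have "\<dots> = real n * \<bar>infdist x C - infdist y C\<bar>"
      by (simp add: abs_mult flip: right_diff_distrib)
    also have "\<dots> \<le> real n * \<bar>x - y\<bar>"
      using infdist_triangle_abs[of x C y] by (intro mult_left_mono) (auto simp: dist_real_def)
    finally show "\<bar>F n x - F n y\<bar> \<le> real n * \<bar>x - y\<bar>" .
  qed
  have lim: "(\<lambda>n. F n z) \<longlonglongrightarrow> indicator ({0..<1} \<inter> {a<..}) z" if z: "z \<in> {0..<1}" for z
  proof (cases "z \<le> a")
    case True
    then have "z \<in> C" using z by (simp add: C_def frac_eq[THEN iffD2])
    then show ?thesis using True by (simp add: F_def)
  next
    case zl: False
    \<comment> \<open>\<open>C\<close> does not meet the open interval from \<open>a\<close> to 1,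
      so its distance from \<open>z\<close> is at least the distance of \<open>z\<close> to the
      nearer endpoint.\<close>
    define d where "d = min (z - a) (1 - z)"
    have d: "d > 0" using z zl by (simp add: d_def)
    have "d \<le> dist z c" if "c \<in> C" for c
    proof -
      have c: "c = of_int \<lfloor>c\<rfloor> + frac c" "frac c \<le> a" "frac c \<ge> 0"
        using that by (auto simp: C_def frac_def)
      show ?thesis
      proof (cases "\<lfloor>c\<rfloor> \<le> 0")
        case True
        then have "real_of_int \<lfloor>c\<rfloor> \<le> 0" by simp
        then have "c \<le> a" using c by linarith
        then show ?thesis by (auto simp: d_def dist_real_def)
      next
        case False
        then have "real_of_int \<lfloor>c\<rfloor> \<ge> 1" by simp
        then have "c \<ge> 1" using c by linarith
        then show ?thesis by (auto simp: d_def dist_real_def)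
      qed
    qed
    then have inf: "d \<le> infdist z C"
      unfolding infdist_notempty[OF ne] by (rule cINF_greatest[OF ne])
    obtain N where N: "real N * d \<ge> 1"
      using d reals_Archimedean3 by (metis less_imp_le)
    have "eventually (\<lambda>n. F n z = 1) sequentially"
    proof (rule eventually_sequentiallyI)
      fix n assume "n \<ge> N"
      then have "real N * d \<le> real n * infdist z C"
        using d inf by (intro mult_mono) auto
      then show "F n z = 1" using N by (simp add: F_def)
    qed
    then show ?thesis using zl z by (simp add: tendsto_eventually)
  qed
  show ?thesis
    using lip lim by (intro exI[of _ F]) (auto simp: F_def infdist_nonneg)
qed

text \<open>Dominated convergence along the approximants of the previous lemma recovers the masses
  of the arcs, and the arcs form a generator that is stable under intersection.\<close>

lemma torus_measure_eqI_lip: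
  assumes \<rho>: "sets \<rho> = sets torus" "finite_measure \<rho>" and \<nu>: "sets \<nu> = sets torus" "finite_measure \<nu>"
    and eq: "\<And>L f. lip_per L f \<Longrightarrow> (\<integral>x. f x \<partial>\<rho>) = (\<integral>x. f x \<partial>\<nu>)"
  shows "\<rho> = \<nu>"
proof (rule measure_eqI_generator_eq)
  have sp: "space \<rho> = {0..<1}" "space \<nu> = {0..<1}"
    using \<rho> \<nu> sets_eq_imp_space_eq[of _ torus] by auto
  have gen: "emeasure \<rho> ({0..<1} \<inter> {a<..}) = emeasure \<nu> ({0..<1} \<inter> {a<..})" for a
  proof -
    obtain F where F: "\<And>n. lip_per (real n) (F n)" "\<And>n z. 0 \<le> F n z \<and> F n z \<le> 1"
      "\<And>z. z \<in> {0..<1} \<Longrightarrow> (\<lambda>n. F n z) \<longlonglongrightarrow> indicator ({0..<1} \<inter> {a<..}) z"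
      using torus_indicator_approx[of a] by blast
    have lim: "(\<lambda>n. \<integral>z. F n z \<partial>\<kappa>) \<longlonglongrightarrow> measure \<kappa> ({0..<1} \<inter> {a<..})"
      if \<kappa>: "sets \<kappa> = sets torus" "finite_measure \<kappa>" for \<kappa>
    proof -
      interpret finite_measure \<kappa> by fact
      have sp: "space \<kappa> = {0..<1}" using \<kappa> sets_eq_imp_space_eq[of \<kappa> torus] by auto
      have A: "{0..<1} \<inter> {a<..} \<in> sets \<kappa>" by (auto simp: \<kappa> sets_torus)
      have "(\<lambda>n. \<integral>z. F n z \<partial>\<kappa>) \<longlonglongrightarrow> (\<integral>z. indicator ({0..<1} \<inter> {a<..}) z \<partial>\<kappa>)"
      proof (rule integral_dominated_convergence[where w = "\<lambda>_. 1"])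
        show "(\<lambda>z. indicator ({0..<1} \<inter> {a<..}) z :: real) \<in> borel_measurable \<kappa>"
          using A by simp
        show "F n \<in> borel_measurable \<kappa>" for n
          using lip_per_integrable[OF F(1) \<kappa>] by blast
      qed (use F sp in auto)
      then show ?thesis using A by simp
    qed
    have "measure \<rho> ({0..<1} \<inter> {a<..}) = measure \<nu> ({0..<1} \<inter> {a<..})"
      using LIMSEQ_unique[OF lim[OF \<rho>]] lim[OF \<nu>] eq[OF F(1)] by simp
    then show ?thesis
      using \<rho> \<nu> by (simp add: finite_measure.emeasure_eq_measure)
  qed
  show "Int_stable (range (\<lambda>a::real. {0..<1} \<inter> {a<..}))" by (rule Int_stable_torus_generator)
  show "range (\<lambda>a::real. {0..<1} \<inter> {a<..}) \<subseteq> Pow {0..<1}" by auto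
  show "sets \<rho> = sigma_sets {0..<1} (range (\<lambda>a. {0..<1} \<inter> {a<..}))"
       "sets \<nu> = sigma_sets {0..<1} (range (\<lambda>a. {0..<1} \<inter> {a<..}))"
    using \<rho> \<nu> sets_torus_generated by auto
  show "emeasure \<rho> X = emeasure \<nu> X" if "X \<in> range (\<lambda>a. {0..<1} \<inter> {a<..})" for X
    using that gen by auto
  show "range (\<lambda>_::nat. {0..<1} \<inter> {-1<..}) \<subseteq> range (\<lambda>a::real. {0..<1} \<inter> {a<..})" by auto
  show "(\<Union>i::nat. {0..<1::real} \<inter> {-1<..}) = {0..<1}" by auto
  show "emeasure \<rho> ({0..<1} \<inter> {-1<..}) \<noteq> \<infinity>" using \<rho> finite_measure.emeasure_finite by auto
qed

section \<open>Rotation invariance of Lebesgue measure on the torus\<close>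

lemma nn_integral_periodic_shift:
  fixes p :: "real \<Rightarrow> ennreal"
  assumes [measurable]: "p \<in> borel_measurable borel" and per: "\<And>x. p (x + 1) = p x"
  shows "(\<integral>\<^sup>+y\<in>{0..<1}. p (y + \<theta>) \<partial>lborel) = (\<integral>\<^sup>+y\<in>{0..<1}. p y \<partial>lborel)"
proof -
  define \<phi> where "\<phi> = frac \<theta>"
  have \<phi>: "0 \<le> \<phi>" "\<phi> < 1" by (auto simp: \<phi>_def frac_lt_1)
  have 1: "p (y + \<theta>) = p (y + \<phi>)" for y
    using periodic_add_int[of p "y + \<phi>" "\<lfloor>\<theta>\<rfloor>"] per by (simp add: \<phi>_def frac_def)
  have "(\<integral>\<^sup>+y. p y * indicator {\<phi>..<1+\<phi>} y \<partial>lborel) = (\<integral>\<^sup>+y. p (y + \<phi>) * indicator {0..<1} y \<partial>lborel)"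
    by (subst nn_integral_real_affine[where c = 1 and t = \<phi>])
      (auto intro!: nn_integral_cong split: split_indicator simp: add.commute[of \<phi>])
  \<comment> \<open>The shifted period is cut at 1; periodicity then moves the part beyond 1 back to
    the beginning of \<open>{0..<1}\<close>.\<close>
  also have "(\<integral>\<^sup>+y. p y * indicator {\<phi>..<1+\<phi>} y \<partial>lborel) =
    (\<integral>\<^sup>+y. p y * indicator {\<phi>..<1} y + p y * indicator {1..<1+\<phi>} y \<partial>lborel)"
    using \<phi> by (intro nn_integral_cong) (auto split: split_indicator)
  also have "\<dots> = (\<integral>\<^sup>+y. p y * indicator {\<phi>..<1} y \<partial>lborel) + (\<integral>\<^sup>+y. p y * indicator {1..<1+\<phi>} y \<partial>lborel)"
    by (intro nn_integral_add) auto
  also have "(\<integral>\<^sup>+y. p y * indicator {1..<1+\<phi>} y \<partial>lborel) = (\<integral>\<^sup>+y. p y * indicator {0..<\<phi>} y \<partial>lborel)"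
  proof (subst nn_integral_real_affine[where c = 1 and t = 1])
    have "p (1 + y) = p y" for y using per[of y] by (simp add: add.commute)
    then show "ennreal \<bar>1\<bar> * (\<integral>\<^sup>+ y. p (1 + 1 * y) * indicator {1..<1 + \<phi>} (1 + 1 * y) \<partial>lborel) =
      (\<integral>\<^sup>+ y. p y * indicator {0..<\<phi>} y \<partial>lborel)"
      by (auto intro!: nn_integral_cong split: split_indicator)
  qed auto
  also have "(\<integral>\<^sup>+y. p y * indicator {\<phi>..<1} y \<partial>lborel) + (\<integral>\<^sup>+y. p y * indicator {0..<\<phi>} y \<partial>lborel) =
    (\<integral>\<^sup>+y. p y * indicator {\<phi>..<1} y + p y * indicator {0..<\<phi>} y \<partial>lborel)"
    by (intro nn_integral_add[symmetric]) auto
  also have "\<dots> = (\<integral>\<^sup>+y\<in>{0..<1}. p y \<partial>lborel)"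
    using \<phi> by (intro nn_integral_cong) (auto split: split_indicator)
  finally show ?thesis by (simp add: 1)
qed

lemma measurable_frac_shift [measurable]: "(\<lambda>y. frac (y + \<theta>)) \<in> measurable torus torus"
  by (intro measurable_torus_borel measurable_compose[OF _ measurable_frac_torus]) measurable

lemma nn_integral_torus_lebesgue:
  "(\<integral>\<^sup>+x. f x \<partial>torus_lebesgue) = (\<integral>\<^sup>+x\<in>{0..<1}. f x \<partial>lborel)"
  by (simp add: torus_lebesgue_def nn_integral_restrict_space)

lemma torus_lebesgue_rotation: "distr torus_lebesgue torus (\<lambda>y. frac (y + \<theta>)) = torus_lebesgue"
proof (rule measure_eqI)
  fix A assume "A \<in> sets (distr torus_lebesgue torus (\<lambda>y. frac (y + \<theta>)))"
  then have A: "A \<in> sets torus" by simp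
  let ?p = "\<lambda>z. indicator A (frac z) :: ennreal"
  have m: "?p \<in> borel_measurable borel"
    using A by (intro measurable_compose[OF measurable_frac_torus]) auto
  have "emeasure (distr torus_lebesgue torus (\<lambda>y. frac (y + \<theta>))) A = (\<integral>\<^sup>+y. indicator A y \<partial>distr torus_lebesgue torus (\<lambda>y. frac (y + \<theta>)))"
    using A by (simp add: nn_integral_indicator)
  also have "\<dots> = (\<integral>\<^sup>+y. ?p (y + \<theta>) \<partial>torus_lebesgue)"
    using A by (subst nn_integral_distr) auto
  also have "\<dots> = (\<integral>\<^sup>+y\<in>{0..<1}. ?p y \<partial>lborel)"
    unfolding nn_integral_torus_lebesgue
    by (rule nn_integral_periodic_shift[OF m]) (simp add: frac_1_eq)
  also have "\<dots> = (\<integral>\<^sup>+y. indicator A y \<partial>torus_lebesgue)"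
    unfolding nn_integral_torus_lebesgue
    by (intro nn_integral_cong) (auto split: split_indicator simp: frac_eq[THEN iffD2])
  also have "\<dots> = emeasure torus_lebesgue A" using A by (simp add: nn_integral_indicator)
  finally show "emeasure (distr torus_lebesgue torus (\<lambda>y. frac (y + \<theta>))) A = emeasure torus_lebesgue A" .
qed simp

lemma integral_periodic_shift:
  fixes p :: "real \<Rightarrow> real"
  assumes [measurable]: "p \<in> borel_measurable borel" and per: "\<And>x. p (x + 1) = p x"
  shows "(\<integral>y. p (y + \<theta>) \<partial>torus_lebesgue) = (\<integral>y. p y \<partial>torus_lebesgue)"
proof -
  have fr: "p (frac x) = p x" for x
    using periodic_add_int[of p "frac x" "\<lfloor>x\<rfloor>"] per by (simp add: frac_def)
  have "(\<integral>y. p y \<partial>torus_lebesgue) = (\<integral>y. p y \<partial>distr torus_lebesgue torus (\<lambda>y. frac (y + \<theta>)))"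
    by (simp add: torus_lebesgue_rotation)
  also have "\<dots> = (\<integral>y. p (frac (y + \<theta>)) \<partial>torus_lebesgue)"
    by (rule integral_distr) (auto intro: measurable_torus_borel)
  finally show ?thesis by (simp add: fr)
qed

subsection \<open>Primitives of bounded functions\<close>

text \<open>The difference of indicators encodes the oriented integral from 0 to \<open>x\<close>
  for either sign of \<open>x\<close>, so that increments become integrals over
  \<open>{a..<b}\<close> without case distinctions.\<close>

definition prim :: "(real \<Rightarrow> real) \<Rightarrow> real \<Rightarrow> real" where
  "prim k x = (\<integral>z. k z * (indicator {0..<x} z - indicator {x..<0} z) \<partial>lborel)"

lemma emeasure_lborel_Ico_finite: "emeasure lborel {a..<b::real} < \<infinity>"
  by (cases "a \<le> b") auto

lemma integrable_bounded_indicator: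
  fixes k :: "real \<Rightarrow> real"
  assumes [measurable]: "k \<in> borel_measurable borel" and k: "\<And>x. \<bar>k x\<bar> \<le> C"
  shows "integrable lborel (\<lambda>z. k z * indicator {a..<b} z)"
proof -
  have "integrable lborel (\<lambda>z. indicator {a..<b} z *\<^sub>R k z)"
    by (rule integrableI_bounded_set_indicator[of _ _ _ C]) (use k emeasure_lborel_Ico_finite in auto)
  then show ?thesis by (simp add: mult.commute)
qed

lemma prim_diff:
  assumes k: "k \<in> borel_measurable borel" "\<And>x. \<bar>k x\<bar> \<le> C" and "a \<le> b"
  shows "prim k b - prim k a = (\<integral>z. k z * indicator {a..<b} z \<partial>lborel)"
proof -
  note int = integrable_bounded_indicator[OF k]
  have "prim k b - prim k a = (\<integral>z. k z * (indicator {0..<b} z - indicator {b..<0} z) -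
      k z * (indicator {0..<a} z - indicator {a..<0} z) \<partial>lborel)"
    unfolding prim_def
    using int by (intro Bochner_Integration.integral_diff[symmetric]) (auto simp: right_diff_distrib)
  also have "\<dots> = (\<integral>z. k z * indicator {a..<b} z \<partial>lborel)"
    using \<open>a \<le> b\<close> by (intro Bochner_Integration.integral_cong) (auto split: split_indicator)
  finally show ?thesis .
qed

lemma prim_0 [simp]: "prim k 0 = 0"
  by (simp add: prim_def)

lemma integral_torus_lebesgue:
  fixes k :: "real \<Rightarrow> real"
  shows "(\<integral>x. k x \<partial>torus_lebesgue) = (\<integral>x. k x * indicator {0..<1} x \<partial>lborel)"
  by (simp add: torus_lebesgue_def integral_restrict_space mult.commute)

text \<open>The vanishing mean is what makes the primitive periodic: the increment over any period
  is the mean of \<open>k\<close>.\<close>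

lemma lip_per_prim:
  assumes k: "k \<in> borel_measurable borel" "\<And>x. \<bar>k x\<bar> \<le> C"
    and per: "\<And>x. k (x + 1) = k x" and zero: "(\<integral>x. k x \<partial>torus_lebesgue) = 0"
  shows "lip_per C (prim k)"
  unfolding lip_per_def
proof (intro conjI allI)
  fix x y
  have "(\<integral>z. k z * indicator {x..<x + 1} z \<partial>lborel) = (\<integral>z. k (z + x) * indicator {0..<1} z \<partial>lborel)"
    by (subst lborel_integral_real_affine[where c = 1 and t = x])
      (auto intro!: Bochner_Integration.integral_cong split: split_indicator simp: add.commute[of x])
  also have "\<dots> = 0"
    using integral_periodic_shift[OF k(1) per, of x] zero by (simp add: integral_torus_lebesgue)
  finally show "prim k (x + 1) = prim k x"
    using prim_diff[OF k, of x "x + 1"] by simp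
  have *: "\<bar>prim k b - prim k a\<bar> \<le> C * (b - a)" if "a \<le> b" for a b
  proof -
    have "\<bar>\<integral>z. k z * indicator {a..<b} z \<partial>lborel\<bar> \<le> (\<integral>z. C * indicator {a..<b} z \<partial>lborel)"
      using k(2) integrable_bounded_indicator[of "\<lambda>_. C" "\<bar>C\<bar>" a b] integrable_bounded_indicator[OF k, of a b]
      by (intro integral_abs_bound[THEN order_trans] integral_mono) (auto split: split_indicator)
    also have "\<dots> = C * (b - a)" using that by simp
    finally show ?thesis using prim_diff[OF k that] by simp
  qed
  show "\<bar>prim k x - prim k y\<bar> \<le> C * \<bar>x - y\<bar>"
    using *[of x y] *[of y x] by (cases "x \<le> y") auto
qed

subsection \<open>Quasi-periodic distribution functions\<close>

text \<open>The distribution function of the periodic lift of \<rho> to the line. In contrast to the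
  distribution function of \<rho> on the line, it grows by 1 over each period.\<close>

definition tcdf :: "real measure \<Rightarrow> real \<Rightarrow> real" where
  "tcdf \<rho> x = of_int \<lfloor>x\<rfloor> + measure \<rho> {0..frac x}"

text \<open>The shift is chosen such that the coupling of \<open>\<rho>\<close> with Lebesgue measure induced by the
  generalized inverse \<open>gquant\<close> of \<open>gcdf\<close> is optimal for the periodic distance.\<close>

definition gcdf :: "real measure \<Rightarrow> real \<Rightarrow> real" where
  "gcdf \<rho> x = tcdf \<rho> x - ((\<integral>z. tcdf \<rho> z \<partial>torus_lebesgue) - 1 / 2)"

definition gquant :: "real measure \<Rightarrow> real \<Rightarrow> real" where
  "gquant \<rho> y = Inf {x. y \<le> gcdf \<rho> x}"

lemma real_distribution_torus:
  assumes "torus_prob \<rho>"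
  shows "real_distribution (distr \<rho> borel (\<lambda>x. x))"
    and "0 \<le> x \<Longrightarrow> x < 1 \<Longrightarrow> cdf (distr \<rho> borel (\<lambda>x. x)) x = measure \<rho> {0..x}"
    and "x < 0 \<Longrightarrow> cdf (distr \<rho> borel (\<lambda>x. x)) x = 0"
    and "1 \<le> x \<Longrightarrow> cdf (distr \<rho> borel (\<lambda>x. x)) x = 1"
proof -
  note \<rho> = torus_probD[OF assms]
  have m: "(\<lambda>x. x) \<in> measurable \<rho> borel"
    by (rule torus_prob_measurable[OF assms measurable_torus_id])
  interpret prob_space \<rho> by fact
  show "real_distribution (distr \<rho> borel (\<lambda>x. x))"
    using m by (simp add: real_distribution_def real_distribution_axioms_def prob_space_distr)
  have c: "cdf (distr \<rho> borel (\<lambda>x. x)) x = measure \<rho> ({..x} \<inter> {0..<1})" for x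
    using m \<rho> by (simp add: cdf_def measure_distr)
  show "cdf (distr \<rho> borel (\<lambda>x. x)) x = measure \<rho> {0..x}" if "0 \<le> x" "x < 1"
  proof -
    have "{..x} \<inter> {0..<1} = {0..x}" using that by auto
    then show ?thesis by (simp add: c)
  qed
  show "cdf (distr \<rho> borel (\<lambda>x. x)) x = 0" if "x < 0"
  proof -
    have "{..x} \<inter> {0..<1} = {}" using that by auto
    then show ?thesis by (simp add: c)
  qed
  show "cdf (distr \<rho> borel (\<lambda>x. x)) x = 1" if "1 \<le> x"
  proof -
    have "{..x} \<inter> {0..<1} = {0..<1}" using that by auto
    then show ?thesis using prob_space by (simp add: c \<rho>)
  qed
qed

context
  fixes \<rho> assumes \<rho>: "torus_prob \<rho>"
begin

interpretation R: real_distribution "distr \<rho> borel (\<lambda>x. x)"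
  by (rule real_distribution_torus[OF \<rho>])

lemma tcdf_eq_cdf: "of_int n \<le> x \<Longrightarrow> x < of_int n + 1 \<Longrightarrow>
    tcdf \<rho> x = of_int n + cdf (distr \<rho> borel (\<lambda>x. x)) (x - of_int n)"
proof -
  assume n: "of_int n \<le> x" "x < of_int n + 1"
  then have "\<lfloor>x\<rfloor> = n" by (simp add: floor_eq_iff)
  then show ?thesis
    using n real_distribution_torus(2)[OF \<rho>, of "x - of_int n"] by (simp add: tcdf_def frac_def)
qed

lemma tcdf_add_1: "tcdf \<rho> (x + 1) = tcdf \<rho> x + 1"
  by (simp add: tcdf_def frac_1_eq)

lemma tcdf_floor: "of_int \<lfloor>x\<rfloor> \<le> tcdf \<rho> x" "tcdf \<rho> x \<le> of_int \<lfloor>x\<rfloor> + 1"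
proof -
  interpret prob_space \<rho> using torus_probD[OF \<rho>] by simp
  show "of_int \<lfloor>x\<rfloor> \<le> tcdf \<rho> x" "tcdf \<rho> x \<le> of_int \<lfloor>x\<rfloor> + 1"
    by (auto simp: tcdf_def)
qed

lemma mono_tcdf: "mono (tcdf \<rho>)"
proof (rule monoI)
  fix x y :: real assume xy: "x \<le> y"
  show "tcdf \<rho> x \<le> tcdf \<rho> y"
  proof (cases "\<lfloor>x\<rfloor> = \<lfloor>y\<rfloor>")
    case True
    have n: "of_int \<lfloor>x\<rfloor> \<le> x" "of_int \<lfloor>x\<rfloor> \<le> y" "x < of_int \<lfloor>x\<rfloor> + 1" "y < of_int \<lfloor>x\<rfloor> + 1"
      subgoal by linarith
      subgoal using xy by linarith
      subgoal by linarith
      subgoal unfolding True by linarith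
      done
    show ?thesis
      using tcdf_eq_cdf[OF n(1,3)] tcdf_eq_cdf[OF n(2,4)] xy
        R.cdf_nondecreasing[of "x - of_int \<lfloor>x\<rfloor>" "y - of_int \<lfloor>x\<rfloor>"] by linarith
  next
    case False
    then have "\<lfloor>x\<rfloor> + 1 \<le> \<lfloor>y\<rfloor>" using floor_mono[OF xy] by linarith
    then have "real_of_int \<lfloor>x\<rfloor> + 1 \<le> of_int \<lfloor>y\<rfloor>" by linarith
    then show ?thesis using tcdf_floor[of x] tcdf_floor[of y] by linarith
  qed
qed

lemma right_cont_tcdf: "continuous (at_right x) (tcdf \<rho>)"
proof -
  define n where "n = \<lfloor>x\<rfloor>"
  have n: "of_int n \<le> x" "x < of_int n + 1" unfolding n_def by linarith+
  have "((\<lambda>z. cdf (distr \<rho> borel (\<lambda>x. x)) z) \<longlongrightarrow> cdf (distr \<rho> borel (\<lambda>x. x)) (x - of_int n)) (at_right (x - of_int n))"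
    using R.cdf_is_right_cont[of "x - of_int n"] by (simp add: continuous_within)
  moreover have "filterlim (\<lambda>z. z - of_int n) (at_right (x - of_int n)) (at_right x)"
    by (auto simp: filterlim_at eventually_at_filter intro!: tendsto_intros)
  ultimately have "((\<lambda>z. cdf (distr \<rho> borel (\<lambda>x. x)) (z - of_int n)) \<longlongrightarrow> cdf (distr \<rho> borel (\<lambda>x. x)) (x - of_int n)) (at_right x)"
    by (rule filterlim_compose)
  from tendsto_add[OF tendsto_const this]
  have "((\<lambda>z. of_int n + cdf (distr \<rho> borel (\<lambda>x. x)) (z - of_int n)) \<longlongrightarrow> of_int n + cdf (distr \<rho> borel (\<lambda>x. x)) (x - of_int n)) (at_right x)" .
  moreover have "eventually (\<lambda>z. of_int n + cdf (distr \<rho> borel (\<lambda>x. x)) (z - of_int n) = tcdf \<rho> z) (at_right x)"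
    using n tcdf_eq_cdf[of n] by (auto simp: eventually_at_right_field intro!: exI[of _ "of_int n + 1"])
  ultimately have "(tcdf \<rho> \<longlongrightarrow> of_int n + cdf (distr \<rho> borel (\<lambda>x. x)) (x - of_int n)) (at_right x)"
    by (rule Lim_transform_eventually)
  then show ?thesis using tcdf_eq_cdf[OF n] by (simp add: continuous_within)
qed

lemma borel_measurable_tcdf [measurable]: "tcdf \<rho> \<in> borel_measurable borel"
  by (intro borel_measurable_mono mono_tcdf)

lemma integrable_tcdf: "integrable torus_lebesgue (tcdf \<rho>)"
proof -
  interpret prob_space torus_lebesgue by (rule prob_space_torus_lebesgue)
  show ?thesis
  proof (rule integrable_const_bound[of _ 2])
    show "AE x in torus_lebesgue. norm (tcdf \<rho> x) \<le> 2"
    proof (rule AE_I2)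
      fix x assume "x \<in> space torus_lebesgue"
      then have "\<lfloor>x\<rfloor> = 0" by (auto simp: floor_eq_iff)
      then show "norm (tcdf \<rho> x) \<le> 2" using tcdf_floor[of x] by auto
    qed
  qed (simp add: measurable_torus_borel cong: measurable_cong_sets)
qed

lemma integral_tcdf: "0 \<le> (\<integral>z. tcdf \<rho> z \<partial>torus_lebesgue)" "(\<integral>z. tcdf \<rho> z \<partial>torus_lebesgue) \<le> 1"
proof -
  interpret prob_space torus_lebesgue by (rule prob_space_torus_lebesgue)
  have *: "0 \<le> tcdf \<rho> x" "tcdf \<rho> x \<le> 1" if "x \<in> space torus_lebesgue" for x
  proof -
    have "\<lfloor>x\<rfloor> = 0" using that by (auto simp: floor_eq_iff)
    then show "0 \<le> tcdf \<rho> x" "tcdf \<rho> x \<le> 1" using tcdf_floor[of x] by auto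
  qed
  show "0 \<le> (\<integral>z. tcdf \<rho> z \<partial>torus_lebesgue)" using * by (intro Bochner_Integration.integral_nonneg) auto
  have "(\<integral>z. tcdf \<rho> z \<partial>torus_lebesgue) \<le> (\<integral>z. 1 \<partial>torus_lebesgue)"
    using * integrable_tcdf by (intro integral_mono) auto
  then show "(\<integral>z. tcdf \<rho> z \<partial>torus_lebesgue) \<le> 1" using prob_space by simp
qed

lemma gcdf_add_1: "gcdf \<rho> (x + 1) = gcdf \<rho> x + 1"
  by (simp add: gcdf_def tcdf_add_1)

lemma mono_gcdf: "mono (gcdf \<rho>)"
  using mono_tcdf by (auto simp: mono_def gcdf_def)

lemma borel_measurable_gcdf [measurable]: "gcdf \<rho> \<in> borel_measurable borel"
  by (intro borel_measurable_mono mono_gcdf)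

text \<open>\<open>tcdf\<close> stays within 1 of the identity and its mean lies between 0 and 1, so
  the shift is at most 1/2 in absolute value. Doubled, this 3/2 becomes the Lipschitz constant 3 of
  the Kantorovich potential.\<close>

lemma gcdf_bound: "\<bar>gcdf \<rho> x - x\<bar> \<le> 3 / 2"
  using integral_tcdf tcdf_floor[of x] floor_correct[of x] unfolding gcdf_def by linarith

lemma integrable_gcdf: "integrable torus_lebesgue (gcdf \<rho>)"
proof -
  interpret prob_space torus_lebesgue by (rule prob_space_torus_lebesgue)
  show ?thesis using integrable_tcdf by (simp add: gcdf_def[abs_def])
qed

lemma integral_gcdf: "(\<integral>x. gcdf \<rho> x \<partial>torus_lebesgue) = 1 / 2"
proof -
  interpret prob_space torus_lebesgue by (rule prob_space_torus_lebesgue)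
  show ?thesis using integrable_tcdf prob_space by (simp add: gcdf_def[abs_def])
qed

text \<open>The Galois connection between distribution function and quantile function, which
  replaces all inversion arguments. Right continuity makes the infimum that defines
  \<open>gquant\<close> a minimum; closeness of \<open>gcdf\<close> to the identity makes the set
  nonempty and bounded below.\<close>

lemma gquant_le_iff: "gquant \<rho> y \<le> x \<longleftrightarrow> y \<le> gcdf \<rho> x"
proof
  let ?F = "{x. y \<le> gcdf \<rho> x}"
  have bdd: "bdd_below ?F"
  proof (rule bdd_belowI[of _ "y - 2"])
    fix x assume "x \<in> ?F"
    then show "y - 2 \<le> x" using gcdf_bound[of x] unfolding mem_Collect_eq by linarith
  qed
  have "y + 2 \<in> ?F" using gcdf_bound[of "y + 2"] unfolding mem_Collect_eq by linarith
  then have ne: "?F \<noteq> {}" by blast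
  show "y \<le> gcdf \<rho> x \<Longrightarrow> gquant \<rho> y \<le> x"
    unfolding gquant_def by (auto intro!: cInf_lower bdd)
  assume "gquant \<rho> y \<le> x"
  have "y \<le> (INF s\<in>?F. gcdf \<rho> s)" by (rule cINF_greatest[OF ne]) auto
  also have "\<dots> = gcdf \<rho> (Inf ?F)"
  proof -
    have "continuous (at_right x) (gcdf \<rho>)" for x
      unfolding gcdf_def[abs_def] by (intro continuous_intros right_cont_tcdf)
    from continuous_at_Inf_mono[OF mono_gcdf this ne bdd] show ?thesis by simp
  qed
  also have "\<dots> \<le> gcdf \<rho> x"
    using \<open>gquant \<rho> y \<le> x\<close> by (intro monoD[OF mono_gcdf]) (simp add: gquant_def)
  finally show "y \<le> gcdf \<rho> x" .
qed

lemma gquant_bound: "\<bar>gquant \<rho> y - y\<bar> \<le> 3 / 2"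
proof -
  have "gquant \<rho> y \<le> y + 3 / 2"
    unfolding gquant_le_iff using gcdf_bound[of "y + 3/2"] by linarith
  moreover have "y \<le> gcdf \<rho> (gquant \<rho> y)" using gquant_le_iff[of y "gquant \<rho> y"] by simp
  then have "y - 3 / 2 \<le> gquant \<rho> y" using gcdf_bound[of "gquant \<rho> y"] by linarith
  ultimately show ?thesis by linarith
qed

lemma gquant_add_1: "gquant \<rho> (y + 1) = gquant \<rho> y + 1"
proof -
  have 1: "gquant \<rho> (y + 1) \<le> x + 1 \<longleftrightarrow> gquant \<rho> y \<le> x" for x
    by (simp add: gquant_le_iff gcdf_add_1)
  show ?thesis using 1[of "gquant \<rho> y"] 1[of "gquant \<rho> (y + 1) - 1"] by simp
qed

lemma mono_gquant: "mono (gquant \<rho>)"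
proof (rule monoI)
  fix x y :: real assume "x \<le> y"
  then show "gquant \<rho> x \<le> gquant \<rho> y"
    using gquant_le_iff[of y "gquant \<rho> y"] gquant_le_iff[of x "gquant \<rho> y"] by simp
qed

lemma borel_measurable_gquant [measurable]: "gquant \<rho> \<in> borel_measurable borel"
  by (intro borel_measurable_mono mono_gquant)

lemma measurable_frac_gquant [measurable]: "(\<lambda>y. frac (gquant \<rho> y)) \<in> measurable torus torus"
  by (intro measurable_torus_borel measurable_compose[OF _ measurable_frac_torus]) measurable

text \<open>Up to a translation of its argument, \<open>gquant\<close> is the usual quantile
  function, which transports Lebesgue measure on the unit interval to \<rho>. The translation is
  harmless: \<open>gquant\<close> commutes with adding 1, so the integrand is periodic and any full
  period gives the same integral.\<close>

lemma distr_frac_gquant: "distr torus_lebesgue torus (\<lambda>y. frac (gquant \<rho> y)) = \<rho>"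
proof (rule measure_eqI)
  interpret C: cdf_distribution "distr \<rho> borel (\<lambda>x. x)" ..
  let ?M = "distr \<rho> borel (\<lambda>x. x)"
  define \<theta> where "\<theta> = (\<integral>z. tcdf \<rho> z \<partial>torus_lebesgue) - 1 / 2"
  have q: "gquant \<rho> (v - \<theta>) = Inf {x. v \<le> cdf ?M x}" if v: "0 < v" "v < 1" for v
  proof -
    have "v - \<theta> \<le> gcdf \<rho> x \<longleftrightarrow> v \<le> cdf ?M x" for x
    proof -
      have "v - \<theta> \<le> gcdf \<rho> x \<longleftrightarrow> v \<le> tcdf \<rho> x" by (simp add: gcdf_def \<theta>_def)
      also have "\<dots> \<longleftrightarrow> v \<le> cdf ?M x"
      proof -
        \<comment> \<open>Outside the fundamental domain the two distribution functions differ, but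
          for \<open>v\<close> strictly between 0 and 1 both comparisons have the same truth value
          there.\<close>
        consider "x < 0" | "0 \<le> x" "x < 1" | "1 \<le> x" by linarith
        then show ?thesis
        proof cases
          case 1
          then have "\<lfloor>x\<rfloor> \<le> -1" by linarith
          then have "real_of_int \<lfloor>x\<rfloor> \<le> -1" by linarith
          then show ?thesis using 1 tcdf_floor[of x] real_distribution_torus(3)[OF \<rho>, of x] v by auto
        next
          case 2
          then show ?thesis using tcdf_eq_cdf[of 0 x] by simp
        next
          case 3
          then have "1 \<le> \<lfloor>x\<rfloor>" by linarith
          then have "1 \<le> real_of_int \<lfloor>x\<rfloor>" by linarith
          then have "1 \<le> tcdf \<rho> x" using tcdf_floor(1)[of x] by linarith
          then show ?thesis using 3 real_distribution_torus(4)[OF \<rho>, of x] v by auto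
        qed
      qed
      finally show ?thesis .
    qed
    then show ?thesis by (simp add: gquant_def)
  qed
  show "sets (distr torus_lebesgue torus (\<lambda>y. frac (gquant \<rho> y))) = sets \<rho>"
    using torus_probD[OF \<rho>] by simp
  fix A assume "A \<in> sets (distr torus_lebesgue torus (\<lambda>y. frac (gquant \<rho> y)))"
  then have A: "A \<in> sets torus" by simp
  let ?p = "\<lambda>z. indicator A (frac z) :: ennreal"
  have [measurable]: "?p \<in> borel_measurable borel"
    using A by (intro measurable_compose[OF measurable_frac_torus]) auto
  have "emeasure (distr torus_lebesgue torus (\<lambda>y. frac (gquant \<rho> y))) A = (\<integral>\<^sup>+y. indicator A y \<partial>distr torus_lebesgue torus (\<lambda>y. frac (gquant \<rho> y)))"
    using A by (simp add: nn_integral_indicator)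
  also have "\<dots> = (\<integral>\<^sup>+y. ?p (gquant \<rho> y) \<partial>torus_lebesgue)"
    using A by (subst nn_integral_distr) auto
  also have "\<dots> = (\<integral>\<^sup>+y\<in>{0..<1}. ?p (gquant \<rho> (y + - \<theta>)) \<partial>lborel)"
    unfolding nn_integral_torus_lebesgue
    by (rule nn_integral_periodic_shift[symmetric]) (auto simp: gquant_add_1 frac_1_eq)
  also have "\<dots> = (\<integral>\<^sup>+y\<in>{0<..<1}. ?p (gquant \<rho> (y + - \<theta>)) \<partial>lborel)"
    using AE_lborel_singleton[of 0]
    by (intro nn_integral_cong_AE) (auto elim!: eventually_mono split: split_indicator)
  also have "\<dots> = (\<integral>\<^sup>+y\<in>{0<..<1}. ?p (Inf {x. y \<le> cdf ?M x}) \<partial>lborel)"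
    using q by (intro nn_integral_cong) (auto split: split_indicator)
  also have "\<dots> = (\<integral>\<^sup>+y. ?p (Inf {x. y \<le> cdf ?M x}) \<partial>restrict_space lborel {0<..<1})"
    by (simp add: nn_integral_restrict_space)
  also have "\<dots> = (\<integral>\<^sup>+x. ?p x \<partial>distr (restrict_space lborel {0<..<1}) borel (\<lambda>y. Inf {x. y \<le> cdf ?M x}))"
  proof (rule nn_integral_distr[symmetric])
    have "(\<lambda>y. Inf {x. y \<le> cdf ?M x}) \<in> borel_measurable (restrict_space borel {0<..<1})"
      by (rule C.measurable_CI)
    then show "(\<lambda>y. Inf {x. y \<le> cdf ?M x}) \<in> borel_measurable (restrict_space lborel {0<..<1})"
      using measurable_cong_sets[OF restrict_space_sets_cong[OF refl sets_lborel] refl] by blast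
  qed simp
  also have "\<dots> = (\<integral>\<^sup>+x. ?p x \<partial>?M)" by (simp add: C.distr_I_eq_M)
  also have "\<dots> = (\<integral>\<^sup>+x. ?p x \<partial>\<rho>)"
    by (rule nn_integral_distr[OF torus_prob_measurable[OF \<rho> measurable_torus_id]]) simp
  also have "\<dots> = (\<integral>\<^sup>+x. indicator A x \<partial>\<rho>)"
    using torus_probD[OF \<rho>] by (intro nn_integral_cong) (auto simp: frac_eq[THEN iffD2])
  also have "\<dots> = emeasure \<rho> A" using A torus_probD[OF \<rho>] by (simp add: nn_integral_indicator)
  finally show "emeasure (distr torus_lebesgue torus (\<lambda>y. frac (gquant \<rho> y))) A = emeasure \<rho> A" .
qed

end

subsection \<open>Couplings and duality for the periodic Wasserstein distance\<close>

lemma measurable_dist_per_torus: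
  "(\<lambda>p. dist_per (fst p) (snd p)) \<in> borel_measurable (torus \<Otimes>\<^sub>M torus)"
proof -
  have "(\<lambda>p. (fst p, snd p)) \<in> measurable (torus \<Otimes>\<^sub>M torus) (borel \<Otimes>\<^sub>M borel)"
    by (intro measurable_Pair measurable_compose[OF measurable_fst measurable_torus_id]
        measurable_compose[OF measurable_snd measurable_torus_id])
  then have "(\<lambda>p. p) \<in> measurable (torus \<Otimes>\<^sub>M torus) (borel :: (real \<times> real) measure)"
    by (simp add: borel_prod)
  from measurable_compose[OF this measurable_dist_per] show ?thesis .
qed

text \<open>The image of Lebesgue measure under the pair of maps is a coupling, and its cost is the
  integral on the right.\<close>

lemma W_per_sq_le_maps:
  assumes q: "q1 \<in> measurable torus torus" "q2 \<in> measurable torus torus"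
    and \<rho>: "distr torus_lebesgue torus q1 = \<rho>" and \<nu>: "distr torus_lebesgue torus q2 = \<nu>"
  shows "W_per_sq \<rho> \<nu> \<le> (\<integral>\<^sup>+y. ennreal ((dist_per (q1 y) (q2 y))\<^sup>2) \<partial>torus_lebesgue)"
proof -
  let ?\<pi> = "distr torus_lebesgue (torus \<Otimes>\<^sub>M torus) (\<lambda>y. (q1 y, q2 y))"
  have q': "q1 \<in> measurable torus_lebesgue torus" "q2 \<in> measurable torus_lebesgue torus"
    using q by (auto simp: measurable_def)
  have m: "(\<lambda>y. (q1 y, q2 y)) \<in> measurable torus_lebesgue (torus \<Otimes>\<^sub>M torus)"
    using q' by (rule measurable_Pair)
  have "distr ?\<pi> torus fst = distr torus_lebesgue torus (fst \<circ> (\<lambda>y. (q1 y, q2 y)))"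
    by (rule distr_distr[OF measurable_fst m])
  moreover have "distr ?\<pi> torus snd = distr torus_lebesgue torus (snd \<circ> (\<lambda>y. (q1 y, q2 y)))"
    by (rule distr_distr[OF measurable_snd m])
  ultimately have "?\<pi> \<in> couplings \<rho> \<nu>"
    using \<rho> \<nu> by (simp add: couplings_def comp_def)
  then have "W_per_sq \<rho> \<nu> \<le> (\<integral>\<^sup>+(x, y). ennreal ((dist_per x y)\<^sup>2) \<partial>?\<pi>)"
    unfolding W_per_sq_def by (rule INF_lower)
  also have "\<dots> = (\<integral>\<^sup>+p. ennreal ((dist_per (fst p) (snd p))\<^sup>2) \<partial>?\<pi>)"
    by (intro nn_integral_cong) (simp add: split_beta)
  also have "\<dots> = (\<integral>\<^sup>+y. ennreal ((dist_per (q1 y) (q2 y))\<^sup>2) \<partial>torus_lebesgue)"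
    by (subst nn_integral_distr[OF m]) (use measurable_dist_per_torus in \<open>auto\<close>)
  finally show ?thesis .
qed

text \<open>Expresses a difference of quantiles as the length of a set of thresholds. With Fubini
  and \<open>gquant_le_iff\<close>, the area between two quantile functions becomes the area between
  the distribution functions.\<close>

lemma ennreal_abs_diff_eq_nn_integral:
  "ennreal \<bar>a - b\<bar> = (\<integral>\<^sup>+x. indicator {x. (a \<le> x) \<noteq> (b \<le> x)} x \<partial>lborel)"
proof -
  have "{x. (a \<le> x) \<noteq> (b \<le> x)} = {min a b..<max a b}" by (auto simp: min_def max_def)
  then show ?thesis by (simp add: max_def min_def abs_if)
qed

lemma nn_integral_five_periods:
  fixes p :: "real \<Rightarrow> ennreal"
  assumes [measurable]: "p \<in> borel_measurable borel" and per: "\<And>x. p (x + 1) = p x"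
  shows "(\<integral>\<^sup>+x\<in>{-2..<3}. p x \<partial>lborel) = 5 * (\<integral>\<^sup>+x\<in>{0..<1}. p x \<partial>lborel)"
proof -
  have 1: "(\<integral>\<^sup>+x\<in>{of_int k..<of_int k + 1}. p x \<partial>lborel) = (\<integral>\<^sup>+x\<in>{0..<1}. p x \<partial>lborel)" for k :: int
  proof (subst nn_integral_real_affine[where c = 1 and t = "of_int k"])
    have "p (of_int k + y) = p y" for y
      using periodic_add_int[of p y k] per by (simp add: add.commute)
    then show "ennreal \<bar>1\<bar> * (\<integral>\<^sup>+y. p (of_int k + 1 * y) * indicator {of_int k..<of_int k + 1} (of_int k + 1 * y) \<partial>lborel)
        = (\<integral>\<^sup>+x\<in>{0..<1}. p x \<partial>lborel)"
      by (auto intro!: nn_integral_cong split: split_indicator)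
  qed auto
  have five: "(\<Sum>k\<in>{-2,-1,0,1,2::int}. h k) = h (-2) + h (-1) + h 0 + h 1 + h 2" for h :: "int \<Rightarrow> ennreal"
    by (simp add: add.assoc)
  have "(\<integral>\<^sup>+x\<in>{-2..<3}. p x \<partial>lborel) = (\<integral>\<^sup>+x. (\<Sum>k\<in>{-2,-1,0,1,2::int}. p x * indicator {of_int k..<of_int k + 1} x) \<partial>lborel)"
    unfolding five by (intro nn_integral_cong) (auto split: split_indicator)
  also have "\<dots> = (\<Sum>k\<in>{-2,-1,0,1,2::int}. \<integral>\<^sup>+x\<in>{of_int k..<of_int k + 1}. p x \<partial>lborel)"
    by (intro nn_integral_sum) auto
  also have "\<dots> = (\<Sum>k\<in>{-2,-1,0,1,2::int}. \<integral>\<^sup>+x\<in>{0..<1}. p x \<partial>lborel)"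
    by (intro sum.cong refl 1)
  finally show ?thesis by simp
qed

text \<open>Both measures are driven by the same \<open>y\<close> through their quantile functions.
  As \<open>dist_per\<close> is at most 1, its square is at most the distance, and the area between
  the quantile functions is measured along the other axis. Since \<open>gcdf\<close> is within 3/2
  of the identity, values \<open>y\<close> in \<open>{0..<1}\<close> only involve \<open>x\<close>
  in \<open>{-2..<3}\<close>, hence the five periods.\<close>

lemma W_per_sq_le_gcdf:
  assumes \<rho>: "torus_prob \<rho>" and \<nu>: "torus_prob \<nu>"
  shows "W_per_sq \<rho> \<nu> \<le> 5 * (\<integral>\<^sup>+x\<in>{0..<1}. ennreal \<bar>gcdf \<rho> x - gcdf \<nu> x\<bar> \<partial>lborel)"
proof -
  note [measurable] = borel_measurable_gcdf[OF \<rho>] borel_measurable_gcdf[OF \<nu>]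
    borel_measurable_gquant[OF \<rho>] borel_measurable_gquant[OF \<nu>]
  let ?S = "\<lambda>x y. (y \<le> gcdf \<rho> x) \<noteq> (y \<le> gcdf \<nu> x)"
  have "W_per_sq \<rho> \<nu> \<le> (\<integral>\<^sup>+y. ennreal ((dist_per (frac (gquant \<rho> y)) (frac (gquant \<nu> y)))\<^sup>2) \<partial>torus_lebesgue)"
    by (intro W_per_sq_le_maps measurable_frac_gquant distr_frac_gquant \<rho> \<nu>)
  also have "\<dots> = (\<integral>\<^sup>+y\<in>{0..<1}. ennreal ((dist_per (gquant \<rho> y) (gquant \<nu> y))\<^sup>2) \<partial>lborel)"
    by (simp add: dist_per_frac nn_integral_torus_lebesgue)
  also have "\<dots> \<le> (\<integral>\<^sup>+y\<in>{0..<1}. ennreal \<bar>gquant \<rho> y - gquant \<nu> y\<bar> \<partial>lborel)"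
  proof (intro nn_integral_mono mult_right_mono ennreal_leI)
    fix y
    have "(dist_per (gquant \<rho> y) (gquant \<nu> y))\<^sup>2 \<le> dist_per (gquant \<rho> y) (gquant \<nu> y)"
      using dist_per_nonneg dist_per_le_1 by (simp add: power2_eq_square mult_left_le)
    also have "\<dots> \<le> \<bar>gquant \<rho> y - gquant \<nu> y\<bar>" by (rule dist_per_le_abs)
    finally show "(dist_per (gquant \<rho> y) (gquant \<nu> y))\<^sup>2 \<le> \<bar>gquant \<rho> y - gquant \<nu> y\<bar>" .
  qed simp
  also have "\<dots> = (\<integral>\<^sup>+y. (\<integral>\<^sup>+x. indicator {x. ?S x y} x * indicator {0..<1} y \<partial>lborel) \<partial>lborel)"
    by (simp add: ennreal_abs_diff_eq_nn_integral gquant_le_iff[OF \<rho>] gquant_le_iff[OF \<nu>] nn_integral_multc)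
  also have "\<dots> = (\<integral>\<^sup>+x. (\<integral>\<^sup>+y. indicator {x. ?S x y} x * indicator {0..<1} y \<partial>lborel) \<partial>lborel)"
    by (intro lborel_pair.Fubini') (simp add: indicator_def)
  also have "\<dots> \<le> (\<integral>\<^sup>+x\<in>{-2..<3}. ennreal \<bar>gcdf \<rho> x - gcdf \<nu> x\<bar> \<partial>lborel)"
  proof (rule nn_integral_mono)
    fix x :: real
    show "(\<integral>\<^sup>+y. indicator {x. ?S x y} x * indicator {0..<1} y \<partial>lborel) \<le> ennreal \<bar>gcdf \<rho> x - gcdf \<nu> x\<bar> * indicator {-2..<3} x"
    proof (cases "x \<in> {-2..<3}")
      case True
      have "(\<integral>\<^sup>+y. indicator {x. ?S x y} x * indicator {0..<1} y \<partial>lborel) \<le>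
          (\<integral>\<^sup>+y. indicator {min (gcdf \<rho> x) (gcdf \<nu> x)..max (gcdf \<rho> x) (gcdf \<nu> x)} y \<partial>lborel)"
        by (intro nn_integral_mono) (auto split: split_indicator)
      also have "\<dots> = ennreal \<bar>gcdf \<rho> x - gcdf \<nu> x\<bar>"
        by (simp add: min_def max_def abs_if)
      finally show ?thesis using True by simp
    next
      case False
      have z: "(\<lambda>y. indicator {x. ?S x y} x * indicator {0..<1} y) = (\<lambda>_. 0::ennreal)"
      proof (rule ext)
        fix y
        have "x - 3 / 2 \<le> gcdf \<kappa> x" "gcdf \<kappa> x \<le> x + 3 / 2" if "torus_prob \<kappa>" for \<kappa>
          using gcdf_bound[OF that, of x] by linarith+
        from this[OF \<rho>] this[OF \<nu>] show "indicator {x. ?S x y} x * indicator {0..<1} y = (0::ennreal)"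
          using False by (auto simp: indicator_def)
      qed
      show ?thesis unfolding z by simp
    qed
  qed
  also have "\<dots> = 5 * (\<integral>\<^sup>+x\<in>{0..<1}. ennreal \<bar>gcdf \<rho> x - gcdf \<nu> x\<bar> \<partial>lborel)"
    by (rule nn_integral_five_periods) (auto simp: gcdf_add_1 \<rho> \<nu>)
  finally show ?thesis .
qed

text \<open>Integration by parts through Fubini: on \<open>{0..<1}\<close>,
  \<open>tcdf \<rho> x\<close> is the mass of the points \<open>z \<le> x\<close>, and the integral
  of \<open>k\<close> from \<open>z\<close> to 1 is \<open>prim k 1 - prim k z\<close>, where
  \<open>prim k 1 = 0\<close> by periodicity.\<close>

lemma integral_tcdf_mult:
  assumes \<rho>: "torus_prob \<rho>" and k: "k \<in> borel_measurable borel" "\<And>x. \<bar>k x\<bar> \<le> C"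
    and per: "\<And>x. k (x + 1) = k x" and zero: "(\<integral>x. k x \<partial>torus_lebesgue) = 0"
  shows "(\<integral>x. tcdf \<rho> x * k x \<partial>torus_lebesgue) = - (\<integral>z. prim k z \<partial>\<rho>)"
proof -
  note \<rho>' = torus_probD[OF \<rho>]
  interpret R: prob_space \<rho> by fact
  interpret T: prob_space torus_lebesgue by (rule prob_space_torus_lebesgue)
  interpret P: pair_prob_space torus_lebesgue \<rho> ..
  have lip: "lip_per C (prim k)" by (rule lip_per_prim[OF k per zero])
  let ?f = "\<lambda>x z. indicator {z..} x * k x :: real"
  have id1: "(\<lambda>x. x) \<in> measurable torus_lebesgue borel"
    using measurable_torus_id by (simp cong: measurable_cong_sets)
  have id2: "(\<lambda>x. x) \<in> measurable \<rho> borel"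
    by (rule torus_prob_measurable[OF \<rho> measurable_torus_id])
  have 1: "(\<lambda>p. fst p) \<in> borel_measurable (torus_lebesgue \<Otimes>\<^sub>M \<rho>)"
    by (rule measurable_compose[OF measurable_fst id1])
  have 2: "(\<lambda>p. snd p) \<in> borel_measurable (torus_lebesgue \<Otimes>\<^sub>M \<rho>)"
    by (rule measurable_compose[OF measurable_snd id2])
  have 3: "(\<lambda>p. k (fst p)) \<in> borel_measurable (torus_lebesgue \<Otimes>\<^sub>M \<rho>)"
    by (rule measurable_compose[OF 1 k(1)])
  have "(\<lambda>p. (if snd p \<le> fst p then 1 else 0) * k (fst p)) \<in> borel_measurable (torus_lebesgue \<Otimes>\<^sub>M \<rho>)"
    using 1 2 3 by measurable
  moreover have "(\<lambda>p. (if snd p \<le> fst p then 1 else 0) * k (fst p)) = (\<lambda>(x, z). ?f x z)"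
    by (auto simp: fun_eq_iff)
  ultimately have m: "(\<lambda>(x, z). ?f x z) \<in> borel_measurable (torus_lebesgue \<Otimes>\<^sub>M \<rho>)" by simp
  have int: "integrable (torus_lebesgue \<Otimes>\<^sub>M \<rho>) (\<lambda>(x, z). ?f x z)"
  proof (rule P.P.integrable_const_bound[of _ C])
    have "0 \<le> C" using k(2)[of 0] by linarith
    then show "AE p in torus_lebesgue \<Otimes>\<^sub>M \<rho>. norm (case p of (x, z) \<Rightarrow> ?f x z) \<le> C"
      using k(2) by (auto split: split_indicator)
  qed fact
  have "(\<integral>x. tcdf \<rho> x * k x \<partial>torus_lebesgue) = (\<integral>x. (\<integral>z. ?f x z \<partial>\<rho>) \<partial>torus_lebesgue)"
  proof (rule Bochner_Integration.integral_cong)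
    fix x assume x: "x \<in> space torus_lebesgue"
    then have "\<lfloor>x\<rfloor> = 0" by (auto simp: floor_eq_iff)
    then have t: "tcdf \<rho> x = measure \<rho> {0..x}" by (simp add: tcdf_def frac_def)
    have s: "{0..x} \<in> sets \<rho>" using x \<rho>' by (auto simp: sets_torus)
    have "(\<integral>z. ?f x z \<partial>\<rho>) = (\<integral>z. k x * indicator {0..x} z \<partial>\<rho>)"
      using \<rho>' by (intro Bochner_Integration.integral_cong) (auto split: split_indicator)
    also have "\<dots> = k x * measure \<rho> {0..x}" using s by simp
    finally show "tcdf \<rho> x * k x = (\<integral>z. ?f x z \<partial>\<rho>)" by (simp only: t mult.commute)
  qed simp
  also have "\<dots> = (\<integral>z. (\<integral>x. ?f x z \<partial>torus_lebesgue) \<partial>\<rho>)"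
    by (rule P.Fubini_integral[OF int, symmetric])
  also have "\<dots> = (\<integral>z. - prim k z \<partial>\<rho>)"
  proof (rule Bochner_Integration.integral_cong)
    fix z assume "z \<in> space \<rho>"
    then have z: "0 \<le> z" "z < 1" using \<rho>' by auto
    have "(\<integral>x. ?f x z \<partial>torus_lebesgue) = (\<integral>x. k x * indicator {z..<1} x \<partial>lborel)"
      unfolding integral_torus_lebesgue using z
      by (intro Bochner_Integration.integral_cong) (auto split: split_indicator)
    also have "\<dots> = prim k 1 - prim k z" using z by (intro prim_diff[symmetric, OF k]) auto
    also have "prim k 1 = 0" using lip unfolding lip_per_def by (metis add_0 prim_0)
    finally show "(\<integral>x. ?f x z \<partial>torus_lebesgue) = - prim k z" by simp
  qed simp
  finally show ?thesis by simp
qed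

text \<open>Turns control of Lipschitz integrals into Wasserstein continuity. The L1 distance of the
  distribution functions is obtained by testing their difference \<open>D\<close> with its sign.
  Subtracting the mean \<open>c\<close> of the sign makes the primitive periodic and changes
  nothing, since \<open>D\<close> has mean zero. The recentred sign is bounded by 2, so its
  primitive is 2-Lipschitz; with the five periods this gives 10.\<close>

lemma W_per_sq_le_dual_lipschitz:
  assumes \<rho>: "torus_prob \<rho>" and \<nu>: "torus_prob \<nu>"
    and lip: "\<And>L f. lip_per L f \<Longrightarrow> \<bar>(\<integral>x. f x \<partial>\<rho>) - (\<integral>x. f x \<partial>\<nu>)\<bar> \<le> L * \<delta>"
  shows "W_per_sq \<rho> \<nu> \<le> ennreal (10 * \<delta>)"
proof -
  interpret T: prob_space torus_lebesgue by (rule prob_space_torus_lebesgue)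
  note [measurable] = borel_measurable_gcdf[OF \<rho>] borel_measurable_gcdf[OF \<nu>]
  define D where "D x = gcdf \<rho> x - gcdf \<nu> x" for x
  have Dm [measurable]: "D \<in> borel_measurable borel" unfolding D_def by measurable
  have Dper: "D (x + 1) = D x" for x by (simp add: D_def gcdf_add_1 \<rho> \<nu>)
  have D0: "(\<integral>x. D x \<partial>torus_lebesgue) = 0"
    using integrable_gcdf \<rho> \<nu> by (simp add: D_def integral_gcdf)
  have Dint: "integrable torus_lebesgue D"
    using integrable_gcdf \<rho> \<nu> by (simp add: D_def[abs_def])
  define h where "h x = sgn (D x)" for x
  have hm [measurable]: "h \<in> borel_measurable borel" unfolding h_def by measurable
  have hb: "\<bar>h x\<bar> \<le> 1" for x by (simp add: h_def abs_sgn_eq)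
  have hint: "integrable torus_lebesgue h"
    by (rule T.integrable_const_bound[of _ 1])
      (use hb measurable_torus_borel[OF hm] in \<open>auto cong: measurable_cong_sets\<close>)
  define c where "c = (\<integral>x. h x \<partial>torus_lebesgue)"
  have "\<bar>c\<bar> \<le> (\<integral>x. 1 \<partial>torus_lebesgue)"
    unfolding c_def using hint hb
    by (intro integral_abs_bound[THEN order_trans] integral_mono) auto
  then have cb: "\<bar>c\<bar> \<le> 1" using T.prob_space by simp
  define k where "k x = h x - c" for x
  have km: "k \<in> borel_measurable borel" unfolding k_def by measurable
  have kb: "\<bar>k x\<bar> \<le> 2" for x using hb[of x] cb by (simp add: k_def)
  have kper: "k (x + 1) = k x" for x by (simp add: k_def h_def Dper)
  have kz: "(\<integral>x. k x \<partial>torus_lebesgue) = 0"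
    using hint T.prob_space by (simp add: k_def c_def)
  have mult: "integrable torus_lebesgue (\<lambda>x. f x * k x)" if f: "integrable torus_lebesgue f" for f
  proof (rule Bochner_Integration.integrable_bound[where f = "\<lambda>x. 2 * f x"])
    show "(\<lambda>x. f x * k x) \<in> borel_measurable torus_lebesgue"
      using f measurable_torus_borel[OF km] by (intro borel_measurable_times) (auto cong: measurable_cong_sets)
    show "AE x in torus_lebesgue. norm (f x * k x) \<le> norm (2 * f x)"
      using kb by (auto simp: abs_mult mult.commute[of "\<bar>f _\<bar>"] intro!: mult_right_mono)
  qed (use f in auto)
  have gk: "(\<integral>x. gcdf \<kappa> x * k x \<partial>torus_lebesgue) = - (\<integral>z. prim k z \<partial>\<kappa>)" if \<kappa>: "torus_prob \<kappa>" for \<kappa>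
  proof -
    have "(\<integral>x. gcdf \<kappa> x * k x \<partial>torus_lebesgue) = (\<integral>x. tcdf \<kappa> x * k x - ((\<integral>z. tcdf \<kappa> z \<partial>torus_lebesgue) - 1 / 2) * k x \<partial>torus_lebesgue)"
      by (simp add: gcdf_def left_diff_distrib)
    also have "\<dots> = (\<integral>x. tcdf \<kappa> x * k x \<partial>torus_lebesgue) - (\<integral>x. ((\<integral>z. tcdf \<kappa> z \<partial>torus_lebesgue) - 1 / 2) * k x \<partial>torus_lebesgue)"
      using mult[OF integrable_tcdf[OF \<kappa>]] mult[of "\<lambda>_. (\<integral>z. tcdf \<kappa> z \<partial>torus_lebesgue) - 1 / 2"]
      by (intro Bochner_Integration.integral_diff) auto
    also have "\<dots> = - (\<integral>z. prim k z \<partial>\<kappa>)"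
      using integral_tcdf_mult[OF \<kappa> km kb kper kz] kz by simp
    finally show ?thesis .
  qed
  have "(\<integral>x. \<bar>D x\<bar> \<partial>torus_lebesgue) = (\<integral>x. D x * k x + c * D x \<partial>torus_lebesgue)"
    by (intro Bochner_Integration.integral_cong) (auto simp: k_def h_def algebra_simps sgn_if)
  also have "\<dots> = (\<integral>x. D x * k x \<partial>torus_lebesgue)"
    using mult[OF Dint] Dint D0 by simp
  also have "\<dots> = (\<integral>x. gcdf \<rho> x * k x - gcdf \<nu> x * k x \<partial>torus_lebesgue)"
    by (simp add: D_def left_diff_distrib)
  also have "\<dots> = (\<integral>z. prim k z \<partial>\<nu>) - (\<integral>z. prim k z \<partial>\<rho>)"
    using mult[OF integrable_gcdf[OF \<rho>]] mult[OF integrable_gcdf[OF \<nu>]] by (simp add: gk \<rho> \<nu>)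
  also have "\<dots> \<le> 2 * \<delta>"
    using lip[OF lip_per_prim[OF km kb kper kz]] by linarith
  finally have le: "(\<integral>x. \<bar>D x\<bar> \<partial>torus_lebesgue) \<le> 2 * \<delta>" .
  have "(\<integral>\<^sup>+x\<in>{0..<1}. ennreal \<bar>gcdf \<rho> x - gcdf \<nu> x\<bar> \<partial>lborel) = (\<integral>\<^sup>+x. ennreal \<bar>D x\<bar> \<partial>torus_lebesgue)"
    by (simp add: nn_integral_torus_lebesgue D_def)
  also have "\<dots> = ennreal (\<integral>x. \<bar>D x\<bar> \<partial>torus_lebesgue)"
    using Dint by (intro nn_integral_eq_integral) auto
  also have "\<dots> \<le> ennreal (2 * \<delta>)" using le by (rule ennreal_leI)
  finally have "W_per_sq \<rho> \<nu> \<le> 5 * ennreal (2 * \<delta>)"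
    using W_per_sq_le_gcdf[OF \<rho> \<nu>] by (meson mult_left_mono order_trans zero_le)
  also have "5 * ennreal (2 * \<delta>) = ennreal (10 * \<delta>)"
    using ennreal_mult'[of 5 "2 * \<delta>"] by simp
  finally show ?thesis .
qed

section \<open>Kantorovich potentials for the quadratic cost against Lebesgue measure\<close>

lemma integral_affine_Ico:
  fixes a b y :: real
  assumes "a \<le> b"
  shows "integrable lborel (\<lambda>w. 2 * (w - y) * indicator {a..<b} w)"
    "(\<integral>w. 2 * (w - y) * indicator {a..<b} w \<partial>lborel) = (b - y)\<^sup>2 - (a - y)\<^sup>2"
proof -
  have D: "((\<lambda>w. (w - y)\<^sup>2) has_real_derivative 2 * (w - y)) (at w)" for w
    by (auto intro!: derivative_eq_intros)
  have h: "has_bochner_integral lborel (\<lambda>w. 2 * (w - y) * indicator {a..b} w) ((b - y)\<^sup>2 - (a - y)\<^sup>2)"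
    by (rule has_bochner_integral_FTC_Icc_real[OF assms D]) (auto intro!: continuous_intros)
  have ae: "AE w in lborel. 2 * (w - y) * indicator {a..<b} w = 2 * (w - y) * indicator {a..b} w"
    using AE_lborel_singleton[of b] by eventually_elim (auto split: split_indicator)
  have "has_bochner_integral lborel (\<lambda>w. 2 * (w - y) * indicator {a..<b} w) ((b - y)\<^sup>2 - (a - y)\<^sup>2)"
    using h ae by (subst has_bochner_integral_cong_AE) auto
  then show "integrable lborel (\<lambda>w. 2 * (w - y) * indicator {a..<b} w)"
    "(\<integral>w. 2 * (w - y) * indicator {a..<b} w \<partial>lborel) = (b - y)\<^sup>2 - (a - y)\<^sup>2"
    by (auto simp: has_bochner_integral_iff)
qed

text \<open>The Kantorovich potential has derivative \<open>2 (x - gcdf \<rho> x)\<close>; it is periodic because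
  \<open>gcdf \<rho>\<close> has the mean of the identity.\<close>

lemma W_per_sq_lebesgue_potential:
  assumes \<rho>: "torus_prob \<rho>"
  shows "\<exists>f g. lip_per 3 f \<and> g \<in> borel_measurable borel \<and> (\<exists>C. \<forall>y. \<bar>g y\<bar> \<le> C) \<and>
    (\<forall>x y. f x + g y \<le> (dist_per x y)\<^sup>2) \<and>
    W_per_sq \<rho> torus_lebesgue \<le> ennreal ((\<integral>x. f x \<partial>\<rho>) + (\<integral>y. g y \<partial>torus_lebesgue))"
proof -
  interpret T: prob_space torus_lebesgue by (rule prob_space_torus_lebesgue)
  note [measurable] = borel_measurable_gcdf[OF \<rho>] borel_measurable_gquant[OF \<rho>]
  define k where "k w = 2 * (w - gcdf \<rho> w)" for w
  have km [measurable]: "k \<in> borel_measurable borel" unfolding k_def by measurable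
  have kb: "\<bar>k w\<bar> \<le> 3" for w
  proof -
    have "gcdf \<rho> w - w \<le> 3 / 2" "- (3 / 2) \<le> gcdf \<rho> w - w"
      using gcdf_bound[OF \<rho>, of w] by linarith+
    then show ?thesis unfolding k_def abs_le_iff by auto
  qed
  have kper: "k (w + 1) = k w" for w by (simp add: k_def gcdf_add_1[OF \<rho>])
  have id: "(\<integral>x. x \<partial>torus_lebesgue) = 1 / 2" "integrable torus_lebesgue (\<lambda>x. x)"
  proof -
    have "(\<integral>w. 2 * (w - 0) * indicator {0..<1::real} w \<partial>lborel) = 2 * (\<integral>w. w * indicator {0..<1} w \<partial>lborel)"
      by (simp only: diff_zero mult.assoc integral_mult_right_zero)
    then show "(\<integral>x. x \<partial>torus_lebesgue) = 1 / 2"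
      using integral_affine_Ico(2)[of 0 1 0] by (simp add: integral_torus_lebesgue)
    show "integrable torus_lebesgue (\<lambda>x. x :: real)"
      by (rule T.integrable_const_bound[of _ 1]) (use measurable_torus_id in \<open>auto cong: measurable_cong_sets\<close>)
  qed
  have kz: "(\<integral>x. k x \<partial>torus_lebesgue) = 0"
    using id integrable_gcdf[OF \<rho>] integral_gcdf[OF \<rho>] by (simp add: k_def)
  define f where "f = prim k"
  have f: "lip_per 3 f" unfolding f_def by (rule lip_per_prim[OF km kb kper kz])
  \<comment> \<open>The conjugate of \<open>f\<close>: by \<open>ineq\<close> below,
    \<open>gquant \<rho> y\<close> minimizes \<open>(z - y)\<^sup>2 - f z\<close> over all
    \<open>z\<close>, and \<open>g y\<close> is the minimal value.\<close>
  define g where "g y = (gquant \<rho> y - y)\<^sup>2 - f (gquant \<rho> y)" for y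
  have [measurable]: "f \<in> borel_measurable borel" by (rule lip_per_borel[OF f])
  have gm: "g \<in> borel_measurable borel" unfolding g_def by measurable
  obtain B where B: "\<And>x. \<bar>f x\<bar> \<le> B" using lip_per_bounded[OF f] by blast
  have gb: "\<bar>g y\<bar> \<le> 9 / 4 + B" for y
  proof -
    have "(gquant \<rho> y - y)\<^sup>2 \<le> (3 / 2)\<^sup>2"
      using gquant_bound[OF \<rho>, of y] by (intro power2_le_iff_abs_le[THEN iffD2]) auto
    then have "(gquant \<rho> y - y)\<^sup>2 \<le> 9 / 4" by (simp add: power2_eq_square)
    moreover have "(gquant \<rho> y - y)\<^sup>2 \<ge> 0" by simp
    moreover have "f (gquant \<rho> y) \<le> B" "- B \<le> f (gquant \<rho> y)"
      using B[of "gquant \<rho> y"] by linarith+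
    ultimately show ?thesis unfolding g_def abs_le_iff by linarith
  qed
  \<comment> \<open>The derivative of \<open>(z - y)\<^sup>2 - f z\<close> in \<open>z\<close> is
    \<open>2 * (gcdf \<rho> z - y)\<close>, which by the Galois connection is negative before
    \<open>gquant \<rho> y\<close> and nonnegative from there on.\<close>
  have ineq: "f z + g y \<le> (z - y)\<^sup>2" for z y
  proof (cases "gquant \<rho> y \<le> z")
    case True
    have "f z - f (gquant \<rho> y) = (\<integral>w. k w * indicator {gquant \<rho> y..<z} w \<partial>lborel)"
      unfolding f_def by (rule prim_diff[OF km kb True])
    also have "\<dots> \<le> (\<integral>w. 2 * (w - y) * indicator {gquant \<rho> y..<z} w \<partial>lborel)"
      using integrable_bounded_indicator[OF km kb] integral_affine_Ico[OF True]
      by (intro integral_mono) (auto simp: k_def gquant_le_iff[OF \<rho>] split: split_indicator)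
    finally show ?thesis unfolding g_def integral_affine_Ico(2)[OF True] by linarith
  next
    case False
    then have le: "z \<le> gquant \<rho> y" by simp
    have "gcdf \<rho> w < y" if "w < gquant \<rho> y" for w
      using that gquant_le_iff[OF \<rho>, of y w] by linarith
    then have "(\<integral>w. 2 * (w - y) * indicator {z..<gquant \<rho> y} w \<partial>lborel) \<le> (\<integral>w. k w * indicator {z..<gquant \<rho> y} w \<partial>lborel)"
      using integrable_bounded_indicator[OF km kb] integral_affine_Ico[OF le]
      by (intro integral_mono) (auto simp: k_def less_imp_le split: split_indicator)
    also have "\<dots> = f (gquant \<rho> y) - f z"
      unfolding f_def by (rule prim_diff[OF km kb le, symmetric])
    finally show ?thesis unfolding g_def integral_affine_Ico(2)[OF le] by linarith
  qed
  have dual: "f x + g y \<le> (dist_per x y)\<^sup>2" for x y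
  proof -
    obtain j :: int where j: "dist_per x y = \<bar>x - y - of_int j\<bar>" using dist_per_int by blast
    have "f (x - of_int j) = f x"
      using periodic_add_int[of f x "- j"] f by (simp add: lip_per_def)
    then show ?thesis using ineq[of "x - of_int j" y] by (simp add: j algebra_simps)
  qed
  have fq: "(\<integral>x. f x \<partial>\<rho>) = (\<integral>y. f (gquant \<rho> y) \<partial>torus_lebesgue)"
  proof -
    have "(\<integral>x. f x \<partial>\<rho>) = (\<integral>x. f x \<partial>distr torus_lebesgue torus (\<lambda>y. frac (gquant \<rho> y)))"
      by (simp add: distr_frac_gquant[OF \<rho>])
    also have "\<dots> = (\<integral>y. f (frac (gquant \<rho> y)) \<partial>torus_lebesgue)"
      by (rule integral_distr[OF torus_prob_measurable[OF torus_prob_torus_lebesgue measurable_frac_gquant[OF \<rho>]]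
            measurable_torus_borel[OF lip_per_borel[OF f]]])
    finally show ?thesis by (simp add: lip_per_frac[OF f])
  qed
  have tm: "u \<in> borel_measurable torus_lebesgue" if "u \<in> borel_measurable borel" for u :: "real \<Rightarrow> real"
    by (rule torus_prob_measurable[OF torus_prob_torus_lebesgue measurable_torus_borel[OF that]])
  have i1: "integrable torus_lebesgue (\<lambda>y. f (gquant \<rho> y))"
    by (rule T.integrable_const_bound[of _ B]) (auto simp: B intro!: tm)
  have i2: "integrable torus_lebesgue g"
    by (rule T.integrable_const_bound[of _ "9 / 4 + B"]) (auto simp: gb intro!: tm gm)
  \<comment> \<open>The identity is written as \<open>frac (y + 0)\<close> so that
    \<open>torus_lebesgue_rotation\<close> identifies the second marginal.\<close>
  have "W_per_sq \<rho> torus_lebesgue \<le> (\<integral>\<^sup>+y. ennreal ((dist_per (frac (gquant \<rho> y)) (frac (y + 0)))\<^sup>2) \<partial>torus_lebesgue)"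
    by (intro W_per_sq_le_maps measurable_frac_gquant distr_frac_gquant \<rho> measurable_frac_shift torus_lebesgue_rotation)
  also have "\<dots> \<le> (\<integral>\<^sup>+y. ennreal (f (gquant \<rho> y) + g y) \<partial>torus_lebesgue)"
  proof (intro nn_integral_mono ennreal_leI)
    fix y
    have "(dist_per (gquant \<rho> y) y)\<^sup>2 \<le> (gquant \<rho> y - y)\<^sup>2"
      using power_mono[OF dist_per_le_abs dist_per_nonneg, of _ _ 2] by simp
    then show "(dist_per (frac (gquant \<rho> y)) (frac (y + 0)))\<^sup>2 \<le> f (gquant \<rho> y) + g y"
      by (simp add: dist_per_frac g_def)
  qed
  also have "\<dots> = ennreal (\<integral>y. f (gquant \<rho> y) + g y \<partial>torus_lebesgue)"
    by (rule nn_integral_eq_integral[OF Bochner_Integration.integrable_add[OF i1 i2]]) (simp add: g_def)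
  also have "\<dots> = ennreal ((\<integral>x. f x \<partial>\<rho>) + (\<integral>y. g y \<partial>torus_lebesgue))"
    using i1 i2 by (simp add: fq)
  finally show ?thesis using f gm gb dual by blast
qed

text \<open>The easy half of Kantorovich duality: the pointwise inequality is integrated against a
  coupling. The cost is an extended nonnegative integral, so the integrand on the left is first cut
  off at 0.\<close>

lemma W_per_sq_ge_potential:
  assumes f: "lip_per L f" and g: "g \<in> borel_measurable borel" "\<And>y. \<bar>g y\<bar> \<le> C"
    and le: "\<And>x y. f x + g y \<le> (dist_per x y)\<^sup>2"
    and \<nu>: "torus_prob \<nu>" and \<sigma>: "torus_prob \<sigma>"
  shows "ennreal ((\<integral>x. f x \<partial>\<nu>) + (\<integral>y. g y \<partial>\<sigma>)) \<le> W_per_sq \<nu> \<sigma>"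
  unfolding W_per_sq_def
proof (rule INF_greatest)
  fix \<pi> assume "\<pi> \<in> couplings \<nu> \<sigma>"
  then have \<pi>: "sets \<pi> = sets (torus \<Otimes>\<^sub>M torus)" "distr \<pi> torus fst = \<nu>" "distr \<pi> torus snd = \<sigma>"
    by (auto simp: couplings_def)
  have mf: "fst \<in> measurable \<pi> torus" "snd \<in> measurable \<pi> torus"
    by (simp_all add: measurable_cong_sets[OF \<pi>(1) refl])
  have ft: "f \<in> borel_measurable torus" "g \<in> borel_measurable torus"
    using lip_per_borel[OF f] g by (auto intro: measurable_torus_borel)
  have sp: "prob_space \<nu>" "prob_space \<sigma>" using \<nu> \<sigma> torus_probD by auto
  interpret \<pi>: prob_space \<pi>
    by (rule prob_space_distrD[OF mf(1)]) (simp only: \<pi>(2) sp(1))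
  have i1: "integrable \<pi> (\<lambda>p. f (fst p))"
    by (rule \<pi>.integrable_const_bound[of _ "\<bar>f 0\<bar> + L", OF _ measurable_compose[OF mf(1) ft(1)]])
      (simp add: lip_per_bounded[OF f])
  have i2: "integrable \<pi> (\<lambda>p. g (snd p))"
    by (rule \<pi>.integrable_const_bound[of _ C, OF _ measurable_compose[OF mf(2) ft(2)]]) (simp add: g)
  have i3: "integrable \<pi> (\<lambda>p. f (fst p) + g (snd p))"
    using i1 i2 by (rule Bochner_Integration.integrable_add)
  have i4: "integrable \<pi> (\<lambda>p. max 0 (f (fst p) + g (snd p)))"
    using Bochner_Integration.integrable_max[OF _ i3, of "\<lambda>_. 0"] by simp
  have 5: "(\<integral>x. f x \<partial>\<nu>) = (\<integral>p. f (fst p) \<partial>\<pi>)"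
    using integral_distr[OF mf(1) ft(1)] unfolding \<pi>(2) .
  have 6: "(\<integral>x. g x \<partial>\<sigma>) = (\<integral>p. g (snd p) \<partial>\<pi>)"
    using integral_distr[OF mf(2) ft(2)] unfolding \<pi>(3) .
  have 1: "(\<integral>x. f x \<partial>\<nu>) + (\<integral>y. g y \<partial>\<sigma>) = (\<integral>p. f (fst p) + g (snd p) \<partial>\<pi>)"
    unfolding 5 6 by (rule Bochner_Integration.integral_add[OF i1 i2, symmetric])
  have 2: "(\<integral>p. f (fst p) + g (snd p) \<partial>\<pi>) \<le> (\<integral>p. max 0 (f (fst p) + g (snd p)) \<partial>\<pi>)"
    by (rule integral_mono[OF i3 i4]) simp
  have 3: "ennreal (\<integral>p. max 0 (f (fst p) + g (snd p)) \<partial>\<pi>) = (\<integral>\<^sup>+p. ennreal (max 0 (f (fst p) + g (snd p))) \<partial>\<pi>)"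
    by (rule nn_integral_eq_integral[OF i4, symmetric]) simp
  have 4: "(\<integral>\<^sup>+p. ennreal (max 0 (f (fst p) + g (snd p))) \<partial>\<pi>) \<le> (\<integral>\<^sup>+(x, y). ennreal ((dist_per x y)\<^sup>2) \<partial>\<pi>)"
  proof (rule nn_integral_mono)
    fix p :: "real \<times> real"
    obtain x y where p: "p = (x, y)" by (cases p)
    have "max 0 (f x + g y) \<le> (dist_per x y)\<^sup>2"
      using le[of x y] by simp
    then show "ennreal (max 0 (f (fst p) + g (snd p))) \<le> (case p of (x, y) \<Rightarrow> ennreal ((dist_per x y)\<^sup>2))"
      unfolding p fst_conv snd_conv prod.case by (rule ennreal_leI)
  qed
  show "ennreal ((\<integral>x. f x \<partial>\<nu>) + (\<integral>y. g y \<partial>\<sigma>)) \<le> (\<integral>\<^sup>+(x, y). ennreal ((dist_per x y)\<^sup>2) \<partial>\<pi>)"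
    unfolding 1 using ennreal_leI[OF 2] 4 unfolding 3 by (rule order_trans)
qed

subsection \<open>Smooth functions of one variable\<close>

text \<open>Smoothness with all derivatives given as an explicit sequence, the one-variable
  counterpart of the family in \<open>smooth_function\<close>. Derivatives of products and
  rescalings can then be written down directly.\<close>

definition deriv_chain :: "(nat \<Rightarrow> real \<Rightarrow> real) \<Rightarrow> bool" where
  "deriv_chain E \<longleftrightarrow> (\<forall>i t. (E i has_real_derivative E (Suc i) t) (at t))"

text \<open>Leibniz rule: after the index of one of the two sums is shifted, Pascal's rule merges
  them.\<close>

lemma deriv_chain_mult:
  assumes E: "deriv_chain E" and F: "deriv_chain F"
  shows "deriv_chain (\<lambda>n x. \<Sum>k\<le>n. real (n choose k) * (E k x * F (n - k) x))"
  unfolding deriv_chain_def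
proof (intro allI)
  fix n t
  let ?a = "\<lambda>k. E k t" and ?b = "\<lambda>k. F k t"
  have "((\<lambda>x. \<Sum>k\<le>n. real (n choose k) * (E k x * F (n - k) x)) has_real_derivative
      (\<Sum>k\<le>n. real (n choose k) * (?a (Suc k) * ?b (n - k) + ?b (Suc (n - k)) * ?a k))) (at t)"
    using E F unfolding deriv_chain_def by (intro DERIV_sum DERIV_cmult DERIV_mult) auto
  also have "(\<Sum>k\<le>n. real (n choose k) * (?a (Suc k) * ?b (n - k) + ?b (Suc (n - k)) * ?a k)) =
      (\<Sum>k\<le>n. real (n choose k) * (?a (Suc k) * ?b (n - k))) + (\<Sum>k\<le>n. real (n choose k) * (?a k * ?b (Suc n - k)))"
    by (simp add: sum.distrib[symmetric] distrib_left Suc_diff_le mult.commute)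
  also have "(\<Sum>k\<le>n. real (n choose k) * (?a k * ?b (Suc n - k))) =
      (\<Sum>k\<le>Suc n. real (n choose k) * (?a k * ?b (Suc n - k)))"
    by simp
  also have "\<dots> = ?a 0 * ?b (Suc n) + (\<Sum>k\<le>n. real (n choose Suc k) * (?a (Suc k) * ?b (n - k)))"
    by (simp only: sum.atMost_Suc_shift) simp
  also have "(\<Sum>k\<le>n. real (n choose k) * (?a (Suc k) * ?b (n - k))) +
      (?a 0 * ?b (Suc n) + (\<Sum>k\<le>n. real (n choose Suc k) * (?a (Suc k) * ?b (n - k)))) =
      ?a 0 * ?b (Suc n) + (\<Sum>k\<le>n. real (Suc n choose Suc k) * (?a (Suc k) * ?b (n - k)))"
    by (simp add: sum.distrib[symmetric] distrib_right)
  also have "\<dots> = (\<Sum>k\<le>Suc n. real (Suc n choose k) * (?a k * ?b (Suc n - k)))"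
    by (simp only: sum.atMost_Suc_shift) simp
  finally show "((\<lambda>x. \<Sum>k\<le>n. real (n choose k) * (E k x * F (n - k) x)) has_real_derivative
      (\<Sum>k\<le>Suc n. real (Suc n choose k) * (?a k * ?b (Suc n - k)))) (at t)" .
qed

lemma deriv_chain_affine:
  assumes E: "deriv_chain E"
  shows "deriv_chain (\<lambda>i x. c ^ i * E i (c * x + d))"
  unfolding deriv_chain_def
proof (intro allI)
  fix i t
  have "(E i has_real_derivative E (Suc i) (c * t + d)) (at (c * t + d))"
    using E by (simp add: deriv_chain_def)
  moreover have "((\<lambda>x. c * x + d) has_real_derivative c) (at t)"
    by (auto intro!: derivative_eq_intros)
  ultimately have "((\<lambda>x. E i (c * x + d)) has_real_derivative E (Suc i) (c * t + d) * c) (at t)"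
    by (rule DERIV_chain2)
  from DERIV_cmult[OF this, of "c ^ i"]
  show "((\<lambda>x. c ^ i * E i (c * x + d)) has_real_derivative c ^ Suc i * E (Suc i) (c * t + d)) (at t)"
    by (simp add: mult_ac)
qed

lemma deriv_chain_cmult: "deriv_chain E \<Longrightarrow> deriv_chain (\<lambda>i x. c * E i x)"
  unfolding deriv_chain_def by (intro allI DERIV_cmult) blast

lemma deriv_chain_diff: "deriv_chain E \<Longrightarrow> deriv_chain F \<Longrightarrow> deriv_chain (\<lambda>i x. E i x - F i x)"
  unfolding deriv_chain_def by (intro allI DERIV_diff) blast+

lemma deriv_chain_continuous: "deriv_chain E \<Longrightarrow> continuous_on S (E i)"
  unfolding deriv_chain_def by (meson DERIV_isCont continuous_at_imp_continuous_on)

text \<open>With \<open>z = 1 / x\<close>, the derivatives of \<open>exp (- (1 / x))\<close> on the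
  positive axis are polynomials in \<open>z\<close> times the exponential. Differentiation turns the
  factor \<open>p\<close> into \<open>z\<^sup>2 * (p - pderiv p)\<close>, and
  \<open>[:0, 0, 1:]\<close> is \<open>z\<^sup>2\<close>.\<close>

primrec flat_poly :: "nat \<Rightarrow> real poly" where
  "flat_poly 0 = 1"
| "flat_poly (Suc n) = [:0, 0, 1:] * (flat_poly n - pderiv (flat_poly n))"

definition flat :: "nat \<Rightarrow> real \<Rightarrow> real" where
  "flat n x = (if x > 0 then poly (flat_poly n) (1 / x) * exp (- (1 / x)) else 0)"

lemma tendsto_poly_mult_exp_0: "((\<lambda>z::real. poly q z * exp (- z)) \<longlongrightarrow> 0) at_top"
proof -
  have "((\<lambda>z::real. \<Sum>i\<le>degree q. coeff q i * (z ^ i / exp z)) \<longlongrightarrow> (\<Sum>i\<le>degree q. coeff q i * 0)) at_top"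
    by (intro tendsto_sum tendsto_mult tendsto_const tendsto_power_div_exp_0)
  then show ?thesis
    by (simp add: poly_altdef sum_distrib_right exp_minus divide_inverse mult.assoc)
qed

text \<open>Only the origin needs an argument: from the right, the difference quotient is again a
  polynomial in \<open>1 / y\<close> times \<open>exp (- (1 / y))\<close>, with one more factor
  \<open>1 / y\<close>, hence \<open>pCons 0\<close>, and it tends to 0.\<close>

lemma deriv_chain_flat: "deriv_chain flat"
  unfolding deriv_chain_def
proof (intro allI)
  fix n and x :: real
  let ?p = "flat_poly n"
  consider "x > 0" | "x < 0" | "x = 0" by linarith
  then show "(flat n has_real_derivative flat (Suc n) x) (at x)"
  proof cases
    case 1
    have "((\<lambda>x. poly ?p (1 / x) * exp (- (1 / x))) has_real_derivative
        poly (pderiv ?p) (1 / x) * (- (1 / x\<^sup>2)) * exp (- (1 / x)) + exp (- (1 / x)) * (1 / x\<^sup>2) * poly ?p (1 / x)) (at x)"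
      using 1 by (auto intro!: derivative_eq_intros DERIV_chain2[OF poly_DERIV] simp: power2_eq_square)
    also have "poly (pderiv ?p) (1 / x) * (- (1 / x\<^sup>2)) * exp (- (1 / x)) + exp (- (1 / x)) * (1 / x\<^sup>2) * poly ?p (1 / x)
        = flat (Suc n) x"
      using 1 by (simp add: flat_def power2_eq_square field_simps)
    finally show ?thesis
      by (rule has_field_derivative_transform_within_open[of _ _ _ "{0<..}"]) (use 1 in \<open>auto simp: flat_def\<close>)
  next
    case 2
    have "((\<lambda>_. 0) has_real_derivative flat (Suc n) x) (at x)"
      using 2 by (simp add: flat_def)
    then show ?thesis
      by (rule has_field_derivative_transform_within_open[of _ _ _ "{..<0}"]) (use 2 in \<open>auto simp: flat_def\<close>)
  next
    case 3
    have right: "((\<lambda>y. (flat n y - flat n 0) / (y - 0)) \<longlongrightarrow> 0) (at_right 0)"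
    proof -
      have "((\<lambda>y. poly (pCons 0 ?p) (inverse y) * exp (- inverse y)) \<longlongrightarrow> 0) (at_right 0)"
        by (rule filterlim_compose[OF tendsto_poly_mult_exp_0 filterlim_inverse_at_top_right])
      moreover have "eventually (\<lambda>y. poly (pCons 0 ?p) (inverse y) * exp (- inverse y) = (flat n y - flat n 0) / (y - 0)) (at_right 0)"
        by (auto simp: eventually_at_right_field flat_def field_simps intro!: exI[of _ 1])
      ultimately show ?thesis by (rule Lim_transform_eventually)
    qed
    have left: "((\<lambda>y. (flat n y - flat n 0) / (y - 0)) \<longlongrightarrow> 0) (at_left 0)"
    proof (rule tendsto_eventually)
      show "eventually (\<lambda>y. (flat n y - flat n 0) / (y - 0) = 0) (at_left 0)"
        by (auto simp: eventually_at_left_field flat_def intro!: exI[of _ "-1"])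
    qed
    show ?thesis
      unfolding 3 has_field_derivative_iff using filterlim_split_at[OF left right] by (simp add: flat_def)
  qed
qed

lemma continuous_antiderivative:
  fixes f :: "real \<Rightarrow> real"
  assumes "continuous_on UNIV f"
  shows "\<exists>F. \<forall>x. (F has_real_derivative f x) (at x)"
proof -
  have "\<exists>F. \<forall>x::real. -\<infinity> < ereal x \<longrightarrow> ereal x < \<infinity> \<longrightarrow> (F has_vector_derivative f x) (at x)"
    using assms by (intro einterval_antiderivative) (auto simp: continuous_on_eq_continuous_at)
  then show ?thesis by (auto simp: has_real_derivative_iff_has_vector_derivative)
qed

lemma DERIV_zero_const:
  fixes F :: "real \<Rightarrow> real"
  assumes "\<And>x. a \<le> x \<Longrightarrow> x \<le> b \<Longrightarrow> (F has_real_derivative 0) (at x)" "a \<le> b"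
  shows "F a = F b"
proof (rule antisym)
  show "F a \<le> F b"
    using assms by (intro DERIV_nonneg_imp_nondecreasing[of a b F]) (auto intro!: exI[of _ 0])
  show "F b \<le> F a"
    using assms by (intro DERIV_nonpos_imp_nonincreasing[of a b F]) (auto intro!: exI[of _ 0])
qed

text \<open>The product of \<open>flat\<close> with its reflection is a bump on the unit interval;
  its normalized primitive is a smooth step, and the primitive of the step is the ramp. The offset
  \<open>c\<close> cancels because only differences of ramps will be used.\<close>

lemma smooth_ramp:
  "\<exists>E c. deriv_chain E \<and> (\<forall>x\<le>0. E 0 x = 0) \<and> (\<forall>x\<ge>1. E 0 x = x + c) \<and>
    (\<forall>x\<le>0. E 1 x = 0) \<and> (\<forall>x\<ge>1. E 1 x = 1) \<and> (\<forall>x. 0 \<le> E 1 x \<and> E 1 x \<le> (1::real))"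
proof -
  define R where "R = (\<lambda>n x. \<Sum>k\<le>n. real (n choose k) * (flat k x * ((-1) ^ (n - k) * flat (n - k) (-1 * x + 1))))"
  have R: "deriv_chain R"
    unfolding R_def by (intro deriv_chain_mult deriv_chain_affine deriv_chain_flat)
  have R0: "R 0 x = flat 0 x * flat 0 (1 - x)" for x by (simp add: R_def)
  have Rnn: "0 \<le> R 0 x" for x by (simp add: R0 flat_def)
  have Rz: "R 0 x = 0" if "x \<le> 0 \<or> 1 \<le> x" for x using that by (auto simp: R0 flat_def)
  have Rpos: "0 < R 0 x" if "0 < x" "x < 1" for x using that by (simp add: R0 flat_def)
  obtain F where F: "\<And>x. (F has_real_derivative R 0 x) (at x)"
    using continuous_antiderivative[OF deriv_chain_continuous[OF R, of _ 0]] by blast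
  have F0: "F x = F 0" if "x \<le> 0" for x
    using F Rz by (intro DERIV_zero_const that) (metis (full_types))
  have F1: "F x = F 1" if "1 \<le> x" for x
    using F Rz by (intro DERIV_zero_const[symmetric] that) (metis (full_types))
  have mono: "F x \<le> F y" if "x \<le> y" for x y
  proof (rule DERIV_nonneg_imp_nondecreasing[OF that])
    fix z show "\<exists>w. (F has_real_derivative w) (at z) \<and> 0 \<le> w"
      using F[of z] Rnn[of z] by blast
  qed
  have lt: "F 0 < F 1"
    using F Rpos by (intro DERIV_pos_imp_increasing_open[of 0 1 F]) (auto intro!: continuous_at_imp_continuous_on DERIV_isCont)
  define s where "s = F 1 - F 0"
  have s: "s > 0" using lt by (simp add: s_def)
  define P where "P x = (F x - F 0) / s" for x
  have P: "(P has_real_derivative (1 / s) * R 0 x) (at x)" for x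
    unfolding P_def[abs_def] using F[of x] s by (auto intro!: derivative_eq_intros)
  have P0: "P x = 0" if "x \<le> 0" for x using F0[OF that] by (simp add: P_def)
  have P1: "P x = 1" if "1 \<le> x" for x using F1[OF that] s by (simp add: P_def s_def)
  have Pb: "0 \<le> P x" "P x \<le> 1" for x
  proof -
    have "F 0 \<le> F x" using mono[of 0 x] F0[of x] by (cases "0 \<le> x") auto
    then show "0 \<le> P x" using s by (simp add: P_def)
    have "F x \<le> F 1" using mono[of x 1] F1[of x] by (cases "x \<le> 1") auto
    then show "P x \<le> 1" using s by (simp add: P_def s_def)
  qed
  have "continuous_on UNIV P" using P by (meson DERIV_isCont continuous_at_imp_continuous_on)
  then obtain Q where Q: "\<And>x. (Q has_real_derivative P x) (at x)"
    using continuous_antiderivative by blast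
  have Q0: "Q x = Q 0" if "x \<le> 0" for x
    using Q P0 by (intro DERIV_zero_const that) (metis (full_types))
  have Q1: "Q x - x = Q 1 - 1" if "1 \<le> x" for x
  proof -
    have "((\<lambda>x. Q x - x) has_real_derivative 0) (at y)" if "1 \<le> y" for y
      using DERIV_diff[OF Q DERIV_ident, of y] P1[OF that] by simp
    from DERIV_zero_const[of 1 x "\<lambda>x. Q x - x", OF this that] show ?thesis by simp
  qed
  \<comment> \<open>The first two levels are the primitives themselves; the later ones are the bump
    and its derivatives, divided by the total mass \<open>s\<close> of the bump.\<close>
  define E where "E i x = (case i of 0 \<Rightarrow> Q x - Q 0 | Suc 0 \<Rightarrow> P x | Suc (Suc j) \<Rightarrow> (1 / s) * R j x)" for i x
  have "deriv_chain E"
    unfolding deriv_chain_def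
  proof (intro allI)
    fix i t
    consider "i = 0" | "i = Suc 0" | j where "i = Suc (Suc j)" by (metis not0_implies_Suc)
    then show "(E i has_real_derivative E (Suc i) t) (at t)"
    proof cases
      case 1
      then show ?thesis using DERIV_diff[OF Q[of t] DERIV_const[of "Q 0"]] by (simp add: E_def[abs_def])
    next
      case 2
      then show ?thesis using P[of t] by (simp add: E_def[abs_def])
    next
      case 3
      then show ?thesis using R DERIV_cmult[of "R j" "R (Suc j) t" t UNIV "1 / s"]
        unfolding deriv_chain_def by (simp add: E_def[abs_def])
    qed
  qed
  moreover have "E 0 x = x + (Q 1 - Q 0 - 1)" if "1 \<le> x" for x
    using Q1[OF that] by (simp add: E_def)
  moreover have "E 0 x = 0" if "x \<le> 0" for x using Q0[OF that] by (simp add: E_def)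
  moreover have "E 1 = P" by (simp add: E_def[abs_def])
  ultimately show ?thesis using P0 P1 Pb by (intro exI[of _ E] exI[of _ "Q 1 - Q 0 - 1"]) auto
qed

text \<open>Differences of shifted ramps, combined so as to vanish near both ends, are test
  functions. Their derivatives tend to the indicator of \<open>{a<..b}\<close> minus
  \<open>(b - a) / T\<close> times the indicator of \<open>{- (T / 2)<..T / 2}\<close>. Hence the
  integral of \<open>u\<close> over an interval is proportional to its length, and \<open>u\<close>
  and a constant are densities of measures that agree on rays.\<close>

lemma du_Bois_Reymond:
  fixes u :: "real \<Rightarrow> real"
  assumes u: "u \<in> borel_measurable borel" "\<And>t. \<bar>u t\<bar> \<le> K" and T: "T > 0"
    and zero: "\<And>E a. deriv_chain E \<Longrightarrow> a < T \<Longrightarrow> (\<And>t. \<bar>t\<bar> > a \<Longrightarrow> E 0 t = 0) \<Longrightarrow>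
      (\<integral>t. indicator {-T<..<T} t * (E 1 t * u t) \<partial>lborel) = 0"
  shows "\<exists>c. AE t in lborel. t \<in> {-T<..<T} \<longrightarrow> u t = c"
proof -
  note [measurable] = u(1)
  obtain S c0 where S: "deriv_chain S" "\<And>x. x \<le> 0 \<Longrightarrow> S 0 x = 0" "\<And>x. 1 \<le> x \<Longrightarrow> S 0 x = x + c0"
    "\<And>x. x \<le> 0 \<Longrightarrow> S 1 x = 0" "\<And>x. 1 \<le> x \<Longrightarrow> S 1 x = 1" "\<And>x. 0 \<le> S 1 x" "\<And>x. S 1 x \<le> 1"
    using smooth_ramp by blast
  have S1m [measurable]: "S 1 \<in> borel_measurable borel"
    by (intro borel_measurable_continuous_onI deriv_chain_continuous S)
  \<comment> \<open>For positive \<open>n\<close>, \<open>A n a\<close> is a ramp that starts at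
    \<open>a\<close> and has slope 1 after a transition of width \<open>1 / real n\<close>; the
    index \<open>i\<close> counts derivatives.\<close>
  define A where "A n a = (\<lambda>i x. (1 / real n) * (real n ^ i * S i (real n * x + - (real n * a))))" for n a
  have Ac: "deriv_chain (A n a)" for n a
    unfolding A_def by (intro deriv_chain_cmult deriv_chain_affine S)
  have A1: "A n a 1 x = S 1 (real n * (x - a))" if "n > 0" for n a x
    using that by (simp add: A_def right_diff_distrib)
  have A0l: "A n a 0 x = 0" if "x \<le> a" for n a x
  proof -
    have "real n * (x - a) \<le> 0" using that by (simp add: mult_nonneg_nonpos)
    then show ?thesis by (simp add: A_def S(2) right_diff_distrib)
  qed
  have A0r: "A n a 0 x = x - a + c0 / real n" if "n > 0" "a + 1 / real n \<le> x" for n a x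
  proof -
    have "real n * (1 / real n) \<le> real n * (x - a)" using that by (intro mult_left_mono) auto
    then have "1 \<le> real n * x + - (real n * a)" using that by (simp add: right_diff_distrib)
    then have "A n a 0 x = (1 / real n) * (real n * x + - (real n * a) + c0)"
      by (simp add: A_def S(3))
    then show ?thesis using that by (simp add: field_simps)
  qed
  \<comment> \<open>The corners are kept away from the ends: a transition of width
    \<open>1 / real n\<close> that starts at \<open>bn b n\<close> is over by
    \<open>T - 1 / real n\<close>, and \<open>an a n\<close> is at least
    \<open>- T + 1 / real n\<close>.\<close>
  define an bn where "an a n = max a (- T + 1 / real n)" and "bn b n = min b (T - 2 / real n)" for a b :: real and n
  let ?I = "\<lambda>a b. (\<integral>t. indicator {a<..b} t * u t \<partial>lborel)"
  have Iint: "integrable lborel (\<lambda>t. indicator {a<..b} t * u t)" for a b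
  proof -
    have "emeasure lborel {a<..b} < \<infinity>" by (cases "a \<le> b") auto
    then have "integrable lborel (\<lambda>t. indicator {a<..b} t *\<^sub>R u t)"
      by (intro integrableI_bounded_set_indicator[of _ _ _ K]) (use u in auto)
    then show ?thesis by simp
  qed
  have key: "?I a b * T = (b - a) * ?I (- (T / 2)) (T / 2)" if ab: "-T \<le> a" "a < b" "b \<le> T" for a b
  proof -
    define n0 where "n0 = nat \<lceil>max (4 / T) (3 / (b - a))\<rceil> + 1"
    have n0: "4 / T < real n" "3 / (b - a) < real n" "n > 0" if "n \<ge> n0" for n
      using that unfolding n0_def by linarith+
    \<comment> \<open>To the right of all transitions the first difference at level 0 equals
      \<open>bn b n - an a n\<close> and the second equals \<open>T\<close>, so this weight makes
      \<open>W n 0\<close> vanish there.\<close>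
    define W where "W n = (\<lambda>i x. (A n (an a n) i x - A n (bn b n) i x) - ((bn b n - an a n) / T) * (A n (- (T / 2)) i x - A n (T / 2) i x))" for n
    have Wz: "(\<integral>t. indicator {-T<..<T} t * (W n 1 t * u t) \<partial>lborel) = 0" if n: "n \<ge> n0" for n
    proof (rule zero)
      show "deriv_chain (W n)"
        unfolding W_def by (intro deriv_chain_diff deriv_chain_cmult Ac)
      have n': "1 / real n < T / 4" using n0[OF n] T by (simp add: field_simps)
      show "T - 1 / real n < T" using n0[OF n] by simp
      fix t assume t: "\<bar>t\<bar> > T - 1 / real n"
      have le: "an a n \<ge> - T + 1 / real n" "bn b n \<le> T - 2 / real n" by (auto simp: an_def bn_def)
      have "3 / real n < b - a" using n0[OF n] ab by (simp add: field_simps)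
      then have lt: "an a n \<le> bn b n" using ab n' by (auto simp: an_def bn_def)
      consider "t > T - 1 / real n" | "t < - T + 1 / real n" using t by linarith
      then show "W n 0 t = 0"
      proof cases
        case 1
        have 2: "2 / real n = 1 / real n + 1 / real n" by simp
        have "A n (an a n) 0 t = t - an a n + c0 / real n" "A n (bn b n) 0 t = t - bn b n + c0 / real n"
          "A n (- (T / 2)) 0 t = t - (- (T / 2)) + c0 / real n" "A n (T / 2) 0 t = t - T / 2 + c0 / real n"
          using 1 le lt n0(3)[OF n] n' T 2 by (intro A0r; linarith)+
        then show ?thesis using T by (simp add: W_def)
      next
        case 2
        have "A n (an a n) 0 t = 0" "A n (bn b n) 0 t = 0" "A n (- (T / 2)) 0 t = 0" "A n (T / 2) 0 t = 0"
          using 2 le lt n' T by (intro A0l; linarith)+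
        then show ?thesis by (simp add: W_def)
      qed
    qed
    \<comment> \<open>The rescaled steps converge away from the jump even if the jump moves; the
      four jump points are a null set for the dominated convergence below.\<close>
    have step: "(\<lambda>n. S 1 (real n * (t - f n))) \<longlonglongrightarrow> (if t > l then 1 else 0)"
      if f: "f \<longlonglongrightarrow> l" "t \<noteq> l" for f :: "nat \<Rightarrow> real" and l t
    proof (cases "t > l")
      case True
      have lim: "(\<lambda>n. t - f n) \<longlonglongrightarrow> t - l" using f by (intro tendsto_intros)
      have "filterlim (\<lambda>n. real n * (t - f n)) at_top sequentially"
        using filterlim_tendsto_pos_mult_at_top[OF lim _ filterlim_real_sequentially] True by (simp add: mult.commute)
      then have "eventually (\<lambda>n. 1 \<le> real n * (t - f n)) sequentially"
        by (simp add: filterlim_at_top)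
      then have "eventually (\<lambda>n. S 1 (real n * (t - f n)) = 1) sequentially"
        by eventually_elim (rule S)
      then show ?thesis using True by (simp add: tendsto_eventually)
    next
      case False
      then have "eventually (\<lambda>n. t < f n) sequentially" using f by (intro order_tendstoD) auto
      then have "eventually (\<lambda>n. S 1 (real n * (t - f n)) = 0) sequentially"
        by eventually_elim (intro S, simp add: mult_nonneg_nonpos)
      then show ?thesis using False by (simp add: tendsto_eventually)
    qed
    have anl: "an a \<longlonglongrightarrow> a"
    proof -
      have "(\<lambda>n. max a (- T + 1 / real n)) \<longlonglongrightarrow> max a (- T + 0)"
        by (intro tendsto_intros lim_1_over_n)
      then show ?thesis using ab by (simp add: an_def[abs_def])
    qed
    have bnl: "bn b \<longlonglongrightarrow> b"
    proof -
      have "(\<lambda>n. min b (T - 2 * (1 / real n))) \<longlonglongrightarrow> min b (T - 2 * 0)"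
        by (intro tendsto_intros lim_1_over_n)
      then show ?thesis using ab by (simp add: bn_def[abs_def])
    qed
    let ?\<kappa> = "(b - a) / T"
    let ?g = "\<lambda>t. (if t > a then 1 else 0) - (if t > b then 1 else 0) - ?\<kappa> * ((if t > - (T / 2) then 1 else 0) - (if t > T / 2 then 1 else 0)) :: real"
    let ?W = "\<lambda>n t. (S 1 (real n * (t - an a n)) - S 1 (real n * (t - bn b n))) -
        ((bn b n - an a n) / T) * (S 1 (real n * (t - (- (T / 2)))) - S 1 (real n * (t - T / 2)))"
    let ?B = "1 + (2 * T + 3) / T"
    have lim: "(\<lambda>n. \<integral>t. indicator {-T<..<T} t * (?W n t * u t) \<partial>lborel) \<longlonglongrightarrow> (\<integral>t. indicator {-T<..<T} t * (?g t * u t) \<partial>lborel)"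
    proof (rule integral_dominated_convergence[where w = "\<lambda>t. ?B * K * indicator {-T..T} t"])
      show "(\<lambda>t. indicator {-T<..<T} t * (?g t * u t)) \<in> borel_measurable lborel" by measurable
      show "(\<lambda>t. indicator {-T<..<T} t * (?W n t * u t)) \<in> borel_measurable lborel" for n by measurable
      show "integrable lborel (\<lambda>t. ?B * K * indicator {-T..T} t)"
        using T by (intro integrable_mult_right) simp
      show "AE t in lborel. (\<lambda>n. indicator {-T<..<T} t * (?W n t * u t)) \<longlonglongrightarrow> indicator {-T<..<T} t * (?g t * u t)"
        using AE_lborel_singleton[of a] AE_lborel_singleton[of b] AE_lborel_singleton[of "-(T/2)"] AE_lborel_singleton[of "T/2"]
      proof eventually_elim
        case (elim t)
        have 1: "(\<lambda>n. S 1 (real n * (t - an a n))) \<longlonglongrightarrow> (if t > a then 1 else 0)"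
          "(\<lambda>n. S 1 (real n * (t - bn b n))) \<longlonglongrightarrow> (if t > b then 1 else 0)"
          "(\<lambda>n. S 1 (real n * (t - (- (T / 2))))) \<longlonglongrightarrow> (if t > - (T / 2) then 1 else 0)"
          "(\<lambda>n. S 1 (real n * (t - T / 2))) \<longlonglongrightarrow> (if t > T / 2 then 1 else 0)"
          by (rule step[OF anl elim(1)] step[OF bnl elim(2)] step[OF tendsto_const elim(3)] step[OF tendsto_const elim(4)])+
        have 2: "(\<lambda>n. (bn b n - an a n) / T) \<longlonglongrightarrow> ?\<kappa>"
          using T by (intro tendsto_divide tendsto_diff bnl anl tendsto_const) auto
        show ?case
          by (rule tendsto_mult[OF tendsto_const tendsto_mult[OF tendsto_diff[OF tendsto_diff[OF 1(1,2)]
            tendsto_mult[OF 2 tendsto_diff[OF 1(3,4)]]] tendsto_const]])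
      qed
      show "AE t in lborel. norm (indicator {-T<..<T} t * (?W n t * u t)) \<le> ?B * K * indicator {-T..T} t" for n
      proof (rule AE_I2)
        fix t
        have d: "\<bar>S 1 x - S 1 y\<bar> \<le> 1" for x y using S(6,7)[of x] S(6,7)[of y] by linarith
        \<comment> \<open>\<open>1 / real 0\<close> is 0, so these bounds, and with them the
          constant \<open>2 * T + 3\<close>, hold for every \<open>n\<close>.\<close>
        have n1: "1 / real n \<le> 1" "0 \<le> 1 / real n" "2 / real n \<le> 2" "0 \<le> 2 / real n"
          by (cases "n = 0"; simp add: field_simps)+
        have "- T \<le> an a n" "an a n \<le> T + 1" "bn b n \<le> T" "- T - 2 \<le> bn b n"
          using n1 ab T unfolding an_def bn_def by linarith+
        then have "\<bar>bn b n - an a n\<bar> \<le> 2 * T + 3" by linarith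
        then have "\<bar>(bn b n - an a n) / T\<bar> \<le> (2 * T + 3) / T"
          using T by (simp add: divide_right_mono)
        then have "\<bar>((bn b n - an a n) / T) * (S 1 (real n * (t - (- (T / 2)))) - S 1 (real n * (t - T / 2)))\<bar> \<le> (2 * T + 3) / T * 1"
          unfolding abs_mult using T by (intro mult_mono d) auto
        then have W: "\<bar>?W n t\<bar> \<le> ?B" using d[of "real n * (t - an a n)" "real n * (t - bn b n)"] by linarith
        have "\<bar>?W n t * u t\<bar> \<le> ?B * K"
          unfolding abs_mult using T by (intro mult_mono W u) auto
        then show "norm (indicator {-T<..<T} t * (?W n t * u t)) \<le> ?B * K * indicator {-T..T} t"
          by (auto split: split_indicator)
      qed
    qed
    have ev: "eventually (\<lambda>n. (\<integral>t. indicator {-T<..<T} t * (?W n t * u t) \<partial>lborel) = 0) sequentially"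
    proof (rule eventually_sequentiallyI)
      fix n assume n: "n \<ge> n0"
      have "W n 1 t = ?W n t" for t
        using n0(3)[OF n] by (simp only: W_def A1)
      then show "(\<integral>t. indicator {-T<..<T} t * (?W n t * u t) \<partial>lborel) = 0"
        using Wz[OF n] by simp
    qed
    have "(\<integral>t. indicator {-T<..<T} t * (?g t * u t) \<partial>lborel) = 0"
      using lim tendsto_eventually[OF ev] by (rule LIMSEQ_unique)
    moreover have "(\<integral>t. indicator {-T<..<T} t * (?g t * u t) \<partial>lborel) =
        (\<integral>t. indicator {a<..b} t * u t - ?\<kappa> * (indicator {- (T / 2)<..T / 2} t * u t) \<partial>lborel)"
    proof (rule integral_cong_AE)
      show "AE t in lborel. indicator {-T<..<T} t * (?g t * u t) = indicator {a<..b} t * u t - ?\<kappa> * (indicator {- (T / 2)<..T / 2} t * u t)"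
        using AE_lborel_singleton[of T]
      proof eventually_elim
        case (elim t)
        consider "t \<le> -T" | "T < t" | "-T < t" "t < T" using elim by linarith
        then show ?case
          using ab T by cases (auto simp: indicator_def algebra_simps)
      qed
    qed measurable
    moreover have int: "integrable lborel (\<lambda>t. indicator {a<..b} t * u t)" for a b
      by (rule Iint)
    ultimately have "?I a b - ?\<kappa> * ?I (- (T / 2)) (T / 2) = 0" by simp
    then show ?thesis using T by (simp add: field_simps)
  qed
  define c where "c = ?I (- (T / 2)) (T / 2) / T"
  \<comment> \<open>A shift that makes both \<open>u\<close> and \<open>c\<close> nonnegative, so
    that they can serve as densities.\<close>
  define K' where "K' = K + \<bar>c\<bar>"
  have pos: "0 \<le> u t + K'" "0 \<le> c + K'" for t
    using u(2)[of t] u(2)[of 0] unfolding K'_def by linarith+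
  have eq: "?I a T = (T - a) * c" if "- T \<le> a" "a < T" for a
    using key[of a T] that T by (simp add: c_def field_simps)
  have Ioc [simp]: "integrable lborel (indicat_real {a<..b})" for a b :: real
    by (rule integrable_real_indicator) (cases "a \<le> b"; simp)+
  let ?M = "\<lambda>f. density lborel (\<lambda>t. ennreal (f t + K') * indicator {-T<..<T} t)"
  have M: "emeasure (?M f) {x<..} = (if max x (-T) < T then ennreal ((\<integral>t. indicator {max x (-T)<..T} t * f t \<partial>lborel) + K' * (T - max x (-T))) else 0)"
    if [measurable]: "f \<in> borel_measurable borel" and f: "\<And>t. 0 \<le> f t + K'" "\<And>a b. integrable lborel (\<lambda>t. indicator {a<..b} t * f t)" for f x
  proof -
    let ?a = "max x (-T)"
    have "emeasure (?M f) {x<..} = (\<integral>\<^sup>+t. ennreal (f t + K') * indicator {-T<..<T} t * indicator {x<..} t \<partial>lborel)"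
      by (subst emeasure_density) auto
    also have "\<dots> = (\<integral>\<^sup>+t. ennreal (indicator {?a<..T} t * f t + K' * indicator {?a<..T} t) \<partial>lborel)"
      using AE_lborel_singleton[of T]
      by (intro nn_integral_cong_AE) (auto elim!: eventually_mono split: split_indicator)
    also have "\<dots> = ennreal (\<integral>t. indicator {?a<..T} t * f t + K' * indicator {?a<..T} t \<partial>lborel)"
      using f by (intro nn_integral_eq_integral Bochner_Integration.integrable_add) (auto split: split_indicator)
    also have "(\<integral>t. indicator {?a<..T} t * f t + K' * indicator {?a<..T} t \<partial>lborel) =
        (\<integral>t. indicator {?a<..T} t * f t \<partial>lborel) + (\<integral>t. K' * indicator {?a<..T} t \<partial>lborel)"
      using f by (intro Bochner_Integration.integral_add) auto
    finally show ?thesis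
      by (cases "?a < T") (auto simp: not_less)
  qed
  have cint: "integrable lborel (\<lambda>t. indicator {a<..b} t * c)" for a b :: real
    by simp
  have "?M u = ?M (\<lambda>_. c)"
  proof (rule measure_eqI_lessThan)
    show "emeasure (?M u) {x<..} < \<infinity>" for x
      unfolding M[OF u(1) pos(1) Iint] by simp
    show "emeasure (?M u) {x<..} = emeasure (?M (\<lambda>_. c)) {x<..}" for x
    proof (cases "max x (-T) < T")
      case True
      then have "?I (max x (-T)) T = (\<integral>t. indicator {max x (-T)<..T} t * c \<partial>lborel)"
        using eq[of "max x (-T)"] by simp
      then show ?thesis
        unfolding M[OF u(1) pos(1) Iint] M[OF borel_measurable_const pos(2) cint] by (simp only:)
    next
      case False
      then show ?thesis
        unfolding M[OF u(1) pos(1) Iint] M[OF borel_measurable_const pos(2) cint] by (simp only: False if_False)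
    qed
  qed auto
  then have "AE t in lborel. ennreal (u t + K') * indicator {-T<..<T} t = ennreal (c + K') * indicator {-T<..<T} t"
  proof (rule finite_density_unique[THEN iffD1, rotated 5])
    have "(\<integral>\<^sup>+t. ennreal (u t + K') * indicator {-T<..<T} t \<partial>lborel) \<le> (\<integral>\<^sup>+t. ennreal (K + K') * indicator {-T..T} t \<partial>lborel)"
      using u(2) by (intro nn_integral_mono mult_mono ennreal_leI) (auto simp: abs_le_iff split: split_indicator)
    also have "\<dots> < \<infinity>" using T by (simp add: nn_integral_cmult_indicator ennreal_mult_less_top)
    finally show "(\<integral>\<^sup>+t. ennreal (u t + K') * indicator {-T<..<T} t \<partial>lborel) \<noteq> \<infinity>" by simp
  qed auto
  then have "AE t in lborel. t \<in> {-T<..<T} \<longrightarrow> u t = c"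
  proof eventually_elim
    case (elim t)
    then show ?case using pos(1)[of t] pos(2) by (auto simp: indicator_def)
  qed
  then show ?thesis by blast
qed

subsection \<open>Trigonometric approximation of Lipschitz functions\<close>

text \<open>A trigonometric polynomial paired with its derivative. The generators are countably
  many, so almost sure identities for them hold outside one common null set and extend by
  linearity.\<close>

inductive trig_poly :: "(real \<Rightarrow> real) \<Rightarrow> (real \<Rightarrow> real) \<Rightarrow> bool" where
  cos: "trig_poly (\<lambda>x. cos (2 * pi * real k * x)) (\<lambda>x. - (2 * pi * real k * sin (2 * pi * real k * x)))"
| sin: "trig_poly (\<lambda>x. sin (2 * pi * real k * x)) (\<lambda>x. 2 * pi * real k * cos (2 * pi * real k * x))"
| add: "trig_poly f f' \<Longrightarrow> trig_poly g g' \<Longrightarrow> trig_poly (\<lambda>x. f x + g x) (\<lambda>x. f' x + g' x)"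
| cmult: "trig_poly f f' \<Longrightarrow> trig_poly (\<lambda>x. c * f x) (\<lambda>x. c * f' x)"

lemma trig_poly_DERIV: "trig_poly f f' \<Longrightarrow> (f has_real_derivative f' x) (at x)"
  by (induction rule: trig_poly.induct) (auto intro!: derivative_eq_intros)

text \<open>The even trigonometric polynomials, which serve as convolution kernels; the class
  absorbs multiplication by \<open>cos (2 * pi * z)\<close>.\<close>

inductive cos_poly :: "(real \<Rightarrow> real) \<Rightarrow> bool" where
  base: "cos_poly (\<lambda>z. cos (2 * pi * real k * z))"
| add: "cos_poly p \<Longrightarrow> cos_poly q \<Longrightarrow> cos_poly (\<lambda>z. p z + q z)"
| cmult: "cos_poly p \<Longrightarrow> cos_poly (\<lambda>z. c * p z)"

lemma cos_poly_mult_cos: "cos_poly p \<Longrightarrow> cos_poly (\<lambda>z. cos (2 * pi * z) * p z)"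
proof (induction rule: cos_poly.induct)
  case (base k)
  show ?case
  proof (cases k)
    case 0
    then show ?thesis using cos_poly.base[of 1] by simp
  next
    case (Suc j)
    have "cos (2 * pi * z) * cos (2 * pi * real k * z) =
        1 / 2 * cos (2 * pi * real j * z) + 1 / 2 * cos (2 * pi * real (Suc k) * z)" for z
    proof -
      have "2 * pi * real k * z - 2 * pi * z = 2 * pi * real j * z"
        "2 * pi * real k * z + 2 * pi * z = 2 * pi * real (Suc k) * z"
        by (simp_all add: Suc algebra_simps)
      then show ?thesis
        using cos_times_cos[of "2 * pi * real k * z" "2 * pi * z"] by (simp add: mult.commute)
    qed
    then show ?thesis
      using cos_poly.add[OF cos_poly.cmult[OF cos_poly.base[of j], of "1 / 2"] cos_poly.cmult[OF cos_poly.base[of "Suc k"], of "1 / 2"]]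
      by (simp only:)
  qed
next
  case (add p q)
  then show ?case using cos_poly.add[OF add.IH] by (simp only: distrib_left)
next
  case (cmult p c)
  then show ?case using cos_poly.cmult[OF cmult.IH, of c] by (simp only: mult.left_commute)
qed

lemma cos_poly_power: "cos_poly (\<lambda>z. (1 + cos (2 * pi * z)) ^ n)"
proof (induction n)
  case 0
  show ?case using cos_poly.base[of 0] by simp
next
  case (Suc n)
  have "(1 + cos (2 * pi * z)) ^ Suc n = (1 + cos (2 * pi * z)) ^ n + cos (2 * pi * z) * (1 + cos (2 * pi * z)) ^ n" for z
    by (simp add: distrib_right)
  then show ?case
    using cos_poly.add[OF Suc cos_poly_mult_cos[OF Suc]] by (simp only:)
qed

section \<open>Convolution of bounded functions with cosine polynomials\<close>

lemma integrable_torus_lebesgue_bounded: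
  fixes f :: "real \<Rightarrow> real"
  assumes "f \<in> borel_measurable borel" "\<And>x. \<bar>f x\<bar> \<le> C"
  shows "integrable torus_lebesgue f"
proof -
  interpret T: prob_space torus_lebesgue by (rule prob_space_torus_lebesgue)
  have "f \<in> borel_measurable torus_lebesgue"
    by (rule torus_prob_measurable[OF torus_prob_torus_lebesgue measurable_torus_borel[OF assms(1)]])
  then show ?thesis
    by (intro T.integrable_const_bound[of _ C]) (auto simp: assms)
qed

lemma cos_poly_borel: "cos_poly p \<Longrightarrow> p \<in> borel_measurable borel"
  by (induction rule: cos_poly.induct) (auto intro!: borel_measurable_continuous_onI continuous_intros)

lemma cos_poly_bounded: "cos_poly p \<Longrightarrow> \<exists>C. \<forall>z. \<bar>p z\<bar> \<le> C"
proof (induction rule: cos_poly.induct)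
  case (base k)
  show ?case by (intro exI[of _ 1]) simp
next
  case (add p q)
  then obtain C D where "\<And>z. \<bar>p z\<bar> \<le> C" "\<And>z. \<bar>q z\<bar> \<le> D" by blast
  then show ?case by (intro exI[of _ "C + D"]) (meson abs_triangle_ineq add_mono order_trans)
next
  case (cmult p c)
  then obtain C where "\<And>z. \<bar>p z\<bar> \<le> C" by blast
  then show ?case by (intro exI[of _ "\<bar>c\<bar> * C"]) (simp add: abs_mult mult_left_mono)
qed

lemma cos_poly_convolution_integrable:
  assumes f: "f \<in> borel_measurable borel" "\<And>y. \<bar>f y\<bar> \<le> B" and p: "cos_poly p"
  shows "integrable torus_lebesgue (\<lambda>y. f y * p (x - y))"
proof -
  note [measurable] = f(1) cos_poly_borel[OF p]
  obtain C where C: "\<And>z. \<bar>p z\<bar> \<le> C" using cos_poly_bounded[OF p] by blast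
  show ?thesis
  proof (rule integrable_torus_lebesgue_bounded[of _ "B * C"])
    show "\<bar>f y * p (x - y)\<bar> \<le> B * C" for y
      unfolding abs_mult using f(2)[of 0] by (intro mult_mono f C) auto
  qed measurable
qed

text \<open>The addition theorem separates \<open>x\<close> from \<open>y\<close>: for each
  frequency the convolution is a combination of a cosine and a sine in \<open>x\<close>, with
  integrals of \<open>f\<close> as coefficients.\<close>

lemma trig_poly_convolution:
  assumes f: "f \<in> borel_measurable borel" "\<And>y. \<bar>f y\<bar> \<le> B" and p: "cos_poly p"
  shows "\<exists>g'. trig_poly (\<lambda>x. \<integral>y. f y * p (x - y) \<partial>torus_lebesgue) g'"
  using p
proof (induction rule: cos_poly.induct)
  case (base k)
  note [measurable] = f(1)
  let ?w = "2 * pi * real k"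
  have int: "integrable torus_lebesgue (\<lambda>y. f y * cos (?w * y))" "integrable torus_lebesgue (\<lambda>y. f y * sin (?w * y))"
  proof -
    have 1: "\<bar>f y * s\<bar> \<le> B * 1" if "\<bar>s\<bar> \<le> 1" for y s
      unfolding abs_mult using f(2)[of y] that by (intro mult_mono) auto
    show "integrable torus_lebesgue (\<lambda>y. f y * cos (?w * y))"
    proof (rule integrable_torus_lebesgue_bounded)
      show "\<bar>f y * cos (?w * y)\<bar> \<le> B * 1" for y by (rule 1) simp
    qed measurable
    show "integrable torus_lebesgue (\<lambda>y. f y * sin (?w * y))"
    proof (rule integrable_torus_lebesgue_bounded)
      show "\<bar>f y * sin (?w * y)\<bar> \<le> B * 1" for y by (rule 1) simp
    qed measurable
  qed
  have "(\<integral>y. f y * cos (?w * (x - y)) \<partial>torus_lebesgue) =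
      (\<integral>y. f y * cos (?w * y) \<partial>torus_lebesgue) * cos (?w * x) + (\<integral>y. f y * sin (?w * y) \<partial>torus_lebesgue) * sin (?w * x)" for x
  proof -
    have "(\<integral>y. f y * cos (?w * (x - y)) \<partial>torus_lebesgue) =
        (\<integral>y. f y * cos (?w * y) * cos (?w * x) + f y * sin (?w * y) * sin (?w * x) \<partial>torus_lebesgue)"
    proof (rule Bochner_Integration.integral_cong)
      fix y
      have "?w * (x - y) = ?w * x - ?w * y" by (rule right_diff_distrib)
      then show "f y * cos (?w * (x - y)) = f y * cos (?w * y) * cos (?w * x) + f y * sin (?w * y) * sin (?w * x)"
        by (simp only: cos_diff) (simp add: distrib_left mult_ac)
    qed simp
    then show ?thesis using int by simp
  qed
  then show ?case
    using trig_poly.add[OF trig_poly.cmult[OF trig_poly.cos[of k]] trig_poly.cmult[OF trig_poly.sin[of k]],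
      of "\<integral>y. f y * cos (?w * y) \<partial>torus_lebesgue" "\<integral>y. f y * sin (?w * y) \<partial>torus_lebesgue"]
    by (simp only:) blast
next
  case (add p q)
  then obtain a b where ab: "trig_poly (\<lambda>x. \<integral>y. f y * p (x - y) \<partial>torus_lebesgue) a"
    "trig_poly (\<lambda>x. \<integral>y. f y * q (x - y) \<partial>torus_lebesgue) b" by blast
  have "(\<integral>y. f y * (p (x - y) + q (x - y)) \<partial>torus_lebesgue) =
      (\<integral>y. f y * p (x - y) \<partial>torus_lebesgue) + (\<integral>y. f y * q (x - y) \<partial>torus_lebesgue)" for x
    unfolding distrib_left
    by (rule Bochner_Integration.integral_add[OF cos_poly_convolution_integrable[OF f add.hyps(1)] cos_poly_convolution_integrable[OF f add.hyps(2)]])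
  then show ?case using trig_poly.add[OF ab] by (simp only:) blast
next
  case (cmult p c)
  then obtain a where a: "trig_poly (\<lambda>x. \<integral>y. f y * p (x - y) \<partial>torus_lebesgue) a" by blast
  have "(\<integral>y. f y * (c * p (x - y)) \<partial>torus_lebesgue) = c * (\<integral>y. f y * p (x - y) \<partial>torus_lebesgue)" for x
    unfolding mult.left_commute[of _ c] by (rule integral_mult_right_zero)
  then show ?case using trig_poly.cmult[OF a, of c] by (simp only:) blast
qed

lemma integral_torus_lebesgue_FTC:
  assumes F: "\<And>x. (F has_real_derivative f x) (at x)" and f: "continuous_on UNIV f"
  shows "(\<integral>x. f x \<partial>torus_lebesgue) = F 1 - F 0"
proof -
  have "has_bochner_integral lborel (\<lambda>x. f x * indicator {0..1} x) (F 1 - F 0)"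
    using f by (intro has_bochner_integral_FTC_Icc_real F) (auto simp: continuous_on_eq_continuous_at)
  then have "(\<integral>x. f x * indicator {0..1} x \<partial>lborel) = F 1 - F 0"
    by (simp add: has_bochner_integral_iff)
  moreover have "(\<integral>x. f x * indicator {0..<1} x \<partial>lborel) = (\<integral>x. f x * indicator {0..1} x \<partial>lborel)"
  proof (rule integral_cong_AE)
    show "AE x in lborel. f x * indicator {0..<1} x = f x * indicator {0..1} x"
      using AE_lborel_singleton[of 1] by eventually_elim (auto split: split_indicator)
  qed (use borel_measurable_continuous_onI[OF f] in measurable)
  ultimately show ?thesis by (simp add: integral_torus_lebesgue)
qed

text \<open>The powers of \<open>1 + cos (2 * pi * z)\<close> concentrate at the integers. For the
  second bound, the derivative of \<open>sin (2 * pi * z) * (1 + cos (2 * pi * z)) ^ n\<close> is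
  integrated over a period; factoring the squared sine as a product of
  \<open>1 - cos (2 * pi * z)\<close> and \<open>1 + cos (2 * pi * z)\<close> shows that
  \<open>real n\<close> times the moment equals the integral of the kernel multiplied by the cosine,
  which is at most \<open>I n\<close>.\<close>

lemma cos_kernel_moments:
  defines "I \<equiv> \<lambda>n::nat. (\<integral>z. (1 + cos (2 * pi * z)) ^ n \<partial>torus_lebesgue)"
  shows "0 < I n"
    and "n \<ge> 1 \<Longrightarrow> (\<integral>z. (1 - cos (2 * pi * z)) * (1 + cos (2 * pi * z)) ^ n \<partial>torus_lebesgue) \<le> I n / real n"
proof -
  interpret T: prob_space torus_lebesgue by (rule prob_space_torus_lebesgue)
  have cb: "0 \<le> 1 + cos x" "1 + cos x \<le> 2" "0 \<le> 1 - cos x" for x :: real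
    using cos_ge_minus_one[of x] cos_le_one[of x] by linarith+
  have pb: "(1 + cos x) ^ n \<le> 2 ^ n" for x :: real and n
    using cb by (intro power_mono) auto
  have int: "integrable torus_lebesgue (\<lambda>z. (1 + cos (2 * pi * z)) ^ n)" for n
    using cb pb by (intro integrable_torus_lebesgue_bounded[of _ "2 ^ n"]) (auto intro!: borel_measurable_continuous_onI continuous_intros)
  have cint: "integrable torus_lebesgue (\<lambda>z. cos (2 * pi * z) * (1 + cos (2 * pi * z)) ^ n)" for n
  proof (intro integrable_torus_lebesgue_bounded[of _ "1 * 2 ^ n"])
    show "\<bar>cos (2 * pi * z) * (1 + cos (2 * pi * z)) ^ n\<bar> \<le> 1 * 2 ^ n" for z
      unfolding abs_mult using cb pb by (intro mult_mono) auto
  qed (auto intro!: borel_measurable_continuous_onI continuous_intros)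
  show "0 < I n" for n
  proof -
    \<comment> \<open>On a quarter period the cosine is nonnegative, so the integrand is at least
      1.\<close>
    have "(\<integral>z. indicator {0..1/4} z \<partial>torus_lebesgue) \<le> I n"
      unfolding I_def
    proof (rule integral_mono)
      show "integrable torus_lebesgue (indicat_real {0..1/4})"
        by (rule integrable_torus_lebesgue_bounded[of _ 1]) (auto split: split_indicator)
      show "integrable torus_lebesgue (\<lambda>z. (1 + cos (2 * pi * z)) ^ n)" by (rule int)
      fix z :: real
      show "indicat_real {0..1/4} z \<le> (1 + cos (2 * pi * z)) ^ n"
      proof (cases "z \<in> {0..1/4}")
        case True
        then have "2 * pi * z \<le> 2 * pi * (1 / 4)" by (intro mult_left_mono) auto
        moreover have "0 \<le> 2 * pi * z" using True by simp
        ultimately have "0 \<le> cos (2 * pi * z)"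
          using pi_gt_zero by (intro cos_ge_zero) linarith+
        then show ?thesis using True by (simp add: one_le_power)
      qed (use cb in auto)
    qed
    moreover have "(\<integral>z. indicator {0..1/4} z \<partial>torus_lebesgue) = (1 / 4 :: real)"
    proof -
      have "(\<lambda>x. indicat_real {0..1/4::real} x * indicat_real {0..<1} x) = indicat_real {0..1/4::real}"
        by (auto simp: fun_eq_iff split: split_indicator)
      then have "(\<integral>z. indicator {0..1/4::real} z \<partial>torus_lebesgue) = integral\<^sup>L lborel (indicat_real {0..1/4::real})"
        unfolding integral_torus_lebesgue by (simp only:)
      also have "\<dots> = 1 / 4" by simp
      finally show ?thesis .
    qed
    ultimately show ?thesis by simp
  qed
  assume n: "n \<ge> 1"
  let ?c = "\<lambda>z. cos (2 * pi * z)" and ?s = "\<lambda>z. sin (2 * pi * z)"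
  let ?f = "\<lambda>z. 2 * pi * (?c z * (1 + ?c z) ^ n) - 2 * pi * (real n * ((1 - ?c z) * (1 + ?c z) ^ n))"
  have "((\<lambda>z. ?s z * (1 + ?c z) ^ n) has_real_derivative ?f z) (at z)" for z
  proof -
    obtain k where k: "n = Suc k" using n by (cases n) auto
    have s2: "?s z * ?s z = (1 - ?c z) * (1 + ?c z)"
      using sin_cos_squared_add[of "2 * pi * z"] by (simp add: power2_eq_square algebra_simps)
    have c: "((\<lambda>z. 1 + ?c z) has_real_derivative - (?s z * (2 * pi))) (at z)"
      by (auto intro!: derivative_eq_intros)
    have d: "(?s has_real_derivative ?c z * (2 * pi)) (at z)"
      by (auto intro!: derivative_eq_intros)
    have "((\<lambda>z. ?s z * (1 + ?c z) ^ n) has_real_derivative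
        ?c z * (2 * pi) * (1 + ?c z) ^ Suc k + (1 + real k) * (- (?s z * (2 * pi)) * (1 + ?c z) ^ k) * ?s z) (at z)"
      unfolding k by (rule DERIV_mult[OF d DERIV_power_Suc[OF c]])
    moreover have "(1 + real k) * (- (?s z * (2 * pi)) * (1 + ?c z) ^ k) * ?s z = - (2 * pi * (real n * (?s z * ?s z * (1 + ?c z) ^ k)))"
      by (simp add: k)
    moreover have "?s z * ?s z * (1 + ?c z) ^ k = (1 - ?c z) * (1 + ?c z) ^ n"
      unfolding s2 k by simp
    ultimately show ?thesis by (simp only: k mult.commute[of _ "2 * pi"] mult.assoc minus_diff_eq diff_conv_add_uminus)
  qed
  then have "(\<integral>z. ?f z \<partial>torus_lebesgue) = ?s 1 * (1 + ?c 1) ^ n - ?s 0 * (1 + ?c 0) ^ n"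
    by (rule integral_torus_lebesgue_FTC) (intro continuous_intros)
  then have z: "(\<integral>z. ?f z \<partial>torus_lebesgue) = 0" by simp
  have dint: "integrable torus_lebesgue (\<lambda>z. (1 - ?c z) * (1 + ?c z) ^ n)"
    using Bochner_Integration.integrable_diff[OF int[of n] cint[of n]] by (simp add: left_diff_distrib)
  have "(\<integral>z. ?f z \<partial>torus_lebesgue) = 2 * pi * (\<integral>z. ?c z * (1 + ?c z) ^ n \<partial>torus_lebesgue) - 2 * pi * (real n * (\<integral>z. (1 - ?c z) * (1 + ?c z) ^ n \<partial>torus_lebesgue))"
    by (subst Bochner_Integration.integral_diff) (intro integrable_mult_right dint cint, intro integrable_mult_right dint cint, simp)
  then have "real n * (\<integral>z. (1 - ?c z) * (1 + ?c z) ^ n \<partial>torus_lebesgue) = (\<integral>z. ?c z * (1 + ?c z) ^ n \<partial>torus_lebesgue)"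
    using z by simp
  also have "\<dots> \<le> I n"
    unfolding I_def
  proof (rule integral_mono[OF cint int])
    show "?c z * (1 + ?c z) ^ n \<le> (1 + ?c z) ^ n" for z
      using mult_right_mono[OF cos_le_one zero_le_power[OF cb(1)]] by simp
  qed
  finally show "(\<integral>z. (1 - ?c z) * (1 + ?c z) ^ n \<partial>torus_lebesgue) \<le> I n / real n"
    using n by (simp add: field_simps)
qed

text \<open>Within \<open>e\<close> of an integer the first term suffices; elsewhere the fraction is
  at least 1, which \<open>dist_per\<close> never exceeds. The displacement is thus bounded by the
  quantity whose mean \<open>cos_kernel_moments\<close> controls.\<close>

lemma dist_per_le_cos:
  assumes e: "0 < e" "e < 1 / 2" and z: "0 \<le> z" "z < 1"
  shows "dist_per (x + z) x \<le> e + (1 - cos (2 * pi * z)) / (1 - cos (2 * pi * e))"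
proof -
  have "cos (2 * pi * e) < cos 0" using e by (intro cos_monotone_0_pi) auto
  then have pos: "0 < 1 - cos (2 * pi * e)" by simp
  have nn: "0 \<le> (1 - cos (2 * pi * z)) / (1 - cos (2 * pi * e))" using pos by simp
  consider "z \<le> e" | "1 - e \<le> z" | "e < z" "z < 1 - e" by linarith
  then show ?thesis
  proof cases
    case 1
    moreover have "dist_per (x + z) x \<le> z" using dist_per_le_abs[of "x + z" x] z by simp
    ultimately show ?thesis using nn by linarith
  next
    case 2
    moreover have "dist_per (x + z) x \<le> 1 - z" using dist_per_le_int[of "x + z" x 1] z by simp
    ultimately show ?thesis using nn by linarith
  next
    case 3
    have "cos (2 * pi * z) \<le> cos (2 * pi * e)"
    proof (cases "z \<le> 1 / 2")
      case True
      then have "2 * pi * z \<le> 2 * pi * (1 / 2)" by (intro mult_left_mono) auto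
      then show ?thesis using 3 e by (intro cos_monotone_0_pi_le) auto
    next
      case False
      have "cos (2 * pi * z) = cos (2 * pi * (1 - z))"
        by (simp add: right_diff_distrib cos_diff)
      also have "\<dots> \<le> cos (2 * pi * e)"
      proof (intro cos_monotone_0_pi_le)
        have "2 * pi * (1 - z) \<le> 2 * pi * (1 / 2)" using False by (intro mult_left_mono) auto
        then show "2 * pi * (1 - z) \<le> pi" by simp
        show "2 * pi * e \<le> 2 * pi * (1 - z)" using 3 by (intro mult_left_mono) auto
      qed (use e in auto)
      finally show ?thesis .
    qed
    then have "1 \<le> (1 - cos (2 * pi * z)) / (1 - cos (2 * pi * e))"
      using pos by (simp add: le_divide_eq)
    then show ?thesis using dist_per_le_1[of "x + z" x] e by linarith
  qed
qed

lemma DERIV_bound_of_lipschitz: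
  fixes g :: "real \<Rightarrow> real"
  assumes lip: "\<And>x y. \<bar>g x - g y\<bar> \<le> L * \<bar>x - y\<bar>" and D: "(g has_real_derivative d) (at x)"
  shows "\<bar>d\<bar> \<le> L"
proof -
  have lim: "((\<lambda>y. (g y - g x) / (y - x)) \<longlongrightarrow> d) (at x)"
    using D by (simp add: has_field_derivative_iff)
  have "((\<lambda>y. \<bar>(g y - g x) / (y - x)\<bar>) \<longlongrightarrow> \<bar>d\<bar>) (at x)"
    using lim by (rule tendsto_rabs)
  moreover have "eventually (\<lambda>y. \<bar>(g y - g x) / (y - x)\<bar> \<le> L) (at x)"
    using lip by (auto simp: eventually_at_filter abs_divide divide_le_eq intro!: always_eventually)
  ultimately show ?thesis by (rule tendsto_upperbound) simp
qed

text \<open>Convolution with a nonnegative kernel of mass 1. An average of translates of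
  \<open>f\<close> keeps the Lipschitz constant, so \<open>g'\<close> is bounded by \<open>L\<close>
  itself and no constant is lost in the limit. The error splits into \<open>L * e\<close> and a
  moment term of order \<open>1 / real n\<close>.\<close>

lemma lip_per_trig_approx:
  assumes f: "lip_per L f" and \<epsilon>: "\<epsilon> > 0"
  shows "\<exists>g g'. trig_poly g g' \<and> (\<forall>x. \<bar>f x - g x\<bar> \<le> \<epsilon>) \<and> (\<forall>x. \<bar>g' x\<bar> \<le> L)"
proof -
  interpret T: prob_space torus_lebesgue by (rule prob_space_torus_lebesgue)
  have L: "0 \<le> L" by (rule lip_per_nonneg[OF f])
  have fm [measurable]: "f \<in> borel_measurable borel" by (rule lip_per_borel[OF f])
  obtain B where B: "\<And>x. \<bar>f x\<bar> \<le> B" using lip_per_bounded[OF f] by blast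
  \<comment> \<open>Half of \<epsilon> is spent on the term \<open>L * e\<close>, half on the moment
    term; \<open>L + 1\<close> avoids a division by zero.\<close>
  define e where "e = min (1 / 4) (\<epsilon> / (2 * (L + 1)))"
  have e: "0 < e" "e < 1 / 2" using \<epsilon> L by (auto simp: e_def)
  have "e \<le> \<epsilon> / (2 * (L + 1))" by (simp add: e_def)
  then have "e * (2 * (L + 1)) \<le> \<epsilon>" using L by (subst (asm) le_divide_eq) auto
  then have Le: "L * e \<le> \<epsilon> / 2" using e by (simp add: algebra_simps)
  define C where "C = 1 / (1 - cos (2 * pi * e))"
  have "cos (2 * pi * e) < cos 0" using e by (intro cos_monotone_0_pi) auto
  then have C: "0 < C" by (simp add: C_def)
  obtain n where n: "2 * L * C / \<epsilon> < real n" "n \<ge> 1"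
  proof -
    obtain n where "2 * L * C / \<epsilon> < real n" using reals_Archimedean2 by blast
    then show ?thesis using that[of "Suc n"] by auto
  qed
  have "L * C * 2 < real n * \<epsilon>" using n(1) \<epsilon> by (simp add: field_simps)
  then have LC: "L * C / real n \<le> \<epsilon> / 2" using n(2) by (simp add: field_simps)
  define I where "I = (\<integral>z. (1 + cos (2 * pi * z)) ^ n \<partial>torus_lebesgue)"
  have I: "I > 0" unfolding I_def by (rule cos_kernel_moments)
  define k where "k z = 1 / I * (1 + cos (2 * pi * z)) ^ n" for z
  have kc: "cos_poly k" unfolding k_def by (rule cos_poly.cmult[OF cos_poly_power])
  note km [measurable] = cos_poly_borel[OF kc]
  have knn: "0 \<le> k z" for z
  proof -
    have "0 \<le> 1 + cos (2 * pi * z)" using cos_ge_minus_one[of "2 * pi * z"] by linarith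
    then show ?thesis unfolding k_def using I by (intro mult_nonneg_nonneg zero_le_power) auto
  qed
  obtain D where D: "\<And>z. \<bar>k z\<bar> \<le> D" using cos_poly_bounded[OF kc] by blast
  have kint: "integrable torus_lebesgue k"
    by (rule integrable_torus_lebesgue_bounded[OF km D])
  have k1: "(\<integral>z. k z \<partial>torus_lebesgue) = 1"
    using I by (simp add: k_def I_def)
  have kev: "k (x - (y + x)) = k y" for x y by (simp add: k_def)
  define g where "g x = (\<integral>y. f y * k (x - y) \<partial>torus_lebesgue)" for x
  obtain g' where g': "trig_poly g g'"
    using trig_poly_convolution[OF fm B kc] unfolding g_def[abs_def] by blast
  have fkint: "integrable torus_lebesgue (\<lambda>y. f (y + x) * k y)" for x
  proof (rule integrable_torus_lebesgue_bounded[of _ "B * D"])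
    show "\<bar>f (y + x) * k y\<bar> \<le> B * D" for y
      unfolding abs_mult using B[of 0] by (intro mult_mono B D) auto
  qed measurable
  have g_eq: "g x = (\<integral>y. f (y + x) * k y \<partial>torus_lebesgue)" for x
  proof -
    have "k (x - (y + 1)) = k (x - y)" for y
      using cos_periodic[of "2 * pi * (x - (y + 1))"] by (simp add: k_def algebra_simps)
    then have "g x = (\<integral>y. f (y + x) * k (x - (y + x)) \<partial>torus_lebesgue)"
      unfolding g_def using f
      by (intro integral_periodic_shift[symmetric]) (auto simp: lip_per_def)
    then show ?thesis by (simp only: kev)
  qed
  have lip: "\<bar>g x - g y\<bar> \<le> L * \<bar>x - y\<bar>" for x y
  proof -
    have "g x - g y = (\<integral>z. f (z + x) * k z - f (z + y) * k z \<partial>torus_lebesgue)"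
      unfolding g_eq by (rule Bochner_Integration.integral_diff[symmetric, OF fkint fkint])
    also have "\<bar>\<dots>\<bar> \<le> (\<integral>z. L * \<bar>x - y\<bar> * k z \<partial>torus_lebesgue)"
    proof (rule order_trans[OF integral_abs_bound integral_mono])
      show "integrable torus_lebesgue (\<lambda>z. \<bar>f (z + x) * k z - f (z + y) * k z\<bar>)"
        using fkint by auto
      fix z
      have "\<bar>f (z + x) - f (z + y)\<bar> \<le> L * \<bar>(z + x) - (z + y)\<bar>"
        using f unfolding lip_per_def by blast
      then have "\<bar>f (z + x) - f (z + y)\<bar> * k z \<le> L * \<bar>x - y\<bar> * k z"
        using knn by (intro mult_right_mono) auto
      then show "\<bar>f (z + x) * k z - f (z + y) * k z\<bar> \<le> L * \<bar>x - y\<bar> * k z"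
        using knn[of z] by (simp add: abs_mult flip: left_diff_distrib)
    qed (use kint in auto)
    also have "\<dots> = L * \<bar>x - y\<bar>" using k1 by simp
    finally show ?thesis .
  qed
  have approx: "\<bar>f x - g x\<bar> \<le> \<epsilon>" for x
  proof -
    have cint: "integrable torus_lebesgue (\<lambda>z. (1 - cos (2 * pi * z)) * k z)"
    proof (rule integrable_torus_lebesgue_bounded[of _ "2 * D"])
      fix z
      have "\<bar>1 - cos (2 * pi * z)\<bar> \<le> 2"
        using cos_ge_minus_one[of "2 * pi * z"] cos_le_one[of "2 * pi * z"] by linarith
      then show "\<bar>(1 - cos (2 * pi * z)) * k z\<bar> \<le> 2 * D"
        unfolding abs_mult by (intro mult_mono D) auto
    qed measurable
    have "f x - g x = (\<integral>z. f x * k z - f (z + x) * k z \<partial>torus_lebesgue)"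
      using k1 kint fkint by (simp add: g_eq)
    also have "\<bar>\<dots>\<bar> \<le> (\<integral>z. L * e * k z + L * C * ((1 - cos (2 * pi * z)) * k z) \<partial>torus_lebesgue)"
    proof (rule order_trans[OF integral_abs_bound integral_mono])
      show "integrable torus_lebesgue (\<lambda>z. \<bar>f x * k z - f (z + x) * k z\<bar>)"
        using fkint kint by auto
      show "integrable torus_lebesgue (\<lambda>z. L * e * k z + L * C * ((1 - cos (2 * pi * z)) * k z))"
        using kint cint by auto
      fix z assume "z \<in> space torus_lebesgue"
      then have z: "0 \<le> z" "z < 1" by auto
      have "\<bar>f (x + z) - f x\<bar> \<le> L * dist_per (x + z) x" by (rule lip_per_dist_per[OF f])
      also have "\<dots> \<le> L * (e + (1 - cos (2 * pi * z)) * C)"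
        using dist_per_le_cos[OF e z, of x] L by (intro mult_left_mono) (auto simp: C_def)
      finally have "\<bar>f (x + z) - f x\<bar> * k z \<le> L * (e + (1 - cos (2 * pi * z)) * C) * k z"
        using knn by (intro mult_right_mono)
      moreover have "\<bar>f x * k z - f (z + x) * k z\<bar> = \<bar>f (x + z) - f x\<bar> * k z"
        using knn[of z] by (simp add: abs_mult abs_minus_commute add.commute[of z x] flip: left_diff_distrib)
      ultimately show "\<bar>f x * k z - f (z + x) * k z\<bar> \<le> L * e * k z + L * C * ((1 - cos (2 * pi * z)) * k z)"
        by (simp add: algebra_simps)
    qed
    also have "\<dots> = L * e + L * C * (\<integral>z. (1 - cos (2 * pi * z)) * k z \<partial>torus_lebesgue)"
      using kint cint k1 by simp
    finally have "\<bar>f x - g x\<bar> \<le> L * e + L * C * (\<integral>z. (1 - cos (2 * pi * z)) * k z \<partial>torus_lebesgue)" .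
    moreover have "(\<integral>z. (1 - cos (2 * pi * z)) * k z \<partial>torus_lebesgue) \<le> 1 / real n"
    proof -
      have "(\<integral>z. (1 - cos (2 * pi * z)) * (1 + cos (2 * pi * z)) ^ n \<partial>torus_lebesgue) \<le> I / real n"
        unfolding I_def by (rule cos_kernel_moments(2)[OF n(2)])
      then show ?thesis using I by (simp add: k_def divide_le_eq mult.commute)
    qed
    then have "L * C * (\<integral>z. (1 - cos (2 * pi * z)) * k z \<partial>torus_lebesgue) \<le> L * C * (1 / real n)"
      using L C by (intro mult_left_mono) auto
    ultimately show ?thesis
      using Le LC unfolding times_divide_eq_right mult_1_right by linarith
  qed
  show ?thesis
    using g' approx DERIV_bound_of_lipschitz[OF lip trig_poly_DERIV[OF g']] by blast
qed

lemma trig_poly_properties: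
  "trig_poly f f' \<Longrightarrow> f \<in> borel_measurable borel \<and> f' \<in> borel_measurable borel \<and>
    (\<exists>c. \<forall>x. \<bar>f x\<bar> \<le> c) \<and> (\<exists>c. \<forall>x. \<bar>f' x\<bar> \<le> c)"
proof (induction rule: trig_poly.induct)
  case (cos k)
  have "(\<lambda>x. cos (2 * pi * real k * x)) \<in> borel_measurable borel"
    "(\<lambda>x. - (2 * pi * real k * sin (2 * pi * real k * x))) \<in> borel_measurable borel"
    by (intro borel_measurable_continuous_onI continuous_intros)+
  moreover have "\<bar>cos (2 * pi * real k * x)\<bar> \<le> 1" for x by (rule abs_cos_le_one)
  moreover have "\<bar>- (2 * pi * real k * sin (2 * pi * real k * x))\<bar> \<le> \<bar>2 * pi * real k\<bar> * 1" for x
    unfolding abs_minus_cancel abs_mult[of "2 * pi * real k" "sin (2 * pi * real k * x)"]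
    by (rule mult_left_mono[OF abs_sin_le_one abs_ge_zero])
  ultimately show ?case by blast
next
  case (sin k)
  have "(\<lambda>x. sin (2 * pi * real k * x)) \<in> borel_measurable borel"
    "(\<lambda>x. 2 * pi * real k * cos (2 * pi * real k * x)) \<in> borel_measurable borel"
    by (intro borel_measurable_continuous_onI continuous_intros)+
  moreover have "\<bar>sin (2 * pi * real k * x)\<bar> \<le> 1" for x by (rule abs_sin_le_one)
  moreover have "\<bar>2 * pi * real k * cos (2 * pi * real k * x)\<bar> \<le> \<bar>2 * pi * real k\<bar> * 1" for x
    unfolding abs_mult[of "2 * pi * real k" "cos (2 * pi * real k * x)"]
    by (rule mult_left_mono[OF abs_cos_le_one abs_ge_zero])
  ultimately show ?case by blast
next
  case (add f f' g g')
  then obtain a b c d where ab: "\<And>x. \<bar>f x\<bar> \<le> a" "\<And>x. \<bar>f' x\<bar> \<le> b" "\<And>x. \<bar>g x\<bar> \<le> c" "\<And>x. \<bar>g' x\<bar> \<le> d"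
    by blast
  have 1: "\<bar>f x + g x\<bar> \<le> a + c" for x
    by (rule order_trans[OF abs_triangle_ineq add_mono[OF ab(1) ab(3)]])
  have 2: "\<bar>f' x + g' x\<bar> \<le> b + d" for x
    by (rule order_trans[OF abs_triangle_ineq add_mono[OF ab(2) ab(4)]])
  show ?case
  proof (intro conjI)
    show "(\<lambda>x. f x + g x) \<in> borel_measurable borel"
      by (rule borel_measurable_add) (use add.IH in blast)+
    show "(\<lambda>x. f' x + g' x) \<in> borel_measurable borel"
      by (rule borel_measurable_add) (use add.IH in blast)+
    show "\<exists>c. \<forall>x. \<bar>f x + g x\<bar> \<le> c" "\<exists>c. \<forall>x. \<bar>f' x + g' x\<bar> \<le> c"
      using 1 2 by blast+
  qed
next
  case (cmult f f' r)
  then obtain a b where "\<And>x. \<bar>f x\<bar> \<le> a" "\<And>x. \<bar>f' x\<bar> \<le> b" by blast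
  then have 1: "\<bar>r * f x\<bar> \<le> \<bar>r\<bar> * a" "\<bar>r * f' x\<bar> \<le> \<bar>r\<bar> * b" for x
    by (simp_all add: abs_mult mult_left_mono)
  show ?case
  proof (intro conjI)
    show "(\<lambda>x. r * f x) \<in> borel_measurable borel"
      by (rule borel_measurable_times[OF borel_measurable_const]) (use cmult.IH in blast)
    show "(\<lambda>x. r * f' x) \<in> borel_measurable borel"
      by (rule borel_measurable_times[OF borel_measurable_const]) (use cmult.IH in blast)
    show "\<exists>c. \<forall>x. \<bar>r * f x\<bar> \<le> c" "\<exists>c. \<forall>x. \<bar>r * f' x\<bar> \<le> c"
      using 1 by blast+
  qed
qed

subsection \<open>Kernels and disintegrations\<close>

abbreviation time_space :: "real \<Rightarrow> real measure" where
  "time_space T \<equiv> restrict_space lborel {-T<..<T}"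

lemma space_time_space [simp]: "space (time_space T) = {-T<..<T}"
  by (simp add: space_restrict_space)

lemma space_cylinder [simp]: "space (cylinder T) = {-T<..<T} \<times> {0..<1}"
  by (simp add: cylinder_def space_restrict_space)

lemma measurable_time_space_id: "(\<lambda>x. x) \<in> measurable (time_space T) borel"
  by (intro measurable_restrict_space1) simp

lemma measurable_time_borel: "f \<in> measurable borel N \<Longrightarrow> f \<in> measurable (time_space T) N"
  by (intro measurable_restrict_space1) simp

lemma measurable_cylinder_borel: "f \<in> measurable borel N \<Longrightarrow> f \<in> measurable (cylinder T) N"
  unfolding cylinder_def by (intro measurable_restrict_space1)

lemma sets_cylinder: "sets (cylinder T) = sets (time_space T \<Otimes>\<^sub>M torus)"
proof (intro equalityI subsetI)
  fix A assume "A \<in> sets (cylinder T)"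
  then obtain B where B: "B \<in> sets borel" "A = ({-T<..<T} \<times> {0..<1}) \<inter> B"
    by (auto simp: cylinder_def sets_restrict_space)
  have "(\<lambda>p. (fst p, snd p)) \<in> measurable (time_space T \<Otimes>\<^sub>M torus) (borel \<Otimes>\<^sub>M borel)"
    by (intro measurable_Pair measurable_compose[OF measurable_fst measurable_time_space_id]
        measurable_compose[OF measurable_snd measurable_torus_id])
  then have "(\<lambda>p. p) \<in> measurable (time_space T \<Otimes>\<^sub>M torus) (borel :: (real \<times> real) measure)"
    by (simp add: borel_prod)
  from measurable_sets[OF this B(1)] show "A \<in> sets (time_space T \<Otimes>\<^sub>M torus)"
    by (simp add: B(2) space_pair_measure Int_commute)
next
  fix A assume A: "A \<in> sets (time_space T \<Otimes>\<^sub>M torus)"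
  have f: "fst \<in> measurable (cylinder T) (time_space T)"
  proof (rule measurable_restrict_space2)
    show "fst \<in> measurable (cylinder T) lborel"
      using measurable_cylinder_borel[OF borel_measurable_continuous_onI[OF continuous_on_fst[OF continuous_on_id]]]
      by simp
  qed auto
  have s: "snd \<in> measurable (cylinder T) torus"
    unfolding torus_def
  proof (rule measurable_restrict_space2)
    show "snd \<in> measurable (cylinder T) borel"
      by (intro measurable_cylinder_borel borel_measurable_continuous_onI continuous_intros)
  qed auto
  have "(\<lambda>p. (fst p, snd p)) \<in> measurable (cylinder T) (time_space T \<Otimes>\<^sub>M torus)"
    by (rule measurable_Pair[OF f s])
  from measurable_sets[OF this A] show "A \<in> sets (cylinder T)"
    using sets.sets_into_space[OF A] by (simp add: space_pair_measure Int_absorb2)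
qed

lemma measurable_cylinder: "measurable (cylinder T) N = measurable (time_space T \<Otimes>\<^sub>M torus) N"
  by (rule measurable_cong_sets[OF sets_cylinder refl])

lemma measurable_Pair_cylinder:
  "(\<lambda>(t, x). (t, x)) \<in> measurable (time_space T \<Otimes>\<^sub>M torus) (cylinder T)"
  unfolding case_prod_Pair id_def by (rule measurable_ident_sets[OF sets_cylinder[symmetric]])

definition torus_kernel :: "real \<Rightarrow> (real \<Rightarrow> real measure) \<Rightarrow> bool" where
  "torus_kernel T \<kappa> \<longleftrightarrow> \<kappa> \<in> measurable (time_space T) (prob_algebra torus)"

lemma torus_kernel_prob: "torus_kernel T \<kappa> \<Longrightarrow> t \<in> {-T<..<T} \<Longrightarrow> torus_prob (\<kappa> t)"
  using measurable_space[of \<kappa> "time_space T" "prob_algebra torus" t]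
  by (simp add: torus_kernel_def torus_prob_def space_prob_algebra)

lemma torus_kernelI:
  assumes "\<And>t. t \<in> {-T<..<T} \<Longrightarrow> torus_prob (\<kappa> t)"
    and "\<And>A. A \<in> sets torus \<Longrightarrow> (\<lambda>t. emeasure (\<kappa> t) A) \<in> borel_measurable (restrict_space borel {-T<..<T})"
  shows "torus_kernel T \<kappa>"
  unfolding torus_kernel_def
proof (rule measurable_prob_algebraI)
  show "prob_space (\<kappa> t)" if "t \<in> space (time_space T)" for t
    using assms(1)[of t] that by (simp add: torus_prob_def)
  have m: "measurable (time_space T) N = measurable (restrict_space borel {-T<..<T}) N" for N :: "ennreal measure"
    by (rule measurable_cong_sets[OF restrict_space_sets_cong[OF refl sets_lborel] refl])
  show "\<kappa> \<in> measurable (time_space T) (subprob_algebra torus)"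
    using assms by (intro measurable_subprob_algebra) (auto simp: torus_prob_def m prob_space_imp_subprob_space)
qed

lemma torus_kernel_subprob: "torus_kernel T \<kappa> \<Longrightarrow> \<kappa> \<in> measurable (time_space T) (subprob_algebra torus)"
  unfolding torus_kernel_def by (rule measurable_prob_algebraD)

lemma measurable_kernel_Pair:
  assumes "torus_kernel T \<kappa>"
  shows "(\<lambda>t. distr (\<kappa> t) (cylinder T) (Pair t)) \<in> measurable (time_space T) (subprob_algebra (cylinder T))"
  using measurable_distr2[OF measurable_Pair_cylinder torus_kernel_subprob[OF assms]] by simp

text \<open>Lebesgue time combined with the slices \<kappa>, written as a monadic bind so that
  measurability and iterated integrals come from the rules for bind.\<close>

definition of_kernel :: "real \<Rightarrow> (real \<Rightarrow> real measure) \<Rightarrow> (real \<times> real) measure" where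
  "of_kernel T \<kappa> = time_space T \<bind> (\<lambda>t. distr (\<kappa> t) (cylinder T) (Pair t))"

lemma measurable_Pair_kernel:
  assumes "torus_kernel T \<kappa>" "t \<in> {-T<..<T}"
  shows "Pair t \<in> measurable (\<kappa> t) (cylinder T)"
proof -
  have "Pair t \<in> measurable torus (time_space T \<Otimes>\<^sub>M torus)"
    using assms(2) by (intro measurable_Pair1') simp
  then have "Pair t \<in> measurable torus (cylinder T)"
    using measurable_cong_sets[OF refl sets_cylinder] by blast
  then show ?thesis by (rule torus_prob_measurable[OF torus_kernel_prob[OF assms]])
qed

context
  fixes T :: real and \<kappa> :: "real \<Rightarrow> real measure"
  assumes T: "T > 0" and \<kappa>: "torus_kernel T \<kappa>"
begin

lemma time_space_nonempty: "space (time_space T) \<noteq> {}"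
  using T by simp

lemma sets_of_kernel: "sets (of_kernel T \<kappa>) = sets (cylinder T)"
  unfolding of_kernel_def
  by (rule sets_bind[OF _ time_space_nonempty]) simp

lemma emeasure_of_kernel:
  assumes A: "A \<in> sets (cylinder T)"
  shows "emeasure (of_kernel T \<kappa>) A = (\<integral>\<^sup>+t\<in>{-T<..<T}. emeasure (\<kappa> t) {x. (t, x) \<in> A} \<partial>lborel)"
proof -
  have "emeasure (of_kernel T \<kappa>) A = (\<integral>\<^sup>+t. emeasure (distr (\<kappa> t) (cylinder T) (Pair t)) A \<partial>time_space T)"
    unfolding of_kernel_def by (rule emeasure_bind[OF time_space_nonempty measurable_kernel_Pair[OF \<kappa>] A])
  also have "\<dots> = (\<integral>\<^sup>+t. emeasure (\<kappa> t) {x. (t, x) \<in> A} \<partial>time_space T)"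
  proof (rule nn_integral_cong)
    fix t assume "t \<in> space (time_space T)"
    then have t: "t \<in> {-T<..<T}" by simp
    have "Pair t -` A \<inter> space (\<kappa> t) = {x. (t, x) \<in> A}"
      using sets.sets_into_space[OF A] torus_probD(2)[OF torus_kernel_prob[OF \<kappa> t]] by auto
    then show "emeasure (distr (\<kappa> t) (cylinder T) (Pair t)) A = emeasure (\<kappa> t) {x. (t, x) \<in> A}"
      using emeasure_distr[OF measurable_Pair_kernel[OF \<kappa> t] A] by simp
  qed
  also have "\<dots> = (\<integral>\<^sup>+t\<in>{-T<..<T}. emeasure (\<kappa> t) {x. (t, x) \<in> A} \<partial>lborel)"
    by (rule nn_integral_restrict_space) simp
  finally show ?thesis .
qed

lemma disintegration_of_kernel: "disintegration T (of_kernel T \<kappa>) \<kappa>"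
  unfolding disintegration_def
proof (intro conjI ballI)
  fix t assume "t \<in> {-T<..<T}"
  then show "sets (\<kappa> t) = sets torus" "finite_measure (\<kappa> t)"
    using torus_probD[OF torus_kernel_prob[OF \<kappa>]] by auto
next
  fix A assume "A \<in> sets torus"
  then have "(\<lambda>t. emeasure (\<kappa> t) A) \<in> borel_measurable (time_space T)"
    by (rule measurable_emeasure_kernel[OF torus_kernel_subprob[OF \<kappa>]])
  then show "(\<lambda>t. emeasure (\<kappa> t) A) \<in> borel_measurable (restrict_space borel {-T<..<T})"
    using measurable_cong_sets[OF restrict_space_sets_cong[OF refl sets_lborel] refl] by blast
qed (rule emeasure_of_kernel)

lemma disintegration_imp_of_kernel:
  assumes "sets \<mu> = sets (cylinder T)" "disintegration T \<mu> \<kappa>"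
  shows "\<mu> = of_kernel T \<kappa>"
  by (rule measure_eqI) (use assms in \<open>auto simp: sets_of_kernel emeasure_of_kernel disintegration_def\<close>)

lemma nn_integral_of_kernel:
  assumes f: "f \<in> borel_measurable (cylinder T)"
  shows "(\<integral>\<^sup>+p. f p \<partial>of_kernel T \<kappa>) = (\<integral>\<^sup>+t. (\<integral>\<^sup>+x. f (t, x) \<partial>\<kappa> t) \<partial>time_space T)"
proof -
  have "(\<integral>\<^sup>+p. f p \<partial>of_kernel T \<kappa>) = (\<integral>\<^sup>+t. (\<integral>\<^sup>+p. f p \<partial>distr (\<kappa> t) (cylinder T) (Pair t)) \<partial>time_space T)"
    unfolding of_kernel_def by (rule nn_integral_bind[OF f measurable_kernel_Pair[OF \<kappa>]])
  also have "\<dots> = (\<integral>\<^sup>+t. (\<integral>\<^sup>+x. f (t, x) \<partial>\<kappa> t) \<partial>time_space T)"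
    by (intro nn_integral_cong nn_integral_distr[OF measurable_Pair_kernel[OF \<kappa>]]) (simp_all add: f)
  finally show ?thesis .
qed

lemma finite_measure_time_space: "finite_measure (time_space T)"
  using T by (intro finite_measureI) (simp add: emeasure_restrict_space)

lemma integral_of_kernel:
  fixes f :: "real \<times> real \<Rightarrow> real"
  assumes f: "f \<in> borel_measurable (cylinder T)" and b: "\<And>p. p \<in> space (cylinder T) \<Longrightarrow> \<bar>f p\<bar> \<le> C"
  shows "(\<integral>p. f p \<partial>of_kernel T \<kappa>) = (\<integral>t. (\<integral>x. f (t, x) \<partial>\<kappa> t) \<partial>time_space T)"
proof -
  have "(\<integral>p. f p \<partial>of_kernel T \<kappa>) = (\<integral>t. (\<integral>p. f p \<partial>distr (\<kappa> t) (cylinder T) (Pair t)) \<partial>time_space T)"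
    unfolding of_kernel_def
  proof (rule integral_bind[OF f _ measurable_kernel_Pair[OF \<kappa>] finite_measure_time_space])
    show "\<bar>f x\<bar> \<le> C" if "x \<in> space (cylinder T)" for x using b[OF that] .
    show "AE t in time_space T. emeasure (distr (\<kappa> t) (cylinder T) (Pair t)) (space (distr (\<kappa> t) (cylinder T) (Pair t))) \<le> ennreal 1"
    proof (rule AE_I2)
      fix t assume "t \<in> space (time_space T)"
      then have "subprob_space (distr (\<kappa> t) (cylinder T) (Pair t))"
        by (rule subprob_space_kernel[OF measurable_kernel_Pair[OF \<kappa>]])
      then show "emeasure (distr (\<kappa> t) (cylinder T) (Pair t)) (space (distr (\<kappa> t) (cylinder T) (Pair t))) \<le> ennreal 1"
        unfolding ennreal_1 by (rule subprob_space.emeasure_space_le_1)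
    qed
  qed
  also have "\<dots> = (\<integral>t. (\<integral>x. f (t, x) \<partial>\<kappa> t) \<partial>time_space T)"
    by (intro Bochner_Integration.integral_cong refl integral_distr[OF measurable_Pair_kernel[OF \<kappa>] f]) simp
  finally show ?thesis .
qed

lemma finite_measure_of_kernel: "finite_measure (of_kernel T \<kappa>)"
proof (rule finite_measureI)
  have "emeasure (of_kernel T \<kappa>) (space (of_kernel T \<kappa>)) = (\<integral>\<^sup>+p. 1 \<partial>of_kernel T \<kappa>)" by simp
  also have "\<dots> = (\<integral>\<^sup>+t. (\<integral>\<^sup>+x. 1 \<partial>\<kappa> t) \<partial>time_space T)"
    by (rule nn_integral_of_kernel) simp
  also have "\<dots> = (\<integral>\<^sup>+t. 1 \<partial>time_space T)"
  proof (rule nn_integral_cong)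
    fix t assume "t \<in> space (time_space T)"
    then have "prob_space (\<kappa> t)" using torus_probD[OF torus_kernel_prob[OF \<kappa>]] by simp
    then show "(\<integral>\<^sup>+x. 1 \<partial>\<kappa> t) = 1" by (simp add: prob_space.emeasure_space_1)
  qed
  also have "\<dots> < \<infinity>"
    using T by (simp add: emeasure_restrict_space)
  finally show "emeasure (of_kernel T \<kappa>) (space (of_kernel T \<kappa>)) \<noteq> \<infinity>" by simp
qed

end

section \<open>Uniqueness of disintegrations\<close>

lemma sets_torus_generated_rat:
  "sets torus = sigma_sets {0..<1} ((\<lambda>q. {0..<1} \<inter> {q<..}) ` \<rat>)"
proof -
  let ?G = "(\<lambda>q::real. {0..<1} \<inter> {q<..}) ` \<rat>"
  have "{0..<1} \<inter> {a<..} \<in> sigma_sets {0..<1} ?G" for a :: real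
  proof -
    have "{0..<1} \<inter> {a<..} = (\<Union>q\<in>{q\<in>\<rat>. a < q}. {0..<1} \<inter> {q<..})"
    proof (intro equalityI subsetI)
      fix x assume x: "x \<in> {0..<1} \<inter> {a<..}"
      then obtain q where "q \<in> \<rat>" "a < q" "q < x" using Rats_dense_in_real[of a x] by auto
      then show "x \<in> (\<Union>q\<in>{q\<in>\<rat>. a < q}. {0..<1} \<inter> {q<..})" using x by blast
    qed auto
    moreover have "countable {q\<in>\<rat>. a < (q::real)}"
      by (rule countable_subset[OF _ countable_rat]) auto
    moreover have "(\<Union>q\<in>{q\<in>\<rat>. a < q}. {0..<1} \<inter> {q<..}) \<in> sigma_sets {0..<1} ?G"
      using calculation(2) by (intro sigma_sets_UNION) (auto intro!: sigma_sets.Basic)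
    ultimately show ?thesis by (simp only:)
  qed
  then have "sigma_sets {0..<1} (range (\<lambda>a::real. {0..<1} \<inter> {a<..})) = sigma_sets {0..<1} ?G"
    by (intro sigma_sets_eqI) auto
  then show ?thesis by (simp add: sets_torus_generated)
qed

lemma torus_measure_eqI_rat:
  assumes \<rho>: "sets \<rho> = sets torus" "finite_measure \<rho>" and \<nu>: "sets \<nu> = sets torus"
    and eq: "\<And>q. q \<in> \<rat> \<Longrightarrow> emeasure \<rho> ({0..<1} \<inter> {q<..}) = emeasure \<nu> ({0..<1} \<inter> {q<..})"
  shows "\<rho> = \<nu>"
proof (rule measure_eqI_generator_eq)
  let ?G = "(\<lambda>q::real. {0..<1} \<inter> {q<..}) ` \<rat>"
  show "Int_stable ?G"
  proof (rule Int_stableI_image)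
    fix a b :: real assume "a \<in> \<rat>" "b \<in> \<rat>"
    then show "\<exists>k\<in>\<rat>. {0..<1} \<inter> {a<..} \<inter> ({0..<1} \<inter> {b<..}) = {0..<1} \<inter> {k<..}"
      by (intro bexI[of _ "max a b"]) (auto simp: max_def)
  qed
  show "?G \<subseteq> Pow {0..<1}" by auto
  show "sets \<rho> = sigma_sets {0..<1} ?G" "sets \<nu> = sigma_sets {0..<1} ?G"
    using \<rho> \<nu> sets_torus_generated_rat by auto
  show "emeasure \<rho> X = emeasure \<nu> X" if "X \<in> ?G" for X
    using that eq by auto
  show "range (\<lambda>_::nat. {0..<1} \<inter> {-1<..}) \<subseteq> ?G" by auto
  show "(\<Union>i::nat. {0..<1::real} \<inter> {-1<..}) = {0..<1}" by auto
  show "emeasure \<rho> ({0..<1} \<inter> {-1<..}) \<noteq> \<infinity>" using \<rho> finite_measure.emeasure_finite by auto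
qed

text \<open>For each fixed set the masses of the two slices are densities in time of the same
  measure, so they agree almost everywhere. The exceptional times depend on the set; hence the
  countable generator with rational endpoints, which determines the slices.\<close>

lemma disintegration_unique:
  assumes fin: "finite_measure \<mu>" and \<kappa>: "disintegration T \<mu> \<kappa>" and \<kappa>': "disintegration T \<mu> \<kappa>'"
  shows "AE t\<in>{-T<..<T} in lborel. \<kappa> t = \<kappa>' t"
proof -
  let ?L = "time_space T"
  have m: "(\<lambda>t. emeasure (\<sigma> t) A) \<in> borel_measurable ?L"
    if "disintegration T \<mu> \<sigma>" "A \<in> sets torus" for \<sigma> A
  proof -
    have "(\<lambda>t. emeasure (\<sigma> t) A) \<in> borel_measurable (restrict_space borel {-T<..<T})"
      using that by (simp add: disintegration_def)
    then show ?thesis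
      using measurable_cong_sets[OF restrict_space_sets_cong[OF refl sets_lborel] refl] by blast
  qed
  have e: "emeasure (density ?L (\<lambda>t. emeasure (\<sigma> t) A)) B = emeasure \<mu> (B \<times> A)"
    if \<sigma>: "disintegration T \<mu> \<sigma>" and A: "A \<in> sets torus" and B: "B \<in> sets ?L" for \<sigma> A B
  proof -
    have BA: "B \<times> A \<in> sets (cylinder T)" unfolding sets_cylinder using A B by auto
    have Bsub: "B \<subseteq> {-T<..<T}" using sets.sets_into_space[OF B] by simp
    have "emeasure (density ?L (\<lambda>t. emeasure (\<sigma> t) A)) B = (\<integral>\<^sup>+t. emeasure (\<sigma> t) A * indicator B t \<partial>?L)"
      by (rule emeasure_density[OF m[OF \<sigma> A] B])
    also have "\<dots> = (\<integral>\<^sup>+t. emeasure (\<sigma> t) A * indicator B t * indicator {-T<..<T} t \<partial>lborel)"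
      by (rule nn_integral_restrict_space) simp
    also have "\<dots> = (\<integral>\<^sup>+t\<in>{-T<..<T}. emeasure (\<sigma> t) {x. (t, x) \<in> B \<times> A} \<partial>lborel)"
      by (intro nn_integral_cong) (auto split: split_indicator)
    also have "\<dots> = emeasure \<mu> (B \<times> A)"
      using \<sigma> BA by (simp add: disintegration_def)
    finally show ?thesis .
  qed
  have A: "AE t in ?L. emeasure (\<kappa> t) A = emeasure (\<kappa>' t) A" if A: "A \<in> sets torus" for A
  proof (rule finite_density_unique[THEN iffD1])
    show "density ?L (\<lambda>t. emeasure (\<kappa> t) A) = density ?L (\<lambda>t. emeasure (\<kappa>' t) A)"
      by (rule measure_eqI) (simp_all add: e \<kappa> \<kappa>' A)
    have "(\<integral>\<^sup>+t. emeasure (\<kappa> t) A \<partial>?L) = emeasure (density ?L (\<lambda>t. emeasure (\<kappa> t) A)) (space ?L)"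
      by (subst emeasure_density[OF m[OF \<kappa> A] sets.top]) (auto intro!: nn_integral_cong)
    also have "\<dots> = emeasure \<mu> (space ?L \<times> A)"
      by (rule e[OF \<kappa> A sets.top])
    finally show "(\<integral>\<^sup>+t. emeasure (\<kappa> t) A \<partial>?L) \<noteq> \<infinity>"
      using finite_measure.emeasure_finite[OF fin] by simp
  qed (auto intro: m \<kappa> \<kappa>' A)
  have "AE t in ?L. \<forall>q\<in>\<rat>. emeasure (\<kappa> t) ({0..<1} \<inter> {q<..}) = emeasure (\<kappa>' t) ({0..<1} \<inter> {q<..})"
    by (subst AE_ball_countable[OF countable_rat]) (auto intro!: A simp: sets_torus)
  then have "AE t in ?L. \<kappa> t = \<kappa>' t"
  proof (rule AE_mp, intro AE_I2 impI)
    fix t assume t: "t \<in> space ?L"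
      and eq: "\<forall>q\<in>\<rat>. emeasure (\<kappa> t) ({0..<1} \<inter> {q<..}) = emeasure (\<kappa>' t) ({0..<1} \<inter> {q<..})"
    show "\<kappa> t = \<kappa>' t"
      using t \<kappa> \<kappa>' eq by (intro torus_measure_eqI_rat) (auto simp: disintegration_def)
  qed
  then show ?thesis by (simp add: AE_restrict_space_iff)
qed

subsection \<open>The continuity equation tested with product functions\<close>

text \<open>Differentiation shifts the phase by \<open>pi / 2\<close>, so one formula covers all
  derivatives of sines and cosines.\<close>

lemma deriv_chain_cos:
  "deriv_chain (\<lambda>j x. w ^ j * cos (w * x + (\<phi> + real j * (pi / 2))))"
  unfolding deriv_chain_def
proof (intro allI)
  fix j t
  have "((\<lambda>x. w ^ j * cos (w * x + (\<phi> + real j * (pi / 2)))) has_real_derivative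
      w ^ j * (- sin (w * t + (\<phi> + real j * (pi / 2))) * w)) (at t)"
    by (auto intro!: derivative_eq_intros)
  moreover have "- sin (w * t + (\<phi> + real j * (pi / 2))) = cos (w * t + (\<phi> + real (Suc j) * (pi / 2)))"
  proof -
    have "w * t + (\<phi> + real (Suc j) * (pi / 2)) = (w * t + (\<phi> + real j * (pi / 2))) + pi / 2"
      by (simp add: field_simps)
    then show ?thesis by (simp only: cos_add[of "w * t + (\<phi> + real j * (pi / 2))" "pi / 2"]
          cos_pi_half sin_pi_half mult_zero_right mult_1_right diff_0)
  qed
  ultimately show "((\<lambda>x. w ^ j * cos (w * x + (\<phi> + real j * (pi / 2)))) has_real_derivative
      w ^ Suc j * cos (w * t + (\<phi> + real (Suc j) * (pi / 2)))) (at t)"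
    by (simp only: power_Suc mult_ac)
qed

lemma test_function_product:
  assumes E: "deriv_chain E" and C: "deriv_chain C" and per: "\<And>x. C 0 (x + 1) = C 0 x"
    and a: "a < T" "\<And>t. \<bar>t\<bar> > a \<Longrightarrow> E 0 t = 0"
  shows "test_function T (\<lambda>(t, x). E 0 t * C 0 x)"
  unfolding test_function_def smooth_function_def
proof (intro conjI exI[of _ "\<lambda>i j (t, x). E i t * C j x"] exI[of _ a] allI)
  fix i j and p :: "real \<times> real"
  have 1: "((\<lambda>q. E i (fst q)) has_derivative (\<lambda>h. E (Suc i) (fst p) * fst h)) (at p)"
    using E[unfolded deriv_chain_def, rule_format, of i "fst p", unfolded has_field_derivative_def]
    by (rule has_derivative_compose[OF has_derivative_fst[OF has_derivative_ident]])
  have 2: "((\<lambda>q. C j (snd q)) has_derivative (\<lambda>h. C (Suc j) (snd p) * snd h)) (at p)"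
    using C[unfolded deriv_chain_def, rule_format, of j "snd p", unfolded has_field_derivative_def]
    by (rule has_derivative_compose[OF has_derivative_snd[OF has_derivative_ident]])
  have "((\<lambda>q. E i (fst q) * C j (snd q)) has_derivative
      (\<lambda>h. E i (fst p) * (C (Suc j) (snd p) * snd h) + E (Suc i) (fst p) * fst h * C j (snd p))) (at p)"
    by (rule has_derivative_mult[OF 1 2])
  moreover have "(\<lambda>h. E i (fst p) * (C (Suc j) (snd p) * snd h) + E (Suc i) (fst p) * fst h * C j (snd p)) =
      (\<lambda>(h, k). (case p of (t, x) \<Rightarrow> E (Suc i) t * C j x) * h + (case p of (t, x) \<Rightarrow> E i t * C (Suc j) x) * k)"
    by (auto simp: fun_eq_iff split_beta)
  ultimately show "((case_prod (\<lambda>t x. E i t * C j x)) has_derivative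
      (\<lambda>(h, k). (case p of (t, x) \<Rightarrow> E (Suc i) t * C j x) * h + (case p of (t, x) \<Rightarrow> E i t * C (Suc j) x) * k)) (at p)"
    by (simp add: case_prod_unfold)
qed (use per a in auto)

section \<open>Evolution of the slices under a flux\<close>

locale flux_kernel =
  fixes T :: real and \<kappa> :: "real \<Rightarrow> real measure" and m :: "(real \<times> real) set \<Rightarrow> real"
  assumes T: "T > 0" and \<kappa>: "torus_kernel T \<kappa>" and m: "flux T (of_kernel T \<kappa>) m"
begin

abbreviation "\<mu> \<equiv> of_kernel T \<kappa>"

text \<open>The velocity field: the flux has density \<open>v\<close> with respect to the measure
  that it moves.\<close>

definition "v = signed_RN_deriv \<mu> m"

lemma sets_\<mu>: "sets \<mu> = sets (cylinder T)"
  by (rule sets_of_kernel[OF T \<kappa>])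

lemma space_\<mu>: "space \<mu> = {-T<..<T} \<times> {0..<1}"
  using sets_eq_imp_space_eq[OF sets_\<mu>] by simp

lemma borel_\<mu>: "f \<in> measurable borel N \<Longrightarrow> f \<in> measurable \<mu> N"
  using measurable_cylinder_borel measurable_cong_sets[OF sets_\<mu> refl] by blast

sublocale M: finite_measure \<mu>
  by (rule finite_measure_of_kernel[OF T \<kappa>])

lemma v: "integrable \<mu> v" "\<And>A. A \<in> sets \<mu> \<Longrightarrow> m A = (\<integral>x\<in>A. v x \<partial>\<mu>)"
  using signed_RN_deriv[OF M.finite_measure_axioms] m unfolding flux_def v_def by auto

lemma fst_snd_\<mu> [measurable]: "fst \<in> borel_measurable \<mu>" "snd \<in> borel_measurable \<mu>"
  by (intro borel_\<mu> borel_measurable_continuous_onI continuous_intros)+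

lemma flux_product:
  assumes E: "deriv_chain E" and C: "deriv_chain C" and per: "\<And>x. C 0 (x + 1) = C 0 x"
    and a: "a < T" "\<And>t. \<bar>t\<bar> > a \<Longrightarrow> E 0 t = 0" and c: "\<And>x. \<bar>C 1 x\<bar> \<le> c"
  shows "(\<integral>p. E 1 (fst p) * C 0 (snd p) \<partial>\<mu>) + (\<integral>p. E 0 (fst p) * C 1 (snd p) * v p \<partial>\<mu>) = 0"
proof -
  have D1: "deriv (\<lambda>s. E 0 s * C 0 x) t = E 1 t * C 0 x" for t x
    using E[unfolded deriv_chain_def, rule_format, of 0 t]
    by (intro DERIV_imp_deriv DERIV_cmult_right) simp
  have D2: "deriv (\<lambda>y. E 0 t * C 0 y) x = E 0 t * C 1 x" for t x
    using C[unfolded deriv_chain_def, rule_format, of 0 x]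
    by (intro DERIV_imp_deriv DERIV_cmult) simp
  have "compact (E 0 ` {-T..T})"
    by (intro compact_continuous_image deriv_chain_continuous[OF E]) simp
  then obtain B where B: "\<And>t. t \<in> {-T..T} \<Longrightarrow> \<bar>E 0 t\<bar> \<le> B"
    by (metis (no_types, lifting) compact_imp_bounded bounded_iff image_eqI real_norm_def)
  have [measurable]: "E 0 \<in> borel_measurable borel" "C 1 \<in> borel_measurable borel"
    by (intro borel_measurable_continuous_onI deriv_chain_continuous E C)+
  have b: "\<bar>E 0 (fst p) * C 1 (snd p)\<bar> \<le> B * c" if "p \<in> space \<mu>" for p
  proof -
    have "fst p \<in> {-T..T}" using that unfolding space_\<mu> by auto
    then show ?thesis unfolding abs_mult
      using B[of "fst p"] by (intro mult_mono c) auto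
  qed
  have "(\<integral>(t, x). deriv (\<lambda>s. (\<lambda>(t, x). E 0 t * C 0 x) (s, x)) t \<partial>\<mu>) +
      signed_integral \<mu> m (\<lambda>(t, x). deriv (\<lambda>y. (\<lambda>(t, x). E 0 t * C 0 x) (t, y)) x) = 0"
    using m test_function_product[OF E C per a] unfolding flux_def by blast
  then have "(\<integral>(t, x). E 1 t * C 0 x \<partial>\<mu>) + signed_integral \<mu> m (\<lambda>(t, x). E 0 t * C 1 x) = 0"
    unfolding prod.case D1 D2 .
  moreover have "(\<lambda>(t, x). E 0 t * C 1 x) = (\<lambda>p. E 0 (fst p) * C 1 (snd p))"
    "(\<lambda>(t, x). E 1 t * C 0 x) = (\<lambda>p. E 1 (fst p) * C 0 (snd p))"
    by auto
  moreover have "signed_integral \<mu> m (\<lambda>p. E 0 (fst p) * C 1 (snd p)) = (\<integral>p. E 0 (fst p) * C 1 (snd p) * v p \<partial>\<mu>)"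
  proof (rule signed_integral_density(2)[OF v _ b])
    show "(\<lambda>p. E 0 (fst p) * C 1 (snd p)) \<in> borel_measurable \<mu>"
      by (intro borel_measurable_times measurable_compose[OF fst_snd_\<mu>(1)] measurable_compose[OF fst_snd_\<mu>(2)]
          borel_measurable_continuous_onI deriv_chain_continuous E C)
  qed
  ultimately show ?thesis by simp
qed

lemma integrable_mult_v:
  assumes [measurable]: "g \<in> borel_measurable borel" and g: "\<And>x. \<bar>g x\<bar> \<le> c"
  shows "integrable \<mu> (\<lambda>p. g (snd p) * v p)"
proof (rule Bochner_Integration.integrable_bound)
  show "integrable \<mu> (\<lambda>p. c * v p)" using v(1) by simp
  have [measurable]: "v \<in> borel_measurable \<mu>" using v(1) by blast
  show "(\<lambda>p. g (snd p) * v p) \<in> borel_measurable \<mu>" by measurable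
  have "\<bar>g x\<bar> \<le> \<bar>c\<bar>" for x using g[of x] by linarith
  then show "AE p in \<mu>. norm (g (snd p) * v p) \<le> norm (c * v p)"
    by (auto simp: abs_mult intro!: mult_right_mono)
qed

lemma integrable_indicator_time:
  assumes "integrable \<mu> (f :: real \<times> real \<Rightarrow> real)"
  shows "integrable \<mu> (\<lambda>p. indicator {..<t} (fst p) * f p)"
proof (rule Bochner_Integration.integrable_bound[OF assms])
  have [measurable]: "f \<in> borel_measurable \<mu>" using assms by blast
  show "(\<lambda>p. indicator {..<t} (fst p) * f p) \<in> borel_measurable \<mu>" by measurable
qed (auto split: split_indicator)

text \<open>In the weak sense, the time derivative of the slice integral of \<open>C 0\<close> is
  the slice integral of \<open>C 1\<close> times the velocity, and the integral over all earlier
  times is a primitive of the latter. When the time factor \<open>E 0\<close> is written as an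
  integral of \<open>E 1\<close> and the integrals are exchanged, the equation says that the
  difference is orthogonal to every \<open>E 1\<close>, which is the situation of
  \<open>du_Bois_Reymond\<close>.\<close>

lemma slice_integral_minus_flux_const:
  assumes C: "deriv_chain C" and per: "\<And>x. C 0 (x + 1) = C 0 x"
    and c: "\<And>x. \<bar>C 0 x\<bar> \<le> c" "\<And>x. \<bar>C 1 x\<bar> \<le> c"
  shows "\<exists>d. AE t in lborel. t \<in> {-T<..<T} \<longrightarrow>
    (\<integral>x. C 0 x \<partial>\<kappa> t) - (\<integral>p. indicator {..<t} (fst p) * (C 1 (snd p) * v p) \<partial>\<mu>) = d"
proof -
  let ?L = "time_space T"
  define a where "a t = (\<integral>x. C 0 x \<partial>\<kappa> t)" for t
  define w where "w p = C 1 (snd p) * v p" for p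
  define b where "b t = (\<integral>p. indicator {..<t} (fst p) * w p \<partial>\<mu>)" for t
  interpret L: finite_measure ?L by (rule finite_measure_time_space[OF T \<kappa>])
  interpret P: pair_sigma_finite ?L \<mu> ..
  have Cm [measurable]: "C j \<in> borel_measurable borel" for j
    by (intro borel_measurable_continuous_onI deriv_chain_continuous C)
  have w: "integrable \<mu> w"
    unfolding w_def by (rule integrable_mult_v[OF Cm c(2)])
  have wm [measurable]: "w \<in> borel_measurable \<mu>" using w by blast
  have tm [measurable]: "(\<lambda>q. fst q) \<in> borel_measurable (?L \<Otimes>\<^sub>M \<mu>)"
    by (rule measurable_compose[OF measurable_fst measurable_time_space_id])
  have pair_m: "(\<lambda>q. indicator {..<fst q} (fst (snd q)) * w (snd q)) \<in> borel_measurable (?L \<Otimes>\<^sub>M \<mu>)"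
  proof -
    have "(\<lambda>q. (if fst (snd q) < fst q then 1 else 0) * w (snd q)) \<in> borel_measurable (?L \<Otimes>\<^sub>M \<mu>)"
      by measurable
    moreover have "(\<lambda>q. (if fst (snd q) < fst q then 1 else 0) * w (snd q)) = (\<lambda>q. indicator {..<fst q} (fst (snd q)) * w (snd q))"
      by (auto simp: fun_eq_iff)
    ultimately show ?thesis by simp
  qed
  have am: "a \<in> borel_measurable ?L"
    unfolding a_def
    by (rule measurable_compose[OF torus_kernel_subprob[OF \<kappa>] integral_measurable_subprob_algebra[OF measurable_torus_borel[OF Cm]]])
  have bm: "b \<in> borel_measurable ?L"
    unfolding b_def
    by (rule M.borel_measurable_lebesgue_integral) (use pair_m in \<open>simp add: case_prod_unfold\<close>)
  have ab: "\<bar>a t\<bar> \<le> c" if "t \<in> {-T<..<T}" for t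
  proof -
    interpret K: prob_space "\<kappa> t" using torus_probD[OF torus_kernel_prob[OF \<kappa> that]] by simp
    have i: "integrable (\<kappa> t) (C 0)"
      using c(1) by (intro K.integrable_const_bound[of _ c] torus_prob_measurable[OF torus_kernel_prob[OF \<kappa> that]] measurable_torus_borel Cm) auto
    have "\<bar>a t\<bar> \<le> (\<integral>x. c \<partial>\<kappa> t)"
      unfolding a_def using i c(1) by (intro order_trans[OF integral_abs_bound integral_mono]) auto
    then show ?thesis by (simp add: K.prob_space)
  qed
  have bb: "\<bar>b t\<bar> \<le> (\<integral>p. \<bar>w p\<bar> \<partial>\<mu>)" for t
    unfolding b_def using w integrable_indicator_time[OF w]
    by (intro order_trans[OF integral_abs_bound integral_mono]) (auto split: split_indicator)
  \<comment> \<open>Extended by zero, since \<open>du_Bois_Reymond\<close> expects a bounded Borel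
    function on the whole line.\<close>
  define u where "u t = indicator {-T<..<T} t * (a t - b t)" for t
  have um: "u \<in> borel_measurable borel"
  proof -
    have "(\<lambda>t. a t - b t) \<in> borel_measurable ?L" using am bm by measurable
    then have "(\<lambda>t. indicator {-T<..<T} t *\<^sub>R (a t - b t)) \<in> borel_measurable lborel"
      by (subst (asm) borel_measurable_restrict_space_iff) auto
    then show ?thesis by (simp add: u_def[abs_def])
  qed
  have ub: "\<bar>u t\<bar> \<le> c + (\<integral>p. \<bar>w p\<bar> \<partial>\<mu>)" for t
  proof (cases "t \<in> {-T<..<T}")
    case True
    then show ?thesis using ab[OF True] bb[of t] by (simp add: u_def)
  next
    case False
    have "0 \<le> c" using c(1)[of 0] by linarith
    moreover have "0 \<le> (\<integral>p. \<bar>w p\<bar> \<partial>\<mu>)" by simp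
    ultimately show ?thesis using False by (simp add: u_def)
  qed
  have "\<exists>d. AE t in lborel. t \<in> {-T<..<T} \<longrightarrow> u t = d"
  proof (rule du_Bois_Reymond[OF um ub T])
    fix E r assume E: "deriv_chain E" and r: "r < T" "\<And>t. \<bar>t\<bar> > r \<Longrightarrow> E 0 t = 0"
    have Em [measurable]: "E j \<in> borel_measurable borel" for j
      by (intro borel_measurable_continuous_onI deriv_chain_continuous E)
    have "compact (E 1 ` {-T..T})"
      by (intro compact_continuous_image deriv_chain_continuous[OF E]) simp
    then obtain B where B: "\<And>t. t \<in> {-T..T} \<Longrightarrow> \<bar>E 1 t\<bar> \<le> B"
      by (metis (no_types, lifting) compact_imp_bounded bounded_iff image_eqI real_norm_def)
    have B0: "0 \<le> B" using B[of 0] T by auto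
    have E1b: "\<bar>E 1 t\<bar> \<le> B" if "t \<in> {-T<..<T}" for t using B[of t] that by auto
    have E1i: "integrable ?L (\<lambda>t. E 1 t * g t)" if g: "g \<in> borel_measurable ?L" "\<And>t. t \<in> {-T<..<T} \<Longrightarrow> \<bar>g t\<bar> \<le> K" for g K
    proof (rule L.integrable_const_bound[of _ "B * K"])
      show "AE t in ?L. norm (E 1 t * g t) \<le> B * K"
        using E1b g(2) B0 by (intro AE_I2) (auto simp: abs_mult intro!: mult_mono)
      show "(\<lambda>t. E 1 t * g t) \<in> borel_measurable ?L"
        using g(1) measurable_time_borel[OF Em] by (intro borel_measurable_times)
    qed
    have first: "(\<integral>p. E 1 (fst p) * C 0 (snd p) \<partial>\<mu>) = (\<integral>t. E 1 t * a t \<partial>?L)"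
    proof -
      have m1: "(\<lambda>p. E 1 (fst p) * C 0 (snd p)) \<in> borel_measurable (cylinder T)"
        by (intro measurable_cylinder_borel borel_measurable_continuous_onI continuous_intros
            continuous_on_compose2[OF deriv_chain_continuous[OF E]] continuous_on_compose2[OF deriv_chain_continuous[OF C]]) auto
      have b1: "\<bar>E 1 (fst p) * C 0 (snd p)\<bar> \<le> B * c" if "p \<in> space (cylinder T)" for p
        unfolding abs_mult using that B0 by (intro mult_mono E1b c) auto
      have "(\<integral>p. E 1 (fst p) * C 0 (snd p) \<partial>\<mu>) = (\<integral>t. (\<integral>x. E 1 (fst (t, x)) * C 0 (snd (t, x)) \<partial>\<kappa> t) \<partial>?L)"
        by (rule integral_of_kernel[OF T \<kappa> m1 b1])
      then show ?thesis by (simp add: a_def)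
    qed
    \<comment> \<open>\<open>E 0\<close> vanishes at \<open>T\<close>, so it is recovered from
      \<open>E 1\<close> by integration over the later times.\<close>
    have E0: "E 0 s = - (\<integral>t. E 1 t * indicator {..<t} s \<partial>?L)" if s: "s \<in> {-T<..<T}" for s
    proof -
      have D: "(E 0 has_real_derivative E 1 t) (at t)" for t
        using E[unfolded deriv_chain_def, rule_format, of 0 t] by simp
      have "has_bochner_integral lborel (\<lambda>t. E 1 t * indicator {s..T} t) (E 0 T - E 0 s)"
        using s deriv_chain_continuous[OF E, of UNIV 1]
        by (intro has_bochner_integral_FTC_Icc_real D) (auto simp: continuous_on_eq_continuous_at)
      then have "(\<integral>t. E 1 t * indicator {s..T} t \<partial>lborel) = E 0 T - E 0 s"
        by (simp add: has_bochner_integral_iff)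
      moreover have "E 0 T = 0" using r T by simp
      moreover have "(\<integral>t. E 1 t * indicator {..<t} s \<partial>?L) = (\<integral>t. indicator {-T<..<T} t *\<^sub>R (E 1 t * indicator {..<t} s) \<partial>lborel)"
        by (rule integral_restrict_space) simp
      moreover have "(\<integral>t. indicator {-T<..<T} t *\<^sub>R (E 1 t * indicator {..<t} s) \<partial>lborel) = (\<integral>t. E 1 t * indicator {s..T} t \<partial>lborel)"
      proof (rule integral_cong_AE)
        show "AE t in lborel. indicator {-T<..<T} t *\<^sub>R (E 1 t * indicator {..<t} s) = E 1 t * indicator {s..T} t"
          using AE_lborel_singleton[of T] AE_lborel_singleton[of s]
          by eventually_elim (use s in \<open>auto split: split_indicator\<close>)
        have "(\<lambda>t. E 1 t * indicator {s<..} t) \<in> borel_measurable lborel" by measurable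
        moreover have "(\<lambda>t. E 1 t * indicator {s<..} t) = (\<lambda>t. E 1 t * indicator {..<t} s)"
          by (auto simp: fun_eq_iff split: split_indicator)
        ultimately have "(\<lambda>t. E 1 t * indicator {..<t} s) \<in> borel_measurable lborel" by (simp only:)
        then show "(\<lambda>t. indicator {-T<..<T} t *\<^sub>R (E 1 t * indicator {..<t} s)) \<in> borel_measurable lborel" by measurable
      qed measurable
      ultimately show ?thesis by simp
    qed
    have second: "(\<integral>p. E 0 (fst p) * C 1 (snd p) * v p \<partial>\<mu>) = - (\<integral>t. E 1 t * b t \<partial>?L)"
    proof -
      have pm: "(\<lambda>q. E 1 (fst q) * (indicator {..<fst q} (fst (snd q)) * w (snd q))) \<in> borel_measurable (?L \<Otimes>\<^sub>M \<mu>)"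
        using measurable_compose[OF tm Em] pair_m by (rule borel_measurable_times)
      have int: "integrable (?L \<Otimes>\<^sub>M \<mu>) (\<lambda>(t, p). E 1 t * (indicator {..<t} (fst p) * w p))"
      proof (rule integrableI_bounded)
        show "(\<lambda>(t, p). E 1 t * (indicator {..<t} (fst p) * w p)) \<in> borel_measurable (?L \<Otimes>\<^sub>M \<mu>)"
          using pm by (simp add: case_prod_unfold)
        have "(\<integral>\<^sup>+q. ennreal (norm (case q of (t, p) \<Rightarrow> E 1 t * (indicator {..<t} (fst p) * w p))) \<partial>(?L \<Otimes>\<^sub>M \<mu>)) \<le>
            (\<integral>\<^sup>+q. ennreal (B * \<bar>w (snd q)\<bar>) \<partial>(?L \<Otimes>\<^sub>M \<mu>))"
        proof (rule nn_integral_mono)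
          fix q assume "q \<in> space (?L \<Otimes>\<^sub>M \<mu>)"
          then have "fst q \<in> {-T<..<T}" by (auto simp: space_pair_measure)
          then have "\<bar>E 1 (fst q)\<bar> * \<bar>indicator {..<fst q} (fst (snd q)) * w (snd q)\<bar> \<le> B * \<bar>w (snd q)\<bar>"
            using B0 by (intro mult_mono E1b) (auto split: split_indicator)
          then show "ennreal (norm (case q of (t, p) \<Rightarrow> E 1 t * (indicator {..<t} (fst p) * w p))) \<le> ennreal (B * \<bar>w (snd q)\<bar>)"
            by (intro ennreal_leI) (simp add: case_prod_unfold abs_mult)
        qed
        also have "\<dots> = (\<integral>\<^sup>+t. (\<integral>\<^sup>+p. ennreal (B * \<bar>w p\<bar>) \<partial>\<mu>) \<partial>?L)"
        proof (subst M.nn_integral_fst[symmetric])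
          show "(\<lambda>q. ennreal (B * \<bar>w (snd q)\<bar>)) \<in> borel_measurable (?L \<Otimes>\<^sub>M \<mu>)" by measurable
        qed simp
        also have "\<dots> = (\<integral>\<^sup>+t. ennreal (\<integral>p. B * \<bar>w p\<bar> \<partial>\<mu>) \<partial>?L)"
          using w B0 by (subst nn_integral_eq_integral) auto
        also have "\<dots> < \<infinity>"
        proof -
          have "emeasure ?L {-T<..<T} < \<infinity>" using T by (simp add: emeasure_restrict_space)
          then show ?thesis by (simp add: ennreal_mult_less_top)
        qed
        finally show "(\<integral>\<^sup>+q. ennreal (norm (case q of (t, p) \<Rightarrow> E 1 t * (indicator {..<t} (fst p) * w p))) \<partial>(?L \<Otimes>\<^sub>M \<mu>)) < \<infinity>" .
      qed
      have "(\<integral>p. E 0 (fst p) * C 1 (snd p) * v p \<partial>\<mu>) = (\<integral>p. - (\<integral>t. E 1 t * (indicator {..<t} (fst p) * w p) \<partial>?L) \<partial>\<mu>)"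
      proof (rule Bochner_Integration.integral_cong)
        fix p assume "p \<in> space \<mu>"
        then have p: "fst p \<in> {-T<..<T}" unfolding space_\<mu> by auto
        have "(\<integral>t. E 1 t * (indicator {..<t} (fst p) * w p) \<partial>?L) = (\<integral>t. E 1 t * indicator {..<t} (fst p) \<partial>?L) * w p"
          unfolding mult.assoc[symmetric] by (rule integral_mult_left_zero)
        then show "E 0 (fst p) * C 1 (snd p) * v p = - (\<integral>t. E 1 t * (indicator {..<t} (fst p) * w p) \<partial>?L)"
          using E0[OF p] by (simp add: w_def)
      qed simp
      also have "\<dots> = - (\<integral>p. (\<integral>t. E 1 t * (indicator {..<t} (fst p) * w p) \<partial>?L) \<partial>\<mu>)"
        by simp
      also have "(\<integral>p. (\<integral>t. E 1 t * (indicator {..<t} (fst p) * w p) \<partial>?L) \<partial>\<mu>) = (\<integral>t. (\<integral>p. E 1 t * (indicator {..<t} (fst p) * w p) \<partial>\<mu>) \<partial>?L)"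
        by (rule P.Fubini_integral[OF int])
      also have "\<dots> = (\<integral>t. E 1 t * b t \<partial>?L)"
        unfolding b_def by simp
      finally show ?thesis .
    qed
    have "(\<integral>t. E 1 t * a t \<partial>?L) - (\<integral>t. E 1 t * b t \<partial>?L) = 0"
      using flux_product[OF E C per r c(2)] unfolding first second by simp
    then have "(\<integral>t. E 1 t * a t - E 1 t * b t \<partial>?L) = 0"
      using E1i[OF am ab] E1i[OF bm bb] by simp
    moreover have "(\<integral>t. E 1 t * a t - E 1 t * b t \<partial>?L) = (\<integral>t. indicator {-T<..<T} t *\<^sub>R (E 1 t * a t - E 1 t * b t) \<partial>lborel)"
      by (rule integral_restrict_space) simp
    moreover have "(\<integral>t. indicator {-T<..<T} t *\<^sub>R (E 1 t * a t - E 1 t * b t) \<partial>lborel) = (\<integral>t. indicator {-T<..<T} t * (E 1 t * u t) \<partial>lborel)"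
      by (intro Bochner_Integration.integral_cong) (auto simp: u_def right_diff_distrib split: split_indicator)
    ultimately show "(\<integral>t. indicator {-T<..<T} t * (E 1 t * u t) \<partial>lborel) = 0" by simp
  qed
  then obtain d where "AE t in lborel. t \<in> {-T<..<T} \<longrightarrow> u t = d" by blast
  then have "AE t in lborel. t \<in> {-T<..<T} \<longrightarrow> a t - b t = d"
    by eventually_elim (simp add: u_def)
  then show ?thesis unfolding a_def b_def w_def by blast
qed


definition "flux_prim f t = (\<integral>p. indicator {..<t} (fst p) * (f (snd p) * v p) \<partial>\<mu>)"

text \<open>The total momentum spent before time \<open>t\<close>. Its increments bound how far mass
  can travel, and it will be the modulus of continuity of the curve.\<close>

definition "flux_var t = (\<integral>p. indicator {..<t} (fst p) * \<bar>v p\<bar> \<partial>\<mu>)"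

end

context flux_kernel
begin

lemma integrable_slice:
  assumes "t \<in> {-T<..<T}" "f \<in> borel_measurable borel" "\<And>x. \<bar>f x\<bar> \<le> (c::real)"
  shows "integrable (\<kappa> t) f"
proof -
  have p: "torus_prob (\<kappa> t)" by (rule torus_kernel_prob[OF \<kappa> assms(1)])
  have "f \<in> borel_measurable (\<kappa> t)"
    by (rule torus_prob_measurable[OF p measurable_torus_borel[OF assms(2)]])
  then show ?thesis
    by (intro finite_measure.integrable_const_bound[OF torus_probD(4)[OF p], of _ c]) (simp_all add: assms(3))
qed

text \<open>For each sine and cosine the difference of slice integral and flux primitive is constant
  off a null set. Countably many null sets are united into \<open>N\<close>, and linearity carries
  the identity to all trigonometric polynomials.\<close>

lemma trig_poly_slice_difference:
  "\<exists>N\<in>null_sets lborel. \<forall>s\<in>{-T<..<T} - N. \<forall>t\<in>{-T<..<T} - N. \<forall>f f'. trig_poly f f' \<longrightarrow>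
    (\<integral>x. f x \<partial>\<kappa> t) - (\<integral>x. f x \<partial>\<kappa> s) = flux_prim f' t - flux_prim f' s"
proof -
  have ae: "\<exists>d. AE t in lborel. t \<in> {-T<..<T} \<longrightarrow> (\<integral>x. f x \<partial>\<kappa> t) - flux_prim f' t = d"
    if "f = (\<lambda>x. cos (2 * pi * real k * x + \<phi>))" "f' = (\<lambda>x. 2 * pi * real k * cos (2 * pi * real k * x + (\<phi> + pi / 2)))" for f f' k \<phi>
  proof -
    let ?w = "2 * pi * real k"
    let ?C = "\<lambda>j x. ?w ^ j * cos (?w * x + (\<phi> + real j * (pi / 2)))"
    have per: "?C 0 (x + 1) = ?C 0 x" for x
    proof -
      have e: "?w * (x + 1) + (\<phi> + real 0 * (pi / 2)) = (?w * x + (\<phi> + real 0 * (pi / 2))) + of_nat k * (2 * pi)"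
        by (simp add: algebra_simps)
      show ?thesis unfolding e
        using Periodic_Fun.cos.plus_of_nat[of "?w * x + (\<phi> + real 0 * (pi / 2))" k] by simp
    qed
    have 0: "\<bar>?C 0 x\<bar> \<le> 1 + ?w" for x
      using abs_cos_le_one[of "?w * x + (\<phi> + real 0 * (pi / 2))"] by (simp add: add_increasing2)
    have 1: "\<bar>?C 1 x\<bar> \<le> 1 + ?w" for x
    proof -
      have "\<bar>?C 1 x\<bar> \<le> ?w * 1"
        unfolding power_one_right abs_mult by (intro mult_mono) auto
      then show ?thesis by simp
    qed
    from slice_integral_minus_flux_const[OF deriv_chain_cos per 0 1]
    show ?thesis using that by (simp add: flux_prim_def)
  qed
  have c: "\<exists>d. AE t in lborel. t \<in> {-T<..<T} \<longrightarrow> (\<integral>x. cos (2 * pi * real k * x) \<partial>\<kappa> t) -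
      flux_prim (\<lambda>x. - (2 * pi * real k * sin (2 * pi * real k * x))) t = d" for k
    by (rule ae[of _ k 0]) (auto simp: fun_eq_iff cos_add)
  have s: "\<exists>d. AE t in lborel. t \<in> {-T<..<T} \<longrightarrow> (\<integral>x. sin (2 * pi * real k * x) \<partial>\<kappa> t) -
      flux_prim (\<lambda>x. 2 * pi * real k * cos (2 * pi * real k * x)) t = d" for k
    by (rule ae[of _ k "- (pi / 2)"]) (simp_all add: fun_eq_iff cos_diff)
  let ?P = "\<lambda>k d t. t \<in> {-T<..<T} \<longrightarrow> (\<integral>x. cos (2 * pi * real k * x) \<partial>\<kappa> t) -
      flux_prim (\<lambda>x. - (2 * pi * real k * sin (2 * pi * real k * x))) t = d"
  let ?Q = "\<lambda>k d t. t \<in> {-T<..<T} \<longrightarrow> (\<integral>x. sin (2 * pi * real k * x) \<partial>\<kappa> t) -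
      flux_prim (\<lambda>x. 2 * pi * real k * cos (2 * pi * real k * x)) t = d"
  obtain dc where dc: "\<And>k. AE t in lborel. ?P k (dc k) t"
    using choice[of "\<lambda>k d. AE t in lborel. ?P k d t", OF allI[OF c]] by blast
  obtain ds where ds: "\<And>k. AE t in lborel. ?Q k (ds k) t"
    using choice[of "\<lambda>k d. AE t in lborel. ?Q k d t", OF allI[OF s]] by blast
  have "AE t in lborel. \<forall>k. ?P k (dc k) t \<and> ?Q k (ds k) t"
    unfolding AE_all_countable by (intro allI AE_conjI dc ds)
  then obtain N where N: "\<And>t. t \<in> space lborel - N \<Longrightarrow> \<forall>k. ?P k (dc k) t \<and> ?Q k (ds k) t" "N \<in> null_sets lborel"
    by (rule AE_E3) blast
  have "(\<integral>x. f x \<partial>\<kappa> t) - (\<integral>x. f x \<partial>\<kappa> s) = flux_prim f' t - flux_prim f' s"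
    if st: "s \<in> {-T<..<T} - N" "t \<in> {-T<..<T} - N" and f: "trig_poly f f'" for s t f f'
    using f
  proof (induction rule: trig_poly.induct)
    case (cos k)
    have "?P k (dc k) t" "?P k (dc k) s" using N(1)[of t] N(1)[of s] st by auto
    then show ?case using st by auto
  next
    case (sin k)
    have "?Q k (ds k) t" "?Q k (ds k) s" using N(1)[of t] N(1)[of s] st by auto
    then show ?case using st by auto
  next
    case (add f f' g g')
    obtain a b c d where f: "\<And>x. \<bar>f x\<bar> \<le> a" "\<And>x. \<bar>f' x\<bar> \<le> b" and g: "\<And>x. \<bar>g x\<bar> \<le> c" "\<And>x. \<bar>g' x\<bar> \<le> d"
      using trig_poly_properties[OF add.hyps(1)] trig_poly_properties[OF add.hyps(2)] by blast
    have m: "f \<in> borel_measurable borel" "f' \<in> borel_measurable borel" "g \<in> borel_measurable borel" "g' \<in> borel_measurable borel"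
      using trig_poly_properties[OF add.hyps(1)] trig_poly_properties[OF add.hyps(2)] by auto
    have 1: "(\<integral>x. f x + g x \<partial>\<kappa> r) = (\<integral>x. f x \<partial>\<kappa> r) + (\<integral>x. g x \<partial>\<kappa> r)" if "r \<in> {-T<..<T} - N" for r
      using that by (intro Bochner_Integration.integral_add integrable_slice[OF _ m(1) f(1)] integrable_slice[OF _ m(3) g(1)]) auto
    have 2: "flux_prim (\<lambda>x. f' x + g' x) r = flux_prim f' r + flux_prim g' r" for r
      unfolding flux_prim_def
      using Bochner_Integration.integral_add[OF integrable_indicator_time[OF integrable_mult_v[OF m(2) f(2)], of r]
          integrable_indicator_time[OF integrable_mult_v[OF m(4) g(2)], of r]]
      by (simp add: distrib_left distrib_right)
    show ?case using add.IH by (simp add: 1[OF st(1)] 1[OF st(2)] 2)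
  next
    case (cmult f f' r)
    have "flux_prim (\<lambda>x. r * f' x) q = r * flux_prim f' q" for q
    proof -
      have "flux_prim (\<lambda>x. r * f' x) q = (\<integral>p. r * (indicator {..<q} (fst p) * (f' (snd p) * v p)) \<partial>\<mu>)"
        unfolding flux_prim_def by (intro Bochner_Integration.integral_cong) (auto simp: mult_ac)
      then show ?thesis unfolding flux_prim_def by simp
    qed
    then show ?case using cmult.IH by (simp flip: right_diff_distrib)
  qed
  then show ?thesis using N(2) by blast
qed

lemma integrable_abs_v: "integrable \<mu> (\<lambda>p. \<bar>v p\<bar>)"
  using v(1) by simp

lemma flux_var_mono: "s \<le> t \<Longrightarrow> flux_var s \<le> flux_var t"
  unfolding flux_var_def
  by (intro integral_mono integrable_indicator_time[OF integrable_abs_v]) (auto split: split_indicator)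

lemma flux_prim_diff_le:
  assumes f: "f \<in> borel_measurable borel" "\<And>x. \<bar>f x\<bar> \<le> L"
  shows "\<bar>flux_prim f t - flux_prim f s\<bar> \<le> L * \<bar>flux_var t - flux_var s\<bar>"
proof -
  have *: "\<bar>flux_prim f t - flux_prim f s\<bar> \<le> L * (flux_var t - flux_var s)" if "s \<le> t" for s t
  proof -
    note i = integrable_indicator_time[OF integrable_mult_v[OF f]] and j = integrable_indicator_time[OF integrable_abs_v]
    have 1: "flux_prim f t - flux_prim f s = (\<integral>p. indicator {..<t} (fst p) * (f (snd p) * v p) - indicator {..<s} (fst p) * (f (snd p) * v p) \<partial>\<mu>)"
      unfolding flux_prim_def by (rule Bochner_Integration.integral_diff[symmetric, OF i i])
    have 2: "\<bar>\<integral>p. indicator {..<t} (fst p) * (f (snd p) * v p) - indicator {..<s} (fst p) * (f (snd p) * v p) \<partial>\<mu>\<bar> \<le>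
        (\<integral>p. L * (indicator {..<t} (fst p) * \<bar>v p\<bar> - indicator {..<s} (fst p) * \<bar>v p\<bar>) \<partial>\<mu>)"
    proof (rule order_trans[OF integral_abs_bound integral_mono])
      show "integrable \<mu> (\<lambda>p. \<bar>indicator {..<t} (fst p) * (f (snd p) * v p) - indicator {..<s} (fst p) * (f (snd p) * v p)\<bar>)"
        by (intro integrable_abs Bochner_Integration.integrable_diff i)
      show "integrable \<mu> (\<lambda>p. L * (indicator {..<t} (fst p) * \<bar>v p\<bar> - indicator {..<s} (fst p) * \<bar>v p\<bar>))"
        by (intro integrable_mult_right Bochner_Integration.integrable_diff j)
      fix p
      have "\<bar>f (snd p) * v p\<bar> \<le> L * \<bar>v p\<bar>"
        unfolding abs_mult by (intro mult_right_mono f) simp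
      then show "\<bar>indicator {..<t} (fst p) * (f (snd p) * v p) - indicator {..<s} (fst p) * (f (snd p) * v p)\<bar>
          \<le> L * (indicator {..<t} (fst p) * \<bar>v p\<bar> - indicator {..<s} (fst p) * \<bar>v p\<bar>)"
        using that by (auto split: split_indicator)
    qed
    have 3: "(\<integral>p. L * (indicator {..<t} (fst p) * \<bar>v p\<bar> - indicator {..<s} (fst p) * \<bar>v p\<bar>) \<partial>\<mu>) = L * (flux_var t - flux_var s)"
      unfolding flux_var_def integral_mult_right_zero
      by (simp only: Bochner_Integration.integral_diff[OF j j])
    show ?thesis using 2 unfolding 1 3 .
  qed
  show ?thesis
  proof (cases "s \<le> t")
    case True
    then show ?thesis using *[OF True] flux_var_mono[OF True] by simp
  next
    case False
    then have "t \<le> s" by simp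
    then show ?thesis using *[of t s] flux_var_mono[of t s] by (simp add: abs_minus_commute)
  qed
qed

text \<open>The approximants from \<open>lip_per_trig_approx\<close> have derivatives bounded by the
  Lipschitz constant of \<open>f\<close>, so the estimate passes to \<open>f\<close> without loss
  and outside the same null set.\<close>

lemma lip_per_slice_difference:
  "\<exists>N\<in>null_sets lborel. \<forall>s\<in>{-T<..<T} - N. \<forall>t\<in>{-T<..<T} - N. \<forall>L f. lip_per L f \<longrightarrow>
    \<bar>(\<integral>x. f x \<partial>\<kappa> t) - (\<integral>x. f x \<partial>\<kappa> s)\<bar> \<le> L * \<bar>flux_var t - flux_var s\<bar>"
proof -
  obtain N where N: "N \<in> null_sets lborel" "\<And>s t f f'. s \<in> {-T<..<T} - N \<Longrightarrow> t \<in> {-T<..<T} - N \<Longrightarrow> trig_poly f f' \<Longrightarrow>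
      (\<integral>x. f x \<partial>\<kappa> t) - (\<integral>x. f x \<partial>\<kappa> s) = flux_prim f' t - flux_prim f' s"
    using trig_poly_slice_difference by blast
  have "\<bar>(\<integral>x. f x \<partial>\<kappa> t) - (\<integral>x. f x \<partial>\<kappa> s)\<bar> \<le> L * \<bar>flux_var t - flux_var s\<bar>"
    if st: "s \<in> {-T<..<T} - N" "t \<in> {-T<..<T} - N" and f: "lip_per L f" for s t L f
  proof (rule field_le_epsilon)
    fix e :: real assume "e > 0"
    then obtain g g' where g: "trig_poly g g'" "\<And>x. \<bar>f x - g x\<bar> \<le> e / 2" "\<And>x. \<bar>g' x\<bar> \<le> L"
      using lip_per_trig_approx[OF f, of "e / 2"] by auto
    note gp = trig_poly_properties[OF g(1)]
    have d: "\<bar>(\<integral>x. f x \<partial>\<kappa> r) - (\<integral>x. g x \<partial>\<kappa> r)\<bar> \<le> e / 2" if r: "r \<in> {-T<..<T}" for r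
    proof -
      interpret K: prob_space "\<kappa> r" using torus_probD[OF torus_kernel_prob[OF \<kappa> r]] by simp
      have i: "integrable (\<kappa> r) f" "integrable (\<kappa> r) g"
        using integrable_slice[OF r lip_per_borel[OF f] lip_per_bounded[OF f]] gp integrable_slice[OF r] by blast+
      have "(\<integral>x. f x \<partial>\<kappa> r) - (\<integral>x. g x \<partial>\<kappa> r) = (\<integral>x. f x - g x \<partial>\<kappa> r)"
        using i by simp
      also have "\<bar>\<dots>\<bar> \<le> (\<integral>x. e / 2 \<partial>\<kappa> r)"
        using i g(2) by (intro order_trans[OF integral_abs_bound integral_mono]) auto
      finally show ?thesis by (simp add: K.prob_space)
    qed
    have ds: "\<bar>(\<integral>x. f x \<partial>\<kappa> s) - (\<integral>x. g x \<partial>\<kappa> s)\<bar> \<le> e / 2"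
      and dt: "\<bar>(\<integral>x. f x \<partial>\<kappa> t) - (\<integral>x. g x \<partial>\<kappa> t)\<bar> \<le> e / 2"
      by (rule d, use st in blast)+
    have "\<bar>(\<integral>x. g x \<partial>\<kappa> t) - (\<integral>x. g x \<partial>\<kappa> s)\<bar> \<le> L * \<bar>flux_var t - flux_var s\<bar>"
      unfolding N(2)[OF st g(1)] using gp by (intro flux_prim_diff_le g(3)) auto
    then show "\<bar>(\<integral>x. f x \<partial>\<kappa> t) - (\<integral>x. f x \<partial>\<kappa> s)\<bar> \<le> L * \<bar>flux_var t - flux_var s\<bar> + e"
      using ds dt by linarith
  qed
  then show ?thesis using N(1) by blast
qed

lemma AE_fst_neq: "AE p in \<mu>. fst p \<noteq> t"
proof (rule AE_I)
  show "{p \<in> space \<mu>. \<not> fst p \<noteq> t} \<subseteq> {p \<in> space \<mu>. fst p = t}" by auto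
  have A: "{p \<in> space \<mu>. fst p = t} \<in> sets \<mu>" by measurable
  then show "{p \<in> space \<mu>. fst p = t} \<in> sets \<mu>" .
  have "emeasure \<mu> {p \<in> space \<mu>. fst p = t} = (\<integral>\<^sup>+s\<in>{-T<..<T}. emeasure (\<kappa> s) {x. (s, x) \<in> {p \<in> space \<mu>. fst p = t}} \<partial>lborel)"
    using A by (intro emeasure_of_kernel[OF T \<kappa>]) (simp add: sets_\<mu>)
  also have "\<dots> = (\<integral>\<^sup>+s. 0 \<partial>(lborel :: real measure))"
  proof (rule nn_integral_cong_AE)
    show "AE s in lborel. emeasure (\<kappa> s) {x. (s, x) \<in> {p \<in> space \<mu>. fst p = t}} * indicator {-T<..<T} s = 0"
      using AE_lborel_singleton[of t] by eventually_elim simp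
  qed
  finally show "emeasure \<mu> {p \<in> space \<mu>. fst p = t} = 0" by simp
qed

text \<open>Single times carry no mass, since the time marginal is Lebesgue measure; therefore the
  indicators of earlier times converge almost everywhere when the time does.\<close>

lemma continuous_flux_var: "continuous_on UNIV flux_var"
  unfolding continuous_on_sequentially
proof (intro allI ballI impI)
  fix x :: "nat \<Rightarrow> real" and a :: real
  assume "(\<forall>n. x n \<in> UNIV) \<and> x \<longlonglongrightarrow> a"
  then have x: "x \<longlonglongrightarrow> a" by simp
  have [measurable]: "v \<in> borel_measurable \<mu>" using v(1) by blast
  have "(\<lambda>n. \<integral>p. indicator {..<x n} (fst p) * \<bar>v p\<bar> \<partial>\<mu>) \<longlonglongrightarrow> (\<integral>p. indicator {..<a} (fst p) * \<bar>v p\<bar> \<partial>\<mu>)"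
  proof (rule integral_dominated_convergence[where w = "\<lambda>p. \<bar>v p\<bar>"])
    show "AE p in \<mu>. (\<lambda>n. indicator {..<x n} (fst p) * \<bar>v p\<bar>) \<longlonglongrightarrow> indicator {..<a} (fst p) * \<bar>v p\<bar>"
      using AE_fst_neq[of a]
    proof eventually_elim
      case (elim p)
      have "eventually (\<lambda>n. indicator {..<x n} (fst p) = (indicator {..<a} (fst p) :: real)) sequentially"
      proof (cases "fst p < a")
        case True
        then have "eventually (\<lambda>n. fst p < x n) sequentially" using x by (rule order_tendstoD(1)[rotated])
        then show ?thesis by eventually_elim (use True in simp)
      next
        case False
        then have "a < fst p" using elim by simp
        then have "eventually (\<lambda>n. x n < fst p) sequentially" using x by (rule order_tendstoD(2)[rotated])
        then show ?thesis by eventually_elim (use False in simp)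
      qed
      then show ?case by (intro tendsto_mult tendsto_eventually tendsto_const)
    qed
    show "(\<lambda>p. indicator {..<a} (fst p) * \<bar>v p\<bar>) \<in> borel_measurable \<mu>" by measurable
    show "(\<lambda>p. indicator {..<x n} (fst p) * \<bar>v p\<bar>) \<in> borel_measurable \<mu>" for n by measurable
    show "integrable \<mu> (\<lambda>p. \<bar>v p\<bar>)" by (rule integrable_abs_v)
    show "AE p in \<mu>. norm (indicator {..<x n} (fst p) * \<bar>v p\<bar>) \<le> \<bar>v p\<bar>" for n
      by (auto split: split_indicator)
  qed
  then show "(flux_var \<circ> x) \<longlonglongrightarrow> flux_var a" by (simp add: comp_def flux_var_def)
qed

end

subsection \<open>Continuous curves of measures\<close>

lemma null_set_dense_sequence:
  assumes N: "N \<in> null_sets lborel" and T: "T > 0" and t: "t \<in> {-T..T}"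
  shows "\<exists>s::nat \<Rightarrow> real. (\<forall>n. s n \<in> {-T<..<T} - N) \<and> s \<longlonglongrightarrow> t"
proof -
  have "\<exists>s. s \<in> {-T<..<T} - N \<and> \<bar>s - t\<bar> \<le> 1 / real (Suc n)" for n
  proof -
    define e where "e = 1 / real (Suc n)"
    have e: "e > 0" by (simp add: e_def)
    define a b where "a = max (-T) (t - e)" and "b = min T (t + e)"
    have ab: "a < b" using t T e by (auto simp: a_def b_def)
    have "\<not> {a<..<b} \<subseteq> N"
    proof
      assume "{a<..<b} \<subseteq> N"
      then have "{a<..<b} \<in> null_sets lborel" by (intro null_sets_subset[OF N]) auto
      then have "emeasure lborel {a<..<b} = 0" by auto
      then show False using ab by simp
    qed
    then obtain s where "s \<in> {a<..<b}" "s \<notin> N" by blast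
    then have "s \<in> {-T<..<T} - N" "\<bar>s - t\<bar> \<le> e"
      by (auto simp: a_def b_def abs_le_iff)
    then show ?thesis unfolding e_def by blast
  qed
  then obtain s where s: "\<And>n. s n \<in> {-T<..<T} - N" "\<And>n. \<bar>s n - t\<bar> \<le> 1 / real (Suc n)" by metis
  have "(\<lambda>n. s n - t) \<longlonglongrightarrow> 0"
    by (rule Lim_null_comparison[OF _ LIMSEQ_inverse_real_of_nat])
      (use s(2) in \<open>simp add: inverse_eq_divide del: of_nat_Suc\<close>)
  then have "s \<longlonglongrightarrow> t" by (simp add: LIM_zero_iff)
  then show ?thesis using s(1) by blast
qed

text \<open>Read as measures on the line, the sequence is tight because it lives on the unit
  interval. A limit may charge the point 1; \<open>frac\<close> folds it back to 0, which periodic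
  test functions do not notice.\<close>

lemma torus_prob_convergent_subsequence:
  assumes \<kappa>: "\<And>n::nat. torus_prob (\<kappa> n)"
  shows "\<exists>r \<rho>. strict_mono (r :: nat \<Rightarrow> nat) \<and> torus_prob \<rho> \<and>
    (\<forall>L f. lip_per L f \<longrightarrow> (\<lambda>n. \<integral>x. f x \<partial>\<kappa> (r n)) \<longlonglongrightarrow> (\<integral>x. f x \<partial>\<rho>))"
proof -
  define M where "M n = distr (\<kappa> n) borel (\<lambda>x. x)" for n
  have idm: "(\<lambda>x. x) \<in> borel_measurable (\<kappa> n)" for n
    by (rule torus_prob_measurable[OF \<kappa> measurable_torus_id])
  have M: "real_distribution (M n)" for n
    unfolding M_def by (rule real_distribution_torus(1)[OF \<kappa>])
  have "measure (M n) {-1<..1} = 1" for n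
  proof -
    have "measure (M n) {-1<..1} = measure (\<kappa> n) ((\<lambda>x. x) -` {-1<..1} \<inter> space (\<kappa> n))"
      unfolding M_def by (rule measure_distr[OF idm]) simp
    also have "(\<lambda>x. x) -` {-1<..1} \<inter> space (\<kappa> n) = space (\<kappa> n)"
      using torus_probD(2)[OF \<kappa>] by auto
    finally show ?thesis using torus_probD(3)[OF \<kappa>] by (simp add: prob_space.prob_space)
  qed
  then have "tight M"
    unfolding tight_def
  proof (intro conjI allI impI M)
    fix \<epsilon> :: real assume "\<epsilon> > 0"
    then have "(-1::real) < 1 \<and> (\<forall>n. 1 - \<epsilon> < measure (M n) {-1<..1})"
      using \<open>\<And>n. measure (M n) {-1<..1} = 1\<close> by simp
    then show "\<exists>a b. a < b \<and> (\<forall>n. 1 - \<epsilon> < measure (M n) {a<..b})" by blast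
  qed
  from tight_imp_convergent_subsubsequence[OF this strict_mono_id]
  obtain r R where r: "strict_mono (r :: nat \<Rightarrow> nat)" "real_distribution R" "weak_conv_m (M \<circ> id \<circ> r) R"
    by blast
  interpret R: real_distribution R by fact
  define \<rho> where "\<rho> = distr R torus frac"
  have fm: "frac \<in> measurable R torus"
    using measurable_frac_torus measurable_cong_sets[OF R.events_eq_borel refl] by blast
  have \<rho>: "torus_prob \<rho>"
    unfolding torus_prob_def \<rho>_def using R.prob_space_distr[OF fm] by simp
  have "(\<lambda>n. \<integral>x. f x \<partial>\<kappa> (r n)) \<longlonglongrightarrow> (\<integral>x. f x \<partial>\<rho>)" if f: "lip_per L f" for L f
  proof -
    have fb: "f \<in> borel_measurable borel" by (rule lip_per_borel[OF f])
    have "(\<integral>x. f x \<partial>\<rho>) = (\<integral>x. f (frac x) \<partial>R)"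
      unfolding \<rho>_def by (rule integral_distr[OF fm measurable_torus_borel[OF fb]])
    also have "\<dots> = (\<integral>x. f x \<partial>R)" by (simp only: lip_per_frac[OF f])
    finally have 1: "(\<integral>x. f x \<partial>\<rho>) = (\<integral>x. f x \<partial>R)" .
    have 2: "(\<integral>x. f x \<partial>(M \<circ> id \<circ> r) n) = (\<integral>x. f x \<partial>\<kappa> (r n))" for n
      unfolding M_def comp_def id_def by (rule integral_distr[OF idm fb])
    have "(\<lambda>n. \<integral>x. f x \<partial>(M \<circ> id \<circ> r) n) \<longlonglongrightarrow> (\<integral>x. f x \<partial>R)"
    proof (rule weak_conv_imp_integral_bdd_continuous_conv[OF _ r(2,3)])
      show "real_distribution ((M \<circ> id \<circ> r) n)" for n by (simp add: M)
      show "isCont f x" for x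
        using lip_per_continuous[OF f, of UNIV] by (simp add: continuous_on_eq_continuous_at)
      show "norm (f x) \<le> \<bar>f 0\<bar> + L" for x using lip_per_bounded[OF f, of x] by simp
    qed
    then show ?thesis unfolding 1 2 .
  qed
  then show ?thesis using r(1) \<rho> by blast
qed

text \<open>The working notion of a continuous curve: defined at every time, the end times included,
  with one continuous modulus for all Lipschitz test functions. Dually, increments of \<Omega> bound
  the Wasserstein distance of order 1.\<close>

definition lip_controlled :: "real \<Rightarrow> (real \<Rightarrow> real measure) \<Rightarrow> (real \<Rightarrow> real) \<Rightarrow> bool" where
  "lip_controlled T \<gamma> \<Omega> \<longleftrightarrow> (\<forall>t\<in>{-T..T}. torus_prob (\<gamma> t)) \<and> continuous_on {-T..T} \<Omega> \<and>
    (\<forall>s\<in>{-T..T}. \<forall>t\<in>{-T..T}. \<forall>L f. lip_per L f \<longrightarrow>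
      \<bar>(\<integral>x. f x \<partial>\<gamma> t) - (\<integral>x. f x \<partial>\<gamma> s)\<bar> \<le> L * \<bar>\<Omega> t - \<Omega> s\<bar>)"

lemma lip_controlled_tendsto:
  assumes \<gamma>: "lip_controlled T \<gamma> \<Omega>" and f: "lip_per L f" and t: "t \<in> {-T..T}"
  shows "((\<lambda>s. \<integral>x. f x \<partial>\<gamma> s) \<longlongrightarrow> (\<integral>x. f x \<partial>\<gamma> t)) (at t within {-T..T})"
proof -
  have "(\<Omega> \<longlongrightarrow> \<Omega> t) (at t within {-T..T})"
    using \<gamma> t by (simp add: lip_controlled_def continuous_on_def)
  then have "((\<lambda>s. L * \<bar>\<Omega> s - \<Omega> t\<bar>) \<longlongrightarrow> L * \<bar>\<Omega> t - \<Omega> t\<bar>) (at t within {-T..T})"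
    by (intro tendsto_intros)
  then have 0: "((\<lambda>s. L * \<bar>\<Omega> s - \<Omega> t\<bar>) \<longlongrightarrow> 0) (at t within {-T..T})" by simp
  have "((\<lambda>s. (\<integral>x. f x \<partial>\<gamma> s) - (\<integral>x. f x \<partial>\<gamma> t)) \<longlongrightarrow> 0) (at t within {-T..T})"
  proof (rule Lim_null_comparison[OF _ 0])
    show "\<forall>\<^sub>F s in at t within {-T..T}. norm ((\<integral>x. f x \<partial>\<gamma> s) - (\<integral>x. f x \<partial>\<gamma> t)) \<le> L * \<bar>\<Omega> s - \<Omega> t\<bar>"
      unfolding eventually_at_filter real_norm_def
      using \<gamma> f t unfolding lip_controlled_def by (intro always_eventually) blast
  qed
  then show ?thesis by (simp add: LIM_zero_iff)
qed

text \<open>Lipschitz integrals are continuous in time, and the masses of the generating arcs are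
  pointwise limits of such integrals.\<close>

lemma lip_controlled_kernel:
  assumes \<gamma>: "lip_controlled T \<gamma> \<Omega>"
  shows "torus_kernel T \<gamma>"
  unfolding torus_kernel_def
proof (rule measurable_prob_algebra_generated[OF sets_torus_generated Int_stable_torus_generator])
  show "range (\<lambda>a::real. {0..<1} \<inter> {a<..}) \<subseteq> Pow {0..<1}" by auto
  have p: "torus_prob (\<gamma> t)" if "t \<in> {-T<..<T}" for t
    using \<gamma> that unfolding lip_controlled_def by auto
  show "prob_space (\<gamma> t)" "sets (\<gamma> t) = sets torus" if "t \<in> space (time_space T)" for t
    using p[of t] that by (simp_all add: torus_prob_def)
  fix A :: "real set" assume "A \<in> range (\<lambda>a. {0..<1} \<inter> {a<..})"
  then obtain a where a: "A = {0..<1} \<inter> {a<..}" by blast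
  obtain F where F: "\<And>n. lip_per (real n) (F n)" "\<And>n z. 0 \<le> F n z \<and> F n z \<le> 1"
    "\<And>z. z \<in> {0..<1} \<Longrightarrow> (\<lambda>n. F n z) \<longlonglongrightarrow> indicator A z"
    using torus_indicator_approx[of a] unfolding a by blast
  have "(\<lambda>t. measure (\<gamma> t) A) \<in> borel_measurable (time_space T)"
  proof (rule borel_measurable_LIMSEQ_real[of _ "\<lambda>n t. \<integral>x. F n x \<partial>\<gamma> t"])
    fix n
    have "continuous_on {-T<..<T} (\<lambda>t. \<integral>x. F n x \<partial>\<gamma> t)"
      unfolding continuous_on_def
    proof
      fix t assume t: "t \<in> {-T<..<T}"
      then have "((\<lambda>s. \<integral>x. F n x \<partial>\<gamma> s) \<longlongrightarrow> (\<integral>x. F n x \<partial>\<gamma> t)) (at t within {-T..T})"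
        by (intro lip_controlled_tendsto[OF \<gamma> F(1)]) auto
      then show "((\<lambda>s. \<integral>x. F n x \<partial>\<gamma> s) \<longlongrightarrow> (\<integral>x. F n x \<partial>\<gamma> t)) (at t within {-T<..<T})"
        by (rule tendsto_within_subset) auto
    qed
    then have "(\<lambda>t. \<integral>x. F n x \<partial>\<gamma> t) \<in> borel_measurable (restrict_space borel {-T<..<T})"
      by (rule borel_measurable_continuous_on_restrict)
    then show "(\<lambda>t. \<integral>x. F n x \<partial>\<gamma> t) \<in> borel_measurable (time_space T)"
      using measurable_cong_sets[OF restrict_space_sets_cong[OF refl sets_lborel] refl] by blast
  next
    fix t assume "t \<in> space (time_space T)"
    then have pt: "torus_prob (\<gamma> t)" using p by simp
    have A: "A \<in> sets (\<gamma> t)" using torus_probD(1)[OF pt] by (simp add: a sets_torus)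
    have "(\<lambda>n. \<integral>z. F n z \<partial>\<gamma> t) \<longlonglongrightarrow> (\<integral>z. indicator A z \<partial>\<gamma> t)"
    proof (rule integral_dominated_convergence[where w = "\<lambda>_. 1"])
      show "(\<lambda>z. indicator A z :: real) \<in> borel_measurable (\<gamma> t)" using A by simp
      show "F n \<in> borel_measurable (\<gamma> t)" for n
        by (rule torus_prob_measurable[OF pt measurable_torus_borel[OF lip_per_borel[OF F(1)]]])
      show "integrable (\<gamma> t) (\<lambda>_. 1 :: real)"
        using finite_measure.integrable_const[OF torus_probD(4)[OF pt]] .
      show "AE z in \<gamma> t. (\<lambda>n. F n z) \<longlonglongrightarrow> indicator A z"
        using F(3) torus_probD(2)[OF pt] by (intro AE_I2) auto
      show "AE z in \<gamma> t. norm (F n z) \<le> 1" for n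
        using F(2) by (intro AE_I2) auto
    qed
    then show "(\<lambda>n. \<integral>x. F n x \<partial>\<gamma> t) \<longlonglongrightarrow> measure (\<gamma> t) A" using A by simp
  qed
  then have "(\<lambda>t. ennreal (measure (\<gamma> t) A)) \<in> borel_measurable (time_space T)" by simp
  moreover have "ennreal (measure (\<gamma> t) A) = emeasure (\<gamma> t) A" if "t \<in> space (time_space T)" for t
    using p[of t] that by (simp add: finite_measure.emeasure_eq_measure[OF torus_probD(4)])
  ultimately show "(\<lambda>t. emeasure (\<gamma> t) A) \<in> borel_measurable (time_space T)"
    by (subst (asm) measurable_cong) auto
qed

lemma lip_controlled_continuous_slices:
  assumes T: "T > 0" and \<gamma>: "lip_controlled T \<gamma> \<Omega>"
  shows "continuous_slices T (of_kernel T \<gamma>) \<gamma>"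
  unfolding continuous_slices_def
proof (intro conjI ballI)
  show "disintegration T (of_kernel T \<gamma>) \<gamma>"
    by (rule disintegration_of_kernel[OF T lip_controlled_kernel[OF \<gamma>]])
  fix t assume t: "t \<in> {-T..T}"
  have p: "torus_prob (\<gamma> s)" if "s \<in> {-T..T}" for s using \<gamma> that by (simp add: lip_controlled_def)
  show "sets (\<gamma> t) = sets torus" "finite_measure (\<gamma> t)" using torus_probD[OF p[OF t]] by auto
  have "(\<Omega> \<longlongrightarrow> \<Omega> t) (at t within {-T..T})"
    using \<gamma> t by (simp add: lip_controlled_def continuous_on_def)
  then have "((\<lambda>s. ennreal (10 * \<bar>\<Omega> s - \<Omega> t\<bar>)) \<longlongrightarrow> ennreal (10 * \<bar>\<Omega> t - \<Omega> t\<bar>)) (at t within {-T..T})"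
    by (intro tendsto_ennrealI tendsto_intros)
  then have lim: "((\<lambda>s. ennreal (10 * \<bar>\<Omega> s - \<Omega> t\<bar>)) \<longlongrightarrow> 0) (at t within {-T..T})" by simp
  have ev: "\<forall>\<^sub>F s in at t within {-T..T}. W_per_sq (\<gamma> s) (\<gamma> t) \<le> ennreal (10 * \<bar>\<Omega> s - \<Omega> t\<bar>)"
    unfolding eventually_at_filter
  proof (intro always_eventually allI impI)
    fix s assume s: "s \<in> {-T..T}"
    show "W_per_sq (\<gamma> s) (\<gamma> t) \<le> ennreal (10 * \<bar>\<Omega> s - \<Omega> t\<bar>)"
      using \<gamma> s t unfolding lip_controlled_def
      by (intro W_per_sq_le_dual_lipschitz p s t) blast
  qed
  show "((\<lambda>s. W_per_sq (\<gamma> s) (\<gamma> t)) \<longlongrightarrow> 0) (at t within {-T..T})"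
    by (rule tendsto_sandwich[OF _ ev tendsto_const lim]) simp
qed

text \<open>Integrates \<open>d \<le> e + d\<^sup>2 / e\<close>, with \<open>d\<close> the periodic
  distance, against a coupling of cost below \<open>w\<close>. The measure \<nu> is taken finite
  rather than a probability, as this is what \<open>continuous_slices\<close> provides.\<close>

lemma lip_integral_diff_le_W:
  assumes \<nu>: "sets \<nu> = sets torus" "finite_measure \<nu>"
    and W: "W_per_sq \<rho> \<nu> < ennreal w" and f: "lip_per L f" and e: "e > 0" and w: "w \<ge> 0"
  shows "\<bar>(\<integral>x. f x \<partial>\<rho>) - (\<integral>x. f x \<partial>\<nu>)\<bar> \<le> L * (e * measure \<nu> {0..<1} + w / e)"
proof -
  obtain \<pi> where \<pi>: "\<pi> \<in> couplings \<rho> \<nu>" "(\<integral>\<^sup>+(x, y). ennreal ((dist_per x y)\<^sup>2) \<partial>\<pi>) < ennreal w"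
    using W unfolding W_per_sq_def INF_less_iff by blast
  then have \<pi>': "sets \<pi> = sets (torus \<Otimes>\<^sub>M torus)" "distr \<pi> torus fst = \<rho>" "distr \<pi> torus snd = \<nu>"
    by (auto simp: couplings_def)
  have L: "0 \<le> L" by (rule lip_per_nonneg[OF f])
  have mf: "fst \<in> measurable \<pi> torus" "snd \<in> measurable \<pi> torus"
    by (simp_all add: measurable_cong_sets[OF \<pi>'(1) refl])
  have dm: "(\<lambda>p. dist_per (fst p) (snd p)) \<in> borel_measurable \<pi>"
    using measurable_dist_per_torus measurable_cong_sets[OF \<pi>'(1) refl] by blast
  have sp: "emeasure \<pi> (space \<pi>) = emeasure \<nu> {0..<1}"
  proof -
    have "emeasure (distr \<pi> torus snd) {0..<1} = emeasure \<pi> (snd -` {0..<1} \<inter> space \<pi>)"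
      by (rule emeasure_distr[OF mf(2)]) (simp add: sets_torus)
    also have "snd -` {0..<1} \<inter> space \<pi> = space \<pi>"
      using measurable_space[OF mf(2)] by auto
    finally show ?thesis unfolding \<pi>'(3) by simp
  qed
  interpret \<pi>: finite_measure \<pi>
    by (rule finite_measureI) (use sp finite_measure.emeasure_finite[OF \<nu>(2)] in simp)
  have ft: "f \<in> borel_measurable torus" by (rule measurable_torus_borel[OF lip_per_borel[OF f]])
  have i1: "integrable \<pi> (\<lambda>p. f (fst p))"
    by (rule \<pi>.integrable_const_bound[of _ "\<bar>f 0\<bar> + L", OF _ measurable_compose[OF mf(1) ft]])
      (simp add: lip_per_bounded[OF f])
  have i2: "integrable \<pi> (\<lambda>p. f (snd p))"
    by (rule \<pi>.integrable_const_bound[of _ "\<bar>f 0\<bar> + L", OF _ measurable_compose[OF mf(2) ft]])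
      (simp add: lip_per_bounded[OF f])
  have d1: "\<bar>dist_per x y\<bar> \<le> 1" for x y using dist_per_nonneg[of x y] dist_per_le_1[of x y] by simp
  have id: "integrable \<pi> (\<lambda>p. (dist_per (fst p) (snd p))\<^sup>2)"
    by (rule \<pi>.integrable_const_bound[of _ 1]) (use dm d1 in \<open>auto simp: abs_square_le_1\<close>)
  have ib: "integrable \<pi> (\<lambda>p. L * (e + (dist_per (fst p) (snd p))\<^sup>2 / e))"
    using id by simp
  have 1: "(\<integral>x. f x \<partial>\<rho>) - (\<integral>x. f x \<partial>\<nu>) = (\<integral>p. f (fst p) - f (snd p) \<partial>\<pi>)"
  proof -
    have "(\<integral>x. f x \<partial>\<rho>) = (\<integral>p. f (fst p) \<partial>\<pi>)"
      using integral_distr[OF mf(1) ft] unfolding \<pi>'(2) .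
    moreover have "(\<integral>x. f x \<partial>\<nu>) = (\<integral>p. f (snd p) \<partial>\<pi>)"
      using integral_distr[OF mf(2) ft] unfolding \<pi>'(3) .
    ultimately show ?thesis by (simp only: Bochner_Integration.integral_diff[OF i1 i2])
  qed
  have 2: "\<bar>\<integral>p. f (fst p) - f (snd p) \<partial>\<pi>\<bar> \<le> (\<integral>p. L * (e + (dist_per (fst p) (snd p))\<^sup>2 / e) \<partial>\<pi>)"
  proof (rule order_trans[OF integral_abs_bound integral_mono])
    show "integrable \<pi> (\<lambda>p. \<bar>f (fst p) - f (snd p)\<bar>)"
      by (intro integrable_abs Bochner_Integration.integrable_diff i1 i2)
    show "integrable \<pi> (\<lambda>p. L * (e + (dist_per (fst p) (snd p))\<^sup>2 / e))" by (rule ib)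
    fix p
    let ?d = "dist_per (fst p) (snd p)"
    have "?d \<le> e + ?d\<^sup>2 / e"
    proof (cases "?d \<le> e")
      case True
      then show ?thesis using e by (simp add: add_increasing2)
    next
      case False
      then have "?d * e \<le> ?d * ?d" using dist_per_nonneg by (intro mult_left_mono) auto
      then have "?d \<le> ?d\<^sup>2 / e" using e by (simp add: le_divide_eq power2_eq_square)
      then show ?thesis using e by linarith
    qed
    then have "L * ?d \<le> L * (e + ?d\<^sup>2 / e)" using L by (rule mult_left_mono)
    then show "\<bar>f (fst p) - f (snd p)\<bar> \<le> L * (e + ?d\<^sup>2 / e)"
      using lip_per_dist_per[OF f, of "fst p" "snd p"] by linarith
  qed
  have sm: "measure \<pi> (space \<pi>) = measure \<nu> {0..<1}" using sp by (simp add: measure_def)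
  have 3: "(\<integral>p. L * (e + (dist_per (fst p) (snd p))\<^sup>2 / e) \<partial>\<pi>) = L * (e * measure \<nu> {0..<1} + (\<integral>p. (dist_per (fst p) (snd p))\<^sup>2 \<partial>\<pi>) / e)"
    using id sm by simp
  have "ennreal (\<integral>p. (dist_per (fst p) (snd p))\<^sup>2 \<partial>\<pi>) = (\<integral>\<^sup>+p. ennreal ((dist_per (fst p) (snd p))\<^sup>2) \<partial>\<pi>)"
    by (rule nn_integral_eq_integral[OF id, symmetric]) simp
  also have "\<dots> = (\<integral>\<^sup>+(x, y). ennreal ((dist_per x y)\<^sup>2) \<partial>\<pi>)"
    by (intro nn_integral_cong) (simp add: case_prod_unfold)
  finally have "ennreal (\<integral>p. (dist_per (fst p) (snd p))\<^sup>2 \<partial>\<pi>) \<le> ennreal w" using \<pi>(2) by simp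
  then have "(\<integral>p. (dist_per (fst p) (snd p))\<^sup>2 \<partial>\<pi>) \<le> w" using w by (simp add: ennreal_le_iff)
  then have "(\<integral>p. (dist_per (fst p) (snd p))\<^sup>2 \<partial>\<pi>) / e \<le> w / e" using e by (simp add: divide_right_mono)
  then have "L * (e * measure \<nu> {0..<1} + (\<integral>p. (dist_per (fst p) (snd p))\<^sup>2 \<partial>\<pi>) / e) \<le> L * (e * measure \<nu> {0..<1} + w / e)"
    using L by (intro mult_left_mono) auto
  then show ?thesis using 2 unfolding 1 3 by linarith
qed

lemma continuous_slices_tendsto:
  assumes \<gamma>: "continuous_slices T \<mu> \<gamma>" and t: "t \<in> {-T..T}" and f: "lip_per L f"
  shows "((\<lambda>s. \<integral>x. f x \<partial>\<gamma> s) \<longlongrightarrow> (\<integral>x. f x \<partial>\<gamma> t)) (at t within {-T..T})"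
proof (rule tendstoI)
  fix \<epsilon> :: real assume \<epsilon>: "\<epsilon> > 0"
  have L: "0 \<le> L" by (rule lip_per_nonneg[OF f])
  have t': "sets (\<gamma> t) = sets torus" "finite_measure (\<gamma> t)"
    "((\<lambda>s. W_per_sq (\<gamma> s) (\<gamma> t)) \<longlongrightarrow> 0) (at t within {-T..T})"
    using \<gamma> t unfolding continuous_slices_def by auto
  define M where "M = measure (\<gamma> t) {0..<1}"
  have M: "0 \<le> M" by (simp add: M_def)
  \<comment> \<open>Positive majorants of \<open>L\<close> and of the mass, by which one can divide;
    \<open>e\<close> and \<open>w\<close> are then chosen such that each of the two terms is at most
    a third of \<epsilon>.\<close>
  obtain K where K: "K > 0" "L \<le> K" by (rule that[of "L + 1"]) (use L in auto)
  obtain M' where M': "M' > 0" "M \<le> M'" by (rule that[of "M + 1"]) (use M in auto)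
  define e where "e = \<epsilon> / (3 * K * M')"
  define w where "w = e * \<epsilon> / (3 * K)"
  have e: "e > 0" using \<epsilon> K M' by (simp add: e_def)
  have w: "w > 0" using \<epsilon> K e by (simp add: w_def)
  have b: "L * (e * M + w / e) < \<epsilon>"
  proof -
    have "K * (e * M') = \<epsilon> / 3" using K M' by (simp add: e_def)
    moreover have "L * (e * M) \<le> K * (e * M')" using K M' M e by (intro mult_mono) auto
    moreover have "K * (w / e) = \<epsilon> / 3" using K e by (simp add: w_def)
    moreover have "L * (w / e) \<le> K * (w / e)" using w e K by (intro mult_right_mono) auto
    moreover have "L * (e * M + w / e) = L * (e * M) + L * (w / e)" by (rule distrib_left)
    ultimately show ?thesis using \<epsilon> by linarith
  qed
  have "\<forall>\<^sub>F s in at t within {-T..T}. W_per_sq (\<gamma> s) (\<gamma> t) < ennreal w"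
    using t'(3) w by (intro order_tendstoD(2)) auto
  then show "\<forall>\<^sub>F s in at t within {-T..T}. dist (\<integral>x. f x \<partial>\<gamma> s) (\<integral>x. f x \<partial>\<gamma> t) < \<epsilon>"
  proof eventually_elim
    case (elim s)
    have "\<bar>(\<integral>x. f x \<partial>\<gamma> s) - (\<integral>x. f x \<partial>\<gamma> t)\<bar> \<le> L * (e * measure (\<gamma> t) {0..<1} + w / e)"
      by (rule lip_integral_diff_le_W[OF t'(1,2) elim f e less_imp_le[OF w]])
    then show ?case using b by (simp add: M_def dist_real_def)
  qed
qed

text \<open>The two curves agree at almost every time, and every time, the end times included, is a
  limit of such times. Lipschitz integrals pass to the limit and determine the measure
  there.\<close>

lemma continuous_slices_unique:
  assumes T: "T > 0" and fin: "finite_measure \<mu>" and \<gamma>: "continuous_slices T \<mu> \<gamma>" and \<gamma>': "continuous_slices T \<mu> \<gamma>'"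
    and t: "t \<in> {-T..T}"
  shows "\<gamma> t = \<gamma>' t"
proof -
  have "AE s in lborel. s \<in> {-T<..<T} \<longrightarrow> \<gamma> s = \<gamma>' s"
    using disintegration_unique[OF fin] \<gamma> \<gamma>' unfolding continuous_slices_def by blast
  then obtain N where N: "\<And>s. s \<in> space lborel - N \<Longrightarrow> s \<in> {-T<..<T} \<longrightarrow> \<gamma> s = \<gamma>' s" "N \<in> null_sets lborel"
    by (rule AE_E3) blast
  \<comment> \<open>\<open>t\<close> itself is excluded because the limit at \<open>t\<close> is
    taken over punctured neighbourhoods.\<close>
  have "N \<union> {t} \<in> null_sets lborel" using N(2) by (intro null_sets.Un) auto
  from null_set_dense_sequence[OF this T t]
  obtain s :: "nat \<Rightarrow> real" where s: "\<And>n. s n \<in> {-T<..<T} - (N \<union> {t})" "s \<longlonglongrightarrow> t" by blast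
  have fl: "filterlim s (at t within {-T..T}) sequentially"
  proof -
    have "s n \<in> {-T..T} \<and> s n \<noteq> t" for n using s(1)[of n] by auto
    then show ?thesis unfolding filterlim_at using s(2) by (simp only: eventually_True simp_thms)
  qed
  show ?thesis
  proof (rule torus_measure_eqI_lip)
    show "sets (\<gamma> t) = sets torus" "finite_measure (\<gamma> t)" "sets (\<gamma>' t) = sets torus" "finite_measure (\<gamma>' t)"
      using \<gamma> \<gamma>' t unfolding continuous_slices_def by auto
    fix L f assume f: "lip_per L f"
    have 1: "(\<lambda>n. \<integral>x. f x \<partial>\<gamma> (s n)) \<longlonglongrightarrow> (\<integral>x. f x \<partial>\<gamma> t)"
      by (rule filterlim_compose[OF continuous_slices_tendsto[OF \<gamma> t f] fl])
    have 2: "(\<lambda>n. \<integral>x. f x \<partial>\<gamma>' (s n)) \<longlonglongrightarrow> (\<integral>x. f x \<partial>\<gamma>' t)"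
      by (rule filterlim_compose[OF continuous_slices_tendsto[OF \<gamma>' t f] fl])
    have "\<gamma> (s n) = \<gamma>' (s n)" for n using N(1)[of "s n"] s(1)[of n] by auto
    then show "(\<integral>x. f x \<partial>\<gamma> t) = (\<integral>x. f x \<partial>\<gamma>' t)" using LIMSEQ_unique[OF 1] 2 by simp
  qed
qed

lemma slice_eq:
  assumes T: "T > 0" and fin: "finite_measure \<mu>" and \<gamma>: "continuous_slices T \<mu> \<gamma>" and t: "t \<in> {-T..T}"
  shows "slice T \<mu> t = \<gamma> t"
  unfolding slice_def
proof (rule the_equality)
  show "\<exists>\<gamma>'. continuous_slices T \<mu> \<gamma>' \<and> \<gamma> t = \<gamma>' t" using \<gamma> by blast
  fix \<nu> assume "\<exists>\<gamma>'. continuous_slices T \<mu> \<gamma>' \<and> \<nu> = \<gamma>' t"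
  then show "\<nu> = \<gamma> t" using continuous_slices_unique[OF T fin \<gamma> _ t] by auto
qed

context flux_kernel
begin

text \<open>At every time in the closed interval a weak limit of slices at good times is chosen. The
  estimate against all good slices survives the limit, and comparison through good times close to
  \<open>s\<close> gives it for arbitrary pairs. At a good time, the estimate with equal times
  forces \<gamma> and \<kappa> to coincide.\<close>

lemma lip_controlled_extension:
  "\<exists>\<gamma>. lip_controlled T \<gamma> flux_var \<and> (AE t\<in>{-T<..<T} in lborel. \<gamma> t = \<kappa> t)"
proof -
  obtain N where N: "N \<in> null_sets lborel" "\<And>s t L f. s \<in> {-T<..<T} - N \<Longrightarrow> t \<in> {-T<..<T} - N \<Longrightarrow> lip_per L f \<Longrightarrow>
      \<bar>(\<integral>x. f x \<partial>\<kappa> t) - (\<integral>x. f x \<partial>\<kappa> s)\<bar> \<le> L * \<bar>flux_var t - flux_var s\<bar>"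
    using lip_per_slice_difference by blast
  have fv: "(\<lambda>n. flux_var (s n)) \<longlonglongrightarrow> flux_var t" if "s \<longlonglongrightarrow> t" for s :: "nat \<Rightarrow> real" and t
    using continuous_on_tendsto_compose[OF continuous_flux_var that] by simp
  have "\<exists>\<rho>. torus_prob \<rho> \<and> (\<forall>s\<in>{-T<..<T} - N. \<forall>L f. lip_per L f \<longrightarrow>
      \<bar>(\<integral>x. f x \<partial>\<rho>) - (\<integral>x. f x \<partial>\<kappa> s)\<bar> \<le> L * \<bar>flux_var t - flux_var s\<bar>)" if t: "t \<in> {-T..T}" for t
  proof -
    obtain q :: "nat \<Rightarrow> real" where q: "\<And>n. q n \<in> {-T<..<T} - N" "q \<longlonglongrightarrow> t"
      using null_set_dense_sequence[OF N(1) T t] by blast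
    have "torus_prob (\<kappa> (q n))" for n using torus_kernel_prob[OF \<kappa>] q(1)[of n] by blast
    from torus_prob_convergent_subsequence[of "\<lambda>n. \<kappa> (q n)", OF this]
    obtain r :: "nat \<Rightarrow> nat" and \<rho> where r: "strict_mono r" "torus_prob \<rho>"
      "\<And>L f. lip_per L f \<Longrightarrow> (\<lambda>n. \<integral>x. f x \<partial>\<kappa> (q (r n))) \<longlonglongrightarrow> (\<integral>x. f x \<partial>\<rho>)" by blast
    have qr: "(\<lambda>n. q (r n)) \<longlonglongrightarrow> t" using LIMSEQ_subseq_LIMSEQ[OF q(2) r(1)] by (simp add: comp_def)
    have "\<bar>(\<integral>x. f x \<partial>\<rho>) - (\<integral>x. f x \<partial>\<kappa> s)\<bar> \<le> L * \<bar>flux_var t - flux_var s\<bar>"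
      if s: "s \<in> {-T<..<T} - N" and f: "lip_per L f" for s L f
    proof (rule LIMSEQ_le)
      show "(\<lambda>n. \<bar>(\<integral>x. f x \<partial>\<kappa> (q (r n))) - (\<integral>x. f x \<partial>\<kappa> s)\<bar>) \<longlonglongrightarrow> \<bar>(\<integral>x. f x \<partial>\<rho>) - (\<integral>x. f x \<partial>\<kappa> s)\<bar>"
        by (intro tendsto_rabs tendsto_diff r(3)[OF f] tendsto_const)
      show "(\<lambda>n. L * \<bar>flux_var (q (r n)) - flux_var s\<bar>) \<longlonglongrightarrow> L * \<bar>flux_var t - flux_var s\<bar>"
        by (intro tendsto_mult tendsto_rabs tendsto_diff fv[OF qr] tendsto_const)
      show "\<exists>N. \<forall>n\<ge>N. \<bar>(\<integral>x. f x \<partial>\<kappa> (q (r n))) - (\<integral>x. f x \<partial>\<kappa> s)\<bar> \<le> L * \<bar>flux_var (q (r n)) - flux_var s\<bar>"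
        using N(2)[OF s q(1) f] by blast
    qed
    then show ?thesis using r(2) by blast
  qed
  then obtain \<gamma> where \<gamma>: "\<And>t. t \<in> {-T..T} \<Longrightarrow> torus_prob (\<gamma> t)"
    "\<And>s t L f. t \<in> {-T..T} \<Longrightarrow> s \<in> {-T<..<T} - N \<Longrightarrow> lip_per L f \<Longrightarrow>
      \<bar>(\<integral>x. f x \<partial>\<gamma> t) - (\<integral>x. f x \<partial>\<kappa> s)\<bar> \<le> L * \<bar>flux_var t - flux_var s\<bar>"
    by metis
  have "lip_controlled T \<gamma> flux_var"
    unfolding lip_controlled_def
  proof (intro conjI ballI allI impI)
    show "torus_prob (\<gamma> t)" if "t \<in> {-T..T}" for t by (rule \<gamma>(1)[OF that])
    show "continuous_on {-T..T} flux_var" by (rule continuous_on_subset[OF continuous_flux_var]) simp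
    fix s t L f assume st: "s \<in> {-T..T}" "t \<in> {-T..T}" and f: "lip_per L f"
    obtain q :: "nat \<Rightarrow> real" where q: "\<And>n. q n \<in> {-T<..<T} - N" "q \<longlonglongrightarrow> s"
      using null_set_dense_sequence[OF N(1) T st(1)] by blast
    show "\<bar>(\<integral>x. f x \<partial>\<gamma> t) - (\<integral>x. f x \<partial>\<gamma> s)\<bar> \<le> L * \<bar>flux_var t - flux_var s\<bar>"
    proof (rule LIMSEQ_le_const)
      show "(\<lambda>n. L * \<bar>flux_var t - flux_var (q n)\<bar> + L * \<bar>flux_var s - flux_var (q n)\<bar>) \<longlonglongrightarrow> L * \<bar>flux_var t - flux_var s\<bar>"
        using tendsto_add[OF tendsto_mult[OF tendsto_const[of L] tendsto_rabs[OF tendsto_diff[OF tendsto_const[of "flux_var t"] fv[OF q(2)]]]]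
            tendsto_mult[OF tendsto_const[of L] tendsto_rabs[OF tendsto_diff[OF tendsto_const[of "flux_var s"] fv[OF q(2)]]]]]
        by simp
      show "\<exists>N. \<forall>n\<ge>N. \<bar>(\<integral>x. f x \<partial>\<gamma> t) - (\<integral>x. f x \<partial>\<gamma> s)\<bar> \<le> L * \<bar>flux_var t - flux_var (q n)\<bar> + L * \<bar>flux_var s - flux_var (q n)\<bar>"
      proof (intro exI allI impI)
        fix n
        show "\<bar>(\<integral>x. f x \<partial>\<gamma> t) - (\<integral>x. f x \<partial>\<gamma> s)\<bar> \<le> L * \<bar>flux_var t - flux_var (q n)\<bar> + L * \<bar>flux_var s - flux_var (q n)\<bar>"
          using \<gamma>(2)[OF st(2) q(1)[of n] f] \<gamma>(2)[OF st(1) q(1)[of n] f] by linarith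
      qed
    qed
  qed
  moreover have "AE t\<in>{-T<..<T} in lborel. \<gamma> t = \<kappa> t"
    using AE_not_in[OF N(1)]
  proof eventually_elim
    case (elim t)
    show ?case
    proof
      assume t: "t \<in> {-T<..<T}"
      then have t': "t \<in> {-T..T}" "t \<in> {-T<..<T} - N" using elim by auto
      show "\<gamma> t = \<kappa> t"
      proof (rule torus_measure_eqI_lip)
        show "sets (\<gamma> t) = sets torus" "finite_measure (\<gamma> t)" using torus_probD[OF \<gamma>(1)[OF t'(1)]] by auto
        show "sets (\<kappa> t) = sets torus" "finite_measure (\<kappa> t)" using torus_probD[OF torus_kernel_prob[OF \<kappa> t]] by auto
        show "(\<integral>x. f x \<partial>\<gamma> t) = (\<integral>x. f x \<partial>\<kappa> t)" if f: "lip_per L f" for L f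
          using \<gamma>(2)[OF t' f] by simp
      qed
    qed
  qed
  ultimately show ?thesis by blast
qed

text \<open>The extension built from the present flux and the given curve are continuous
  representatives of the same measure, hence equal. The curve can therefore stay fixed while the
  flux is varied.\<close>

lemma lip_controlled_flux_var:
  assumes \<kappa>': "lip_controlled T \<kappa> \<Omega>"
  shows "lip_controlled T \<kappa> flux_var"
proof -
  obtain \<gamma> where \<gamma>: "lip_controlled T \<gamma> flux_var" "AE t\<in>{-T<..<T} in lborel. \<gamma> t = \<kappa> t"
    using lip_controlled_extension by blast
  have "of_kernel T \<kappa> = of_kernel T \<gamma>"
  proof (rule disintegration_imp_of_kernel[OF T lip_controlled_kernel[OF \<gamma>(1)] sets_\<mu>])
    have "disintegration T \<mu> \<kappa>" by (rule disintegration_of_kernel[OF T \<kappa>])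
    moreover have "disintegration T (of_kernel T \<gamma>) \<gamma>"
      by (rule disintegration_of_kernel[OF T lip_controlled_kernel[OF \<gamma>(1)]])
    moreover have "(\<integral>\<^sup>+t\<in>{-T<..<T}. emeasure (\<kappa> t) (A t) \<partial>lborel) = (\<integral>\<^sup>+t\<in>{-T<..<T}. emeasure (\<gamma> t) (A t) \<partial>lborel)" for A
    proof (rule nn_integral_cong_AE)
      show "AE t in lborel. emeasure (\<kappa> t) (A t) * indicator {-T<..<T} t = emeasure (\<gamma> t) (A t) * indicator {-T<..<T} t"
        using \<gamma>(2) by eventually_elim (auto split: split_indicator)
    qed
    ultimately show "disintegration T \<mu> \<gamma>"
      unfolding disintegration_def by simp
  qed
  then have "continuous_slices T \<mu> \<gamma>" using lip_controlled_continuous_slices[OF T \<gamma>(1)] by simp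
  then have eq: "\<kappa> t = \<gamma> t" if "t \<in> {-T..T}" for t
    using continuous_slices_unique[OF T M.finite_measure_axioms lip_controlled_continuous_slices[OF T \<kappa>']] that by blast
  show ?thesis using \<gamma>(1) unfolding lip_controlled_def by (simp add: eq)
qed

end

subsection \<open>Atoms\<close>

text \<open>The weights are positive, so the index set in the definition of \<open>atomic\<close> is
  forced to be the set of atoms.\<close>

lemma atomicE:
  assumes "atomic \<rho>"
  obtains S \<phi> where "sets \<rho> = sets torus" "countable S" "S \<subseteq> {0..<1}" "\<And>x. x \<in> S \<Longrightarrow> \<phi> x > (0::real)" "atoms \<rho> = S"
    "\<And>A. A \<in> sets torus \<Longrightarrow> emeasure \<rho> A = (\<integral>\<^sup>+x. ennreal (\<phi> x) * indicator A x \<partial>count_space S)"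
proof -
  obtain S \<phi> where S: "sets \<rho> = sets torus" "countable S" "S \<subseteq> {0..<1}" "\<And>x. x \<in> S \<Longrightarrow> \<phi> x > (0::real)"
    "\<And>A. A \<in> sets torus \<Longrightarrow> emeasure \<rho> A = (\<integral>\<^sup>+x. ennreal (\<phi> x) * indicator A x \<partial>count_space S)"
    using assms unfolding atomic_def by blast
  have sp: "space \<rho> = {0..<1}" using sets_eq_imp_space_eq[OF S(1)] by simp
  have "emeasure \<rho> {x} > 0 \<longleftrightarrow> x \<in> S" if x: "x \<in> {0..<1}" for x
  proof -
    have e: "emeasure \<rho> {x} = (\<integral>\<^sup>+y. ennreal (\<phi> y) * indicator {x} y \<partial>count_space S)"
      using x by (intro S(5)) (simp add: sets_torus)
    have "emeasure \<rho> {x} = 0 \<longleftrightarrow> (\<forall>y\<in>S. ennreal (\<phi> y) * indicator {x} y = 0)"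
      unfolding e by (subst nn_integral_0_iff_AE) (auto simp: AE_count_space)
    also have "\<dots> \<longleftrightarrow> x \<notin> S"
      using S(4)[of x] by (auto simp: indicator_def ennreal_eq_0_iff)
    finally show ?thesis by (auto simp: zero_less_iff_neq_zero)
  qed
  then have "atoms \<rho> = S" using S(3) by (auto simp: atoms_def sp)
  then show thesis using that S by blast
qed

lemma atomic_positive_contains_atom:
  assumes \<rho>: "atomic \<rho>" and A: "A \<in> sets torus" "emeasure \<rho> A > 0"
  shows "\<exists>x\<in>A. x \<in> atoms \<rho>"
proof (rule ccontr)
  assume no: "\<not> (\<exists>x\<in>A. x \<in> atoms \<rho>)"
  obtain S \<phi> where S: "atoms \<rho> = S"
    "emeasure \<rho> A = (\<integral>\<^sup>+x. ennreal (\<phi> x) * indicator A x \<partial>count_space S)"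
    using atomicE[OF \<rho>] A(1) by metis
  have "emeasure \<rho> A = (\<integral>\<^sup>+x. 0 \<partial>count_space S)"
    unfolding S(2) using no S(1) by (intro nn_integral_cong) (auto split: split_indicator)
  then show False using A(2) by simp
qed

abbreviation grid_interval :: "nat \<Rightarrow> nat \<Rightarrow> real set" where
  "grid_interval n k \<equiv> {real k / real (Suc n)..<real (Suc k) / real (Suc n)}"

text \<open>A version of the number of atoms that depends measurably on the measure.\<close>

definition atom_count :: "real measure \<Rightarrow> ennreal" where
  "atom_count \<rho> = (SUP n. \<Sum>k<Suc n. if emeasure \<rho> (grid_interval n k) > 0 then 1 else 0)"

lemma grid_interval_sets: "k < Suc n \<Longrightarrow> grid_interval n k \<in> sets torus"
proof -
  assume k: "k < Suc n"
  then have "real (Suc k) / real (Suc n) \<le> 1" by simp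
  then show ?thesis by (auto simp: sets_torus simp del: of_nat_Suc)
qed

lemma grid_interval_iff:
  "x \<in> grid_interval n k \<longleftrightarrow> \<lfloor>real (Suc n) * x\<rfloor> = int k"
proof -
  have "x \<in> grid_interval n k \<longleftrightarrow> real k \<le> real (Suc n) * x \<and> real (Suc n) * x < real k + 1"
    by (simp add: divide_le_eq less_divide_eq mult.commute del: of_nat_Suc) auto
  also have "\<dots> \<longleftrightarrow> \<lfloor>real (Suc n) * x\<rfloor> = int k"
    by (simp add: floor_eq_iff)
  finally show ?thesis .
qed

text \<open>Every charged interval of a grid contains an atom, and the intervals of one grid are
  disjoint, so no grid counts too many. Conversely, finitely many atoms lie in different intervals
  once the mesh is below their minimal distance.\<close>

lemma num_atoms_eq_atom_count:
  assumes \<rho>: "atomic \<rho>"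
  shows "num_atoms \<rho> = atom_count \<rho>"
proof (rule antisym)
  obtain S \<phi> where S: "sets \<rho> = sets torus" "S \<subseteq> {0..<1}" "atoms \<rho> = S"
    using atomicE[OF \<rho>] by metis
  let ?K = "\<lambda>n. {k. k < Suc n \<and> emeasure \<rho> (grid_interval n k) > 0}"
  have sum: "(\<Sum>k<Suc n. if emeasure \<rho> (grid_interval n k) > 0 then 1 else 0) = (of_nat (card (?K n)) :: ennreal)" for n
  proof -
    have "(\<Sum>k<Suc n. if emeasure \<rho> (grid_interval n k) > 0 then 1 else 0) = (\<Sum>k\<in>?K n. 1 :: ennreal)"
      by (intro sum.mono_neutral_cong_right) auto
    then show ?thesis by simp
  qed
  show "atom_count \<rho> \<le> num_atoms \<rho>"
    unfolding atom_count_def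
  proof (rule SUP_least)
    fix n
    show "(\<Sum>k<Suc n. if emeasure \<rho> (grid_interval n k) > 0 then 1 else 0) \<le> num_atoms \<rho>"
    proof (cases "finite (atoms \<rho>)")
      case False
      then show ?thesis by (simp add: num_atoms_def)
    next
      case True
      have "\<forall>k\<in>?K n. \<exists>x. x \<in> grid_interval n k \<and> x \<in> atoms \<rho>"
        using atomic_positive_contains_atom[OF \<rho> grid_interval_sets] by blast
      from bchoice[OF this] obtain f
        where f: "\<And>k. k \<in> ?K n \<Longrightarrow> f k \<in> grid_interval n k \<and> f k \<in> atoms \<rho>"
        by blast
      have "inj_on f (?K n)"
      proof (rule inj_onI)
        fix j k assume "j \<in> ?K n" "k \<in> ?K n" "f j = f k"
        then have "int j = int k" using f[of j] f[of k] unfolding grid_interval_iff by metis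
        then show "j = k" by simp
      qed
      then have "card (?K n) \<le> card (atoms \<rho>)"
        using f True by (intro card_inj_on_le[of f]) auto
      then show ?thesis unfolding sum num_atoms_def using True by simp
    qed
  qed
  have ge: "of_nat (card F) \<le> atom_count \<rho>" if F: "finite F" "F \<subseteq> atoms \<rho>" for F
  proof -
    have sub: "F \<subseteq> {0..<1}" using F S by simp
    obtain d where d: "d > 0" "\<And>x y. x \<in> F \<Longrightarrow> y \<in> F \<Longrightarrow> x \<noteq> y \<Longrightarrow> d \<le> dist x y"
    proof -
      have fin: "finite ((\<lambda>(x, y). dist x y) ` {(x, y). x \<in> F \<and> y \<in> F \<and> x \<noteq> y})"
        by (rule finite_imageI, rule finite_subset[of _ "F \<times> F"]) (use F in auto)
      let ?D = "insert 1 ((\<lambda>(x, y). dist x y) ` {(x, y). x \<in> F \<and> y \<in> F \<and> x \<noteq> y})"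
      have "0 < Min ?D" using fin by (subst Min_gr_iff) auto
      moreover have "Min ?D \<le> dist x y" if "x \<in> F" "y \<in> F" "x \<noteq> y" for x y
        using fin that by (intro Min_le) auto
      ultimately show thesis using that by blast
    qed
    obtain n where n: "inverse (real (Suc n)) < d" using d(1) reals_Archimedean by blast
    have n': "1 < d * real (Suc n)" using n by (simp add: inverse_eq_divide divide_less_eq del: of_nat_Suc)
    let ?g = "\<lambda>x. nat \<lfloor>real (Suc n) * x\<rfloor>"
    have int: "int (?g x) = \<lfloor>real (Suc n) * x\<rfloor>" if "x \<in> F" for x
      using that sub by (auto simp del: of_nat_Suc)
    have mem: "x \<in> grid_interval n (?g x)" if "x \<in> F" for x
      unfolding grid_interval_iff by (simp only: int[OF that])
    have lt: "?g x < Suc n" if "x \<in> F" for x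
    proof -
      have "real (Suc n) * x < real (Suc n) * 1" using that sub by (intro mult_strict_left_mono) auto
      then have "\<lfloor>real (Suc n) * x\<rfloor> < int (Suc n)" by (simp add: floor_less_iff del: of_nat_Suc)
      then show ?thesis using int[OF that] by linarith
    qed
    have "?g ` F \<subseteq> ?K n"
    proof
      fix k assume "k \<in> ?g ` F"
      then obtain x where x: "x \<in> F" "k = ?g x" by blast
      have k: "k < Suc n" using lt[OF x(1)] x(2) by simp
      have "0 < emeasure \<rho> {x}" using x(1) F(2) by (auto simp: atoms_def)
      also have "\<dots> \<le> emeasure \<rho> (grid_interval n k)"
        using mem[OF x(1)] x(2) grid_interval_sets[OF k] S(1) by (intro emeasure_mono) auto
      finally show "k \<in> ?K n" using k by simp
    qed
    moreover have "inj_on ?g F"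
    proof (rule inj_onI, rule ccontr)
      fix x y assume xy: "x \<in> F" "y \<in> F" "?g x = ?g y" "x \<noteq> y"
      have "int (?g x) = int (?g y)" using xy(3) by (simp only:)
      then have "\<lfloor>real (Suc n) * x\<rfloor> = \<lfloor>real (Suc n) * y\<rfloor>" unfolding int[OF xy(1)] int[OF xy(2)] .
      then have "\<bar>real (Suc n) * x - real (Suc n) * y\<bar> < 1" by linarith
      then have "real (Suc n) * \<bar>x - y\<bar> < 1" by (simp add: abs_mult flip: right_diff_distrib del: of_nat_Suc)
      moreover have "real (Suc n) * d \<le> real (Suc n) * \<bar>x - y\<bar>"
        using d(2)[OF xy(1,2,4)] by (intro mult_left_mono) (auto simp: dist_real_def)
      moreover have "1 < real (Suc n) * d" using n' by (simp only: mult.commute)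
      ultimately show False by linarith
    qed
    ultimately have "card F \<le> card (?K n)" by (intro card_inj_on_le[of ?g]) auto
    then have "(of_nat (card F) :: ennreal) \<le> of_nat (card (?K n))" by simp
    also have "\<dots> \<le> atom_count \<rho>" unfolding atom_count_def sum[symmetric] by (intro SUP_upper) simp
    finally show ?thesis .
  qed
  show "num_atoms \<rho> \<le> atom_count \<rho>"
  proof (cases "finite (atoms \<rho>)")
    case True
    then show ?thesis using ge[OF True] by (simp add: num_atoms_def)
  next
    case False
    have "of_nat m \<le> atom_count \<rho>" for m
    proof -
      obtain F where "finite F" "card F = m" "F \<subseteq> atoms \<rho>"
        using infinite_arbitrarily_large[OF False] by blast
      then show ?thesis using ge[of F] by simp
    qed
    then have "(SUP m. of_nat m) \<le> atom_count \<rho>" by (rule SUP_least)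
    then show ?thesis by (simp add: ennreal_SUP_of_nat_eq_top top_unique)
  qed
qed

lemma measurable_atom_count:
  assumes "torus_kernel T \<kappa>"
  shows "(\<lambda>t. atom_count (\<kappa> t)) \<in> borel_measurable (time_space T)"
  unfolding atom_count_def
proof (intro borel_measurable_SUP countableI_type borel_measurable_sum)
  fix n k assume "k \<in> {..<Suc n}"
  then have [measurable]: "(\<lambda>t. emeasure (\<kappa> t) (grid_interval n k)) \<in> borel_measurable (time_space T)"
    by (intro measurable_emeasure_kernel[OF torus_kernel_subprob[OF assms]] grid_interval_sets) simp
  show "(\<lambda>t. if emeasure (\<kappa> t) (grid_interval n k) > 0 then 1 else 0 :: ennreal) \<in> borel_measurable (time_space T)"
    by measurable
qed

section \<open>Weak limits of measures with boundedly many atoms\<close>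

lemma dist_per_triangle: "dist_per x z \<le> dist_per x y + dist_per y z"
proof -
  obtain j k :: int where "dist_per x y = \<bar>x - y - of_int j\<bar>" "dist_per y z = \<bar>y - z - of_int k\<bar>"
    using dist_per_int by metis
  then show ?thesis using dist_per_le_int[of x z "j + k"] by simp
qed

lemma dist_per_pos:
  assumes "x \<in> {0..<1}" "y \<in> {0..<1}" "x \<noteq> y"
  shows "0 < dist_per x y"
proof (rule ccontr)
  assume "\<not> 0 < dist_per x y"
  then have 0: "dist_per x y = 0" using dist_per_nonneg[of x y] by linarith
  obtain k :: int where "dist_per x y = \<bar>x - y - of_int k\<bar>" using dist_per_int by blast
  then have k: "x - y = of_int k" using 0 by simp
  have "\<bar>real_of_int k\<bar> < 1" using assms k[symmetric] by auto
  then have "k = 0" by linarith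
  then show False using k assms by simp
qed

text \<open>\<open>S\<close> is the support of the limit, expressed with bumps so that weak
  convergence applies. Disjoint balls around finitely many of its points are eventually all charged
  by the approximating measures, and each such ball contains an atom; so \<open>S\<close> has at
  most \<open>M\<close> points. The rest of the torus is covered by null balls, countably many by
  Lindelof, and only a finite sum of point masses is left.\<close>

lemma weak_limit_finitely_many_atoms:
  assumes \<rho>: "torus_prob \<rho>" and \<rho>': "\<And>n::nat. atomic (\<rho>' n)" "\<And>n. num_atoms (\<rho>' n) \<le> of_nat M"
    and lim: "\<And>L f. lip_per L f \<Longrightarrow> (\<lambda>n. \<integral>x. f x \<partial>\<rho>' n) \<longlonglongrightarrow> (\<integral>x. f x \<partial>\<rho>)"
  shows "atomic \<rho> \<and> finite (atoms \<rho>)"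
proof -
  let ?b = "\<lambda>r x y. max 0 (r - dist_per y x)"
  note sp = torus_probD[OF \<rho>]
  define S where "S = {x\<in>{0..<1}. \<forall>r>0. 0 < (\<integral>y. ?b r x y \<partial>\<rho>)}"
  have small: "card F \<le> M" if F: "finite F" "F \<subseteq> S" for F
  proof -
    \<comment> \<open>Points of \<open>F\<close> are at least \<open>2 * r\<close> apart, so an atom
      within \<open>r\<close> of one of them is not within \<open>r\<close> of another.\<close>
    obtain r where r: "r > 0" "\<And>x y. x \<in> F \<Longrightarrow> y \<in> F \<Longrightarrow> x \<noteq> y \<Longrightarrow> 2 * r \<le> dist_per x y"
    proof -
      have fin: "finite ((\<lambda>(x, y). dist_per x y) ` {(x, y). x \<in> F \<and> y \<in> F \<and> x \<noteq> y})"
        by (rule finite_imageI, rule finite_subset[of _ "F \<times> F"]) (use F in auto)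
      let ?D = "insert 1 ((\<lambda>(x, y). dist_per x y) ` {(x, y). x \<in> F \<and> y \<in> F \<and> x \<noteq> y})"
      have pos: "0 < Min ?D"
        using fin F(2) by (subst Min_gr_iff) (auto intro!: dist_per_pos simp: S_def)
      have "Min ?D \<le> dist_per x y" if "x \<in> F" "y \<in> F" "x \<noteq> y" for x y
        using fin that by (intro Min_le) auto
      then show thesis using pos by (intro that[of "Min ?D / 2"]) auto
    qed
    have "\<forall>x\<in>F. eventually (\<lambda>n. 0 < (\<integral>y. ?b r x y \<partial>\<rho>' n)) sequentially"
    proof
      fix x assume "x \<in> F"
      then have "0 < (\<integral>y. ?b r x y \<partial>\<rho>)" using F(2) r(1) by (auto simp: S_def)
      then show "eventually (\<lambda>n. 0 < (\<integral>y. ?b r x y \<partial>\<rho>' n)) sequentially"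
        by (rule order_tendstoD(1)[OF lim[OF lip_per_bump]])
    qed
    then have "eventually (\<lambda>n. \<forall>x\<in>F. 0 < (\<integral>y. ?b r x y \<partial>\<rho>' n)) sequentially"
      using F(1) by (simp add: eventually_ball_finite)
    then obtain n where n: "\<And>x. x \<in> F \<Longrightarrow> 0 < (\<integral>y. ?b r x y \<partial>\<rho>' n)"
      by (auto simp: eventually_sequentially)
    have fin: "finite (atoms (\<rho>' n))"
    proof (rule ccontr)
      assume "infinite (atoms (\<rho>' n))"
      then show False using \<rho>'(2)[of n] by (simp add: num_atoms_def top_unique)
    qed
    have card: "card (atoms (\<rho>' n)) \<le> M"
      using \<rho>'(2)[of n] fin by (simp add: num_atoms_def)
    have "\<exists>y. y \<in> atoms (\<rho>' n) \<and> dist_per y x < r" if x: "x \<in> F" for x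
    proof (rule ccontr)
      assume no: "\<not> (\<exists>y. y \<in> atoms (\<rho>' n) \<and> dist_per y x < r)"
      have s: "sets (\<rho>' n) = sets torus" using \<rho>'(1)[of n] by (simp add: atomic_def)
      have spn: "space (\<rho>' n) = {0..<1}" using sets_eq_imp_space_eq[OF s] by simp
      have dm: "(\<lambda>y. dist_per y x) \<in> borel_measurable borel"
        unfolding dist_per_def by (intro borel_measurable_continuous_onI continuous_intros)
      have "{0..<1} \<inter> {y\<in>space borel. dist_per y x < r} \<in> sets borel"
        by (intro sets.Int borel_measurable_less dm borel_measurable_const) simp
      moreover have "{0..<1} \<inter> {y\<in>space borel. dist_per y x < r} = {y\<in>{0..<1}. dist_per y x < r}"
        by auto
      ultimately have A: "{y\<in>{0..<1}. dist_per y x < r} \<in> sets torus"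
        unfolding sets_torus by auto
      have "emeasure (\<rho>' n) {y\<in>{0..<1}. dist_per y x < r} = 0"
      proof (rule ccontr)
        assume "emeasure (\<rho>' n) {y\<in>{0..<1}. dist_per y x < r} \<noteq> 0"
        then have "0 < emeasure (\<rho>' n) {y\<in>{0..<1}. dist_per y x < r}" by (simp add: zero_less_iff_neq_zero)
        from atomic_positive_contains_atom[OF \<rho>'(1) A this] show False using no by blast
      qed
      then have "AE y in \<rho>' n. \<not> dist_per y x < r"
        using A by (intro AE_I'[of "{y\<in>{0..<1}. dist_per y x < r}"]) (auto simp: null_sets_def s spn)
      then have "(\<integral>y. ?b r x y \<partial>\<rho>' n) = 0"
        by (intro integral_eq_zero_AE) (auto elim!: eventually_mono)
      then show False using n[OF x] by simp
    qed
    then have "\<forall>x\<in>F. \<exists>y. y \<in> atoms (\<rho>' n) \<and> dist_per y x < r" by blast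
    from bchoice[OF this] obtain h where h: "\<And>x. x \<in> F \<Longrightarrow> h x \<in> atoms (\<rho>' n) \<and> dist_per (h x) x < r"
      by blast
    have "inj_on h F"
    proof (rule inj_onI, rule ccontr)
      fix x y assume xy: "x \<in> F" "y \<in> F" "h x = h y" "x \<noteq> y"
      have "dist_per x y \<le> dist_per x (h x) + dist_per (h x) y" by (rule dist_per_triangle)
      then have "dist_per x y < 2 * r"
        using h[OF xy(1)] h[OF xy(2)] xy(3) dist_per_commute[of x "h x"] by simp
      then show False using r(2)[OF xy(1,2,4)] by simp
    qed
    then have "card F \<le> card (atoms (\<rho>' n))"
      using h fin by (intro card_inj_on_le[of h]) auto
    then show ?thesis using card by simp
  qed
  have finS: "finite S"
  proof (rule ccontr)
    assume "infinite S"
    then obtain F where "finite F" "F \<subseteq> S" "card F = Suc M"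
      using infinite_arbitrarily_large by blast
    then show False using small[of F] by simp
  qed
  have S01: "S \<subseteq> {0..<1}" by (auto simp: S_def)
  have null: "{0..<1} - S \<in> null_sets \<rho>"
  proof -
    have "\<exists>r>0. ball x r \<inter> {0..<1} \<in> null_sets \<rho>" if x: "x \<in> {0..<1} - S" for x
    proof -
      obtain r where r: "r > 0" "\<not> 0 < (\<integral>y. ?b r x y \<partial>\<rho>)" using x by (auto simp: S_def)
      have i: "integrable \<rho> (?b r x)" by (rule lip_per_integrable[OF lip_per_bump sp(1,4)])
      have "0 \<le> (\<integral>y. ?b r x y \<partial>\<rho>)" by simp
      then have "(\<integral>y. ?b r x y \<partial>\<rho>) = 0" using r(2) by linarith
      then have "AE y in \<rho>. ?b r x y = 0"
        using integral_nonneg_eq_0_iff_AE[OF i] by simp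
      then have "AE y in \<rho>. y \<notin> ball x r \<inter> {0..<1}"
      proof eventually_elim
        case (elim y)
        then have "r \<le> dist_per y x" by (simp add: max_def split: if_splits)
        then show ?case using dist_per_le_abs[of y x] by (auto simp: dist_real_def)
      qed
      moreover have "ball x r \<inter> {0..<1} \<in> sets \<rho>" by (auto simp: sp(1) sets_torus)
      ultimately have "ball x r \<inter> {0..<1} \<in> null_sets \<rho>" by (simp add: AE_iff_null_sets)
      then show ?thesis using r(1) by blast
    qed
    then have "\<forall>x\<in>{0..<1} - S. \<exists>r. r > 0 \<and> ball x r \<inter> {0..<1} \<in> null_sets \<rho>" by blast
    from bchoice[OF this] obtain r
      where r: "\<And>x. x \<in> {0..<1} - S \<Longrightarrow> r x > 0 \<and> ball x (r x) \<inter> {0..<1} \<in> null_sets \<rho>"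
      by blast
    obtain F where F: "F \<subseteq> (\<lambda>x. ball x (r x)) ` ({0..<1} - S)" "countable F" "\<Union>F = (\<Union>x\<in>{0..<1} - S. ball x (r x))"
      using Lindelof[of "(\<lambda>x. ball x (r x)) ` ({0..<1} - S)"] by auto
    have n1: "(\<Union>B\<in>F. B \<inter> {0..<1}) \<in> null_sets \<rho>"
      using F(1,2) r by (intro null_sets_UN') auto
    have n2: "{0..<1} - S \<subseteq> (\<Union>B\<in>F. B \<inter> {0..<1})"
    proof
      fix x assume x: "x \<in> {0..<1} - S"
      then have "x \<in> \<Union>F" unfolding F(3) using r by force
      then show "x \<in> (\<Union>B\<in>F. B \<inter> {0..<1})" using x by auto
    qed
    have n3: "{0..<1} - S \<in> sets \<rho>"
    proof -
      have "S \<in> sets borel" by (rule sets.countable[OF _ countable_finite[OF finS]]) simp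
      then show ?thesis by (auto simp: sp(1) sets_torus)
    qed
    show ?thesis by (rule null_sets_subset[OF n1 n3 n2])
  qed
  have sing: "{x} \<in> sets \<rho>" if "x \<in> {0..<1}" for x using that by (simp add: sp(1) sets_torus)
  have at: "atoms \<rho> \<subseteq> S"
  proof
    fix x assume x: "x \<in> atoms \<rho>"
    show "x \<in> S"
    proof (rule ccontr)
      assume "x \<notin> S"
      then have "{x} \<in> null_sets \<rho>"
        using x sing by (intro null_sets_subset[OF null]) (auto simp: atoms_def sp(2))
      then show False using x by (auto simp: atoms_def)
    qed
  qed
  have fa: "finite (atoms \<rho>)" by (rule finite_subset[OF at finS])
  have "atomic \<rho>"
    unfolding atomic_def
  proof (intro conjI exI[of _ "atoms \<rho>"] exI[of _ "\<lambda>x. measure \<rho> {x}"] ballI)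
    interpret prob_space \<rho> by (rule sp(3))
    show "sets \<rho> = sets torus" by (rule sp(1))
    show "countable (atoms \<rho>)" using fa by (rule countable_finite)
    show sub: "atoms \<rho> \<subseteq> {0..<1}" by (auto simp: atoms_def sp(2))
    show "0 < measure \<rho> {x}" if "x \<in> atoms \<rho>" for x
      using that by (auto simp: atoms_def emeasure_eq_measure)
    fix A assume "A \<in> sets torus"
    then have A: "A \<in> sets \<rho>" by (simp add: sp(1))
    have nz: "emeasure \<rho> {x} = 0" if "x \<in> S" "x \<notin> atoms \<rho>" for x
      using that S01 by (auto simp: atoms_def sp(2) zero_less_iff_neq_zero)
    have SA: "A \<inter> S \<in> sets \<rho>"
    proof -
      have "S \<in> sets \<rho>" by (rule sets.countable[OF _ countable_finite[OF finS]]) (use sing S01 in auto)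
      then show ?thesis using A by auto
    qed
    have "emeasure \<rho> A = emeasure \<rho> (A \<inter> S)"
    proof (rule emeasure_eq_AE[OF _ A SA])
      show "AE x in \<rho>. x \<in> A \<longleftrightarrow> x \<in> A \<inter> S"
        using AE_not_in[OF null] by eventually_elim (use sets.sets_into_space[OF A] in \<open>auto simp: sp(2)\<close>)
    qed
    also have "\<dots> = (\<Sum>x\<in>A \<inter> S. emeasure \<rho> {x})"
      by (rule emeasure_eq_sum_singleton) (use finS sing S01 in auto)
    also have "\<dots> = (\<Sum>x\<in>A \<inter> atoms \<rho>. emeasure \<rho> {x})"
      by (rule sum.mono_neutral_right) (use finS at nz in auto)
    also have "\<dots> = (\<Sum>x\<in>atoms \<rho>. ennreal (measure \<rho> {x}) * indicator A x)"
      by (rule sum.mono_neutral_cong_left) (use fa in \<open>auto simp: emeasure_eq_measure indicator_def split: if_splits\<close>)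
    also have "\<dots> = (\<integral>\<^sup>+x. ennreal (measure \<rho> {x}) * indicator A x \<partial>count_space (atoms \<rho>))"
      using fa by (rule nn_integral_count_space_finite[symmetric])
    finally show "emeasure \<rho> A = (\<integral>\<^sup>+x. ennreal (measure \<rho> {x}) * indicator A x \<partial>count_space (atoms \<rho>))" .
  qed
  then show ?thesis using fa by blast
qed

subsection \<open>Competitors\<close>

lemma disintegration_AE_cong:
  assumes \<kappa>: "disintegration T \<mu> \<kappa>" and \<kappa>': "torus_kernel T \<kappa>'" and T: "T > 0"
    and eq: "AE t\<in>{-T<..<T} in lborel. \<kappa> t = \<kappa>' t"
  shows "disintegration T \<mu> \<kappa>'"
proof -
  have "(\<integral>\<^sup>+t\<in>{-T<..<T}. emeasure (\<kappa> t) (A t) \<partial>lborel) = (\<integral>\<^sup>+t\<in>{-T<..<T}. emeasure (\<kappa>' t) (A t) \<partial>lborel)" for A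
  proof (rule nn_integral_cong_AE)
    show "AE t in lborel. emeasure (\<kappa> t) (A t) * indicator {-T<..<T} t = emeasure (\<kappa>' t) (A t) * indicator {-T<..<T} t"
      using eq by eventually_elim (auto split: split_indicator)
  qed
  then show ?thesis
    using \<kappa> disintegration_of_kernel[OF T \<kappa>'] unfolding disintegration_def by simp
qed

lemma slices_of_kernel:
  assumes T: "T > 0" and \<kappa>: "torus_kernel T \<kappa>"
  shows "AE t\<in>{-T<..<T} in lborel. slices T (of_kernel T \<kappa>) t = \<kappa> t"
proof (rule disintegration_unique[OF finite_measure_of_kernel[OF T \<kappa>]])
  show d: "disintegration T (of_kernel T \<kappa>) \<kappa>" by (rule disintegration_of_kernel[OF T \<kappa>])
  show "disintegration T (of_kernel T \<kappa>) (slices T (of_kernel T \<kappa>))"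
    using someI[of "disintegration T (of_kernel T \<kappa>)" \<kappa>] d unfolding slices_def by blast
qed

lemma of_kernel_in_unit_A_star:
  assumes T: "T > 0" and \<kappa>: "torus_kernel T \<kappa>" and at: "AE t\<in>{-T<..<T} in lborel. atomic (\<kappa> t)"
    and m: "flux T (of_kernel T \<kappa>) m"
  shows "of_kernel T \<kappa> \<in> unit_A_star T"
proof -
  have "of_kernel T \<kappa> \<in> A_star T"
    unfolding A_star_def
    using sets_of_kernel[OF T \<kappa>] finite_measure_of_kernel[OF T \<kappa>] disintegration_of_kernel[OF T \<kappa>] at m by blast
  moreover have "AE t\<in>{-T<..<T} in lborel. emeasure (slices T (of_kernel T \<kappa>) t) (space torus) = 1"
    using slices_of_kernel[OF T \<kappa>]
  proof eventually_elim
    case (elim t)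
    show ?case
    proof
      assume t: "t \<in> {-T<..<T}"
      show "emeasure (slices T (of_kernel T \<kappa>) t) (space torus) = 1"
        using elim t torus_probD(5)[OF torus_kernel_prob[OF \<kappa> t]] by simp
    qed
  qed
  ultimately show ?thesis by (simp add: unit_A_star_def)
qed

text \<open>Mass 1 is known only for almost every time and only for the chosen version
  \<open>slices\<close>. Uniqueness of disintegrations transfers it to \<kappa>; after a repair on a
  null set, the flux yields a representative that is defined at every time.\<close>

lemma unit_A_star_curve:
  assumes T: "T > 0" and \<mu>: "\<mu> \<in> unit_A_star T"
  shows "\<exists>\<gamma> \<Omega> m. lip_controlled T \<gamma> \<Omega> \<and> \<mu> = of_kernel T \<gamma> \<and> (AE t\<in>{-T<..<T} in lborel. atomic (\<gamma> t)) \<and> flux T \<mu> m"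
proof -
  obtain \<kappa> m where \<kappa>: "sets \<mu> = sets (cylinder T)" "finite_measure \<mu>" "disintegration T \<mu> \<kappa>"
    "AE t\<in>{-T<..<T} in lborel. atomic (\<kappa> t)" "flux T \<mu> m"
    using \<mu> unfolding unit_A_star_def A_star_def by blast
  have u: "AE t\<in>{-T<..<T} in lborel. emeasure (slices T \<mu> t) (space torus) = 1"
    using \<mu> unfolding unit_A_star_def by blast
  have sl: "disintegration T \<mu> (slices T \<mu>)"
    using someI[of "disintegration T \<mu>" \<kappa>] \<kappa>(3) unfolding slices_def by blast
  have one: "AE t\<in>{-T<..<T} in lborel. emeasure (\<kappa> t) {0..<1} = 1"
    using disintegration_unique[OF \<kappa>(2,3) sl] u by eventually_elim simp
  \<comment> \<open>At the exceptional times of wrong mass some probability measure has to be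
    inserted, and Lebesgue measure keeps the kernel measurable.\<close>
  define \<kappa>' where "\<kappa>' t = (if emeasure (\<kappa> t) {0..<1} = 1 then \<kappa> t else torus_lebesgue)" for t
  have eq: "AE t\<in>{-T<..<T} in lborel. \<kappa> t = \<kappa>' t"
    using one by eventually_elim (simp add: \<kappa>'_def)
  have k': "torus_kernel T \<kappa>'"
  proof (rule torus_kernelI)
    fix t assume t: "t \<in> {-T<..<T}"
    show "torus_prob (\<kappa>' t)"
    proof (cases "emeasure (\<kappa> t) {0..<1} = 1")
      case True
      have s: "sets (\<kappa> t) = sets torus" using \<kappa>(3) t by (simp add: disintegration_def)
      then show ?thesis
        using True sets_eq_imp_space_eq[OF s] by (auto simp: \<kappa>'_def torus_prob_def intro!: prob_spaceI)
    next
      case False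
      then show ?thesis by (simp add: \<kappa>'_def torus_prob_torus_lebesgue)
    qed
  next
    fix A assume A: "A \<in> sets torus"
    have m: "(\<lambda>t. emeasure (\<kappa> t) B) \<in> borel_measurable (restrict_space borel {-T<..<T})" if "B \<in> sets torus" for B
      using \<kappa>(3) that by (simp add: disintegration_def)
    have [measurable]: "(\<lambda>t. emeasure (\<kappa> t) A) \<in> borel_measurable (restrict_space borel {-T<..<T})"
      "(\<lambda>t. emeasure (\<kappa> t) {0..<1}) \<in> borel_measurable (restrict_space borel {-T<..<T})"
      by (rule m[OF A], rule m) (simp add: sets_torus)
    have "(\<lambda>t. if emeasure (\<kappa> t) {0..<1} = 1 then emeasure (\<kappa> t) A else emeasure torus_lebesgue A) \<in> borel_measurable (restrict_space borel {-T<..<T})"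
      by measurable
    then show "(\<lambda>t. emeasure (\<kappa>' t) A) \<in> borel_measurable (restrict_space borel {-T<..<T})"
      by (simp add: \<kappa>'_def if_distrib[of "\<lambda>M. emeasure M A"])
  qed
  have d': "disintegration T \<mu> \<kappa>'" by (rule disintegration_AE_cong[OF \<kappa>(3) k' T eq])
  have \<mu>': "\<mu> = of_kernel T \<kappa>'" by (rule disintegration_imp_of_kernel[OF T k' \<kappa>(1) d'])
  interpret F: flux_kernel T \<kappa>' m
    by standard (use T k' \<kappa>(5) \<mu>' in auto)
  obtain \<gamma> where \<gamma>: "lip_controlled T \<gamma> F.flux_var" "AE t\<in>{-T<..<T} in lborel. \<gamma> t = \<kappa>' t"
    using F.lip_controlled_extension by blast
  have eq2: "AE t\<in>{-T<..<T} in lborel. \<kappa>' t = \<gamma> t" using \<gamma>(2) by eventually_elim simp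
  have "\<mu> = of_kernel T \<gamma>"
    by (rule disintegration_imp_of_kernel[OF T lip_controlled_kernel[OF \<gamma>(1)] \<kappa>(1)
          disintegration_AE_cong[OF d' lip_controlled_kernel[OF \<gamma>(1)] T eq2]])
  moreover have "AE t\<in>{-T<..<T} in lborel. atomic (\<gamma> t)"
    using \<kappa>(4) eq eq2 by eventually_elim simp
  ultimately show ?thesis using \<gamma>(1) \<kappa>(5) by blast
qed

text \<open>Replaces the count for the chosen version \<open>slices\<close> by the measurable count
  for the given kernel, so that its time integral can be split and substituted.\<close>

lemma internal_energy_of_kernel:
  assumes T: "T > 0" and \<kappa>: "torus_kernel T \<kappa>" and at: "AE t\<in>{-T<..<T} in lborel. atomic (\<kappa> t)"
  shows "internal_energy T (of_kernel T \<kappa>) = (INF m\<in>{m. flux T (of_kernel T \<kappa>) m}.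
    (\<integral>\<^sup>+t. atom_count (\<kappa> t) \<partial>time_space T) + (\<integral>\<^sup>+p. ennreal (\<bar>signed_RN_deriv (of_kernel T \<kappa>) m p\<bar>\<^sup>2) \<partial>of_kernel T \<kappa>))"
proof -
  have "(\<integral>\<^sup>+t\<in>{-T<..<T}. num_atoms (slices T (of_kernel T \<kappa>) t) \<partial>lborel) = (\<integral>\<^sup>+t\<in>{-T<..<T}. atom_count (\<kappa> t) \<partial>lborel)"
  proof (rule nn_integral_cong_AE)
    show "AE t in lborel. num_atoms (slices T (of_kernel T \<kappa>) t) * indicator {-T<..<T} t = atom_count (\<kappa> t) * indicator {-T<..<T} t"
      using slices_of_kernel[OF T \<kappa>] at
      by eventually_elim (auto simp: num_atoms_eq_atom_count split: split_indicator)
  qed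
  also have "\<dots> = (\<integral>\<^sup>+t. atom_count (\<kappa> t) \<partial>time_space T)"
    by (rule nn_integral_restrict_space[symmetric]) simp
  finally show ?thesis unfolding internal_energy_def by simp
qed

section \<open>The weak equation for fluxes with a density\<close>

lemma test_function_partial_derivatives:
  assumes "test_function T \<psi>"
  shows "\<exists>D1 D2 C. continuous_on UNIV D1 \<and> continuous_on UNIV D2 \<and>
    (\<forall>t x. ((\<lambda>s. \<psi> (s, x)) has_real_derivative D1 (t, x)) (at t)) \<and>
    (\<forall>t x. ((\<lambda>y. \<psi> (t, y)) has_real_derivative D2 (t, x)) (at x)) \<and>
    (\<forall>t x. \<bar>t\<bar> \<ge> T \<longrightarrow> D1 (t, x) = 0 \<and> D2 (t, x) = 0) \<and>
    (\<forall>t. \<forall>x\<in>{0..1}. \<bar>D1 (t, x)\<bar> \<le> C \<and> \<bar>D2 (t, x)\<bar> \<le> C)"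
proof -
  obtain D :: "nat \<Rightarrow> nat \<Rightarrow> real \<times> real \<Rightarrow> real" where D: "D 0 0 = \<psi>"
    "\<And>i j p. (D i j has_derivative (\<lambda>(h, k). D (Suc i) j p * h + D i (Suc j) p * k)) (at p)"
    using assms unfolding test_function_def smooth_function_def by blast
  obtain b where b: "b < T" "\<And>t x. \<bar>t\<bar> > b \<Longrightarrow> \<psi> (t, x) = 0"
    using assms unfolding test_function_def by blast
  have cont: "continuous_on UNIV (D i j)" for i j
    using D(2) by (meson continuous_at_imp_continuous_on has_derivative_continuous)
  have d1: "((\<lambda>s. \<psi> (s, x)) has_real_derivative D 1 0 (t, x)) (at t)" for t x
  proof -
    have "((\<lambda>s. (s, x)) has_derivative (\<lambda>h. (h, 0))) (at t)"
      by (intro has_derivative_Pair has_derivative_ident has_derivative_const)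
    from has_derivative_compose[OF this D(2)[of 0 0 "(t, x)"]]
    show ?thesis by (simp add: D(1) has_field_derivative_def)
  qed
  have d2: "((\<lambda>y. \<psi> (t, y)) has_real_derivative D 0 1 (t, x)) (at x)" for t x
  proof -
    have "((\<lambda>s. (t, s)) has_derivative (\<lambda>h. (0, h))) (at x)"
      by (intro has_derivative_Pair has_derivative_ident has_derivative_const)
    from has_derivative_compose[OF this D(2)[of 0 0 "(t, x)"]]
    show ?thesis by (simp add: D(1) has_field_derivative_def)
  qed
  have z1: "D 1 0 (t, x) = 0" if t: "\<bar>t\<bar> > b" for t x
  proof -
    have "((\<lambda>s. 0) has_real_derivative D 1 0 (t, x)) (at t)"
      using d1[of x t]
    proof (rule has_field_derivative_transform_within_open)
      show "open {s. \<bar>s\<bar> > b}" by (intro open_Collect_less continuous_intros)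
    qed (use b t in auto)
    then show ?thesis using DERIV_unique[OF _ DERIV_const] by blast
  qed
  have z2: "D 0 1 (t, x) = 0" if t: "\<bar>t\<bar> > b" for t x
  proof -
    have "((\<lambda>y. 0) has_real_derivative D 0 1 (t, x)) (at x)"
      using d2[of t x] b(2)[OF t] by simp
    then show ?thesis using DERIV_unique[OF _ DERIV_const] by blast
  qed
  have bdd: "\<exists>C. \<forall>t\<in>{-T..T}. \<forall>x\<in>{0..1}. \<bar>D i j (t, x)\<bar> \<le> C" for i j
  proof -
    have "compact (D i j ` ({-T..T} \<times> {0..1}))"
      by (intro compact_continuous_image continuous_on_subset[OF cont] compact_Times) auto
    then have "bounded (D i j ` ({-T..T} \<times> {0..1}))" by (rule compact_imp_bounded)
    then obtain C where "\<forall>y\<in>D i j ` ({-T..T} \<times> {0..1}). norm y \<le> C" unfolding bounded_iff by blast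
    then show ?thesis by (intro exI[of _ C]) auto
  qed
  obtain C1 C2 where C: "\<forall>t\<in>{-T..T}. \<forall>x\<in>{0..1}. \<bar>D 1 0 (t, x)\<bar> \<le> C1" "\<forall>t\<in>{-T..T}. \<forall>x\<in>{0..1}. \<bar>D 0 1 (t, x)\<bar> \<le> C2"
    using bdd by blast
  define C where "C = max 0 (max C1 C2)"
  have "\<bar>D 1 0 (t, x)\<bar> \<le> C \<and> \<bar>D 0 1 (t, x)\<bar> \<le> C" if x: "x \<in> {0..1}" for t x
  proof (cases "t \<in> {-T..T}")
    case True
    then show ?thesis using C x unfolding C_def by (meson max.coboundedI1 max.coboundedI2)
  next
    case False
    then have "\<bar>t\<bar> > b" using b(1) by auto
    then show ?thesis using z1 z2 by (simp add: C_def)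
  qed
  moreover have "D 1 0 (t, x) = 0 \<and> D 0 1 (t, x) = 0" if "\<bar>t\<bar> \<ge> T" for t x
    using that b(1) z1[of t x] z2[of t x] by auto
  ultimately show ?thesis
    using cont d1 d2 by (intro exI[of _ "D 1 0"] exI[of _ "D 0 1"] exI[of _ C]) blast
qed

text \<open>Fluxes of competitors are given by a velocity density. The rule reduces the weak
  equation to ordinary integrals of continuous partial derivatives that are bounded on one spatial
  period.\<close>

lemma flux_densityI:
  assumes T: "T > 0" and \<mu>: "sets \<mu> = sets (cylinder T)" and v: "integrable \<mu> v"
    and eq: "\<And>\<psi> D1 D2 C. test_function T \<psi> \<Longrightarrow> continuous_on UNIV D1 \<Longrightarrow> continuous_on UNIV D2 \<Longrightarrow>
      (\<And>t x. ((\<lambda>s. \<psi> (s, x)) has_real_derivative D1 (t, x)) (at t)) \<Longrightarrow>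
      (\<And>t x. ((\<lambda>y. \<psi> (t, y)) has_real_derivative D2 (t, x)) (at x)) \<Longrightarrow>
      (\<And>t x. \<bar>t\<bar> \<ge> T \<Longrightarrow> D1 (t, x) = 0 \<and> D2 (t, x) = 0) \<Longrightarrow>
      (\<And>t x. x \<in> {0..1} \<Longrightarrow> \<bar>D1 (t, x)\<bar> \<le> C \<and> \<bar>D2 (t, x)\<bar> \<le> C) \<Longrightarrow>
      (\<integral>p. D1 p \<partial>\<mu>) + (\<integral>p. D2 p * v p \<partial>\<mu>) = 0"
  shows "flux T \<mu> (\<lambda>A. \<integral>p\<in>A. v p \<partial>\<mu>)"
  unfolding flux_def
proof (intro conjI allI impI signed_measure_on_density v)
  fix \<psi> assume \<psi>: "test_function T \<psi>"
  from test_function_partial_derivatives[OF \<psi>] obtain D1 D2 C where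
    D: "continuous_on UNIV D1" "continuous_on UNIV D2"
    "\<And>t x. ((\<lambda>s. \<psi> (s, x)) has_real_derivative D1 (t, x)) (at t)"
    "\<And>t x. ((\<lambda>y. \<psi> (t, y)) has_real_derivative D2 (t, x)) (at x)"
    "\<And>t x. \<bar>t\<bar> \<ge> T \<Longrightarrow> D1 (t, x) = 0 \<and> D2 (t, x) = 0"
    "\<And>t x. x \<in> {0..1} \<Longrightarrow> \<bar>D1 (t, x)\<bar> \<le> C \<and> \<bar>D2 (t, x)\<bar> \<le> C"
    by blast
  have 1: "(\<lambda>(t, x). deriv (\<lambda>s. \<psi> (s, x)) t) = D1" "(\<lambda>(t, x). deriv (\<lambda>y. \<psi> (t, y)) x) = D2"
    using DERIV_imp_deriv[OF D(3)] DERIV_imp_deriv[OF D(4)] by auto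
  have sp: "space \<mu> = {-T<..<T} \<times> {0..<1}" using sets_eq_imp_space_eq[OF \<mu>] by simp
  have "signed_integral \<mu> (\<lambda>A. \<integral>p\<in>A. v p \<partial>\<mu>) D2 = (\<integral>p. D2 p * v p \<partial>\<mu>)"
  proof (rule signed_integral_density(2)[OF v refl])
    have "D2 \<in> borel_measurable (cylinder T)"
      by (intro measurable_cylinder_borel borel_measurable_continuous_onI D(2))
    then show "D2 \<in> borel_measurable \<mu>" using measurable_cong_sets[OF \<mu> refl] by blast
    fix p assume p: "p \<in> space \<mu>"
    obtain t x where tx: "p = (t, x)" by (cases p)
    show "\<bar>D2 p\<bar> \<le> C" using p D(6)[of x t] unfolding sp tx by simp
  qed
  then show "(\<integral>(t, x). deriv (\<lambda>s. \<psi> (s, x)) t \<partial>\<mu>) +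
      signed_integral \<mu> (\<lambda>A. \<integral>p\<in>A. v p \<partial>\<mu>) (\<lambda>(t, x). deriv (\<lambda>y. \<psi> (t, y)) x) = 0"
    unfolding 1 using eq[OF \<psi> D] by simp
qed

lemma (in flux_kernel) flux_test_function:
  assumes \<psi>: "test_function T \<psi>" and D: "continuous_on UNIV D1" "continuous_on UNIV D2"
    "\<And>t x. ((\<lambda>s. \<psi> (s, x)) has_real_derivative D1 (t, x)) (at t)"
    "\<And>t x. ((\<lambda>y. \<psi> (t, y)) has_real_derivative D2 (t, x)) (at x)"
  shows "(\<integral>p. D1 p \<partial>\<mu>) + (\<integral>p. D2 p * v p \<partial>\<mu>) = 0"
proof -
  have 1: "(\<lambda>(t, x). deriv (\<lambda>s. \<psi> (s, x)) t) = D1" "(\<lambda>(t, x). deriv (\<lambda>y. \<psi> (t, y)) x) = D2"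
    using DERIV_imp_deriv[OF D(3)] DERIV_imp_deriv[OF D(4)] by auto
  have "compact (D2 ` ({-T..T} \<times> {0..1}))"
    by (intro compact_continuous_image continuous_on_subset[OF D(2)] compact_Times) auto
  then have "bounded (D2 ` ({-T..T} \<times> {0..1}))" by (rule compact_imp_bounded)
  then obtain C where C: "\<And>y. y \<in> D2 ` ({-T..T} \<times> {0..1}) \<Longrightarrow> norm y \<le> C" unfolding bounded_iff by blast
  have "signed_integral \<mu> m D2 = (\<integral>p. D2 p * v p \<partial>\<mu>)"
  proof (rule signed_integral_density(2)[OF v])
    show "D2 \<in> borel_measurable \<mu>" by (intro borel_\<mu> borel_measurable_continuous_onI D(2))
    fix p assume "p \<in> space \<mu>"
    then have "D2 p \<in> D2 ` ({-T..T} \<times> {0..1})" unfolding space_\<mu> by auto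
    then show "\<bar>D2 p\<bar> \<le> C" using C by fastforce
  qed
  moreover have "(\<integral>(t, x). deriv (\<lambda>s. \<psi> (s, x)) t \<partial>\<mu>) + signed_integral \<mu> m (\<lambda>(t, x). deriv (\<lambda>y. \<psi> (t, y)) x) = 0"
    using m \<psi> unfolding flux_def by blast
  ultimately show ?thesis unfolding 1 by simp
qed

text \<open>A Dirac mass resting at the origin has one atom at every time, velocity 0, and finite
  distance from Lebesgue measure. It makes the energy of a minimizer finite, which the later
  cancellations require.\<close>

lemma exists_finite_energy:
  assumes T: "T > 0"
  shows "\<exists>\<nu>\<in>unit_A_star T. \<forall>lam. energy lam T \<nu> < \<infinity>"
proof -
  define \<gamma> where "\<gamma> = (\<lambda>_::real. return torus 0)"
  have p: "torus_prob (return torus 0)"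
    by (simp add: torus_prob_def prob_space_return)
  have lc: "lip_controlled T \<gamma> (\<lambda>_. 0)"
    by (simp add: lip_controlled_def \<gamma>_def p)
  note k = lip_controlled_kernel[OF lc]
  let ?\<nu> = "of_kernel T \<gamma>"
  interpret N: finite_measure ?\<nu> by (rule finite_measure_of_kernel[OF T k])
  have "atomic (return torus 0)"
    unfolding atomic_def
  proof (intro conjI exI[of _ "{0::real}"] exI[of _ "\<lambda>_. 1::real"] ballI)
    fix A assume "A \<in> sets torus"
    then show "emeasure (return torus 0) A = (\<integral>\<^sup>+x. ennreal 1 * indicator A x \<partial>count_space {0})"
      by (simp add: nn_integral_count_space_finite)
  qed auto
  then have at: "AE t\<in>{-T<..<T} in lborel. atomic (\<gamma> t)" by (simp add: \<gamma>_def)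
  have fl: "flux T ?\<nu> (\<lambda>A. \<integral>p\<in>A. 0 \<partial>?\<nu>)"
  proof (rule flux_densityI[OF T sets_of_kernel[OF T k]])
    fix \<psi> :: "real \<times> real \<Rightarrow> real" and D1 D2 C
    assume \<psi>: "test_function T \<psi>" and D: "continuous_on UNIV D1"
      "\<And>t x. ((\<lambda>s. \<psi> (s, x)) has_real_derivative D1 (t, x)) (at t)"
      and C: "\<And>t x. x \<in> {0..1} \<Longrightarrow> \<bar>D1 (t, x)\<bar> \<le> C \<and> \<bar>D2 (t, x)\<bar> \<le> C"
    have "(\<integral>p. D1 p \<partial>?\<nu>) = (\<integral>t. (\<integral>x. D1 (t, x) \<partial>\<gamma> t) \<partial>time_space T)"
    proof (rule integral_of_kernel[OF T k])
      show "D1 \<in> borel_measurable (cylinder T)"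
        by (intro measurable_cylinder_borel borel_measurable_continuous_onI D(1))
      fix p assume "p \<in> space (cylinder T)"
      then show "\<bar>D1 p\<bar> \<le> C" using C[of "snd p" "fst p"] by auto
    qed
    also have "\<dots> = (\<integral>t. D1 (t, 0) \<partial>time_space T)"
    proof (rule Bochner_Integration.integral_cong[OF refl])
      fix t
      have "(\<lambda>x. D1 (t, x)) \<in> borel_measurable torus"
        by (intro measurable_torus_borel borel_measurable_continuous_onI continuous_on_compose2[OF D(1)] continuous_intros) auto
      then show "(\<integral>x. D1 (t, x) \<partial>\<gamma> t) = D1 (t, 0)"
        unfolding \<gamma>_def by (intro integral_return) auto
    qed
    also have "\<dots> = (\<integral>t. indicator {-T<..<T} t *\<^sub>R D1 (t, 0) \<partial>lborel)"
      by (rule integral_restrict_space) simp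
    also have "\<dots> = (\<integral>t. D1 (t, 0) * indicator {-T..T} t \<partial>lborel)"
    proof (rule integral_cong_AE)
      have [measurable]: "(\<lambda>t. D1 (t, 0)) \<in> borel_measurable borel"
        by (intro borel_measurable_continuous_onI continuous_on_compose2[OF D(1)] continuous_intros) auto
      show "(\<lambda>t. indicator {-T<..<T} t *\<^sub>R D1 (t, 0)) \<in> borel_measurable lborel" by measurable
      show "(\<lambda>t. D1 (t, 0) * indicator {-T..T} t) \<in> borel_measurable lborel" by measurable
      show "AE t in lborel. indicator {-T<..<T} t *\<^sub>R D1 (t, 0) = D1 (t, 0) * indicator {-T..T} t"
        using AE_lborel_singleton[of T] AE_lborel_singleton[of "-T"]
        by eventually_elim (auto split: split_indicator)
    qed
    also have "\<dots> = \<psi> (T, 0) - \<psi> (-T, 0)"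
    proof -
      have "isCont (\<lambda>t. D1 (t, 0)) t" for t
        using continuous_on_compose2[OF D(1), of UNIV "\<lambda>t. (t, 0)"]
        by (simp add: continuous_on_eq_continuous_at continuous_intros)
      then have "has_bochner_integral lborel (\<lambda>t. D1 (t, 0) * indicator {-T..T} t) (\<psi> (T, 0) - \<psi> (-T, 0))"
        using T by (intro has_bochner_integral_FTC_Icc_real[of "-T" T "\<lambda>t. \<psi> (t, 0)"] D(2)) auto
      then show ?thesis by (simp add: has_bochner_integral_iff)
    qed
    also have "\<dots> = 0"
    proof -
      obtain b where b: "b < T" "\<And>t x. \<bar>t\<bar> > b \<Longrightarrow> \<psi> (t, x) = 0"
        using \<psi> unfolding test_function_def by blast
      then show ?thesis using T by simp
    qed
    finally show "(\<integral>p. D1 p \<partial>?\<nu>) + (\<integral>p. D2 p * 0 \<partial>?\<nu>) = 0" by simp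
  qed simp
  have mem: "?\<nu> \<in> unit_A_star T" by (rule of_kernel_in_unit_A_star[OF T k at fl])
  have "internal_energy T ?\<nu> \<le> (\<integral>\<^sup>+t. atom_count (\<gamma> t) \<partial>time_space T) +
      (\<integral>\<^sup>+p. ennreal (\<bar>signed_RN_deriv ?\<nu> (\<lambda>A. \<integral>p\<in>A. 0 \<partial>?\<nu>) p\<bar>\<^sup>2) \<partial>?\<nu>)"
    unfolding internal_energy_of_kernel[OF T k at] using fl by (intro INF_lower) simp
  also have "(\<integral>\<^sup>+p. ennreal (\<bar>signed_RN_deriv ?\<nu> (\<lambda>A. \<integral>p\<in>A. 0 \<partial>?\<nu>) p\<bar>\<^sup>2) \<partial>?\<nu>) = (\<integral>\<^sup>+p. 0 \<partial>?\<nu>)"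
  proof (rule nn_integral_cong_AE)
    have "AE p in ?\<nu>. signed_RN_deriv ?\<nu> (\<lambda>A. \<integral>p\<in>A. 0 \<partial>?\<nu>) p = 0"
      by (rule signed_RN_deriv_unique) auto
    then show "AE p in ?\<nu>. ennreal (\<bar>signed_RN_deriv ?\<nu> (\<lambda>A. \<integral>p\<in>A. 0 \<partial>?\<nu>) p\<bar>\<^sup>2) = 0"
      by eventually_elim simp
  qed
  also have "(\<integral>\<^sup>+t. atom_count (\<gamma> t) \<partial>time_space T) = (\<integral>\<^sup>+t. 1 \<partial>time_space T)"
  proof (rule nn_integral_cong)
    fix t
    have "0 < emeasure (return torus 0) {x} \<longleftrightarrow> x = 0" if "x \<in> {0..<1}" for x :: real
      using that by (cases "x = 0") (simp_all add: sets_torus)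
    then have "atoms (return torus 0) = {0}" by (auto simp: atoms_def)
    then have "num_atoms (return torus 0) = 1" by (simp add: num_atoms_def)
    then show "atom_count (\<gamma> t) = 1"
      using num_atoms_eq_atom_count[OF \<open>atomic (return torus 0)\<close>] by (simp add: \<gamma>_def)
  qed
  also have "(\<integral>\<^sup>+t. 1 \<partial>time_space T) + (\<integral>\<^sup>+p. 0 \<partial>?\<nu>) < \<infinity>"
    using T by (simp add: emeasure_restrict_space)
  finally have I: "internal_energy T ?\<nu> < \<infinity>" .
  have s: "slice T ?\<nu> t = return torus 0" if "t \<in> {-T..T}" for t
    using slice_eq[OF T N.finite_measure_axioms lip_controlled_continuous_slices[OF T lc] that] by (simp add: \<gamma>_def)
  have W: "W_per_sq (return torus 0) torus_lebesgue < \<infinity>"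
    using W_per_sq_lebesgue_potential[OF p] by (auto intro: le_less_trans)
  have "energy lam T ?\<nu> < \<infinity>" for lam
    unfolding energy_def using I W T s[of T] s[of "-T"] by (simp add: ennreal_mult_less_top)
  then show ?thesis using mem by blast
qed

section \<open>Affine slowing of time\<close>

definition time_change :: "real \<Rightarrow> real \<Rightarrow> real \<Rightarrow> real" where
  "time_change T a s = -T + a * (s + T)"

lemma time_change_inverse: "a \<noteq> 0 \<Longrightarrow> time_change T (1 / a) (time_change T a s) = s"
  by (simp add: time_change_def)

text \<open>The substitution \<open>r = time_change T a s\<close>, which maps the whole time
  interval onto its initial part up to \<open>time_change T a T\<close>.\<close>

lemma nn_integral_time_change:
  assumes a: "0 < a" "a \<le> 1" and g: "g \<in> borel_measurable (time_space T)"
  shows "ennreal a * (\<integral>\<^sup>+s. g (time_change T a s) \<partial>time_space T) =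
    (\<integral>\<^sup>+r. g r * indicator {..<time_change T a T} r \<partial>time_space T)"
proof -
  let ?t = "time_change T a T"
  have eq: "indicator {..<?t} (time_change T a s) * (indicator {-T<..<T} (time_change T a s) :: ennreal) = indicator {-T<..<T} s" for s
  proof -
    have "time_change T a s < ?t \<longleftrightarrow> s < T" "-T < time_change T a s \<longleftrightarrow> -T < s"
      using a by (auto simp: time_change_def zero_less_mult_iff)
    moreover have "time_change T a s < T" if "-T < s" "s < T"
    proof -
      have "a * (s + T) \<le> s + T" using a that by (intro mult_left_le_one_le) auto
      also have "\<dots> < T + T" using that by simp
      finally show ?thesis unfolding time_change_def by (simp only: add.commute[of "-T"] add_diff_eq diff_conv_add_uminus[symmetric] diff_less_eq)
    qed
    ultimately show ?thesis by (auto split: split_indicator)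
  qed
  have [measurable]: "(\<lambda>r. g r * indicator {-T<..<T} r) \<in> borel_measurable borel"
    using g by (subst (asm) borel_measurable_restrict_space_iff_ennreal) auto
  have "(\<integral>\<^sup>+r. g r * indicator {..<?t} r \<partial>time_space T) = (\<integral>\<^sup>+r. (g r * indicator {-T<..<T} r) * indicator {..<?t} r \<partial>lborel)"
    by (subst nn_integral_restrict_space) (simp_all add: mult_ac)
  also have "\<dots> = ennreal \<bar>a\<bar> * (\<integral>\<^sup>+s. (g (time_change T a s) * indicator {-T<..<T} (time_change T a s)) * indicator {..<?t} (time_change T a s) \<partial>lborel)"
  proof -
    have "time_change T a s = (-T + a * T) + a * s" for s by (simp add: time_change_def algebra_simps)
    then show ?thesis
      using nn_integral_real_affine[of "\<lambda>r. (g r * indicator {-T<..<T} r) * indicator {..<?t} r" a "-T + a * T"] a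
      by simp
  qed
  also have "(\<integral>\<^sup>+s. (g (time_change T a s) * indicator {-T<..<T} (time_change T a s)) * indicator {..<?t} (time_change T a s) \<partial>lborel)
      = (\<integral>\<^sup>+s. g (time_change T a s) * indicator {-T<..<T} s \<partial>lborel)"
    by (rule nn_integral_cong, subst eq[symmetric]) (simp only: mult_ac)
  also have "\<dots> = (\<integral>\<^sup>+s. g (time_change T a s) \<partial>time_space T)"
    by (rule nn_integral_restrict_space[symmetric]) simp
  finally show ?thesis using a by simp
qed

lemma lip_controlled_time_change:
  assumes \<gamma>: "lip_controlled T \<gamma> \<Omega>" and a: "0 \<le> a" "a \<le> 1"
  shows "lip_controlled T (\<lambda>s. \<gamma> (time_change T a s)) (\<lambda>s. \<Omega> (time_change T a s))"
proof -
  have mem: "time_change T a s \<in> {-T..T}" if s: "s \<in> {-T..T}" for s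
  proof -
    have "a * (s + T) \<le> s + T" "0 \<le> a * (s + T)" using a s by (auto intro!: mult_left_le_one_le)
    then show ?thesis unfolding time_change_def using s by auto
  qed
  have "continuous_on {-T..T} (\<lambda>s. \<Omega> (time_change T a s))"
  proof (rule continuous_on_compose2[of "{-T..T}" \<Omega>])
    show "continuous_on {-T..T} \<Omega>" using \<gamma> by (simp add: lip_controlled_def)
    show "continuous_on {-T..T} (time_change T a)" unfolding time_change_def by (intro continuous_intros)
  qed (use mem in blast)
  then show ?thesis using \<gamma> mem unfolding lip_controlled_def by blast
qed

text \<open>Testing the slowed curve with \<psi> amounts to testing the original curve with this
  function. As \<open>a \<le> 1\<close>, its time support is compressed towards \<open>-T\<close>
  and stays compact in the open interval.\<close>

lemma test_function_time_change:
  assumes \<psi>: "test_function T \<psi>" and a: "0 < a" "a \<le> 1" and T: "T > 0"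
  shows "test_function T (\<lambda>(r, x). \<psi> (time_change T (1 / a) r, x))"
proof -
  let ?\<eta> = "time_change T (1 / a)"
  obtain D :: "nat \<Rightarrow> nat \<Rightarrow> real \<times> real \<Rightarrow> real" where D: "D 0 0 = \<psi>"
    "\<And>i j p. (D i j has_derivative (\<lambda>(h, k). D (Suc i) j p * h + D i (Suc j) p * k)) (at p)"
    using \<psi> unfolding test_function_def smooth_function_def by blast
  obtain b where b: "b < T" "\<And>t x. \<bar>t\<bar> > b \<Longrightarrow> \<psi> (t, x) = 0"
    using \<psi> unfolding test_function_def by blast
  have sm: "smooth_function (\<lambda>(r, x). \<psi> (?\<eta> r, x))"
    unfolding smooth_function_def
  proof (intro exI[of _ "\<lambda>i j (r, x). (1 / a) ^ i * D i j (?\<eta> r, x)"] conjI allI)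
    fix i j and p :: "real \<times> real"
    have 1: "((\<lambda>q. (?\<eta> (fst q), snd q)) has_derivative (\<lambda>q. (1 / a * fst q, snd q))) (at p)"
      unfolding time_change_def using a by (auto intro!: derivative_eq_intros)
    have "((\<lambda>q. (1 / a) ^ i * D i j (?\<eta> (fst q), snd q)) has_derivative
        (\<lambda>h. (1 / a) ^ i * (case (1 / a * fst h, snd h) of (h, k) \<Rightarrow>
          D (Suc i) j (?\<eta> (fst p), snd p) * h + D i (Suc j) (?\<eta> (fst p), snd p) * k))) (at p)"
      by (rule has_derivative_mult_right[OF has_derivative_compose[OF 1 D(2)]])
    moreover have "(\<lambda>h. (1 / a) ^ i * (case (1 / a * fst h, snd h) of (h, k) \<Rightarrow>
          D (Suc i) j (?\<eta> (fst p), snd p) * h + D i (Suc j) (?\<eta> (fst p), snd p) * k)) =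
        (\<lambda>(h, k). (case p of (r, x) \<Rightarrow> (1 / a) ^ Suc i * D (Suc i) j (?\<eta> r, x)) * h +
          (case p of (r, x) \<Rightarrow> (1 / a) ^ i * D i (Suc j) (?\<eta> r, x)) * k)"
      by (auto simp: fun_eq_iff case_prod_unfold algebra_simps)
    ultimately show "((case_prod (\<lambda>r x. (1 / a) ^ i * D i j (?\<eta> r, x))) has_derivative
        (\<lambda>(h, k). (case p of (r, x) \<Rightarrow> (1 / a) ^ Suc i * D (Suc i) j (?\<eta> r, x)) * h +
          (case p of (r, x) \<Rightarrow> (1 / a) ^ i * D i (Suc j) (?\<eta> r, x)) * k)) (at p)"
      by (simp add: case_prod_unfold)
  qed (simp add: D(1))
  define c where "c = max (time_change T a b) (- time_change T a (-b))"
  have "a * (b + T) < a * (T + T)" "0 < a * (T - b)" using a b by (auto intro!: mult_strict_left_mono)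
  moreover have "a * (T + T) \<le> 1 * (T + T)" using a T by (intro mult_right_mono) auto
  ultimately have c: "c < T" by (simp add: c_def time_change_def algebra_simps)
  have "\<psi> (?\<eta> r, x) = 0" if r: "\<bar>r\<bar> > c" for r x
  proof (rule b(2))
    have mono: "time_change T a s < r \<Longrightarrow> s < ?\<eta> r" "r < time_change T a s \<Longrightarrow> ?\<eta> r < s" for s
      using a by (simp_all add: time_change_def field_simps)
    have "time_change T a b < r \<or> r < time_change T a (-b)" using r unfolding c_def by linarith
    then have "b < ?\<eta> r \<or> ?\<eta> r < -b" using mono by blast
    then show "\<bar>?\<eta> r\<bar> > b" by linarith
  qed
  then show ?thesis
    using sm c \<psi> unfolding test_function_def by (auto intro!: exI[of _ c])
qed

text \<open>The competitor is the slowed curve, with velocity \<open>a\<close> times the velocity at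
  the corresponding original time. Squared velocities gain a factor \<open>a\<^sup>2\<close> and
  time is stretched by \<open>1 / a\<close>, so kinetic energy is multiplied by \<open>a\<close>,
  which is at most 1, while the time integral of the atom count is multiplied by
  \<open>1 / a\<close>.\<close>

lemma (in flux_kernel) time_change_competitor:
  assumes \<kappa>': "lip_controlled T \<kappa> \<Omega>" and at: "AE t\<in>{-T<..<T} in lborel. atomic (\<kappa> t)"
    and a: "0 < a" "a \<le> 1"
  shows "\<exists>\<nu>\<in>unit_A_star T. slice T \<nu> (-T) = \<kappa> (-T) \<and> slice T \<nu> T = \<kappa> (time_change T a T) \<and>
    internal_energy T \<nu> \<le>
      ennreal (1 / a) * (\<integral>\<^sup>+r. atom_count (\<kappa> r) * indicator {..<time_change T a T} r \<partial>time_space T) +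
      (\<integral>\<^sup>+p. ennreal ((v p)\<^sup>2) * indicator {..<time_change T a T} (fst p) \<partial>\<mu>)"
proof -
  let ?\<theta> = "time_change T a" and ?\<eta> = "time_change T (1 / a)"
  let ?t = "?\<theta> T" and ?\<Theta> = "\<lambda>p::real \<times> real. (time_change T a (fst p), snd p)"
  let ?H = "\<lambda>p::real \<times> real. (time_change T (1 / a) (fst p), snd p)"
  define \<kappa>1 where "\<kappa>1 = (\<lambda>s. \<kappa> (?\<theta> s))"
  have lc: "lip_controlled T \<kappa>1 (\<lambda>s. \<Omega> (?\<theta> s))"
    unfolding \<kappa>1_def using a by (intro lip_controlled_time_change[OF \<kappa>']) auto
  note k1 = lip_controlled_kernel[OF lc]
  let ?\<nu> = "of_kernel T \<kappa>1"
  have sets_\<nu>: "sets ?\<nu> = sets (cylinder T)" by (rule sets_of_kernel[OF T k1])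
  have fin: "finite_measure ?\<nu>" by (rule finite_measure_of_kernel[OF T k1])
  have borel_\<nu>: "f \<in> measurable ?\<nu> N" if "f \<in> measurable borel N" for f N
    using measurable_cylinder_borel[OF that] measurable_cong_sets[OF sets_\<nu> refl] by blast
  have cont\<theta>: "continuous_on UNIV (\<lambda>p. (time_change T c (fst p), snd p))" for c
    unfolding time_change_def by (intro continuous_intros)
  have m\<theta>: "(\<lambda>p. (time_change T c (fst p), snd p)) \<in> borel_measurable borel" for c
    by (rule borel_measurable_continuous_onI[OF cont\<theta>])

  \<comment> \<open>Integrals over the competitor are \<open>1 / a\<close> times integrals over the
    initial part of \<mu>; whatever happens after \<open>time_change T a T\<close> drops
    out.\<close>
  have cov: "ennreal a * (\<integral>\<^sup>+p. h (?\<Theta> p) \<partial>?\<nu>) = (\<integral>\<^sup>+p. h p * indicator {..<?t} (fst p) \<partial>\<mu>)"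
    if h: "h \<in> borel_measurable borel" for h :: "real \<times> real \<Rightarrow> ennreal"
  proof -
    have hp: "(\<lambda>(t, x). h (t, x)) \<in> borel_measurable (time_space T \<Otimes>\<^sub>M torus)"
      using measurable_cylinder_borel[OF h] unfolding measurable_cylinder by simp
    have gm: "(\<lambda>r. \<integral>\<^sup>+x. h (r, x) \<partial>\<kappa> r) \<in> borel_measurable (time_space T)"
      by (rule nn_integral_measurable_subprob_algebra2[OF hp torus_kernel_subprob[OF \<kappa>]])
    have "(\<integral>\<^sup>+p. h (?\<Theta> p) \<partial>?\<nu>) = (\<integral>\<^sup>+s. (\<integral>\<^sup>+x. h (?\<theta> s, x) \<partial>\<kappa> (?\<theta> s)) \<partial>time_space T)"
      using nn_integral_of_kernel[OF T k1 measurable_cylinder_borel[OF measurable_compose[OF m\<theta> h]]]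
      by (simp add: \<kappa>1_def)
    then have "ennreal a * (\<integral>\<^sup>+p. h (?\<Theta> p) \<partial>?\<nu>) =
        (\<integral>\<^sup>+r. (\<integral>\<^sup>+x. h (r, x) \<partial>\<kappa> r) * indicator {..<?t} r \<partial>time_space T)"
      using nn_integral_time_change[OF a gm] by simp
    also have "\<dots> = (\<integral>\<^sup>+r. (\<integral>\<^sup>+x. h (r, x) * indicator {..<?t} r \<partial>\<kappa> r) \<partial>time_space T)"
    proof (rule nn_integral_cong)
      fix r assume "r \<in> space (time_space T)"
      then have "torus_prob (\<kappa> r)" using torus_kernel_prob[OF \<kappa>] by simp
      moreover have "(\<lambda>x. (r, x)) \<in> borel_measurable (borel :: real measure)"
        by (intro borel_measurable_continuous_onI continuous_intros)
      from measurable_torus_borel[OF measurable_compose[OF this h]]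
      have "(\<lambda>x. h (r, x)) \<in> borel_measurable torus" .
      ultimately have "(\<lambda>x. h (r, x)) \<in> borel_measurable (\<kappa> r)" by (rule torus_prob_measurable)
      then show "(\<integral>\<^sup>+x. h (r, x) \<partial>\<kappa> r) * indicator {..<?t} r = (\<integral>\<^sup>+x. h (r, x) * indicator {..<?t} r \<partial>\<kappa> r)"
        by (rule nn_integral_multc[symmetric])
    qed
    also have "\<dots> = (\<integral>\<^sup>+p. h p * indicator {..<?t} (fst p) \<partial>\<mu>)"
    proof -
      have [measurable]: "fst \<in> borel_measurable (borel :: (real \<times> real) measure)"
        by (intro borel_measurable_continuous_onI continuous_intros)
      have "(\<lambda>p. h p * indicator {..<?t} (fst p)) \<in> borel_measurable borel"
        using h by measurable
      from nn_integral_of_kernel[OF T \<kappa> measurable_cylinder_borel[OF this]] show ?thesis by simp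
    qed
    finally show ?thesis .
  qed

  have covr: "integrable ?\<nu> (\<lambda>p. h (?\<Theta> p)) \<and>
      a * (\<integral>p. h (?\<Theta> p) \<partial>?\<nu>) = (\<integral>p. h p * indicator {..<?t} (fst p) \<partial>\<mu>)"
    if h: "h \<in> borel_measurable borel" and hi: "integrable \<mu> h" for h :: "real \<times> real \<Rightarrow> real"
  proof
    have [measurable]: "(\<lambda>p. h (?\<Theta> p)) \<in> borel_measurable ?\<nu>"
      by (rule borel_\<nu>[OF measurable_compose[OF m\<theta> h]])
    have "ennreal a * (\<integral>\<^sup>+p. ennreal (norm (h (?\<Theta> p))) \<partial>?\<nu>) = (\<integral>\<^sup>+p. ennreal (norm (h p)) * indicator {..<?t} (fst p) \<partial>\<mu>)"
      using h by (intro cov) measurable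
    also have "\<dots> \<le> (\<integral>\<^sup>+p. ennreal (norm (h p)) \<partial>\<mu>)"
      by (intro nn_integral_mono) (simp split: split_indicator)
    also have "\<dots> < \<infinity>" using hi unfolding integrable_iff_bounded by blast
    finally have "(\<integral>\<^sup>+p. ennreal (norm (h (?\<Theta> p))) \<partial>?\<nu>) < \<infinity>"
      using a by (auto simp: ennreal_mult_less_top)
    then show i: "integrable ?\<nu> (\<lambda>p. h (?\<Theta> p))" unfolding integrable_iff_bounded by simp
    have i': "integrable \<mu> (\<lambda>p. h p * indicator {..<?t} (fst p))"
      by (rule Bochner_Integration.integrable_bound[OF hi])
        (use borel_measurable_integrable[OF hi] in \<open>auto split: split_indicator\<close>)
    have pos: "a * enn2real (\<integral>\<^sup>+p. ennreal (f (?\<Theta> p)) \<partial>?\<nu>) = enn2real (\<integral>\<^sup>+p. ennreal (f p * indicator {..<?t} (fst p)) \<partial>\<mu>)"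
      if "f \<in> borel_measurable borel" for f :: "real \<times> real \<Rightarrow> real"
    proof -
      have "(\<integral>\<^sup>+p. ennreal (f p * indicator {..<?t} (fst p)) \<partial>\<mu>) = (\<integral>\<^sup>+p. ennreal (f p) * indicator {..<?t} (fst p) \<partial>\<mu>)"
        by (intro nn_integral_cong) (simp split: split_indicator)
      also have "\<dots> = ennreal a * (\<integral>\<^sup>+p. ennreal (f (?\<Theta> p)) \<partial>?\<nu>)"
        using that by (intro cov[symmetric]) measurable
      finally show ?thesis using a by (simp add: enn2real_mult)
    qed
    show "a * (\<integral>p. h (?\<Theta> p) \<partial>?\<nu>) = (\<integral>p. h p * indicator {..<?t} (fst p) \<partial>\<mu>)"
      using pos[OF h] pos[of "\<lambda>p. - h p"] h
      by (simp add: real_lebesgue_integral_def[OF i] real_lebesgue_integral_def[OF i'] right_diff_distrib)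
  qed

  \<comment> \<open>\<open>v\<close> is measurable only on the cylinder; extended by zero it is
    Borel on the plane and can be composed with the time change.\<close>
  define v0 where "v0 p = indicator ({-T<..<T} \<times> {0..<1}) p *\<^sub>R v p" for p
  have v0m: "v0 \<in> borel_measurable borel"
  proof -
    have "v \<in> borel_measurable (cylinder T)"
      using borel_measurable_integrable[OF v(1)] measurable_cong_sets[OF sets_\<mu> refl] by blast
    then show ?thesis
      unfolding cylinder_def v0_def
      by (subst (asm) borel_measurable_restrict_space_iff) (auto simp: borel_Times)
  qed
  have v0: "v0 p = v p" if "p \<in> space \<mu>" for p using that by (simp add: v0_def space_\<mu>)
  have v0i: "integrable \<mu> v0" using v(1) by (subst Bochner_Integration.integrable_cong[OF refl v0]) auto
  define w where "w p = a * v0 (?\<Theta> p)" for p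
  have wi: "integrable ?\<nu> w"
    unfolding w_def using covr[OF v0m v0i] by (intro integrable_mult_right) blast

  have fl: "flux T ?\<nu> (\<lambda>A. \<integral>p\<in>A. w p \<partial>?\<nu>)"
  proof (rule flux_densityI[OF T sets_\<nu> wi])
    fix \<psi> :: "real \<times> real \<Rightarrow> real" and D1 D2 C
    assume \<psi>: "test_function T \<psi>" and D: "continuous_on UNIV D1" "continuous_on UNIV D2"
      "\<And>t x. ((\<lambda>s. \<psi> (s, x)) has_real_derivative D1 (t, x)) (at t)"
      "\<And>t x. ((\<lambda>y. \<psi> (t, y)) has_real_derivative D2 (t, x)) (at x)"
      and z: "\<And>t x. \<bar>t\<bar> \<ge> T \<Longrightarrow> D1 (t, x) = 0 \<and> D2 (t, x) = 0"
      and C: "\<And>t x. x \<in> {0..1} \<Longrightarrow> \<bar>D1 (t, x)\<bar> \<le> C \<and> \<bar>D2 (t, x)\<bar> \<le> C"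
    define h1 h2 where "h1 = (\<lambda>p. D1 (?H p))" and "h2 = (\<lambda>p. D2 (?H p))"
    have inv: "?H (?\<Theta> p) = p" for p using a by (simp add: time_change_inverse)
    have c: "continuous_on UNIV h1" "continuous_on UNIV h2"
      unfolding h1_def h2_def
      by (rule continuous_on_compose2[OF D(1) cont\<theta>], simp, rule continuous_on_compose2[OF D(2) cont\<theta>], simp)
    have hm: "h1 \<in> borel_measurable borel" "h2 \<in> borel_measurable borel"
      using c by (auto intro: borel_measurable_continuous_onI)
    have hC: "\<bar>h1 p\<bar> \<le> C" "\<bar>h2 p\<bar> \<le> C" if "p \<in> space \<mu>" for p
      using that C[of "snd p"] by (auto simp: h1_def h2_def space_\<mu>)
    \<comment> \<open>The derivatives of the test function vanish from time \<open>T\<close> on,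
      hence those of its transported version from \<open>time_change T a T\<close> on; the cutoff in
      the change of variables therefore does not alter the weak equation.\<close>
    have hz: "h1 p = 0" "h2 p = 0" if "fst p \<ge> ?t" for p
    proof -
      have "2 * T \<le> (fst p + T) / a" using that a by (simp add: time_change_def pos_le_divide_eq mult_ac)
      then have "T \<le> ?\<eta> (fst p)" by (simp add: time_change_def)
      then have "T \<le> \<bar>?\<eta> (fst p)\<bar>" by linarith
      then show "h1 p = 0" "h2 p = 0" using z by (simp_all add: h1_def h2_def)
    qed
    have i1: "integrable \<mu> h1"
      by (rule M.integrable_const_bound[of _ C]) (use hC borel_\<mu>[OF hm(1)] in auto)
    have i2: "integrable \<mu> (\<lambda>p. h2 p * v0 p)"
    proof (rule Bochner_Integration.integrable_bound[OF integrable_mult_right[OF v0i, of C]])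
      show "(\<lambda>p. h2 p * v0 p) \<in> borel_measurable \<mu>"
        using borel_\<mu>[OF hm(2)] borel_\<mu>[OF v0m] by measurable
      show "AE p in \<mu>. norm (h2 p * v0 p) \<le> norm (C * v0 p)"
      proof (rule AE_I2)
        fix p assume "p \<in> space \<mu>"
        from hC(2)[OF this] have "\<bar>h2 p\<bar> \<le> \<bar>C\<bar>" by linarith
        then show "norm (h2 p * v0 p) \<le> norm (C * v0 p)"
          by (simp add: abs_mult mult_right_mono)
      qed
    qed
    have "(\<integral>p. 1 / a * h1 p \<partial>\<mu>) + (\<integral>p. h2 p * v p \<partial>\<mu>) = 0"
    proof (rule flux_test_function[OF test_function_time_change[OF \<psi> a T]])
      show "continuous_on UNIV (\<lambda>p. 1 / a * h1 p)" by (intro continuous_intros c(1))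
      show "((\<lambda>s. case (s, x) of (r, x) \<Rightarrow> \<psi> (?\<eta> r, x)) has_real_derivative 1 / a * h1 (t, x)) (at t)" for t x
      proof -
        have "(?\<eta> has_real_derivative 1 / a) (at t)"
          unfolding time_change_def using a by (auto intro!: derivative_eq_intros)
        from DERIV_chain2[OF D(3) this] show ?thesis by (simp add: h1_def mult_ac)
      qed
      show "((\<lambda>y. case (t, y) of (r, x) \<Rightarrow> \<psi> (?\<eta> r, x)) has_real_derivative h2 (t, x)) (at x)" for t x
        using D(4)[of "?\<eta> t" x] by (simp add: h2_def)
    qed (rule c(2))
    also have "(\<integral>p. 1 / a * h1 p \<partial>\<mu>) = 1 / a * (\<integral>p. h1 p * indicator {..<?t} (fst p) \<partial>\<mu>)"
    proof -
      have "(\<integral>p. h1 p \<partial>\<mu>) = (\<integral>p. h1 p * indicator {..<?t} (fst p) \<partial>\<mu>)"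
        by (rule Bochner_Integration.integral_cong[OF refl]) (use hz(1) in \<open>auto split: split_indicator\<close>)
      then show ?thesis by simp
    qed
    also have "\<dots> = (\<integral>p. D1 p \<partial>?\<nu>)"
      using conjunct2[OF covr[OF hm(1) i1]] a by (simp add: h1_def time_change_inverse field_simps)
    also have "(\<integral>p. h2 p * v p \<partial>\<mu>) = (\<integral>p. (h2 p * v0 p) * indicator {..<?t} (fst p) \<partial>\<mu>)"
    proof (rule Bochner_Integration.integral_cong[OF refl])
      fix p assume "p \<in> space \<mu>"
      then show "h2 p * v p = (h2 p * v0 p) * indicator {..<?t} (fst p)"
        using hz(2)[of p] v0 by (auto split: split_indicator)
    qed
    also have "\<dots> = a * (\<integral>p. h2 (?\<Theta> p) * v0 (?\<Theta> p) \<partial>?\<nu>)"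
      using conjunct2[OF covr[OF _ i2]] hm(2) v0m by simp
    also have "\<dots> = (\<integral>p. D2 p * w p \<partial>?\<nu>)"
      using a by (simp add: h2_def w_def time_change_inverse mult.left_commute)
    finally show "(\<integral>p. D1 p \<partial>?\<nu>) + (\<integral>p. D2 p * w p \<partial>?\<nu>) = 0" .
  qed

  have at1: "AE s\<in>{-T<..<T} in lborel. atomic (\<kappa>1 s)"
  proof -
    \<comment> \<open>The affine time change pulls null sets back to null sets, so almost every
      slowed slice is atomic.\<close>
    obtain N where N: "{r \<in> space lborel. \<not> (r \<in> {-T<..<T} \<longrightarrow> atomic (\<kappa> r))} \<subseteq> N" "N \<in> null_sets lborel"
      using AE_E[OF at] by (metis null_setsI)
    have "AE s in lborel. (-T + a * T) + a * s \<notin> N"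
    proof (rule AE_borel_affine[of a "\<lambda>r. r \<notin> N"])
      show "Measurable.pred borel (\<lambda>r. r \<notin> N)" using null_setsD2[OF N(2)] by simp
    qed (use a AE_not_in[OF N(2)] in auto)
    then show ?thesis
    proof eventually_elim
      case (elim s)
      show ?case
      proof
        assume s: "s \<in> {-T<..<T}"
        have "?\<theta> s \<notin> N" using elim by (simp add: time_change_def algebra_simps)
        moreover have "?\<theta> s \<in> {-T<..<T}"
        proof -
          have "0 < a * (s + T)" "a * (s + T) \<le> s + T" using a s by (auto intro!: mult_left_le_one_le)
          then show ?thesis unfolding time_change_def using s by auto
        qed
        ultimately show "atomic (\<kappa>1 s)" using N(1) unfolding \<kappa>1_def by auto
      qed
    qed
  qed

  have "internal_energy T ?\<nu> \<le> (\<integral>\<^sup>+s. atom_count (\<kappa>1 s) \<partial>time_space T) +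
      (\<integral>\<^sup>+p. ennreal (\<bar>signed_RN_deriv ?\<nu> (\<lambda>A. \<integral>p\<in>A. w p \<partial>?\<nu>) p\<bar>\<^sup>2) \<partial>?\<nu>)"
    unfolding internal_energy_of_kernel[OF T k1 at1] using fl by (intro INF_lower) simp
  also have "(\<integral>\<^sup>+p. ennreal (\<bar>signed_RN_deriv ?\<nu> (\<lambda>A. \<integral>p\<in>A. w p \<partial>?\<nu>) p\<bar>\<^sup>2) \<partial>?\<nu>) = (\<integral>\<^sup>+p. ennreal ((w p)\<^sup>2) \<partial>?\<nu>)"
  proof (rule nn_integral_cong_AE)
    have "AE p in ?\<nu>. signed_RN_deriv ?\<nu> (\<lambda>A. \<integral>p\<in>A. w p \<partial>?\<nu>) p = w p"
      by (rule signed_RN_deriv_unique[OF wi]) simp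
    then show "AE p in ?\<nu>. ennreal (\<bar>signed_RN_deriv ?\<nu> (\<lambda>A. \<integral>p\<in>A. w p \<partial>?\<nu>) p\<bar>\<^sup>2) = ennreal ((w p)\<^sup>2)"
      by eventually_elim simp
  qed
  also have "(\<integral>\<^sup>+p. ennreal ((w p)\<^sup>2) \<partial>?\<nu>) = ennreal (a\<^sup>2) * (\<integral>\<^sup>+p. ennreal ((v0 (?\<Theta> p))\<^sup>2) \<partial>?\<nu>)"
  proof -
    have "(\<lambda>p. ennreal ((v0 (?\<Theta> p))\<^sup>2)) \<in> borel_measurable ?\<nu>"
      using borel_\<nu>[OF measurable_compose[OF m\<theta> v0m]] by measurable
    from nn_integral_cmult[OF this, of "ennreal (a\<^sup>2)"] show ?thesis
      by (simp add: w_def power_mult_distrib ennreal_mult)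
  qed
  \<comment> \<open>One of the two factors \<open>a\<close> is used up by the change of
    variables.\<close>
  also have "\<dots> = ennreal a * (\<integral>\<^sup>+p. ennreal ((v0 p)\<^sup>2) * indicator {..<?t} (fst p) \<partial>\<mu>)"
  proof -
    have "ennreal a * (\<integral>\<^sup>+p. ennreal ((v0 (?\<Theta> p))\<^sup>2) \<partial>?\<nu>) = (\<integral>\<^sup>+p. ennreal ((v0 p)\<^sup>2) * indicator {..<?t} (fst p) \<partial>\<mu>)"
      using v0m by (intro cov) measurable
    moreover have "ennreal (a\<^sup>2) = ennreal a * ennreal a"
      using a by (simp add: power2_eq_square ennreal_mult)
    ultimately show ?thesis by (simp add: mult.assoc)
  qed
  also have "\<dots> \<le> 1 * (\<integral>\<^sup>+p. ennreal ((v0 p)\<^sup>2) * indicator {..<?t} (fst p) \<partial>\<mu>)"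
    using a by (intro mult_right_mono) auto
  also have "1 * (\<integral>\<^sup>+p. ennreal ((v0 p)\<^sup>2) * indicator {..<?t} (fst p) \<partial>\<mu>) = (\<integral>\<^sup>+p. ennreal ((v p)\<^sup>2) * indicator {..<?t} (fst p) \<partial>\<mu>)"
    unfolding mult_1 by (intro nn_integral_cong) (simp add: v0)
  also have "(\<integral>\<^sup>+s. atom_count (\<kappa>1 s) \<partial>time_space T) =
      ennreal (1 / a) * (\<integral>\<^sup>+r. atom_count (\<kappa> r) * indicator {..<?t} r \<partial>time_space T)"
  proof -
    have "ennreal (1 / a) * ennreal a = 1" using a by (simp add: ennreal_mult[symmetric])
    then show ?thesis
      unfolding \<kappa>1_def nn_integral_time_change[OF a measurable_atom_count[OF \<kappa>], symmetric]
      by (simp add: mult.assoc[symmetric])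
  qed
  finally have I: "internal_energy T ?\<nu> \<le>
      ennreal (1 / a) * (\<integral>\<^sup>+r. atom_count (\<kappa> r) * indicator {..<?t} r \<partial>time_space T) +
      (\<integral>\<^sup>+p. ennreal ((v p)\<^sup>2) * indicator {..<?t} (fst p) \<partial>\<mu>)"
    by (simp add: add_left_mono)
  have sl: "slice T ?\<nu> s = \<kappa>1 s" if "s \<in> {-T..T}" for s
    by (rule slice_eq[OF T fin lip_controlled_continuous_slices[OF T lc] that])
  have "\<kappa>1 (-T) = \<kappa> (-T)" "\<kappa>1 T = \<kappa> ?t"
    by (simp_all only: \<kappa>1_def) (simp add: time_change_def)
  then have "slice T ?\<nu> (-T) = \<kappa> (-T)" "slice T ?\<nu> T = \<kappa> ?t"
    using T by (simp_all add: sl)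
  then show ?thesis
    using I of_kernel_in_unit_A_star[OF T k1 at1 fl] by blast
qed

subsection \<open>The consequence of minimality\<close>

text \<open>The factor 3 is the Lipschitz constant of the potential. Expanding the square of
  \<open>\<bar>v p\<bar> - 3 / 2 * lam\<close> gives the pointwise inequality; it is integrated over
  the times from \<open>t\<close> on, which carry mass \<open>T - t\<close>.\<close>

lemma (in flux_kernel) flux_var_action_bound:
  assumes t: "t \<in> {-T<..<T}" and lam: "lam \<ge> 0"
  shows "(\<integral>\<^sup>+p. ennreal ((v p)\<^sup>2) * indicator {..<t} (fst p) \<partial>\<mu>) + ennreal (3 * lam * (flux_var T - flux_var t))
    \<le> (\<integral>\<^sup>+p. ennreal ((v p)\<^sup>2) \<partial>\<mu>) + ennreal (9 * lam\<^sup>2 / 4 * (T - t))"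
proof -
  have [measurable]: "v \<in> borel_measurable \<mu>" by (rule borel_measurable_integrable[OF v(1)])
  have i: "integrable \<mu> (\<lambda>p. indicator {..<T} (fst p) * \<bar>v p\<bar> - indicator {..<t} (fst p) * \<bar>v p\<bar>)"
    by (intro Bochner_Integration.integrable_diff integrable_indicator_time[OF integrable_abs_v])
  have "ennreal (3 * lam * (flux_var T - flux_var t)) =
      ennreal (\<integral>p. 3 * lam * (indicator {..<T} (fst p) * \<bar>v p\<bar> - indicator {..<t} (fst p) * \<bar>v p\<bar>) \<partial>\<mu>)"
    unfolding flux_var_def
    by (simp add: Bochner_Integration.integral_diff[OF integrable_indicator_time[OF integrable_abs_v] integrable_indicator_time[OF integrable_abs_v]])
  also have "\<dots> = (\<integral>\<^sup>+p. ennreal (3 * lam * (indicator {..<T} (fst p) * \<bar>v p\<bar> - indicator {..<t} (fst p) * \<bar>v p\<bar>)) \<partial>\<mu>)"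
    using i lam t by (intro nn_integral_eq_integral[symmetric] integrable_mult_right AE_I2) (auto split: split_indicator)
  also have "\<dots> \<le> (\<integral>\<^sup>+p. ennreal ((v p)\<^sup>2) * indicator {t..} (fst p) + ennreal (9 * lam\<^sup>2 / 4) * indicator {t..} (fst p) \<partial>\<mu>)"
  proof (rule nn_integral_mono)
    fix p assume "p \<in> space \<mu>"
    then have p: "fst p < T" by (auto simp: space_\<mu>)
    have "0 \<le> (\<bar>v p\<bar> - 3 / 2 * lam)\<^sup>2" by simp
    also have "\<dots> = (v p)\<^sup>2 + 9 * lam\<^sup>2 / 4 - 3 * lam * \<bar>v p\<bar>"
      by (simp add: power2_diff power_mult_distrib power_divide)
    finally have "ennreal (3 * lam * \<bar>v p\<bar>) \<le> ennreal ((v p)\<^sup>2) + ennreal (9 * lam\<^sup>2 / 4)"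
      by (simp add: ennreal_plus[symmetric] ennreal_leI del: ennreal_plus)
    then show "ennreal (3 * lam * (indicator {..<T} (fst p) * \<bar>v p\<bar> - indicator {..<t} (fst p) * \<bar>v p\<bar>))
        \<le> ennreal ((v p)\<^sup>2) * indicator {t..} (fst p) + ennreal (9 * lam\<^sup>2 / 4) * indicator {t..} (fst p)"
      using p by (auto split: split_indicator)
  qed
  also have "\<dots> = (\<integral>\<^sup>+p. ennreal ((v p)\<^sup>2) * indicator {t..} (fst p) \<partial>\<mu>) + ennreal (9 * lam\<^sup>2 / 4) * (\<integral>\<^sup>+p. indicator {t..} (fst p) \<partial>\<mu>)"
    by (subst nn_integral_add) (simp_all add: nn_integral_cmult)
  also have "(\<integral>\<^sup>+p. indicator {t..} (fst p) \<partial>\<mu>) = ennreal (T - t)"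
  proof -
    have [measurable]: "fst \<in> borel_measurable (borel :: (real \<times> real) measure)"
      by (intro borel_measurable_continuous_onI continuous_intros)
    have "(\<lambda>p::real \<times> real. indicator {t..} (fst p) :: ennreal) \<in> borel_measurable borel" by measurable
    from nn_integral_of_kernel[OF T \<kappa> measurable_cylinder_borel[OF this]]
    have "(\<integral>\<^sup>+p. indicator {t..} (fst p) \<partial>\<mu>) = (\<integral>\<^sup>+r. (\<integral>\<^sup>+x. indicator {t..} r \<partial>\<kappa> r) \<partial>time_space T)" by simp
    also have "\<dots> = (\<integral>\<^sup>+r. indicator {t..} r \<partial>time_space T)"
      by (rule nn_integral_cong) (use torus_probD(2,5)[OF torus_kernel_prob[OF \<kappa>]] in simp)
    also have "\<dots> = (\<integral>\<^sup>+r. indicator {t..} r * indicator {-T<..<T} r \<partial>lborel)"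
      by (rule nn_integral_restrict_space) simp
    also have "\<dots> = (\<integral>\<^sup>+r. indicator {t..<T} r \<partial>lborel)"
      using t by (intro nn_integral_cong) (auto split: split_indicator)
    also have "\<dots> = ennreal (T - t)" using t by simp
    finally show ?thesis .
  qed
  finally have X: "ennreal (3 * lam * (flux_var T - flux_var t)) \<le>
      (\<integral>\<^sup>+p. ennreal ((v p)\<^sup>2) * indicator {t..} (fst p) \<partial>\<mu>) + ennreal (9 * lam\<^sup>2 / 4) * ennreal (T - t)" .
  have "ennreal (3 * lam * (flux_var T - flux_var t)) \<le>
      (\<integral>\<^sup>+p. ennreal ((v p)\<^sup>2) * indicator {t..} (fst p) \<partial>\<mu>) + ennreal (9 * lam\<^sup>2 / 4 * (T - t))"
  proof -
    have "ennreal (9 * lam\<^sup>2 / 4 * (T - t)) = ennreal (9 * lam\<^sup>2 / 4) * ennreal (T - t)"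
      using t by (intro ennreal_mult) auto
    then show ?thesis using X by simp
  qed
  moreover have "(\<integral>\<^sup>+p. ennreal ((v p)\<^sup>2) \<partial>\<mu>) =
      (\<integral>\<^sup>+p. ennreal ((v p)\<^sup>2) * indicator {..<t} (fst p) \<partial>\<mu>) + (\<integral>\<^sup>+p. ennreal ((v p)\<^sup>2) * indicator {t..} (fst p) \<partial>\<mu>)"
    by (subst nn_integral_add[symmetric]) (auto intro!: nn_integral_cong split: split_indicator)
  ultimately show ?thesis by (simp add: add.assoc add_left_mono)
qed

text \<open>A pair of potentials that is optimal for \<rho> remains admissible for \<sigma>, so the
  two costs are compared through the integrals of one 3-Lipschitz function.\<close>

lemma W_per_sq_lebesgue_diff:
  assumes \<rho>: "torus_prob \<rho>" and \<sigma>: "torus_prob \<sigma>"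
    and le: "\<And>f. lip_per 3 f \<Longrightarrow> \<bar>(\<integral>x. f x \<partial>\<sigma>) - (\<integral>x. f x \<partial>\<rho>)\<bar> \<le> c"
  shows "W_per_sq \<rho> torus_lebesgue \<le> W_per_sq \<sigma> torus_lebesgue + ennreal c"
proof -
  obtain f g C where f: "lip_per 3 f" and g: "g \<in> borel_measurable borel" "\<And>y. \<bar>g y\<bar> \<le> C"
    "\<And>x y. f x + g y \<le> (dist_per x y)\<^sup>2"
    and W: "W_per_sq \<rho> torus_lebesgue \<le> ennreal ((\<integral>x. f x \<partial>\<rho>) + (\<integral>y. g y \<partial>torus_lebesgue))"
    using W_per_sq_lebesgue_potential[OF \<rho>] by blast
  note W
  also have "ennreal ((\<integral>x. f x \<partial>\<rho>) + (\<integral>y. g y \<partial>torus_lebesgue)) \<le>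
      ennreal (((\<integral>x. f x \<partial>\<sigma>) + (\<integral>y. g y \<partial>torus_lebesgue)) + c)"
    using le[OF f] by (intro ennreal_leI) linarith
  also have "\<dots> \<le> ennreal ((\<integral>x. f x \<partial>\<sigma>) + (\<integral>y. g y \<partial>torus_lebesgue)) + ennreal c"
  proof -
    have "ennreal (x + y) \<le> ennreal x + ennreal y" for x y
    proof -
      have "ennreal (x + y) \<le> ennreal (max 0 x + max 0 y)" by (intro ennreal_leI) auto
      also have "\<dots> = ennreal x + ennreal y" by (subst ennreal_plus) (auto simp: ennreal_max_0)
      finally show ?thesis .
    qed
    then show ?thesis .
  qed
  also have "ennreal ((\<integral>x. f x \<partial>\<sigma>) + (\<integral>y. g y \<partial>torus_lebesgue)) \<le> W_per_sq \<sigma> torus_lebesgue"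
    by (rule W_per_sq_ge_potential[OF f g \<sigma> torus_prob_torus_lebesgue])
  finally show ?thesis by (simp add: add_right_mono)
qed

text \<open>\<open>A\<close>, \<open>B t\<close> and \<open>R t\<close> are the atom counts over all
  times, before \<open>t\<close> and after \<open>t\<close>. Comparison with the slowed curve gives
  \<open>key\<close>. Since \<open>A = B t + R t\<close> and the factor
  \<open>2 * T / (T + t)\<close> exceeds 1 by at most \<open>(T - t) / T\<close> for
  \<open>t \<ge> 0\<close>, cancelling \<open>B t\<close> leaves \<open>R t\<close> bounded by a
  multiple of \<open>T - t\<close>.\<close>

lemma minimizer_atom_bound:
  assumes lam: "lam > 0" and T: "T > 0" and min: "energy_minimizer lam T \<mu>"
  shows "\<exists>\<gamma> \<Omega> C. lip_controlled T \<gamma> \<Omega> \<and> \<mu> = of_kernel T \<gamma> \<and> (AE t\<in>{-T<..<T} in lborel. atomic (\<gamma> t)) \<and>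
    (\<forall>t\<in>{0..<T}. (\<integral>\<^sup>+r. atom_count (\<gamma> r) * indicator {t..} r \<partial>time_space T) \<le> ennreal (C * (T - t)))"
proof -
  have mem: "\<mu> \<in> unit_A_star T" and le: "\<And>\<nu>. \<nu> \<in> unit_A_star T \<Longrightarrow> energy lam T \<mu> \<le> energy lam T \<nu>"
    using min unfolding energy_minimizer_def by auto
  obtain \<gamma> \<Omega> where \<gamma>: "lip_controlled T \<gamma> \<Omega>" and \<mu>: "\<mu> = of_kernel T \<gamma>"
    and at: "AE t\<in>{-T<..<T} in lborel. atomic (\<gamma> t)"
    using unit_A_star_curve[OF T mem] by blast
  note k = lip_controlled_kernel[OF \<gamma>]
  note fin = finite_measure_of_kernel[OF T k]
  have sl: "slice T \<mu> s = \<gamma> s" if "s \<in> {-T..T}" for s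
    unfolding \<mu> by (rule slice_eq[OF T fin lip_controlled_continuous_slices[OF T \<gamma>] that])
  have p: "torus_prob (\<gamma> s)" if "s \<in> {-T..T}" for s using \<gamma> that by (simp add: lip_controlled_def)
  define A where "A = (\<integral>\<^sup>+r. atom_count (\<gamma> r) \<partial>time_space T)"
  define K where "K m = (\<integral>\<^sup>+p. ennreal (\<bar>signed_RN_deriv \<mu> m p\<bar>\<^sup>2) \<partial>\<mu>)" for m
  have I: "internal_energy T \<mu> = (INF m\<in>{m. flux T \<mu> m}. A + K m)"
    unfolding A_def K_def \<mu> by (rule internal_energy_of_kernel[OF T k at])
  have En: "energy lam T \<mu> < \<infinity>"
    using exists_finite_energy[OF T] le by (meson le_less_trans)
  then have fins: "internal_energy T \<mu> < \<infinity>" "ennreal lam * W_per_sq (\<gamma> (-T)) torus_lebesgue < \<infinity>"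
    "ennreal lam * W_per_sq (\<gamma> T) torus_lebesgue < \<infinity>"
    using T by (simp_all add: energy_def sl ennreal_add_eq_top less_top[symmetric])
  \<comment> \<open>The infimum over fluxes is approached up to \<open>e\<close>; finiteness of the
    internal energy makes the enlarged bound strictly larger.\<close>
  have close: "\<exists>m. flux T \<mu> m \<and> A + K m < internal_energy T \<mu> + ennreal e" if e: "e > 0" for e
  proof -
    have "internal_energy T \<mu> < internal_energy T \<mu> + ennreal e"
    proof -
      obtain x where "0 \<le> x" "internal_energy T \<mu> = ennreal x"
        using fins(1) less_top_ennreal[of "internal_energy T \<mu>"] by auto
      then show ?thesis using e by (simp add: ennreal_plus[symmetric] ennreal_lessI del: ennreal_plus)
    qed
    then have "(INF m\<in>{m. flux T \<mu> m}. A + K m) < internal_energy T \<mu> + ennreal e" by (simp only: I)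
    then show ?thesis unfolding INF_less_iff by blast
  qed
  have A: "A < \<infinity>"
  proof -
    obtain m where "A + K m < internal_energy T \<mu> + ennreal 1" using close[of 1] by auto
    then show ?thesis by (auto simp: less_top[symmetric] dest: order.strict_trans2[OF _ top_greatest])
  qed
  define B R where "B t = (\<integral>\<^sup>+r. atom_count (\<gamma> r) * indicator {..<t} r \<partial>time_space T)"
    and "R t = (\<integral>\<^sup>+r. atom_count (\<gamma> r) * indicator {t..} r \<partial>time_space T)" for t
  note [measurable] = measurable_atom_count[OF k]
  have ind [measurable]: "(\<lambda>r. indicator X r :: ennreal) \<in> borel_measurable (time_space T)" if "X \<in> sets borel" for X
    using that by (intro measurable_time_borel) simp
  have split: "A = B t + R t" for t
    unfolding A_def B_def R_def
    by (subst nn_integral_add[symmetric]) (auto intro!: nn_integral_cong split: split_indicator)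

  have key: "A \<le> ennreal (2 * T / (T + t)) * B t + ennreal (9 * lam\<^sup>2 / 4 * (T - t))" if t: "t \<in> {0..<T}" for t
  proof (rule ennreal_le_epsilon)
    fix e :: real assume e: "e > 0"
    obtain m where m: "flux T \<mu> m" "A + K m < internal_energy T \<mu> + ennreal e" using close[OF e] by blast
    interpret F: flux_kernel T \<gamma> m by standard (use T k m(1) \<mu> in auto)
    \<comment> \<open>The slope for which the slowed curve ends at the slice of time
      \<open>t\<close>, as \<open>tc\<close> confirms.\<close>
    define a where "a = (T + t) / (2 * T)"
    have a: "0 < a" "a \<le> 1" "1 / a = 2 * T / (T + t)" using T t by (auto simp: a_def)
    have tc: "time_change T a T = t" using T by (simp add: time_change_def a_def field_simps)
    have Km: "K m = (\<integral>\<^sup>+p. ennreal ((F.v p)\<^sup>2) \<partial>\<mu>)" by (simp add: K_def F.v_def \<mu>)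
    let ?Kt = "\<integral>\<^sup>+p. ennreal ((F.v p)\<^sup>2) * indicator {..<t} (fst p) \<partial>\<mu>"
    let ?W = "\<lambda>s. ennreal lam * W_per_sq (\<gamma> s) torus_lebesgue"
    obtain \<nu> where \<nu>: "\<nu> \<in> unit_A_star T" "slice T \<nu> (-T) = \<gamma> (-T)" "slice T \<nu> T = \<gamma> t"
      "internal_energy T \<nu> \<le> ennreal (2 * T / (T + t)) * B t + ?Kt"
      using F.time_change_competitor[OF \<gamma> at a(1,2)] unfolding tc a(3) B_def \<mu>[symmetric] by blast
    have "internal_energy T \<mu> + ?W (-T) + ?W T \<le> internal_energy T \<nu> + ?W (-T) + ?W t"
      using le[OF \<nu>(1)] T by (simp add: energy_def sl \<nu>(2,3))
    \<comment> \<open>Both curves have the same trace at \<open>-T\<close>, and its finite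
      contribution is cancelled.\<close>
    then have "?W (-T) + (internal_energy T \<mu> + ?W T) \<le> ?W (-T) + (internal_energy T \<nu> + ?W t)"
      by (simp add: ac_simps)
    then have 1: "internal_energy T \<mu> + ?W T \<le> internal_energy T \<nu> + ?W t"
      using fins(2) by (simp add: ennreal_add_left_cancel_le less_top[symmetric])
    \<comment> \<open>The modulus \<Omega> came from some other flux; here it is exchanged for the
      momentum of the nearly optimal one, which its kinetic energy controls.\<close>
    have lc: "lip_controlled T \<gamma> F.flux_var" by (rule F.lip_controlled_flux_var[OF \<gamma>])
    have "W_per_sq (\<gamma> t) torus_lebesgue \<le> W_per_sq (\<gamma> T) torus_lebesgue + ennreal (3 * (F.flux_var T - F.flux_var t))"
    proof (rule W_per_sq_lebesgue_diff)
      show "torus_prob (\<gamma> t)" "torus_prob (\<gamma> T)" using p t T by auto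
      fix f assume "lip_per 3 f"
      then have "\<bar>(\<integral>x. f x \<partial>\<gamma> T) - (\<integral>x. f x \<partial>\<gamma> t)\<bar> \<le> 3 * \<bar>F.flux_var T - F.flux_var t\<bar>"
        using lc t T unfolding lip_controlled_def by auto
      then show "\<bar>(\<integral>x. f x \<partial>\<gamma> T) - (\<integral>x. f x \<partial>\<gamma> t)\<bar> \<le> 3 * (F.flux_var T - F.flux_var t)"
        using F.flux_var_mono[of t T] t by simp
    qed
    then have "?W t \<le> ennreal lam * (W_per_sq (\<gamma> T) torus_lebesgue + ennreal (3 * (F.flux_var T - F.flux_var t)))"
      by (rule mult_left_mono) simp
    also have "\<dots> = ?W T + ennreal (3 * lam * (F.flux_var T - F.flux_var t))"
      using lam F.flux_var_mono[of t T] t by (simp add: distrib_left ennreal_mult[symmetric] mult_ac)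
    finally have Wt: "?W t \<le> ?W T + ennreal (3 * lam * (F.flux_var T - F.flux_var t))" .
    have "?W T + internal_energy T \<mu> \<le> internal_energy T \<nu> + ?W t"
      using 1 by (simp only: add.commute[of "?W T"])
    also have "\<dots> \<le> internal_energy T \<nu> + (?W T + ennreal (3 * lam * (F.flux_var T - F.flux_var t)))"
      by (rule add_left_mono[OF Wt])
    also have "\<dots> = ?W T + (internal_energy T \<nu> + ennreal (3 * lam * (F.flux_var T - F.flux_var t)))"
      by (simp only: ac_simps)
    finally have "?W T + internal_energy T \<mu> \<le> ?W T + (internal_energy T \<nu> + ennreal (3 * lam * (F.flux_var T - F.flux_var t)))" .
    then have "internal_energy T \<mu> \<le> internal_energy T \<nu> + ennreal (3 * lam * (F.flux_var T - F.flux_var t))"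
      using fins(3) by (simp add: ennreal_add_left_cancel_le less_top[symmetric])
    also have "\<dots> \<le> (ennreal (2 * T / (T + t)) * B t + ?Kt) + ennreal (3 * lam * (F.flux_var T - F.flux_var t))"
      by (rule add_right_mono[OF \<nu>(4)])
    also have "\<dots> = ennreal (2 * T / (T + t)) * B t + (?Kt + ennreal (3 * lam * (F.flux_var T - F.flux_var t)))"
      by (rule add.assoc)
    also have "\<dots> \<le> ennreal (2 * T / (T + t)) * B t + (K m + ennreal (9 * lam\<^sup>2 / 4 * (T - t)))"
      using F.flux_var_action_bound[of t lam] t T lam unfolding Km \<mu>[symmetric] by (intro add_left_mono) auto
    finally have "A + K m \<le> (ennreal (2 * T / (T + t)) * B t + (K m + ennreal (9 * lam\<^sup>2 / 4 * (T - t)))) + ennreal e"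
      using m(2) by (meson add_right_mono order.trans order.strict_implies_order)
    \<comment> \<open>The kinetic energy \<open>K m\<close> now stands on both sides; it is finite
      and cancels, so only atom counts and the boundary cost remain.\<close>
    then have "K m + A \<le> K m + (ennreal (2 * T / (T + t)) * B t + ennreal (9 * lam\<^sup>2 / 4 * (T - t)) + ennreal e)"
      by (simp only: ac_simps)
    moreover have "K m < \<infinity>"
      using m(2) by (auto simp: less_top[symmetric])
    ultimately show "A \<le> ennreal (2 * T / (T + t)) * B t + ennreal (9 * lam\<^sup>2 / 4 * (T - t)) + ennreal e"
      by (simp add: ennreal_add_left_cancel_le less_top[symmetric])
  qed

  \<comment> \<open>The first summand pays for the stretching of the atom count, the second for the
    displacement of the trace at \<open>T\<close>.\<close>
  define C where "C = enn2real A / T + 9 * lam\<^sup>2 / 4"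
  have "R t \<le> ennreal (C * (T - t))" if t: "t \<in> {0..<T}" for t
  proof -
    have Bt: "B t \<le> A" unfolding split[of t] by simp
    then have Bf: "B t < \<infinity>" using A by (rule le_less_trans)
    have "2 * T / (T + t) = 1 + (T - t) / (T + t)" using T t by (simp add: field_simps)
    moreover have "(T - t) / (T + t) \<le> (T - t) / T" using T t by (intro divide_left_mono) auto
    ultimately have "2 * T / (T + t) \<le> 1 + (T - t) / T" by simp
    then have "ennreal (2 * T / (T + t)) * B t \<le> ennreal (1 + (T - t) / T) * B t"
      by (intro mult_right_mono ennreal_leI) auto
    also have "\<dots> = B t + ennreal ((T - t) / T) * B t"
      using T t by (subst ennreal_plus) (auto simp: distrib_right)
    also have "\<dots> \<le> B t + ennreal ((T - t) / T) * A"
      by (intro add_left_mono mult_left_mono Bt) simp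
    finally have "B t + R t \<le> (B t + ennreal ((T - t) / T) * A) + ennreal (9 * lam\<^sup>2 / 4 * (T - t))"
      using key[OF t] unfolding split[of t, symmetric] by (meson add_right_mono order_trans)
    then have "R t \<le> ennreal ((T - t) / T) * A + ennreal (9 * lam\<^sup>2 / 4 * (T - t))"
      using Bf by (simp add: add.assoc ennreal_add_left_cancel_le less_top[symmetric])
    also have "A = ennreal (enn2real A)" using A by simp
    also have "ennreal ((T - t) / T) * ennreal (enn2real A) + ennreal (9 * lam\<^sup>2 / 4 * (T - t)) =
        ennreal ((T - t) / T * enn2real A + 9 * lam\<^sup>2 / 4 * (T - t))"
      using T t by (simp add: ennreal_mult[symmetric] ennreal_plus[symmetric] del: ennreal_plus)
    also have "(T - t) / T * enn2real A + 9 * lam\<^sup>2 / 4 * (T - t) = C * (T - t)"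
      by (simp add: C_def algebra_simps)
    finally show ?thesis .
  qed
  then show ?thesis using \<gamma> \<mu> at unfolding R_def by blast
qed

text \<open>Chebyshev's inequality: without such a time, the count would be at least
  \<open>M\<close> almost everywhere after \<open>t\<close>, and its integral at least
  \<open>M * (T - t)\<close>. The bound \<open>max 0 C\<close> makes \<open>M\<close> positive, so
  the contradiction also works for negative \<open>C\<close>, where \<open>ennreal\<close> yields
  0.\<close>

lemma exists_time_few_atoms:
  assumes at: "AE t\<in>{-T<..<T} in lborel. atomic (\<gamma> t)" and t: "t \<in> {0..<T}"
    and R: "(\<integral>\<^sup>+r. atom_count (\<gamma> r) * indicator {t..} r \<partial>time_space T) \<le> ennreal (C * (T - t))"
    and M: "max 0 C < real M"
  shows "\<exists>s\<in>{t<..<T}. atomic (\<gamma> s) \<and> num_atoms (\<gamma> s) \<le> of_nat M"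
proof (rule ccontr)
  assume no: "\<not> ?thesis"
  have "ennreal (real M * (T - t)) = ennreal (real M) * (\<integral>\<^sup>+r. indicator {t..<T} r \<partial>lborel)"
    using t by (simp add: ennreal_mult)
  also have "\<dots> = (\<integral>\<^sup>+r. ennreal (real M) * indicator {t..<T} r \<partial>lborel)"
    by (rule nn_integral_cmult[symmetric]) simp
  also have "\<dots> \<le> (\<integral>\<^sup>+r. atom_count (\<gamma> r) * indicator {t..} r * indicator {-T<..<T} r \<partial>lborel)"
  proof (rule nn_integral_mono_AE)
    show "AE r in lborel. ennreal (real M) * indicator {t..<T} r \<le> atom_count (\<gamma> r) * indicator {t..} r * indicator {-T<..<T} r"
      using at AE_lborel_singleton[of t]
    proof eventually_elim
      case (elim r)
      show ?case
      proof (cases "r \<in> {t<..<T}")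
        case True
        then have "atomic (\<gamma> r)" using elim(1) t by auto
        moreover from this have "\<not> num_atoms (\<gamma> r) \<le> of_nat M" using no True by blast
        ultimately have "of_nat M \<le> atom_count (\<gamma> r)" using num_atoms_eq_atom_count[of "\<gamma> r"] by simp
        then show ?thesis using True t by (simp add: ennreal_of_nat_eq_real_of_nat)
      next
        case False
        then show ?thesis using elim(2) by (simp add: indicator_def)
      qed
    qed
  qed
  also have "\<dots> = (\<integral>\<^sup>+r. atom_count (\<gamma> r) * indicator {t..} r \<partial>time_space T)"
    by (rule nn_integral_restrict_space[symmetric]) simp
  also note R
  finally have "ennreal (real M * (T - t)) \<le> ennreal (C * (T - t))" .
  moreover have "C * (T - t) < real M * (T - t)" "0 < real M * (T - t)" using M t by auto
  ultimately show False by (simp add: ennreal_le_iff2)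
qed

theorem theorem1p5:
  fixes lam T :: real and \<mu> :: "(real \<times> real) measure"
  assumes "lam > 0" and "T > 0"
    and "energy_minimizer lam T \<mu>"
    and "time_symmetric T \<mu>"
  shows "atomic (slice T \<mu> T) \<and> finite (atoms (slice T \<mu> T))"
proof -
  note T = \<open>T > 0\<close>
  obtain \<gamma> \<Omega> C where \<gamma>: "lip_controlled T \<gamma> \<Omega>" and \<mu>: "\<mu> = of_kernel T \<gamma>"
    and at: "AE t\<in>{-T<..<T} in lborel. atomic (\<gamma> t)"
    and R: "\<And>t. t \<in> {0..<T} \<Longrightarrow> (\<integral>\<^sup>+r. atom_count (\<gamma> r) * indicator {t..} r \<partial>time_space T) \<le> ennreal (C * (T - t))"
    using minimizer_atom_bound[OF assms(1-3)] by blast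
  obtain M where M: "max 0 C < real M" using reals_Archimedean2 by blast
  define t where "t n = T - T / real (Suc n)" for n
  have t: "t n \<in> {0..<T}" for n using T by (simp add: t_def field_simps)
  have "\<forall>n. \<exists>s. s \<in> {t n<..<T} \<and> atomic (\<gamma> s) \<and> num_atoms (\<gamma> s) \<le> of_nat M"
    using exists_time_few_atoms[OF at t R[OF t]] M by (simp add: Bex_def)
  from choice[OF this] obtain s where s: "\<And>n. s n \<in> {t n<..<T}" "\<And>n. atomic (\<gamma> (s n))"
    "\<And>n. num_atoms (\<gamma> (s n)) \<le> of_nat M" by blast
  have "(\<lambda>n. T - T / real (Suc n)) \<longlonglongrightarrow> T - 0"
    by (intro tendsto_diff tendsto_const filterlim_compose[OF lim_const_over_n filterlim_Suc])
  then have "t \<longlonglongrightarrow> T" unfolding t_def by simp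
  then have lim: "s \<longlonglongrightarrow> T"
    by (rule tendsto_sandwich[rotated 2, OF _ tendsto_const]) (use s(1) in \<open>auto intro!: always_eventually less_imp_le\<close>)
  \<comment> \<open>The times never equal \<open>T\<close>, as the punctured filter at
    \<open>T\<close> demands.\<close>
  have mem: "s n \<in> {-T..T} - {T}" for n using s(1)[of n] t[of n] T by auto
  have "atomic (\<gamma> T) \<and> finite (atoms (\<gamma> T))"
  proof (rule weak_limit_finitely_many_atoms[OF _ s(2,3)])
    show "torus_prob (\<gamma> T)" using \<gamma> T by (simp add: lip_controlled_def)
    show "(\<lambda>n. \<integral>x. f x \<partial>\<gamma> (s n)) \<longlonglongrightarrow> (\<integral>x. f x \<partial>\<gamma> T)" if "lip_per L f" for L f
      using lip_controlled_tendsto[OF \<gamma> that, of T] T mem lim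
      unfolding tendsto_at_iff_sequentially comp_def by simp
  qed
  moreover have "slice T \<mu> T = \<gamma> T"
    unfolding \<mu> using T
    by (intro slice_eq[OF T finite_measure_of_kernel[OF T lip_controlled_kernel[OF \<gamma>]] lip_controlled_continuous_slices[OF T \<gamma>]]) simp
  ultimately show ?thesis by simp
qed

end
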